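(* Let $(A_n)$ be a sequence of standard deviation profiles satisfying (A1) of the context, with $A_n$ irreducible for every $n$, and let $\mu_n$, $f_n$ be the associated measure and density defined in the context. Then: (1) If (A2) of the context holds, then for $|z|\in(0,\sqrt{\rho(V_n)})$ the density $f_n(z)$ of $\mu_n$ is bounded from below by a positive constant that depends on $|z|$ and is independent of $n$; i.e. for every $s>0$ there is $c(s)>0$ such that $f_n(z)\ge c(s)$ for all $n$ and all $z$ with $|z|=s<\sqrt{\rho(V_n)}$. (2) If (A6) of the context holds, then for $|z|\in[0,\sqrt{\rho(V_n)})$ the density $f_n(z)$ of $\mu_n$ (where $f_n(0)=\lim_{z\to0}f_n(z)$, which exists in this case) is bounded from below by a positive constant that depends on $|z|$ and is independent of $n$; i.e. for every $s\ge0$ there is $c(s)>0$ such that $f_n(z)\ge c(s)$ for all $n$ and all $z$ with $|z|=s<\sqrt{\rho(V_n)}$.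
   Context: Write $[n]=\{1,\dots,n\}$, and $\rho(\cdot)$ for the spectral radius. For each $n$, $A_n=(\sigma_{ij}^{(n)})$ is a deterministic $n\times n$ matrix with nonnegative entries (standard deviation profile) and $V_n=\big(\tfrac1n(\sigma_{ij}^{(n)})^2\big)_{i,j\in[n]}$ is the normalized variance profile. (A1) There is $\sigma_{\max}\in(0,\infty)$ with $\sup_n\max_{i,j}\sigma_{ij}^{(n)}\le\sigma_{\max}$. Regularized Master Equations: for $s,t>0$, $\vec r_n(s,t)=\binom{r(s,t)}{\widetilde r(s,t)}\in(0,\infty)^{2n}$ denotes the unique entrywise positive solution of $$r_i=\frac{(V_n^{\mathsf T}r)_i+t}{s^2+((V_n\widetilde r)_i+t)((V_n^{\mathsf T}r)_i+t)},\qquad \widetilde r_i=\frac{(V_n\widetilde r)_i+t}{s^2+((V_n\widetilde r)_i+t)((V_n^{\mathsf T}r)_i+t)},\quad i\in[n].$$ (A2) (admissibility) For all $s>0$ there is a constant $C=C(s)>0$ such that $\sup_{n}\sup_{t\in(0,1]}\frac1n\sum_{i\in[n]}r_i(s,t)\le C$. Fully indecomposable: a $K\times K$ matrix $T=(t_{ij})$ with nonnegative entries is fully indecomposable if for any two nonempty subsets $I,J\subset[K]$ with $|I|+|J|\ge K$ the submatrix $(t_{ij})_{i\in I,j\in J}$ contains a nonzero entry. (A6) There are constants $\phi>0$, $K\in\mathbb{N}$ independent of $n$ such that for every $n$ in the sequence (in this case the index $n$ ranges over multiples of $K$) there are a fully indecomposable matrix $Z=(z_{ij})_{i,j\in[K]}$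 with $z_{ij}\in\{0,1\}$ and a partition $(I_j)_{j\in[K]}$ of $[n]$ such that $|I_i|=n/K$ and $(V_n)_{xy}\ge\frac{\phi}{n}z_{ij}$ for all $x\in I_i$, $y\in I_j$, $i,j\in[K]$. Master Equations: for $s>0$, consider $$q_i=\frac{(V_n^{\mathsf T}q)_i}{s^2+(V_n\widetilde q)_i(V_n^{\mathsf T}q)_i},\quad \widetilde q_i=\frac{(V_n\widetilde q)_i}{s^2+(V_n\widetilde q)_i(V_n^{\mathsf T}q)_i},\quad \sum_{i}q_i=\sum_i\widetilde q_i,\quad q_i,\widetilde q_i\ge0 .$$ It is known that, for irreducible $A_n$, this system has only the zero solution when $s\ge\sqrt{\rho(V_n)}$ and has a unique nonzero solution (entrywise positive) when $s\in(0,\sqrt{\rho(V_n)})$. $\vec q(s)=\binom{q(s)}{\widetilde q(s)}$ denotes this nonzero solution when $s<\sqrt{\rho(V_n)}$ and $0$ when $s\ge\sqrt{\rho(V_n)}$; it is continuous on $(0,\infty)$ and continuously differentiable on $(0,\sqrt{\rho(V_n)})$. The measure $\mu_n$: the function $F_n(s)=1-\frac1n\langle q(s),V_n\widetilde q(s)\rangle$, $s>0$, extends to an absolutely continuous function on $[0,\infty)$ which is a CDF, and $\mu_n$ is the unique radially symmetric probability measure on $\mathbb{C}$ with $\mu_n(\{|z|\le s\})=F_n(s)$ for $s>0$. Its density on $\mathbb{C}\setminus\{0\}$ is $f_n(z)=\frac{1}{2\pi|z|}F_n'(|z|)$ for $|z|\notin\{0,\sqrt{\rho(V_n)}\}$,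 with the convention $f_n(z)=0$ for $|z|=\sqrt{\rho(V_n)}$. *)

theory Defs
  imports "HOL-Probability.Probability" "Jordan_Normal_Form.Spectral_Radius"
begin

text \<open>Matrices and vectors are those of the AFP entry on Jordan normal forms, so that the dimension \<open>n\<close> is an
  ordinary natural number; the index set \<open>[n] = {1,\<dots>,n}\<close> is represented by \<open>{..<n}\<close>.
  A sequence of profiles is a function \<open>A :: nat \<Rightarrow> real mat\<close> together with the infinite set
  \<open>N\<close> of positive integers over which its index \<open>n\<close> ranges (all positive integers, or only
  multiples of some \<open>K\<close>).\<close>

hide_const (open) Finite_Cartesian_Product.vec_nth Finite_Cartesian_Product.transpose
no_notation Finite_Cartesian_Product.vec_nth (infixl \<open>$\<close> 90)
no_notation inner (infix \<open>\<bullet>\<close> 70)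

definition variance_profile :: "real mat \<Rightarrow> real mat" where
  "variance_profile A = map_mat (\<lambda>\<sigma>. \<sigma>\<^sup>2 / real (dim_row A)) A"

definition spec_rad :: "real mat \<Rightarrow> real" where
  "spec_rad V = spectral_radius (map_mat complex_of_real V)"

text \<open>A square matrix is reducible if a simultaneous permutation of rows and columns makes it
  block triangular with two nonempty diagonal blocks, that is, if its entries vanish on
  \<open>I \<times> ({..<n} - I)\<close> for some nonempty proper \<open>I\<close>. With this convention every
  \<open>1 \<times> 1\<close> matrix is irreducible; the zero one has \<open>spec_rad V = 0\<close>.\<close>

definition irreducible_matrix :: "real mat \<Rightarrow> bool" where
  "irreducible_matrix A \<longleftrightarrow> square_mat A \<and>
     (\<forall>I. I \<noteq> {} \<and> I \<subset> {..<dim_row A} \<longrightarrow>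
        (\<exists>i\<in>I. \<exists>j\<in>{..<dim_row A} - I. A $$ (i, j) \<noteq> 0))"

definition std_profiles :: "nat set \<Rightarrow> (nat \<Rightarrow> real mat) \<Rightarrow> bool" where
  "std_profiles N A \<longleftrightarrow> infinite N \<and> 0 \<notin> N \<and>
     (\<forall>n\<in>N. A n \<in> carrier_mat n n \<and> (\<forall>i<n. \<forall>j<n. A n $$ (i, j) \<ge> 0))"

definition bounded_profiles :: "nat set \<Rightarrow> (nat \<Rightarrow> real mat) \<Rightarrow> bool" where
  "bounded_profiles N A \<longleftrightarrow>
     (\<exists>\<sigma>max>0. \<forall>n\<in>N. \<forall>i<n. \<forall>j<n. A n $$ (i, j) \<le> \<sigma>max)"

definition reg_master_eqs :: "real mat \<Rightarrow> real \<Rightarrow> real \<Rightarrow> real vec \<Rightarrow> real vec \<Rightarrow> bool" where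
  "reg_master_eqs V s t r r' \<longleftrightarrow>
     r \<in> carrier_vec (dim_row V) \<and> r' \<in> carrier_vec (dim_row V) \<and>
     (\<forall>i<dim_row V.
        r $ i = ((V\<^sup>T *\<^sub>v r) $ i + t) /
                  (s\<^sup>2 + ((V *\<^sub>v r') $ i + t) * ((V\<^sup>T *\<^sub>v r) $ i + t)) \<and>
        r' $ i = ((V *\<^sub>v r') $ i + t) /
                  (s\<^sup>2 + ((V *\<^sub>v r') $ i + t) * ((V\<^sup>T *\<^sub>v r) $ i + t)))"

definition reg_master_sol :: "real mat \<Rightarrow> real \<Rightarrow> real \<Rightarrow> real vec \<times> real vec" where
  "reg_master_sol V s t =
     (THE (r, r'). reg_master_eqs V s t r r' \<and>
        (\<forall>i<dim_row V. r $ i > 0 \<and> r' $ i > 0))"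

definition admissible :: "nat set \<Rightarrow> (nat \<Rightarrow> real mat) \<Rightarrow> bool" where
  "admissible N A \<longleftrightarrow>
     (\<forall>s>0. \<exists>C>0. \<forall>n\<in>N. \<forall>t\<in>{0<..1}.
        (1 / real n) * (\<Sum>i<n. fst (reg_master_sol (variance_profile (A n)) s t) $ i) \<le> C)"

definition fully_indecomposable :: "real mat \<Rightarrow> bool" where
  "fully_indecomposable T \<longleftrightarrow> square_mat T \<and>
     (\<forall>i<dim_row T. \<forall>j<dim_row T. T $$ (i, j) \<ge> 0) \<and>
     (\<forall>I J. I \<noteq> {} \<and> J \<noteq> {} \<and> I \<subseteq> {..<dim_row T} \<and> J \<subseteq> {..<dim_row T} \<and>
        card I + card J \<ge> dim_row T \<longrightarrow>
        (\<exists>i\<in>I. \<exists>j\<in>J. T $$ (i, j) \<noteq> 0))"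

definition block_fully_indecomposable :: "nat set \<Rightarrow> (nat \<Rightarrow> real mat) \<Rightarrow> bool" where
  "block_fully_indecomposable N A \<longleftrightarrow>
     (\<exists>\<phi>>0. \<exists>K\<ge>1. \<forall>n\<in>N. K dvd n \<and>
        (\<exists>Z\<in>carrier_mat K K. \<exists>I :: nat \<Rightarrow> nat set.
           fully_indecomposable Z \<and>
           (\<forall>i<K. \<forall>j<K. Z $$ (i, j) \<in> {0, 1}) \<and>
           (\<Union>i<K. I i) = {..<n} \<and> disjoint_family_on I {..<K} \<and>
           (\<forall>i<K. card (I i) = n div K) \<and>
           (\<forall>i<K. \<forall>j<K. \<forall>x\<in>I i. \<forall>y\<in>I j.
              variance_profile (A n) $$ (x, y) \<ge> \<phi> / real n * Z $$ (i, j))))"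

definition master_eqs :: "real mat \<Rightarrow> real \<Rightarrow> real vec \<Rightarrow> real vec \<Rightarrow> bool" where
  "master_eqs V s q q' \<longleftrightarrow>
     q \<in> carrier_vec (dim_row V) \<and> q' \<in> carrier_vec (dim_row V) \<and>
     (\<forall>i<dim_row V.
        q $ i = (V\<^sup>T *\<^sub>v q) $ i / (s\<^sup>2 + (V *\<^sub>v q') $ i * (V\<^sup>T *\<^sub>v q) $ i) \<and>
        q' $ i = (V *\<^sub>v q') $ i / (s\<^sup>2 + (V *\<^sub>v q') $ i * (V\<^sup>T *\<^sub>v q) $ i) \<and>
        q $ i \<ge> 0 \<and> q' $ i \<ge> 0) \<and>
     (\<Sum>i<dim_row V. q $ i) = (\<Sum>i<dim_row V. q' $ i)"

definition master_sol :: "real mat \<Rightarrow> real \<Rightarrow> real vec \<times> real vec" where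
  "master_sol V s =
     (let z = (0\<^sub>v (dim_row V), 0\<^sub>v (dim_row V)) in
      if s < sqrt (spec_rad V)
      then (THE (q, q'). master_eqs V s q q' \<and> (q, q') \<noteq> z)
      else z)"

definition radial_cdf :: "real mat \<Rightarrow> real \<Rightarrow> real" where
  "radial_cdf V s =
     (let (q, q') = master_sol V s in 1 - (1 / real (dim_row V)) * (q \<bullet> (V *\<^sub>v q')))"

definition radially_symmetric :: "complex measure \<Rightarrow> bool" where
  "radially_symmetric M \<longleftrightarrow> (\<forall>\<theta>. distr M borel (\<lambda>z. cis \<theta> * z) = M)"

definition mu :: "real mat \<Rightarrow> complex measure" where
  "mu V = (THE M. prob_space M \<and> sets M = sets borel \<and> radially_symmetric M \<and>
             (\<forall>s>0. measure M {z. cmod z \<le> s} = radial_cdf V s))"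

text \<open>The density of \<open>mu V\<close> on the punctured plane. For \<open>s > 0\<close> the function
  differentiated here is \<open>radial_cdf V\<close>.\<close>

definition mu_density0 :: "real mat \<Rightarrow> complex \<Rightarrow> real" where
  "mu_density0 V z =
     (if cmod z = sqrt (spec_rad V) then 0
      else 1 / (2 * pi * cmod z) * deriv (\<lambda>s. measure (mu V) {w. cmod w \<le> s}) (cmod z))"

text \<open>The density extended to the origin by its limit there, which is meaningful only if that
  limit exists. \<open>at 0\<close> is the punctured neighbourhood filter, so the value of
  \<open>mu_density0 V\<close> at \<open>0\<close> plays no role.\<close>

definition mu_density :: "real mat \<Rightarrow> complex \<Rightarrow> real" where
  "mu_density V z = (if z = 0 then Lim (at 0) (mu_density0 V) else mu_density0 V z)"

end

theory Submission
  imports Defs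
begin

text \<open>
 Put \<open>\<tau> = s^2\<close> and let \<open>\<theta> i = \<tau> + ((V^T q) i + t) * ((V z) i + t)\<close> be the denominators in the (regularized)
 master equations, with \<open>z\<close> for the second half of the solution. The equations then say that \<open>q\<close> and \<open>z\<close>
 are left and right Perron vectors with a site dependent eigenvalue: \<open>\<theta> q = V^T q + t\<close>, \<open>\<theta> z = V z + t\<close> and
 \<open>q z \<theta> = 1 - \<tau> / \<theta>\<close>. Call \<open>m i = q i * z i * \<theta> i\<close> the mass of a site. For \<open>t = 0\<close> the distribution
 function is the mean of \<open>\<tau> / \<theta> = 1 - m\<close>, and the density at radius \<open>s\<close> is its derivative in \<open>\<tau>\<close> divided
 by \<open>\<pi>\<close>.

 The slope. Differentiating the equations in \<open>ln \<tau>\<close> gives a linear system (\<open>lin\<close>) for the derivatives \<open>D\<close>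
 of \<open>ln (\<tau> / \<theta>)\<close>, whose energy identity (\<open>lin_energy\<close>) yields \<open>\<Sum> m (D - 1) = 0\<close> and
 \<open>\<Sum> \<tau>/\<theta> D (D - 1) \<le> 0\<close>. By Cauchy's inequality the slope is bounded below as soon as \<open>\<theta>\<close> is bounded and
 the masses are balanced, \<open>\<Sum> m^2 \<le> K/n (\<Sum> m)^2\<close> (\<open>cdf_slope\<close>). The system determines \<open>D\<close>
 (\<open>lin_unique\<close>), so a compactness argument shows that the derivative exists (\<open>level_derivative\<close>).

 The entropy inequality. Everything else about the solutions comes from \<open>circulation_entropy\<close>: the weights
 \<open>q i * V i j * z j\<close> form a circulation, and Jensen's inequality in every row compares \<open>\<theta>\<close> with the eigenvalues
 \<open>\<theta>'\<close> of any other positive vector. Applied both ways it gives uniqueness (\<open>sol_compare\<close>). Applied to the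
 constant vector it bounds a weighted mean of \<open>ln \<theta>\<close> (\<open>theta_sum\<close>), which makes the solutions
 precompact and lets \<open>t\<close> tend to \<open>0\<close> (\<open>sol_compact\<close>). The limit is nonzero because \<open>\<tau>\<close> lies below the
 spectral radius.

 The admissible case. The hypothesis bounds the means of \<open>q\<close> and \<open>z\<close> for every \<open>t \<le> 1\<close>; the inequality
 along \<open>t, t/2, t/4, ...\<close> then gives \<open>\<Sum> ln^2 (\<theta>_t / \<theta>_0) \<le> C n t\<close>. This must exclude that few sites carry
 most of the mass (\<open>mass_balance\<close>). Sites of large mass are collected in cells on which \<open>q\<close> and \<open>z\<close> are
 constant up to a factor \<open>e\<close>. Each cell is the source of a flow along the edges of \<open>V\<close> that carries away its mass
 until it meets sites with a frequently occurring value of \<open>q\<close> (respectively \<open>z\<close>). Subtracting these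
 flows from \<open>q\<close> and \<open>z\<close> leaves a pair which vanishes on the cells and has sources where the flows ended. The entropy
 inequality for this pair against the solution at a suitable \<open>t\<close> bounds the squared masses in the removed
 cells by those of the remaining sites (\<open>removal_many\<close>, \<open>removal_single\<close>). The constants decay
 exponentially in the distance of the cell from the frequent values, so the estimates can be summed over all
 cells: far cells as a geometric series, near cells by a discrete Gronwall argument.

 The block case. Along the nonzero entries of the pattern the logarithms of the block means of \<open>z\<close> can change only as
 much as the mean of \<open>ln \<theta>\<close> permits. Full indecomposability turns this into a bound for their total spread
 (\<open>fully_indecomposable_spread\<close>), so all masses are comparable. Near \<open>\<tau> = 0\<close> the energy in
 \<open>lin_energy\<close> is of order \<open>\<tau>\<close>; hence \<open>D\<close> tends to \<open>1\<close> and the slope has the same limit as the mean of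
 \<open>1/\<theta>\<close>, which is monotone (\<open>slope_limit_at_zero\<close>).

 The measure. A rotation invariant probability measure is the product of its radial part and the uniform
 angle. This gives its existence and uniqueness for a prescribed distribution of the radius
 (\<open>radial_exists\<close>, \<open>radial_unique\<close>).
\<close>

text \<open>The interpretation of carrier-based rings by the type classes turns these facts into rewrite rules for
 ordinary sums, products and powers, where they compete with the native rules and can send simplification astray.\<close>
declare
 class_semiring.add.finprod_empty [simp del] class_semiring.add.finprod_all1 [simp del] class_semiring.add.finprod_multf [simp del]
 class_semiring.add.finprod_one [simp del] class_semiring.add.finprod_infinite [simp del] class_semiring.add.finprod_0 [simp del]
 class_semiring.add.finprod_Suc [simp del] class_semiring.add.finprod_singleton_set [simp del] class_semiring.add.finprod_insert [simp del]
 class_cring.finprod_empty [simp del] class_cring.finprod_all1 [simp del] class_cring.finprod_multf [simp del]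
 class_cring.finprod_one [simp del] class_cring.finprod_infinite [simp del] class_cring.finprod_0 [simp del]
 class_cring.finprod_Suc [simp del] class_cring.finprod_singleton_set [simp del] class_cring.finprod_insert [simp del]
 class_semiring.l_null [simp del] class_semiring.l_one [simp del] class_semiring.r_null [simp del] class_semiring.r_one [simp del]
 class_semiring.nat_pow_one [simp del] class_semiring.nat_pow_0 [simp del] class_semiring.nat_pow_Suc [simp del]
 class_semiring.add.l_one [simp del] class_semiring.add.r_one [simp del]
 class_ring.minus_zero [simp del] class_ring.add.inv_inv [simp del] class_ring.add.inv_eq_1_iff [simp del]
 class_ring.minus_other_side [simp del] class_ring.add.r_cancel_one [simp del] class_ring.add.l_cancel_one [simp del]
 class_ring.add.r_cancel_one' [simp del] class_ring.add.l_cancel_one' [simp del] class_ring.add.right_cancel [simp del]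

section \<open>The entropy inequality\<close>

text \<open>Jensen's inequality for the logarithm. Zero weights are permitted, so that sums over all sites need no
 restriction to the support.\<close>
lemma weighted_ln_le:
 fixes w u :: "'a \<Rightarrow> real"
 assumes "finite A" and w: "\<And>j. j \<in> A \<Longrightarrow> 0 \<le> w j" and u: "\<And>j. j \<in> A \<Longrightarrow> 0 < u j"
  and W: "(\<Sum>j\<in>A. w j) \<noteq> 0"
 shows "(\<Sum>j\<in>A. w j * ln (u j)) \<le> (\<Sum>j\<in>A. w j) * ln ((\<Sum>j\<in>A. w j * u j) / (\<Sum>j\<in>A. w j))"
proof -
 define W where "W = (\<Sum>j\<in>A. w j)"
 have Wp: "W > 0" using W w unfolding W_def by (simp add: order_less_le sum_nonneg)
 define m where "m = (\<Sum>j\<in>A. w j * u j) / W"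
 obtain k where k: "k \<in> A" "w k \<noteq> 0" using W by (meson sum.neutral)
 have "(\<Sum>j\<in>A. w j * u j) > 0"
  using assms(1)
 proof (rule sum_pos2[OF _ k(1)])
  show "0 < w k * u k" using w[OF k(1)] k u[OF k(1)] by (simp add: order_less_le)
  show "0 \<le> w i * u i" if "i \<in> A" for i using w[OF that] u[OF that] by simp
 qed
 then have mp: "m > 0" using Wp by (simp add: m_def)
 have "(\<Sum>j\<in>A. w j * ln (u j)) \<le> (\<Sum>j\<in>A. w j * (ln m + (u j / m - 1)))"
 proof (rule sum_mono)
  fix j assume j: "j \<in> A"
  have "ln (u j) = ln m + ln (u j / m)" using u[OF j] mp by (simp add: ln_div)
  also have "ln (u j / m) \<le> u j / m - 1" using u[OF j] mp by (intro ln_le_minus_one) simp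
  finally show "w j * ln (u j) \<le> w j * (ln m + (u j / m - 1))"
   using w[OF j] by (intro mult_left_mono) auto
 qed
 also have "\<dots> = W * ln m + (\<Sum>j\<in>A. w j * u j) / m - W"
  by (simp add: algebra_simps sum.distrib sum_subtractf W_def sum_divide_distrib flip: sum_distrib_left)
 also have "(\<Sum>j\<in>A. w j * u j) / m = W" using mp Wp by (auto simp: m_def)
 finally show ?thesis by (simp add: W_def m_def)
qed

text \<open>Let \<open>Z\<close> have the levels \<open>\<theta>'\<close>. Row \<open>i\<close> of \<open>\<theta>' Z = V Z + t'\<close> is a mean of the ratios \<open>Z j / \<beta> j\<close> with
 weights \<open>V i j * \<beta> j\<close>, the source \<open>b i\<close> being one further term of ratio \<open>t' / b i\<close>. Jensen's inequality in each row,
 weighted by \<open>\<alpha> i\<close>, makes the logarithms of the ratios telescope, because \<open>\<alpha> i * V i j * \<beta> j\<close> is a circulation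
 up to the sources. The equations are required only where the opposite factor is positive: this allows
 vectors that have been cut to zero on a set of sites.\<close>
lemma circulation_entropy:
 fixes V :: "nat \<Rightarrow> nat \<Rightarrow> real" and \<alpha> \<beta> b b' Z \<theta> \<theta>' :: "nat \<Rightarrow> real"
 assumes V: "\<And>i j. i < n \<Longrightarrow> j < n \<Longrightarrow> 0 \<le> V i j"
  and a0: "\<And>i. i < n \<Longrightarrow> 0 \<le> \<alpha> i" and b0: "\<And>i. i < n \<Longrightarrow> 0 \<le> \<beta> i"
  and bb: "\<And>i. i < n \<Longrightarrow> 0 < \<alpha> i \<Longrightarrow> 0 \<le> b i"
  and th: "\<And>i. i < n \<Longrightarrow> 0 < \<theta> i" "\<And>i. i < n \<Longrightarrow> 0 < \<theta>' i"
  and eb: "\<And>i. i < n \<Longrightarrow> 0 < \<alpha> i \<Longrightarrow> \<beta> i * \<theta> i = (\<Sum>j<n. V i j * \<beta> j) + b i"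
  and ea: "\<And>j. j < n \<Longrightarrow> 0 < \<beta> j \<Longrightarrow> \<alpha> j * \<theta> j = (\<Sum>i<n. V i j * \<alpha> i) + b' j"
  and Z: "\<And>j. j < n \<Longrightarrow> 0 < Z j"
  and eZ: "\<And>i. i < n \<Longrightarrow> \<theta>' i * Z i = (\<Sum>j<n. V i j * Z j) + t'"
  and t': "t' > 0 \<or> (t' = 0 \<and> (\<forall>i<n. 0 < \<alpha> i \<longrightarrow> b i = 0))"
 shows "(\<Sum>i<n. \<alpha> i * b i * ln (t' / b i)) - (\<Sum>j<n. \<beta> j * b' j * ln (Z j / \<beta> j))
      \<le> (\<Sum>i<n. \<alpha> i * \<beta> i * \<theta> i * ln (\<theta>' i / \<theta> i))"
proof -
 define L where "L j = (if \<beta> j = 0 then 0 else ln (Z j / \<beta> j))" for j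
 have t0: "t' \<ge> 0" using t' by auto
 have row: "\<alpha> i * (\<Sum>j<n. V i j * \<beta> j * L j) + \<alpha> i * b i * ln (t' / b i)
   \<le> \<alpha> i * \<beta> i * \<theta> i * (ln (\<theta>' i / \<theta> i) + L i)" if i: "i < n" for i
 proof (cases "\<alpha> i = 0")
  case False
  then have ai: "\<alpha> i > 0" using a0[OF i] by simp
  note e = eb[OF i ai]
  have Vb: "0 \<le> V i j * \<beta> j" if "j < n" for j using V[OF i that] b0[OF that] by simp
  have bi: "b i \<ge> 0" using bb[OF i ai] .
  show ?thesis
  proof (cases "\<beta> i = 0")
   case True
   then have s: "(\<Sum>j<n. V i j * \<beta> j) + b i = 0" using e by simp
   have "b i = 0" "(\<Sum>j<n. V i j * \<beta> j) = 0"
    using s bi sum_nonneg[of "{..<n}" "\<lambda>j. V i j * \<beta> j"] Vb by (auto simp: add_nonneg_eq_0_iff)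
   moreover from this have "\<forall>j<n. V i j * \<beta> j = 0"
    using sum_nonneg_eq_0_iff[of "{..<n}" "\<lambda>j. V i j * \<beta> j"] Vb by auto
   ultimately have "(\<Sum>j<n. V i j * \<beta> j * L j) = 0" "b i = 0" by (auto intro!: sum.neutral)
   then show ?thesis using True by simp
  next
   case False
   then have bi0: "\<beta> i > 0" using b0[OF i] by simp
   define w where "w k = (case k of None \<Rightarrow> b i | Some j \<Rightarrow> V i j * \<beta> j)" for k
   define u where "u k = (case k of None \<Rightarrow> (if b i = 0 then 1 else t' / b i)
     | Some j \<Rightarrow> (if \<beta> j = 0 then 1 else Z j / \<beta> j))" for k
   let ?A = "insert None (Some ` {..<n})"
   have split: "(\<Sum>k\<in>?A. f k) = f None + (\<Sum>j<n. f (Some j))" for f :: "nat option \<Rightarrow> real"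
    by (subst sum.insert) (auto simp: sum.reindex)
   have wW: "(\<Sum>k\<in>?A. w k) = \<beta> i * \<theta> i"
    unfolding split using e by (simp add: w_def)
   have t'b: "t' > 0" if "b i \<noteq> 0" using t' that i ai by auto
   have wn: "0 \<le> w k" if "k \<in> ?A" for k
    using that Vb bi by (cases k) (auto simp: w_def)
   have up: "0 < u k" if "k \<in> ?A" for k
   proof (cases k)
    case None
    then show ?thesis using bi t'b by (cases "b i = 0") (simp_all add: u_def)
   next
    case (Some j)
    then have j: "j < n" using that by auto
    show ?thesis using Some Z[OF j] b0[OF j] by (cases "\<beta> j = 0") (simp_all add: u_def)
   qed
   have W0: "(\<Sum>k\<in>?A. w k) \<noteq> 0" unfolding wW using bi0 th(1)[OF i] by simp
   have J: "(\<Sum>k\<in>?A. w k * ln (u k)) \<le> (\<Sum>k\<in>?A. w k) * ln ((\<Sum>k\<in>?A. w k * u k) / (\<Sum>k\<in>?A. w k))"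
    by (rule weighted_ln_le[OF _ wn up W0]) simp_all
   have E: "(\<Sum>k\<in>?A. w k * ln (u k)) = (\<Sum>j<n. V i j * \<beta> j * L j) + b i * ln (t' / b i)"
   proof -
    have "w (Some j) * ln (u (Some j)) = V i j * \<beta> j * L j" for j
     by (simp add: w_def u_def L_def)
    moreover have "w None * ln (u None) = b i * ln (t' / b i)" by (simp add: w_def u_def)
    ultimately show ?thesis unfolding split by simp
   qed
   \<comment> \<open>Only an inequality: columns with \<open>\<beta> j = 0\<close>, and the source if \<open>b i = 0\<close>, are missing from the mean.\<close>
   have LE: "(\<Sum>k\<in>?A. w k * u k) \<le> \<theta>' i * Z i"
   proof -
    have "w (Some j) * u (Some j) \<le> V i j * Z j" if "j < n" for j
     using V[OF i that] Z[OF that] by (simp add: w_def u_def)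
    then have "(\<Sum>j<n. w (Some j) * u (Some j)) \<le> (\<Sum>j<n. V i j * Z j)"
     by (intro sum_mono) simp
    moreover have "w None * u None \<le> t'" using t0 by (simp add: w_def u_def)
    ultimately show ?thesis unfolding split eZ[OF i] by simp
   qed
   have POS: "0 < (\<Sum>k\<in>?A. w k * u k)"
   proof -
    obtain k where k: "k \<in> ?A" "w k \<noteq> 0" using W0 by (meson sum.neutral)
    show ?thesis
    proof (rule sum_pos2[OF _ k(1)])
     show "0 < w k * u k" using wn[OF k(1)] k(2) up[OF k(1)] by simp
     show "0 \<le> w i * u i" if "i \<in> ?A" for i using wn[OF that] up[OF that] by simp
    qed simp
   qed
   have p: "\<beta> i * \<theta> i > 0" using bi0 th[OF i] by simp
   have "ln ((\<Sum>k\<in>?A. w k * u k) / (\<beta> i * \<theta> i)) \<le> ln (\<theta>' i * Z i / (\<beta> i * \<theta> i))"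
    using p LE POS by (intro ln_mono divide_right_mono) auto
   then have "\<beta> i * \<theta> i * ln ((\<Sum>k\<in>?A. w k * u k) / (\<beta> i * \<theta> i))
     \<le> \<beta> i * \<theta> i * ln (\<theta>' i * Z i / (\<beta> i * \<theta> i))"
    using p by (intro mult_left_mono) auto
   with J have "(\<Sum>j<n. V i j * \<beta> j * L j) + b i * ln (t' / b i)
     \<le> \<beta> i * \<theta> i * ln (\<theta>' i * Z i / (\<beta> i * \<theta> i))"
    unfolding E wW by (rule order_trans)
   also have "ln (\<theta>' i * Z i / (\<beta> i * \<theta> i)) = ln (\<theta>' i / \<theta> i) + L i"
    using bi0 th[OF i] Z[OF i] by (simp add: L_def ln_div ln_mult)
   finally have "\<alpha> i * ((\<Sum>j<n. V i j * \<beta> j * L j) + b i * ln (t' / b i))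
     \<le> \<alpha> i * (\<beta> i * \<theta> i * (ln (\<theta>' i / \<theta> i) + L i))"
    using ai by (intro mult_left_mono) auto
   then show ?thesis by (simp add: algebra_simps)
  qed
 qed simp
 have "(\<Sum>i<n. \<alpha> i * (\<Sum>j<n. V i j * \<beta> j * L j)) = (\<Sum>j<n. \<beta> j * L j * (\<Sum>i<n. V i j * \<alpha> i))"
  unfolding sum_distrib_left by (subst sum.swap) (simp add: algebra_simps)
 also have "\<dots> = (\<Sum>j<n. \<alpha> j * \<beta> j * \<theta> j * L j - \<beta> j * b' j * ln (Z j / \<beta> j))"
 proof (rule sum.cong[OF refl])
  fix j assume "j \<in> {..<n}" then have j: "j < n" by simp
  show "\<beta> j * L j * (\<Sum>i<n. V i j * \<alpha> i) = \<alpha> j * \<beta> j * \<theta> j * L j - \<beta> j * b' j * ln (Z j / \<beta> j)"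
  proof (cases "\<beta> j = 0")
   case False
   then have "\<beta> j > 0" using b0[OF j] by simp
   from ea[OF j this] have "(\<Sum>i<n. V i j * \<alpha> i) = \<alpha> j * \<theta> j - b' j" by simp
   then have "\<beta> j * L j * (\<Sum>i<n. V i j * \<alpha> i) = \<beta> j * L j * (\<alpha> j * \<theta> j - b' j)" by simp
   then show ?thesis using False by (simp add: L_def algebra_simps)
  qed simp
 qed
 finally have sw: "(\<Sum>i<n. \<alpha> i * (\<Sum>j<n. V i j * \<beta> j * L j)) =
   (\<Sum>j<n. \<alpha> j * \<beta> j * \<theta> j * L j) - (\<Sum>j<n. \<beta> j * b' j * ln (Z j / \<beta> j))"
  by (simp add: sum_subtractf)
 have "(\<Sum>i<n. \<alpha> i * (\<Sum>j<n. V i j * \<beta> j * L j) + \<alpha> i * b i * ln (t' / b i))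
   \<le> (\<Sum>i<n. \<alpha> i * \<beta> i * \<theta> i * (ln (\<theta>' i / \<theta> i) + L i))"
  using row by (intro sum_mono) auto
 then show ?thesis unfolding sum.distrib sw by (simp add: algebra_simps sum.distrib)
qed

section \<open>Flows that start in a set of sites\<close>

text \<open>Left and right positive vectors of \<open>V\<close> with the same bounded levels \<open>\<theta>\<close>. The numbers \<open>\<beta>\<close> and \<open>c0\<close> say what it
 means for two values of \<open>l\<close> to be comparable and for a value to be frequent; the numerical conditions make each of
 three error terms in the contraction below at most one sixth. All notions are used also for the transposed
 matrix with \<open>l\<close> and \<open>r\<close> exchanged.\<close>
locale perron_pair =
 fixes n :: nat and V :: "nat \<Rightarrow> nat \<Rightarrow> real" and l r \<theta> :: "nat \<Rightarrow> real" and S \<tau> \<Theta> \<beta> c0 :: real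
 assumes n: "n > 0" and S: "S > 0" and tau: "\<tau> > 0"
  and V: "\<And>i j. i < n \<Longrightarrow> j < n \<Longrightarrow> 0 \<le> V i j \<and> V i j \<le> S / real n"
  and lp: "\<And>i. i < n \<Longrightarrow> 0 < l i" and rp: "\<And>i. i < n \<Longrightarrow> 0 < r i"
  and th: "\<And>i. i < n \<Longrightarrow> \<tau> \<le> \<theta> i \<and> \<theta> i \<le> \<Theta>"
  and leq: "\<And>i. i < n \<Longrightarrow> \<theta> i * l i = (\<Sum>j<n. V j i * l j)"
  and req: "\<And>i. i < n \<Longrightarrow> \<theta> i * r i = (\<Sum>j<n. V i j * r j)"
  and be: "\<beta> \<ge> 1" "sqrt \<beta> \<ge> 6" "sqrt \<beta> \<ge> 6 * S / \<tau>" and c0: "c0 > 0" "S * c0 * sqrt \<beta> \<le> \<tau> / 6"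
begin

lemma thp: "i < n \<Longrightarrow> 0 < \<theta> i" using th[of i] tau by linarith
lemma V0: "i < n \<Longrightarrow> j < n \<Longrightarrow> 0 \<le> V i j" using V by blast
lemma VS: "i < n \<Longrightarrow> j < n \<Longrightarrow> V i j \<le> S / real n" using V by blast
lemma be0: "\<beta> > 0" using be by linarith

definition mass :: "nat \<Rightarrow> real" where "mass i = l i * r i * \<theta> i"

lemma mass_pos: "i < n \<Longrightarrow> 0 < mass i" using lp rp thp by (simp add: mass_def)

text \<open>There are at most boundedly many well separated frequent values of \<open>l\<close>, since each is shared by a fixed
 proportion of the sites.\<close>
definition frequent :: "nat \<Rightarrow> bool" where
 "frequent i \<longleftrightarrow> c0 * real n \<le> real (card {j. j < n \<and> l i \<le> \<beta>\<^sup>2 * l j \<and> l j \<le> \<beta>\<^sup>2 * l i})"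

text \<open>Flow passes from \<open>k\<close> to \<open>i\<close> with weight \<open>V i k\<close>. It is stopped when it enters a frequent site without a
 substantial change of \<open>l\<close>; these are the only edges on which nothing forces it to decay.\<close>
definition halting :: "nat \<Rightarrow> nat \<Rightarrow> bool" where
 "halting i k \<longleftrightarrow> frequent i \<and> l i \<le> \<beta> * l k \<and> l k \<le> \<beta> * l i"

definition Vh :: "nat \<Rightarrow> nat \<Rightarrow> real" where "Vh i k = (if halting i k then V i k else 0)"
definition Vc :: "nat \<Rightarrow> nat \<Rightarrow> real" where "Vc i k = (if halting i k then 0 else V i k)"

lemma Vsplit: "V i k = Vh i k + Vc i k" by (simp add: Vh_def Vc_def)
lemma Vh0: "i < n \<Longrightarrow> k < n \<Longrightarrow> 0 \<le> Vh i k" using V0 by (simp add: Vh_def)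
lemma Vc0: "i < n \<Longrightarrow> k < n \<Longrightarrow> 0 \<le> Vc i k" using V0 by (simp add: Vc_def)
lemma VcV: "i < n \<Longrightarrow> k < n \<Longrightarrow> Vc i k \<le> V i k" using V0 by (simp add: Vc_def)

text \<open>On an edge which is not halting, either \<open>l\<close> increases by a factor \<open>\<beta>\<close>, and the square root gains \<open>1 / sqrt \<beta>\<close>
 over the exact identity for \<open>l\<close>; or it decreases by such a factor, and the bound \<open>S / n\<close> on the entries suffices;
 or the target is infrequent, and there are few such targets.\<close>
lemma contraction:
 assumes k: "k < n"
 shows "(\<Sum>i<n. Vc i k * sqrt (l i)) \<le> \<theta> k * sqrt (l k) / 2"
proof -
 define N where "N = {i. i < n \<and> \<not> frequent i \<and> l i \<le> \<beta> * l k \<and> l k \<le> \<beta> * l i}"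
 have fN: "finite N" by (simp add: N_def)
 have cN: "real (card N) \<le> c0 * real n"
 proof (cases "N = {}")
  case False
  then obtain i where i: "i \<in> N" by blast
  have "N \<subseteq> {j. j < n \<and> l i \<le> \<beta>\<^sup>2 * l j \<and> l j \<le> \<beta>\<^sup>2 * l i}"
  proof
   fix j assume j: "j \<in> N"
   have "l i \<le> \<beta> * l k" "l k \<le> \<beta> * l j" "l j \<le> \<beta> * l k" "l k \<le> \<beta> * l i"
    using i j by (auto simp: N_def)
   then have "l i \<le> \<beta> * (\<beta> * l j)" "l j \<le> \<beta> * (\<beta> * l i)"
    using be0 by (meson mult_left_mono less_imp_le order_trans)+
   then show "j \<in> {j. j < n \<and> l i \<le> \<beta>\<^sup>2 * l j \<and> l j \<le> \<beta>\<^sup>2 * l i}"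
    using j by (simp add: N_def power2_eq_square mult.assoc)
  qed
  then have "card N \<le> card {j. j < n \<and> l i \<le> \<beta>\<^sup>2 * l j \<and> l j \<le> \<beta>\<^sup>2 * l i}"
   by (intro card_mono) auto
  moreover have "\<not> frequent i" using i by (simp add: N_def)
  ultimately show ?thesis unfolding frequent_def by linarith
 qed (use c0 n in simp)
 have lk: "l k > 0" using lp k by simp
 have sb: "sqrt \<beta> > 0" using be0 by simp
 have pt: "Vc i k * sqrt (l i) \<le> V i k * l i / (sqrt \<beta> * sqrt (l k)) + S / real n * (sqrt (l k) / sqrt \<beta>)
    + (if i \<in> N then S / real n * (sqrt \<beta> * sqrt (l k)) else 0)" if i: "i < n" for i
 proof -
  have li: "l i > 0" using lp i by simp
  have nn: "0 \<le> V i k * l i / (sqrt \<beta> * sqrt (l k))" "0 \<le> S / real n * (sqrt (l k) / sqrt \<beta>)"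
   using V0[OF i k] li lk sb S by auto
  have nN: "0 \<le> (if i \<in> N then S / real n * (sqrt \<beta> * sqrt (l k)) else 0)" using S sb lk by auto
  show ?thesis
  proof (cases "halting i k")
   case True then show ?thesis using nn nN by (simp add: Vc_def)
  next
   case False
   then have V': "Vc i k = V i k" by (simp add: Vc_def)
   consider "l i > \<beta> * l k" | "l k > \<beta> * l i" | "i \<in> N"
    using False i unfolding halting_def N_def by fastforce
   then show ?thesis
   proof cases
    case 1
    then have "sqrt \<beta> * sqrt (l k) \<le> sqrt (l i)" by (metis less_imp_le real_sqrt_le_mono real_sqrt_mult)
    then have "sqrt (l i) \<le> l i / (sqrt \<beta> * sqrt (l k))"
     using li lk sb by (smt (verit) divide_left_mono mult_pos_pos real_div_sqrt real_sqrt_gt_zero)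
    then have "V i k * sqrt (l i) \<le> V i k * (l i / (sqrt \<beta> * sqrt (l k)))"
     using V0[OF i k] by (intro mult_left_mono)
    then show ?thesis unfolding V' using nn nN by simp
   next
    case 2
    then have "sqrt \<beta> * sqrt (l i) \<le> sqrt (l k)" by (metis less_imp_le real_sqrt_le_mono real_sqrt_mult)
    then have "sqrt (l i) \<le> sqrt (l k) / sqrt \<beta>" using sb by (simp add: field_simps)
    then have "V i k * sqrt (l i) \<le> S / real n * (sqrt (l k) / sqrt \<beta>)"
     using V[OF i k] S li by (intro mult_mono) auto
    then show ?thesis unfolding V' using nn nN by simp
   next
    case 3
    then have "sqrt (l i) \<le> sqrt \<beta> * sqrt (l k)"
     unfolding N_def by (simp flip: real_sqrt_mult)
    then have "V i k * sqrt (l i) \<le> S / real n * (sqrt \<beta> * sqrt (l k))"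
     using V[OF i k] S li by (intro mult_mono) auto
    then show ?thesis unfolding V' using nn 3 by simp
   qed
  qed
 qed
 have "(\<Sum>i<n. Vc i k * sqrt (l i)) \<le> (\<Sum>i<n. V i k * l i / (sqrt \<beta> * sqrt (l k)) + S / real n * (sqrt (l k) / sqrt \<beta>)
    + (if i \<in> N then S / real n * (sqrt \<beta> * sqrt (l k)) else 0))"
  using pt by (intro sum_mono) simp
 also have "\<dots> = \<theta> k * l k / (sqrt \<beta> * sqrt (l k)) + S * (sqrt (l k) / sqrt \<beta>)
    + real (card N) * (S / real n * (sqrt \<beta> * sqrt (l k)))"
 proof -
  have "(\<Sum>i<n. if i \<in> N then S / real n * (sqrt \<beta> * sqrt (l k)) else 0)
    = (\<Sum>i\<in>N. S / real n * (sqrt \<beta> * sqrt (l k)))"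
   by (rule sum.mono_neutral_cong_right) (auto simp: N_def)
  then show ?thesis
   using n by (simp add: sum.distrib leq[OF k] sum_divide_distrib)
 qed
 also have "\<theta> k * l k / (sqrt \<beta> * sqrt (l k)) \<le> \<theta> k * sqrt (l k) / 6"
 proof -
  have "\<theta> k * l k / (sqrt \<beta> * sqrt (l k)) = \<theta> k * sqrt (l k) / sqrt \<beta>"
   using lk sb by (simp add: field_simps)
  also have "\<dots> \<le> \<theta> k * sqrt (l k) / 6"
   using be thp[OF k] lk by (intro divide_left_mono) auto
  finally show ?thesis .
 qed
 also have "S * (sqrt (l k) / sqrt \<beta>) \<le> \<theta> k * sqrt (l k) / 6"
 proof -
  have "S / sqrt \<beta> \<le> \<tau> / 6" using be tau sb by (simp add: field_simps)
  also have "\<tau> / 6 \<le> \<theta> k / 6" using th[OF k] by simp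
  finally have "S / sqrt \<beta> * sqrt (l k) \<le> \<theta> k / 6 * sqrt (l k)" using lk by (intro mult_right_mono) auto
  then show ?thesis by simp
 qed
 also have "real (card N) * (S / real n * (sqrt \<beta> * sqrt (l k))) \<le> \<theta> k * sqrt (l k) / 6"
 proof -
  have "real (card N) * (S / real n * (sqrt \<beta> * sqrt (l k))) \<le> c0 * real n * (S / real n * (sqrt \<beta> * sqrt (l k)))"
   using cN S sb lk by (intro mult_right_mono) auto
  also have "\<dots> = S * c0 * sqrt \<beta> * sqrt (l k)" using n by simp
  also have "\<dots> \<le> \<tau> / 6 * sqrt (l k)" using c0 lk by (intro mult_right_mono) auto
  also have "\<dots> \<le> \<theta> k / 6 * sqrt (l k)" using th[OF k] lk by (intro mult_right_mono) auto
  finally show ?thesis by simp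
 qed
 finally show ?thesis by simp
qed

lemma Vc_col: "k < n \<Longrightarrow> (\<Sum>i<n. Vc i k * l i) \<le> \<theta> k * l k"
 unfolding leq using VcV lp by (intro sum_mono mult_right_mono) (auto intro: less_imp_le)

lemma Vc_row: "i < n \<Longrightarrow> (\<Sum>k<n. Vc i k * r k) \<le> \<theta> i * r i"
 unfolding req using VcV rp by (intro sum_mono mult_right_mono) (auto intro: less_imp_le)

text \<open>The stationary flow with prescribed values on \<open>U\<close> which is absorbed on \<open>U\<close> and does not use halting edges.\<close>
definition tube :: "nat set \<Rightarrow> (nat \<Rightarrow> real) \<Rightarrow> (nat \<Rightarrow> real) \<Rightarrow> bool" where
 "tube U s x \<longleftrightarrow> (\<forall>i<n. 0 \<le> x i \<and> x i \<le> r i \<and>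
   (if i \<in> U then x i = s i else \<theta> i * x i = (\<Sum>k<n. Vc i k * x k)))"

text \<open>The flow is the limit of the increasing iteration that starts at zero; \<open>r\<close> is an upper barrier.\<close>
lemma tube_exists:
 assumes s: "\<And>i. i < n \<Longrightarrow> 0 \<le> s i \<and> s i \<le> r i" "\<And>i. i \<notin> U \<Longrightarrow> s i = 0"
 shows "\<exists>x. tube U s x"
proof -
 define X where "X t = rec_nat s (\<lambda>_ x i. if i \<in> U then s i else (\<Sum>k<n. Vc i k * x k) / \<theta> i) t" for t
 have X0: "X 0 = s" and XS: "X (Suc t) i = (if i \<in> U then s i else (\<Sum>k<n. Vc i k * X t k) / \<theta> i)" for t i
  by (simp_all add: X_def)
 have bd: "\<forall>i<n. 0 \<le> X t i \<and> X t i \<le> r i" for t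
 proof (induction t)
  case (Suc t)
  show ?case
  proof (intro allI impI)
   fix i assume i: "i < n"
   have "(\<Sum>k<n. Vc i k * X t k) \<le> (\<Sum>k<n. Vc i k * r k)"
    using Suc Vc0[OF i] by (intro sum_mono mult_left_mono) auto
   also have "\<dots> \<le> \<theta> i * r i" using Vc_row[OF i] .
   finally have "(\<Sum>k<n. Vc i k * X t k) / \<theta> i \<le> r i" using thp[OF i] by (simp add: field_simps)
   moreover have "0 \<le> (\<Sum>k<n. Vc i k * X t k) / \<theta> i"
    using Suc Vc0[OF i] thp[OF i] by (intro divide_nonneg_pos sum_nonneg) auto
   ultimately show "0 \<le> X (Suc t) i \<and> X (Suc t) i \<le> r i" using s(1)[OF i] by (simp add: XS)
  qed
 qed (use s X0 in simp)
 have mono: "\<forall>i<n. X t i \<le> X (Suc t) i" for t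
 proof (induction t)
  case 0
  show ?case using s(2) bd[of 1] by (auto simp: X0 XS)
 next
  case (Suc t)
  show ?case
  proof (intro allI impI)
   fix i assume i: "i < n"
   have "(\<Sum>k<n. Vc i k * X t k) \<le> (\<Sum>k<n. Vc i k * X (Suc t) k)"
    using Suc Vc0[OF i] by (intro sum_mono mult_left_mono) auto
   then have "(\<Sum>k<n. Vc i k * X t k) / \<theta> i \<le> (\<Sum>k<n. Vc i k * X (Suc t) k) / \<theta> i"
    using thp[OF i] by (intro divide_right_mono) auto
   then show "X (Suc t) i \<le> X (Suc (Suc t)) i" unfolding XS[of "Suc t"] XS[of t] by auto
  qed
 qed
 define x where "x i = lim (\<lambda>t. X t i)" for i
 have lim: "(\<lambda>t. X t i) \<longlonglongrightarrow> x i" if "i < n" for i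
 proof -
  have "incseq (\<lambda>t. X t i)" using mono that by (intro incseq_SucI) auto
  then have "convergent (\<lambda>t. X t i)"
   using bd that by (intro Bseq_monoseq_convergent incseq_imp_monoseq)
    (auto intro!: BseqI'[of _ "r i"])
  then show ?thesis by (simp add: x_def convergent_LIMSEQ_iff)
 qed
 have "tube U s x" unfolding tube_def
 proof (intro allI impI conjI)
  fix i assume i: "i < n"
  show "0 \<le> x i" by (rule LIMSEQ_le_const[OF lim[OF i]]) (use bd i in auto)
  show "x i \<le> r i" by (rule LIMSEQ_le_const2[OF lim[OF i]]) (use bd i in auto)
  have l1: "(\<lambda>t. X (Suc t) i) \<longlonglongrightarrow> x i" using lim[OF i] by (rule LIMSEQ_Suc)
  show "if i \<in> U then x i = s i else \<theta> i * x i = (\<Sum>k<n. Vc i k * x k)"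
  proof (cases "i \<in> U")
   case True
   then have "(\<lambda>t. X (Suc t) i) = (\<lambda>_. s i)" by (simp add: XS)
   then show ?thesis using True l1 by (simp add: LIMSEQ_const_iff)
  next
   case False
   have "(\<lambda>t. (\<Sum>k<n. Vc i k * X t k) / \<theta> i) \<longlonglongrightarrow> (\<Sum>k<n. Vc i k * x k) / \<theta> i"
    by (intro tendsto_intros lim) (use thp[OF i] in auto)
   then have "x i = (\<Sum>k<n. Vc i k * x k) / \<theta> i"
    using l1 False LIMSEQ_unique by (simp add: XS)
   then show ?thesis using False thp[OF i] by (simp add: field_simps)
  qed
 qed
 then show ?thesis by blast
qed

text \<open>A maximum principle in weak form: a supersolution \<open>\<phi>\<close> of the adjoint equation with defect \<open>\<psi>\<close> controls the
 flow by its sources. All estimates for flows are obtained by choosing \<open>\<phi>\<close>.\<close>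
lemma tube_weighted:
 assumes x: "\<And>i. i < n \<Longrightarrow> 0 \<le> x i" "\<And>i. i < n \<Longrightarrow> i \<notin> U \<Longrightarrow> \<theta> i * x i \<le> (\<Sum>k<n. Vc i k * x k)"
  and p: "\<And>i. i < n \<Longrightarrow> 0 \<le> \<phi> i"
  and c: "\<And>k. k < n \<Longrightarrow> (\<Sum>i<n. Vc i k * \<phi> i) \<le> \<theta> k * \<phi> k - \<psi> k"
 shows "(\<Sum>k<n. \<psi> k * x k) \<le> (\<Sum>k\<in>{..<n} \<inter> U. \<theta> k * \<phi> k * x k)"
proof -
 have "(\<Sum>i\<in>{..<n} - U. \<theta> i * \<phi> i * x i) \<le> (\<Sum>i\<in>{..<n} - U. \<phi> i * (\<Sum>k<n. Vc i k * x k))"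
 proof (rule sum_mono)
  fix i assume "i \<in> {..<n} - U"
  then have "\<phi> i * (\<theta> i * x i) \<le> \<phi> i * (\<Sum>k<n. Vc i k * x k)"
   using x(2) p by (intro mult_left_mono) auto
  then show "\<theta> i * \<phi> i * x i \<le> \<phi> i * (\<Sum>k<n. Vc i k * x k)" by (simp add: mult_ac)
 qed
 also have "\<dots> \<le> (\<Sum>i<n. \<phi> i * (\<Sum>k<n. Vc i k * x k))"
  using p x(1) Vc0 by (intro sum_mono2 mult_nonneg_nonneg sum_nonneg) auto
 also have "\<dots> = (\<Sum>k<n. x k * (\<Sum>i<n. Vc i k * \<phi> i))"
  unfolding sum_distrib_left by (subst sum.swap) (simp add: mult_ac)
 also have "\<dots> \<le> (\<Sum>k<n. x k * (\<theta> k * \<phi> k - \<psi> k))"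
  using x(1) c by (intro sum_mono mult_left_mono) auto
 also have "\<dots> = (\<Sum>k<n. \<theta> k * \<phi> k * x k) - (\<Sum>k<n. \<psi> k * x k)"
  by (simp add: algebra_simps sum_subtractf)
 also have "(\<Sum>k<n. \<theta> k * \<phi> k * x k) = (\<Sum>k\<in>{..<n} - U. \<theta> k * \<phi> k * x k) + (\<Sum>k\<in>{..<n} \<inter> U. \<theta> k * \<phi> k * x k)"
  by (subst sum.Int_Diff[of "{..<n}" _ U]) auto
 finally show ?thesis by simp
qed

lemma tube_unique:
 assumes "\<And>i. i < n \<Longrightarrow> i \<in> U \<Longrightarrow> d i = 0" "\<And>i. i < n \<Longrightarrow> i \<notin> U \<Longrightarrow> \<theta> i * d i = (\<Sum>k<n. Vc i k * d k)"
  and i: "i < n"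
 shows "d i = (0::real)"
proof -
 have "(\<Sum>k<n. (\<theta> k * sqrt (l k) / 2) * \<bar>d k\<bar>) \<le> (\<Sum>k\<in>{..<n} \<inter> U. \<theta> k * sqrt (l k) * \<bar>d k\<bar>)"
 proof (rule tube_weighted)
  fix i assume i: "i < n" "i \<notin> U"
  have "\<theta> i * \<bar>d i\<bar> = \<bar>\<Sum>k<n. Vc i k * d k\<bar>" using assms(2)[OF i] thp[OF i(1)]
   by (metis abs_mult abs_of_pos)
  also have "\<dots> \<le> (\<Sum>k<n. \<bar>Vc i k * d k\<bar>)" by (rule sum_abs)
  also have "\<dots> = (\<Sum>k<n. Vc i k * \<bar>d k\<bar>)" using Vc0[OF i(1)] by (simp add: abs_mult)
  finally show "\<theta> i * \<bar>d i\<bar> \<le> (\<Sum>k<n. Vc i k * \<bar>d k\<bar>)" .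
 next
  fix k assume "k < n" then show "(\<Sum>i<n. Vc i k * sqrt (l i)) \<le> \<theta> k * sqrt (l k) - \<theta> k * sqrt (l k) / 2"
   using contraction[of k] by simp
 qed (use lp in \<open>auto intro: less_imp_le\<close>)
 also have "\<dots> = 0" using assms(1) by (intro sum.neutral) auto
 finally have le: "(\<Sum>k<n. (\<theta> k * sqrt (l k) / 2) * \<bar>d k\<bar>) \<le> 0" .
 have nn: "0 \<le> (\<theta> k * sqrt (l k) / 2) * \<bar>d k\<bar>" if "k < n" for k
  using thp[OF that] lp[OF that] by simp
 then have "(\<Sum>k<n. (\<theta> k * sqrt (l k) / 2) * \<bar>d k\<bar>) = 0"
  using le by (intro antisym sum_nonneg) auto
 then have "(\<theta> i * sqrt (l i) / 2) * \<bar>d i\<bar> = 0"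
  using i nn by (subst (asm) sum_nonneg_eq_0_iff) auto
 then show ?thesis using thp[OF i] lp[OF i] by simp
qed

definition cellmass :: "nat set \<Rightarrow> real" where "cellmass C = (\<Sum>k\<in>C. mass k)"

text \<open>The sources are the values of \<open>r\<close> on one cell \<open>C\<close>, while all of \<open>U\<close> (the union of the cells) absorbs. The flow of
 a cell may re-enter the cells, and this is accounted for as an exchange of mass.\<close>
definition cell_tube :: "nat set \<Rightarrow> nat set \<Rightarrow> (nat \<Rightarrow> real) \<Rightarrow> bool" where
 "cell_tube U C x \<longleftrightarrow> C \<subseteq> U \<and> C \<subseteq> {..<n} \<and> tube U (\<lambda>k. if k \<in> C then r k else 0) x"

lemma cell_tube_exists: "C \<subseteq> U \<Longrightarrow> C \<subseteq> {..<n} \<Longrightarrow> \<exists>x. cell_tube U C x"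
 unfolding cell_tube_def using rp by (simp add: less_imp_le) (intro tube_exists, auto intro: less_imp_le)

context
 fixes U C x
 assumes ct: "cell_tube U C x"
begin

lemma ct_CU: "C \<subseteq> U" and ct_Cn: "C \<subseteq> {..<n}" using ct by (auto simp: cell_tube_def)

lemma ct_bd: "i < n \<Longrightarrow> 0 \<le> x i" "i < n \<Longrightarrow> x i \<le> r i"
 using ct by (auto simp: cell_tube_def tube_def)

lemma ct_src: "i < n \<Longrightarrow> i \<in> U \<Longrightarrow> x i = (if i \<in> C then r i else 0)"
 using ct by (auto simp: cell_tube_def tube_def)

lemma ct_eq: "i < n \<Longrightarrow> i \<notin> U \<Longrightarrow> \<theta> i * x i = (\<Sum>k<n. Vc i k * x k)"
 using ct by (auto simp: cell_tube_def tube_def)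

lemma ct_sum: "(\<Sum>k\<in>{..<n} \<inter> U. f k * x k) = (\<Sum>k\<in>C. f k * r k)"
proof (rule sum.mono_neutral_cong_right)
 show "C \<subseteq> {..<n} \<inter> U" using ct_CU ct_Cn by blast
 show "\<forall>i\<in>{..<n} \<inter> U - C. f i * x i = 0" using ct_src by auto
 show "f k * x k = f k * r k" if "k \<in> C" for k
  using ct_src[of k] that ct_CU ct_Cn by auto
qed simp

text \<open>Here the supersolution is \<open>sqrt l\<close>, whose defect is half of it by the contraction.\<close>
lemma ct_sqrt:
 assumes lc: "lc > 0" "\<And>k. k \<in> C \<Longrightarrow> lc \<le> l k"
 shows "(\<Sum>k<n. \<theta> k * sqrt (l k) * x k) \<le> 2 * cellmass C / sqrt lc"
proof -
 have "(\<Sum>k<n. (\<theta> k * sqrt (l k) / 2) * x k) \<le> (\<Sum>k\<in>{..<n} \<inter> U. \<theta> k * sqrt (l k) * x k)"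
 proof (rule tube_weighted)
  fix k assume "k < n" then show "(\<Sum>i<n. Vc i k * sqrt (l i)) \<le> \<theta> k * sqrt (l k) - \<theta> k * sqrt (l k) / 2"
   using contraction[of k] by simp
 qed (use lp ct_bd ct_eq in \<open>auto intro: less_imp_le\<close>)
 also have "\<dots> = (\<Sum>k\<in>C. \<theta> k * sqrt (l k) * r k)" by (rule ct_sum)
 also have "\<dots> \<le> (\<Sum>k\<in>C. mass k / sqrt lc)"
 proof (rule sum_mono)
  fix k assume k: "k \<in> C"
  then have kn: "k < n" using ct_Cn by auto
  have "sqrt lc \<le> sqrt (l k)" using lc(2)[OF k] by simp
  then have "\<theta> k * r k * sqrt (l k) * sqrt lc \<le> \<theta> k * r k * sqrt (l k) * sqrt (l k)"
   using thp[OF kn] rp[OF kn] lp[OF kn] by (intro mult_left_mono) auto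
  then have "\<theta> k * sqrt (l k) * r k * sqrt lc \<le> mass k" using lp[OF kn] by (simp add: mass_def mult_ac)
  then show "\<theta> k * sqrt (l k) * r k \<le> mass k / sqrt lc" using lc(1) by (simp add: pos_le_divide_eq)
 qed
 also have "\<dots> = cellmass C / sqrt lc" by (simp add: cellmass_def sum_divide_distrib)
 finally have "(\<Sum>k<n. \<theta> k * sqrt (l k) * x k) / 2 \<le> cellmass C / sqrt lc"
  by (simp add: sum_divide_distrib)
 then show ?thesis by (simp add: mult.commute)
qed

text \<open>The supersolution is \<open>l\<close> below the level \<open>\<mu>\<close>, where only the identity for \<open>l\<close> is used, and \<open>sqrt (\<mu> * l)\<close> above it,
 where the contraction yields a defect. The minimum of the two has the properties of both.\<close>
lemma ct_level:
 assumes la: "\<mu> > 0"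
 shows "(\<Sum>k\<in>{k. k < n \<and> \<mu> \<le> l k}. x k) \<le> 2 * cellmass C / (\<tau> * \<mu>)"
proof -
 define \<phi> where "\<phi> k = (if \<mu> \<le> l k then sqrt (\<mu> * l k) else l k)" for k
 define \<psi> where "\<psi> k = (if \<mu> \<le> l k then \<theta> k * \<phi> k / 2 else 0)" for k
 have pl: "\<phi> k \<le> l k" if "k < n" for k
 proof (cases "\<mu> \<le> l k")
  case True
  then have "sqrt (\<mu> * l k) \<le> sqrt (l k * l k)" using lp[OF that] by (intro real_sqrt_le_mono mult_right_mono) auto
  also have "\<dots> = l k" using lp[OF that] by simp
  finally have "sqrt (\<mu> * l k) \<le> l k" .
  then show ?thesis unfolding \<phi>_def by simp
 qed (simp add: \<phi>_def)
 have pl': "\<phi> k \<le> sqrt (\<mu> * l k)" if "k < n" for k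
 proof (cases "\<mu> \<le> l k")
  case False
  have "l k = sqrt (l k * l k)" using lp[OF that] by simp
  also have "\<dots> \<le> sqrt (\<mu> * l k)" using lp[OF that] False by (intro real_sqrt_le_mono mult_right_mono) auto
  finally show ?thesis using False by (simp add: \<phi>_def)
 qed (simp add: \<phi>_def)
 have p0: "0 \<le> \<phi> k" if "k < n" for k using lp[OF that] la by (simp add: \<phi>_def)
 have "(\<Sum>k<n. \<psi> k * x k) \<le> (\<Sum>k\<in>{..<n} \<inter> U. \<theta> k * \<phi> k * x k)"
 proof (rule tube_weighted)
  fix k assume k: "k < n"
  show "(\<Sum>i<n. Vc i k * \<phi> i) \<le> \<theta> k * \<phi> k - \<psi> k"
  proof (cases "\<mu> \<le> l k")
   case True
   have "(\<Sum>i<n. Vc i k * \<phi> i) \<le> (\<Sum>i<n. sqrt \<mu> * (Vc i k * sqrt (l i)))"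
   proof (rule sum_mono)
    fix i assume "i \<in> {..<n}"
    then have "Vc i k * \<phi> i \<le> Vc i k * sqrt (\<mu> * l i)" using pl' Vc0 k by (intro mult_left_mono) auto
    then show "Vc i k * \<phi> i \<le> sqrt \<mu> * (Vc i k * sqrt (l i))" by (simp add: real_sqrt_mult mult_ac)
   qed
   also have "\<dots> = sqrt \<mu> * (\<Sum>i<n. Vc i k * sqrt (l i))" by (simp add: sum_distrib_left)
   also have "\<dots> \<le> sqrt \<mu> * (\<theta> k * sqrt (l k) / 2)"
    using contraction[OF k] la by (intro mult_left_mono) auto
   finally show ?thesis using True by (simp add: \<phi>_def \<psi>_def real_sqrt_mult)
  next
   case False
   have "(\<Sum>i<n. Vc i k * \<phi> i) \<le> (\<Sum>i<n. Vc i k * l i)"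
    using pl Vc0 k by (intro sum_mono mult_left_mono) auto
   also have "\<dots> \<le> \<theta> k * l k" by (rule Vc_col[OF k])
   finally show ?thesis using False by (simp add: \<phi>_def \<psi>_def)
  qed
 qed (use p0 ct_bd ct_eq in auto)
 also have "\<dots> = (\<Sum>k\<in>C. \<theta> k * \<phi> k * r k)" by (rule ct_sum)
 also have "\<dots> \<le> cellmass C" unfolding cellmass_def
 proof (rule sum_mono)
  fix k assume "k \<in> C" then have kn: "k < n" using ct_Cn by auto
  have "\<phi> k * (\<theta> k * r k) \<le> l k * (\<theta> k * r k)" using pl[OF kn] thp[OF kn] rp[OF kn] by (intro mult_right_mono) auto
  then show "\<theta> k * \<phi> k * r k \<le> mass k" by (simp add: mass_def mult_ac)
 qed
 finally have 1: "(\<Sum>k<n. \<psi> k * x k) \<le> cellmass C" .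
 have "(\<Sum>k\<in>{k. k < n \<and> \<mu> \<le> l k}. (\<tau> * \<mu> / 2) * x k) \<le> (\<Sum>k\<in>{k. k < n \<and> \<mu> \<le> l k}. \<psi> k * x k)"
 proof (rule sum_mono)
  fix k assume "k \<in> {k. k < n \<and> \<mu> \<le> l k}"
  then have k: "k < n" "\<mu> \<le> l k" by auto
  have "\<mu> = sqrt (\<mu> * \<mu>)" using la by simp
  also have "\<dots> \<le> sqrt (\<mu> * l k)" using k la by (intro real_sqrt_le_mono mult_left_mono) auto
  finally have "\<mu> \<le> \<phi> k" using k la by (simp add: \<phi>_def)
  then have "\<tau> * \<mu> \<le> \<theta> k * \<phi> k" using th[OF k(1)] tau la by (intro mult_mono) auto
  then show "(\<tau> * \<mu> / 2) * x k \<le> \<psi> k * x k" using k ct_bd[OF k(1)] by (intro mult_right_mono) (auto simp: \<psi>_def)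
 qed
 also have "\<dots> \<le> (\<Sum>k<n. \<psi> k * x k)"
 proof (rule sum_mono2)
  fix k assume "k \<in> {..<n} - {k. k < n \<and> \<mu> \<le> l k}"
  then show "0 \<le> \<psi> k * x k" by (simp add: \<psi>_def)
 qed auto
 finally have "(\<tau> * \<mu> / 2) * (\<Sum>k\<in>{k. k < n \<and> \<mu> \<le> l k}. x k) \<le> cellmass C"
  using 1 by (simp add: sum_distrib_left)
 then show ?thesis using tau la by (simp add: field_simps)
qed

text \<open>The flow that reaches \<open>i\<close> through halting edges, that is, the source that appears at \<open>i\<close> when the flow of the
 cell is subtracted from \<open>r\<close>.\<close>
definition outflow :: "nat \<Rightarrow> real" where "outflow i = (\<Sum>k<n. Vh i k * x k)"

lemma outflow0: "i < n \<Longrightarrow> 0 \<le> outflow i"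
 unfolding outflow_def using Vh0 ct_bd by (intro sum_nonneg mult_nonneg_nonneg) auto

lemma outflow_frequent: assumes "\<not> frequent i" shows "outflow i = 0"
 using assms by (simp add: outflow_def Vh_def halting_def)

lemma outflow_le_sum: assumes i: "i < n"
 shows "outflow i \<le> S / real n * (\<Sum>k\<in>{k. k < n \<and> l i / \<beta> \<le> l k}. x k)"
proof -
 have "outflow i \<le> (\<Sum>k<n. if l i / \<beta> \<le> l k then S / real n * x k else 0)"
  unfolding outflow_def
 proof (rule sum_mono)
  fix k assume "k \<in> {..<n}" then have k: "k < n" by simp
  have h: "l i / \<beta> \<le> l k" if "halting i k" using that be0 by (simp add: halting_def field_simps)
  have "V i k * x k \<le> S / real n * x k" using VS[OF i k] ct_bd[OF k] by (intro mult_right_mono)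
  then show "Vh i k * x k \<le> (if l i / \<beta> \<le> l k then S / real n * x k else 0)"
   using h S ct_bd[OF k] by (auto simp: Vh_def)
 qed
 also have "\<dots> = (\<Sum>k\<in>{k. k < n \<and> l i / \<beta> \<le> l k}. S / real n * x k)"
  by (rule sum.mono_neutral_cong_right) auto
 finally show ?thesis by (simp add: sum_distrib_left)
qed

text \<open>Halting edges connect comparable values of \<open>l\<close>, so that only the flow at levels above \<open>l i / \<beta>\<close> counts.\<close>
lemma outflow_bound1: assumes i: "i < n"
 shows "outflow i \<le> (2 * S * \<beta> / \<tau>) * cellmass C / (real n * l i)"
proof -
 have "l i / \<beta> > 0" using lp[OF i] be0 by simp
 from ct_level[OF this] have "S / real n * (\<Sum>k\<in>{k. k < n \<and> l i / \<beta> \<le> l k}. x k)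
   \<le> S / real n * (2 * cellmass C / (\<tau> * (l i / \<beta>)))" using S by (intro mult_left_mono) auto
 also have "\<dots> = (2 * S * \<beta> / \<tau>) * cellmass C / (real n * l i)" using lp[OF i] be0 tau n by (simp add: field_simps)
 finally show ?thesis using outflow_le_sum[OF i] by linarith
qed

text \<open>Compared with the previous bound, the decay of \<open>sqrt l\<close> along the flow exchanges the factor \<open>1 / l i\<close> for the
 geometric mean with the level of the cell.\<close>
lemma outflow_bound2:
 assumes lc: "lc > 0" "\<And>k. k \<in> C \<Longrightarrow> lc \<le> l k" and i: "i < n"
 shows "outflow i \<le> (2 * S * sqrt \<beta> / \<tau>) * cellmass C / (real n * (sqrt lc * sqrt (l i)))"
proof -
 have li: "l i > 0" using lp[OF i] .
 let ?q = "sqrt (l i) / sqrt \<beta>"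
 have q: "?q > 0" using li be0 by simp
 have "(\<Sum>k\<in>{k. k < n \<and> l i / \<beta> \<le> l k}. (\<tau> * ?q) * x k) \<le> (\<Sum>k\<in>{k. k < n \<and> l i / \<beta> \<le> l k}. \<theta> k * sqrt (l k) * x k)"
 proof (rule sum_mono)
  fix k assume "k \<in> {k. k < n \<and> l i / \<beta> \<le> l k}"
  then have k: "k < n" "l i / \<beta> \<le> l k" by auto
  have "sqrt (l i / \<beta>) \<le> sqrt (l k)" using k(2) by simp
  then have "\<tau> * ?q \<le> \<theta> k * sqrt (l k)" using th[OF k(1)] tau q by (intro mult_mono) (auto simp: real_sqrt_divide)
  then show "(\<tau> * ?q) * x k \<le> \<theta> k * sqrt (l k) * x k" using ct_bd[OF k(1)] by (intro mult_right_mono)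
 qed
 also have "\<dots> \<le> (\<Sum>k<n. \<theta> k * sqrt (l k) * x k)"
 proof (rule sum_mono2)
  fix k assume "k \<in> {..<n} - {k. k < n \<and> l i / \<beta> \<le> l k}"
  then have k: "k < n" by simp
  show "0 \<le> \<theta> k * sqrt (l k) * x k" using thp[OF k] lp[OF k] ct_bd(1)[OF k] by simp
 qed auto
 also note ct_sqrt[OF lc]
 finally have "(\<tau> * ?q) * (\<Sum>k\<in>{k. k < n \<and> l i / \<beta> \<le> l k}. x k) \<le> 2 * cellmass C / sqrt lc"
  by (simp only: sum_distrib_left)
 moreover have "\<tau> * ?q > 0" by (rule mult_pos_pos[OF tau q])
 ultimately have "(\<Sum>k\<in>{k. k < n \<and> l i / \<beta> \<le> l k}. x k) \<le> 2 * cellmass C / sqrt lc / (\<tau> * ?q)"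
  by (simp only: pos_le_divide_eq mult.commute)
 then have "S / real n * (\<Sum>k\<in>{k. k < n \<and> l i / \<beta> \<le> l k}. x k) \<le> S / real n * (2 * cellmass C / sqrt lc / (\<tau> * ?q))"
  using S by (intro mult_left_mono) auto
 also have "\<dots> = (2 * S * sqrt \<beta> / \<tau>) * cellmass C / (real n * (sqrt lc * sqrt (l i)))"
  using li be0 tau n lc by (simp add: field_simps)
 finally show ?thesis using outflow_le_sum[OF i] by linarith
qed

text \<open>A flow seldom stops far below the level at which it started: the mass stopping at \<open>l i\<close> has a moment of order one
 half in \<open>lc / l i\<close>.\<close>
lemma outflow_moment:
 assumes lc: "lc > 0" "\<And>k. k \<in> C \<Longrightarrow> lc \<le> l k"
 shows "(\<Sum>i<n. l i * outflow i * sqrt (lc / l i)) \<le> 2 * sqrt \<beta> * cellmass C"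
proof -
 have "(\<Sum>i<n. sqrt (l i) * outflow i) = (\<Sum>k<n. x k * (\<Sum>i<n. Vh i k * sqrt (l i)))"
  unfolding outflow_def sum_distrib_left by (subst sum.swap) (simp add: mult_ac)
 also have "\<dots> \<le> (\<Sum>k<n. x k * (sqrt \<beta> * (\<theta> k * sqrt (l k))))"
 proof (intro sum_mono mult_left_mono)
  fix k assume "k \<in> {..<n}" then have k: "k < n" by simp
  have lk: "l k > 0" using lp[OF k] .
  have "(\<Sum>i<n. Vh i k * sqrt (l i)) \<le> (\<Sum>i<n. V i k * l i * (sqrt \<beta> / sqrt (l k)))"
  proof (rule sum_mono)
   fix i assume "i \<in> {..<n}" then have i: "i < n" by simp
   have li: "l i > 0" using lp[OF i] .
   show "Vh i k * sqrt (l i) \<le> V i k * l i * (sqrt \<beta> / sqrt (l k))"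
   proof (cases "halting i k")
    case True
    then have "sqrt (l k) \<le> sqrt \<beta> * sqrt (l i)" unfolding halting_def by (simp flip: real_sqrt_mult)
    then have "sqrt (l i) * sqrt (l k) \<le> sqrt (l i) * (sqrt \<beta> * sqrt (l i))" using li by (intro mult_left_mono) auto
    then have "sqrt (l i) * sqrt (l k) \<le> l i * sqrt \<beta>" using li by (simp add: mult_ac)
    then have "sqrt (l i) \<le> l i * sqrt \<beta> / sqrt (l k)" using lk by (simp add: pos_le_divide_eq)
    then have "V i k * sqrt (l i) \<le> V i k * (l i * sqrt \<beta> / sqrt (l k))" using V0[OF i k] by (intro mult_left_mono)
    then show ?thesis using True by (simp add: Vh_def)
   qed (use V0[OF i k] li lk be0 in \<open>simp add: Vh_def\<close>)
  qed
  also have "\<dots> = \<theta> k * l k * (sqrt \<beta> / sqrt (l k))" unfolding leq[OF k] by (rule sum_distrib_right[symmetric])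
  also have "\<dots> = sqrt \<beta> * (\<theta> k * (l k / sqrt (l k)))" by simp
  also have "l k / sqrt (l k) = sqrt (l k)" using lk by (simp add: real_div_sqrt)
  finally show "(\<Sum>i<n. Vh i k * sqrt (l i)) \<le> sqrt \<beta> * (\<theta> k * sqrt (l k))" .
 qed (use ct_bd in auto)
 also have "\<dots> = sqrt \<beta> * (\<Sum>k<n. \<theta> k * sqrt (l k) * x k)" by (simp add: sum_distrib_left mult_ac)
 also have "\<dots> \<le> sqrt \<beta> * (2 * cellmass C / sqrt lc)" using ct_sqrt[OF lc] be0 by (intro mult_left_mono) auto
 finally have "sqrt lc * (\<Sum>i<n. sqrt (l i) * outflow i) \<le> 2 * sqrt \<beta> * cellmass C"
  using lc by (simp add: field_simps)
 moreover have "(\<Sum>i<n. l i * outflow i * sqrt (lc / l i)) = sqrt lc * (\<Sum>i<n. sqrt (l i) * outflow i)"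
 proof -
  have "l i * outflow i * sqrt (lc / l i) = sqrt lc * (sqrt (l i) * outflow i)" if "i < n" for i
  proof -
   have "l i * sqrt (lc / l i) = sqrt lc * (l i / sqrt (l i))" by (simp add: real_sqrt_divide)
   also have "l i / sqrt (l i) = sqrt (l i)" using lp[OF that] by (simp add: real_div_sqrt)
   finally show ?thesis by (simp add: mult_ac)
  qed
  then show ?thesis unfolding sum_distrib_left by (intro sum.cong refl) (metis lessThan_iff)
 qed
 ultimately show ?thesis by simp
qed

lemma outflow_le_r: assumes i: "i < n" shows "outflow i \<le> \<theta> i * r i"
proof -
 have "outflow i \<le> (\<Sum>k<n. V i k * r k)" unfolding outflow_def
  using ct_bd V0 i Vh0 by (intro sum_mono mult_mono) (auto simp: Vh_def)
 then show ?thesis using req[OF i] by simp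
qed

end

lemma dual_pair: "perron_pair n (\<lambda>i j. V j i) r l \<theta> S \<tau> \<Theta> \<beta> c0"
 using n S tau V lp rp th leq req be c0 by unfold_locales auto

text \<open>By uniqueness the flows of disjoint cells add up to the flow of their union, which lies below \<open>r\<close>. Hence all of
 them can be subtracted at once and the remainder is nonnegative.\<close>
lemma tubes_sum:
 assumes I: "finite I" and ct: "\<And>c. c \<in> I \<Longrightarrow> cell_tube (\<Union>c\<in>I. C c) (C c) (X c)"
  and dj: "\<And>c d. c \<in> I \<Longrightarrow> d \<in> I \<Longrightarrow> c \<noteq> d \<Longrightarrow> C c \<inter> C d = {}"
  and i: "i < n"
 shows "(\<Sum>c\<in>I. X c i) \<le> r i" and "i \<in> (\<Union>c\<in>I. C c) \<Longrightarrow> (\<Sum>c\<in>I. X c i) = r i"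
proof -
 define U where "U = (\<Union>c\<in>I. C c)"
 have onU: "(\<Sum>c\<in>I. X c j) = r j" if j: "j < n" "j \<in> U" for j
 proof -
  obtain d where d: "d \<in> I" "j \<in> C d" using j by (auto simp: U_def)
  have "X c j = (if c = d then r j else 0)" if c: "c \<in> I" for c
   using ct_src[OF ct[OF c] j(1)] j(2) d dj[OF c d(1)] by (auto simp: U_def)
  then have "(\<Sum>c\<in>I. X c j) = (\<Sum>c\<in>I. if c = d then r j else 0)" by (intro sum.cong) auto
  then show ?thesis using d I by simp
 qed
 have "\<exists>x. tube U (\<lambda>k. if k \<in> U then r k else 0) x"
  by (rule tube_exists) (use rp in \<open>auto intro: less_imp_le\<close>)
 then obtain x where x: "tube U (\<lambda>k. if k \<in> U then r k else 0) x" by blast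
 have "(\<Sum>c\<in>I. X c i) - x i = 0"
 proof (rule tube_unique[of U "\<lambda>i. (\<Sum>c\<in>I. X c i) - x i", OF _ _ i])
  fix j assume j: "j < n" "j \<in> U"
  show "(\<Sum>c\<in>I. X c j) - x j = 0" using onU[OF j] x j by (simp add: tube_def)
 next
  fix j assume j: "j < n" "j \<notin> U"
  have "\<theta> j * (\<Sum>c\<in>I. X c j) = (\<Sum>c\<in>I. \<Sum>k<n. Vc j k * X c k)"
   unfolding sum_distrib_left using ct_eq[OF ct j(1)] j(2) by (intro sum.cong) (auto simp: U_def)
  also have "\<dots> = (\<Sum>k<n. Vc j k * (\<Sum>c\<in>I. X c k))"
   unfolding sum_distrib_left by (rule sum.swap)
  finally show "\<theta> j * ((\<Sum>c\<in>I. X c j) - x j) = (\<Sum>k<n. Vc j k * ((\<Sum>c\<in>I. X c k) - x k))"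
   using x j by (simp add: tube_def algebra_simps sum_subtractf)
 qed
 moreover have "x i \<le> r i" using x i by (simp add: tube_def)
 ultimately show "(\<Sum>c\<in>I. X c i) \<le> r i" by simp
 show "i \<in> (\<Union>c\<in>I. C c) \<Longrightarrow> (\<Sum>c\<in>I. X c i) = r i" using onU[OF i] by (simp add: U_def)
qed

end

section \<open>Families of cells and the exchange of mass\<close>

text \<open>The cells are disjoint, lie in a family of logarithmic unit boxes for \<open>(l, r)\<close> and contain at most \<open>\<eta> * n\<close> sites
 each. \<open>X\<close> are the forward flows and \<open>Y\<close> those of the transposed matrix.\<close>
locale cell_family = perron_pair +
 fixes I :: "'c set" and cell :: "'c \<Rightarrow> nat set" and el er :: "'c \<Rightarrow> int" and \<eta> :: real
  and X Y :: "'c \<Rightarrow> nat \<Rightarrow> real"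
 assumes I: "finite I" "I \<noteq> {}"
  and ne: "\<And>c. c \<in> I \<Longrightarrow> cell c \<noteq> {}" and cn: "\<And>c. c \<in> I \<Longrightarrow> cell c \<subseteq> {..<n}"
  and dj: "\<And>c d. c \<in> I \<Longrightarrow> d \<in> I \<Longrightarrow> c \<noteq> d \<Longrightarrow> cell c \<inter> cell d = {}"
  and cl: "\<And>c k. c \<in> I \<Longrightarrow> k \<in> cell c \<Longrightarrow> exp (real_of_int (el c)) \<le> l k \<and> l k \<le> exp (real_of_int (el c) + 1)"
  and cr: "\<And>c k. c \<in> I \<Longrightarrow> k \<in> cell c \<Longrightarrow> exp (real_of_int (er c)) \<le> r k \<and> r k \<le> exp (real_of_int (er c) + 1)"
  and eta: "\<And>c. c \<in> I \<Longrightarrow> real (card (cell c)) \<le> \<eta> * real n"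
  and ctX: "\<And>c. c \<in> I \<Longrightarrow> cell_tube (\<Union>c\<in>I. cell c) (cell c) (X c)"
  and ctY: "\<And>c. c \<in> I \<Longrightarrow> perron_pair.cell_tube n (\<lambda>i j. V j i) r l \<theta> \<beta> c0 (\<Union>c\<in>I. cell c) (cell c) (Y c)"
begin

interpretation dual: perron_pair n "\<lambda>i j. V j i" r l \<theta> S \<tau> \<Theta> \<beta> c0 by (rule dual_pair)

lemma dual_family: "cell_family n (\<lambda>i j. V j i) r l \<theta> S \<tau> \<Theta> \<beta> c0 I cell er el \<eta> Y X"
 using I ne cn dj cl cr eta ctX ctY by unfold_locales auto

end

context perron_pair
begin

text \<open>The constant in the bound for the exchange between two cells.\<close>
definition K5 where "K5 = 2 * sqrt (S * exp 1 / \<tau>) + (2 / \<tau> + \<Theta>\<^sup>2 * exp 2 * (2 * S * sqrt \<beta> / \<tau>)\<^sup>2)"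
lemma Theta_pos: "\<Theta> > 0" using th[of 0] n tau by auto

lemma K5_pos: "K5 > 0"
 unfolding K5_def using S tau by (intro add_nonneg_pos add_pos_nonneg) auto

end

context cell_family
begin

interpretation dual: perron_pair n "\<lambda>i j. V j i" r l \<theta> S \<tau> \<Theta> \<beta> c0 by (rule dual_pair)

definition U where "U = (\<Union>c\<in>I. cell c)"
definition M where "M c = cellmass (cell c)"
text \<open>The part of the mass of cell \<open>c\<close> that its flow delivers into cell \<open>d\<close>, either directly or by stopping at a site
 which the backward flow of \<open>d\<close> occupies (see \<open>B_split\<close>).\<close>
definition B where "B d c = (\<Sum>i<n. Y d i * (\<Sum>k<n. V i k * X c k)) - (\<Sum>i\<in>{..<n}-U. Y d i * \<theta> i * X c i)"
definition lft where "lft i = l i - (\<Sum>d\<in>I. Y d i)"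
definition rgt where "rgt i = r i - (\<Sum>c\<in>I. X c i)"
text \<open>What the flow of \<open>c\<close> delivers to the part of \<open>l\<close> that remains after all cells have been removed.\<close>
definition R where "R c = (\<Sum>i<n. lft i * outflow (X c) i)"

lemma ctX': "c \<in> I \<Longrightarrow> cell_tube U (cell c) (X c)" using ctX by (simp add: U_def)
lemma ctY': "c \<in> I \<Longrightarrow> dual.cell_tube U (cell c) (Y c)" using ctY by (simp add: U_def)

lemma dual_mass: "dual.cellmass C = cellmass C"
 by (simp add: dual.cellmass_def cellmass_def dual.mass_def mass_def mult_ac)

lemma M_pos: assumes c: "c \<in> I" shows "0 < M c"
proof -
 have "finite (cell c)" using cn[OF c] finite_subset by blast
 then show ?thesis unfolding M_def cellmass_def using ne[OF c] cn[OF c] mass_pos by (intro sum_pos) auto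
qed

lemma X0: "c \<in> I \<Longrightarrow> i < n \<Longrightarrow> 0 \<le> X c i" using ct_bd(1)[OF ctX'] .
lemma Y0: "c \<in> I \<Longrightarrow> i < n \<Longrightarrow> 0 \<le> Y c i" using dual.ct_bd(1)[OF ctY'] .

lemma rgt_props: assumes i: "i < n" shows "0 \<le> rgt i" "rgt i \<le> r i" "i \<in> U \<Longrightarrow> rgt i = 0"
proof -
 have "(\<Sum>c\<in>I. X c i) \<le> r i" by (rule tubes_sum(1)[OF I(1) ctX dj i])
 then show "0 \<le> rgt i" by (simp add: rgt_def)
 have "0 \<le> (\<Sum>c\<in>I. X c i)" using X0 i by (intro sum_nonneg) auto
 then show "rgt i \<le> r i" by (simp add: rgt_def)
 show "i \<in> U \<Longrightarrow> rgt i = 0"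
  using tubes_sum(2)[OF I(1) ctX dj i] by (simp add: rgt_def U_def)
qed

lemma lft_props: assumes i: "i < n" shows "0 \<le> lft i" "lft i \<le> l i" "i \<in> U \<Longrightarrow> lft i = 0"
proof -
 have "(\<Sum>c\<in>I. Y c i) \<le> l i" by (rule dual.tubes_sum(1)[OF I(1) ctY dj i])
 then show "0 \<le> lft i" by (simp add: lft_def)
 have "0 \<le> (\<Sum>c\<in>I. Y c i)" using Y0 i by (intro sum_nonneg) auto
 then show "lft i \<le> l i" by (simp add: lft_def)
 show "i \<in> U \<Longrightarrow> lft i = 0"
  using dual.tubes_sum(2)[OF I(1) ctY dj i] by (simp add: lft_def U_def)
qed

lemma flow_off: assumes c: "c \<in> I" and i: "i < n" "i \<notin> U"
 shows "(\<Sum>k<n. V i k * X c k) = outflow (X c) i + \<theta> i * X c i"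
proof -
 have "(\<Sum>k<n. V i k * X c k) = (\<Sum>k<n. (Vh i k + Vc i k) * X c k)"
  by (simp only: Vsplit[symmetric])
 also have "\<dots> = (\<Sum>k<n. Vh i k * X c k) + (\<Sum>k<n. Vc i k * X c k)"
  by (simp only: distrib_right sum.distrib)
 finally show ?thesis using ct_eq[OF ctX'[OF c] i] by (simp only: outflow_def[OF ctX'[OF c]])
qed

lemma B_split: assumes d: "d \<in> I" and c: "c \<in> I"
 shows "B d c = (\<Sum>i\<in>cell d. l i * (\<Sum>k<n. V i k * X c k)) + (\<Sum>i\<in>{..<n}-U. Y d i * outflow (X c) i)"
proof -
 have "(\<Sum>i<n. Y d i * (\<Sum>k<n. V i k * X c k)) = (\<Sum>i\<in>{..<n} \<inter> U. (\<Sum>k<n. V i k * X c k) * Y d i)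
   + (\<Sum>i\<in>{..<n}-U. Y d i * (\<Sum>k<n. V i k * X c k))"
  by (subst sum.Int_Diff[of "{..<n}" _ U]) (auto simp: mult.commute)
 moreover have "(\<Sum>i\<in>{..<n} \<inter> U. (\<Sum>k<n. V i k * X c k) * Y d i) = (\<Sum>i\<in>cell d. (\<Sum>k<n. V i k * X c k) * l i)"
  by (rule dual.ct_sum[OF ctY'[OF d]])
 moreover have "(\<Sum>i\<in>{..<n}-U. Y d i * (\<Sum>k<n. V i k * X c k)) =
   (\<Sum>i\<in>{..<n}-U. Y d i * outflow (X c) i) + (\<Sum>i\<in>{..<n}-U. Y d i * \<theta> i * X c i)"
  using flow_off[OF c] by (simp add: algebra_simps flip: sum.distrib)
 ultimately show ?thesis by (simp add: B_def mult.commute)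
qed

lemma B0: assumes d: "d \<in> I" and c: "c \<in> I" shows "0 \<le> B d c"
proof -
 have "0 \<le> l i * (\<Sum>k<n. V i k * X c k)" if "i \<in> cell d" for i
 proof -
  have i: "i < n" using that cn[OF d] by auto
  then have "0 \<le> (\<Sum>k<n. V i k * X c k)" using V0 X0[OF c] by (intro sum_nonneg mult_nonneg_nonneg) auto
  then show ?thesis using lp[OF i] by simp
 qed
 moreover have "0 \<le> Y d i * outflow (X c) i" if "i < n" for i
  using Y0[OF d that] outflow0[OF ctX'[OF c] that] by simp
 ultimately show ?thesis unfolding B_split[OF assms] by (intro add_nonneg_nonneg sum_nonneg) auto
qed

lemma B_dual: assumes d: "d \<in> I" and c: "c \<in> I"
 shows "B d c = (\<Sum>i<n. X c i * (\<Sum>k<n. V k i * Y d k)) - (\<Sum>i\<in>{..<n}-U. X c i * \<theta> i * Y d i)"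
proof -
 have "(\<Sum>i<n. Y d i * (\<Sum>k<n. V i k * X c k)) = (\<Sum>i<n. X c i * (\<Sum>k<n. V k i * Y d k))"
  unfolding sum_distrib_left by (subst sum.swap) (simp add: mult_ac)
 then show ?thesis by (simp add: B_def mult_ac)
qed

text \<open>Conservation of mass: what starts in \<open>c\<close> ends either in some cell or in the remainder.\<close>
lemma R_eq: assumes c: "c \<in> I" shows "R c = M c - (\<Sum>d\<in>I. B d c)"
proof -
 let ?f = "\<lambda>i. (\<Sum>k<n. V i k * X c k)"
 have "R c = (\<Sum>i<n. lft i * ?f i) - (\<Sum>i\<in>{..<n}-U. lft i * \<theta> i * X c i)"
 proof -
  have "R c = (\<Sum>i\<in>{..<n}-U. lft i * outflow (X c) i)" unfolding R_def
   using lft_props(3) by (intro sum.mono_neutral_right) auto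
  also have "\<dots> = (\<Sum>i\<in>{..<n}-U. lft i * ?f i - lft i * \<theta> i * X c i)"
   using flow_off[OF c] by (intro sum.cong) (auto simp: algebra_simps)
  also have "\<dots> = (\<Sum>i\<in>{..<n}-U. lft i * ?f i) - (\<Sum>i\<in>{..<n}-U. lft i * \<theta> i * X c i)"
   by (rule sum_subtractf)
  also have "(\<Sum>i\<in>{..<n}-U. lft i * ?f i) = (\<Sum>i<n. lft i * ?f i)"
   using lft_props(3) by (intro sum.mono_neutral_left) auto
  finally show ?thesis .
 qed
 also have "(\<Sum>i<n. lft i * ?f i) = (\<Sum>i<n. l i * ?f i) - (\<Sum>d\<in>I. \<Sum>i<n. Y d i * ?f i)"
  unfolding lft_def by (subst sum.swap) (simp add: left_diff_distrib sum_subtractf sum_distrib_right)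
 also have "(\<Sum>i\<in>{..<n}-U. lft i * \<theta> i * X c i) = (\<Sum>i\<in>{..<n}-U. l i * \<theta> i * X c i) - (\<Sum>d\<in>I. \<Sum>i\<in>{..<n}-U. Y d i * \<theta> i * X c i)"
  unfolding lft_def by (subst sum.swap) (simp add: left_diff_distrib sum_subtractf sum_distrib_right)
 also have "(\<Sum>i<n. l i * ?f i) = (\<Sum>k<n. X c k * (\<theta> k * l k))"
  unfolding sum_distrib_left by (subst sum.swap) (simp add: leq sum_distrib_left mult_ac)
 also have "\<dots> = (\<Sum>i\<in>{..<n}-U. l i * \<theta> i * X c i) + (\<Sum>i\<in>{..<n} \<inter> U. (\<theta> i * l i) * X c i)"
  by (subst sum.Int_Diff[of "{..<n}" _ U]) (auto simp: mult_ac)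
 also have "(\<Sum>i\<in>{..<n} \<inter> U. (\<theta> i * l i) * X c i) = (\<Sum>i\<in>cell c. (\<theta> i * l i) * r i)"
  by (rule ct_sum[OF ctX'[OF c]])
 also have "\<dots> = M c" by (simp add: M_def cellmass_def mass_def mult_ac)
 finally show ?thesis by (simp add: B_def sum_subtractf)
qed

lemma R0: "c \<in> I \<Longrightarrow> 0 \<le> R c"
 unfolding R_def using lft_props outflow0[OF ctX'] by (intro sum_nonneg mult_nonneg_nonneg) auto

lemma R_le_M: "c \<in> I \<Longrightarrow> R c \<le> M c"
proof -
 assume c: "c \<in> I"
 have "0 \<le> (\<Sum>d\<in>I. B d c)" using B0[OF _ c] by (rule sum_nonneg)
 then show ?thesis using R_eq[OF c] by simp
qed

lemma card_pos: "c \<in> I \<Longrightarrow> 0 < card (cell c)"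
 using ne cn finite_subset[OF cn] by (simp add: card_gt_0_iff)

lemma M_upper: assumes c: "c \<in> I"
 shows "M c \<le> real (card (cell c)) * (\<Theta> * exp 2 * exp (real_of_int (el c)) * exp (real_of_int (er c)))"
proof -
 have "M c \<le> (\<Sum>k\<in>cell c. \<Theta> * exp 2 * exp (real_of_int (el c)) * exp (real_of_int (er c)))"
  unfolding M_def cellmass_def
 proof (rule sum_mono)
  fix k assume k: "k \<in> cell c" then have kn: "k < n" using cn[OF c] by auto
  have "l k * r k * \<theta> k \<le> exp (real_of_int (el c) + 1) * exp (real_of_int (er c) + 1) * \<Theta>"
   using cl[OF c k] cr[OF c k] th[OF kn] lp[OF kn] rp[OF kn] tau by (intro mult_mono) auto
  also have "\<dots> = \<Theta> * (exp 1 * exp 1) * exp (real_of_int (el c)) * exp (real_of_int (er c))"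
   by (simp add: exp_add mult_ac)
  also have "exp 1 * exp 1 = (exp 2 :: real)" by (simp flip: exp_add)
  finally show "mass k \<le> \<Theta> * exp 2 * exp (real_of_int (el c)) * exp (real_of_int (er c))"
   by (simp add: mass_def)
 qed
 then show ?thesis by simp
qed



text \<open>A sparse cell \<open>d\<close> receives little mass unless it lies at a much higher level of \<open>l\<close> than \<open>c\<close>. For the mass that enters the
 sites of \<open>d\<close> directly, the bounds by the level of \<open>d\<close> and by the identity for \<open>l\<close> are combined in geometric mean
 and integrated against the bound for \<open>sqrt l\<close> along the flow. Where the flow of \<open>c\<close> stops on the backward
 flow of \<open>d\<close>, the two pointwise bounds for the stopped flow are played off against each other.\<close>
lemma B_bound:
 assumes d: "d \<in> I" and c: "c \<in> I" and w: "0 < w" "w \<le> 1"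
  and t: "\<eta> * exp (real_of_int (el d) - real_of_int (el c)) \<le> w ^ 3"
 shows "B d c \<le> K5 * w * max (M c) (M d)"
proof -
 define lc ld rd where "lc = exp (real_of_int (el c))" and "ld = exp (real_of_int (el d))"
  and "rd = exp (real_of_int (er d))"
 have p: "lc > 0" "ld > 0" "rd > 0" by (auto simp: lc_def ld_def rd_def)
 have lclow: "\<And>k. k \<in> cell c \<Longrightarrow> lc \<le> l k" using cl[OF c] by (simp add: lc_def)
 have rdlow: "\<And>k. k \<in> cell d \<Longrightarrow> rd \<le> r k" using cr[OF d] by (simp add: rd_def)
 \<comment> \<open>The density of cell \<open>d\<close>, corrected for the difference of levels.\<close>
 define t2 where "t2 = real (card (cell d)) / real n * ld / lc"
 have t2w: "t2 \<le> w ^ 3"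
 proof -
  have "real (card (cell d)) / real n \<le> \<eta>" using eta[OF d] n by (simp add: field_simps)
  then have "real (card (cell d)) / real n * (ld / lc) \<le> \<eta> * (ld / lc)" using p by (intro mult_right_mono) auto
  then show ?thesis using t by (simp add: t2_def ld_def lc_def exp_diff)
 qed
 have t20: "t2 \<ge> 0" using p by (simp add: t2_def)
 note X' = ctX'[OF c] and Y' = ctY'[OF d]
 have Mc: "M c > 0" and Md: "M d > 0" using M_pos c d by auto
 \<comment> \<open>Mass that enters the sites of \<open>d\<close> directly.\<close>
 have first: "(\<Sum>i\<in>cell d. l i * (\<Sum>k<n. V i k * X c k)) \<le> 2 * sqrt (S * exp 1 / \<tau>) * w * M c"
 proof -
  define A where "A k = (\<Sum>i\<in>cell d. l i * V i k)" for k
  have A0: "0 \<le> A k" if "k < n" for k unfolding A_def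
   using cn[OF d] lp V0 that by (intro sum_nonneg mult_nonneg_nonneg) (auto intro: less_imp_le)
  have A1: "A k \<le> \<theta> k * l k" if k: "k < n" for k
  proof -
   have "A k \<le> (\<Sum>i<n. l i * V i k)" unfolding A_def
    using cn[OF d] lp V0 k by (intro sum_mono2 mult_nonneg_nonneg) (auto intro: less_imp_le)
   then show ?thesis using leq[OF k] by (simp add: mult.commute)
  qed
  have A2: "A k \<le> S * exp 1 * (real (card (cell d)) / real n * ld)" if k: "k < n" for k
  proof -
   have "A k \<le> (\<Sum>i\<in>cell d. (exp 1 * ld) * (S / real n))" unfolding A_def
   proof (rule sum_mono)
    fix i assume i: "i \<in> cell d" then have "i < n" using cn[OF d] by auto
    then show "l i * V i k \<le> (exp 1 * ld) * (S / real n)"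
     using cl[OF d i] V[of i k] k lp by (intro mult_mono) (auto simp: ld_def exp_add mult.commute)
   qed
   then show ?thesis by (simp add: mult_ac)
  qed
  have A3: "A k \<le> sqrt (S * exp 1 * (real (card (cell d)) / real n * ld)) * sqrt (\<theta> k * l k)" if k: "k < n" for k
  proof -
   have "sqrt (A k * A k) \<le> sqrt ((S * exp 1 * (real (card (cell d)) / real n * ld)) * (\<theta> k * l k))"
    using A0[OF k] A1[OF k] A2[OF k] by (intro real_sqrt_le_mono mult_mono) auto
   then show ?thesis using A0[OF k] by (simp only: real_sqrt_mult_self abs_of_nonneg real_sqrt_mult)
  qed
  have "(\<Sum>i\<in>cell d. l i * (\<Sum>k<n. V i k * X c k)) = (\<Sum>k<n. A k * X c k)"
   unfolding A_def sum_distrib_left sum_distrib_right by (subst sum.swap) (simp add: mult_ac)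
  also have "\<dots> \<le> (\<Sum>k<n. sqrt (S * exp 1 * (real (card (cell d)) / real n * ld)) / sqrt \<tau> * (\<theta> k * sqrt (l k) * X c k))"
  proof (rule sum_mono)
   fix k assume "k \<in> {..<n}" then have k: "k < n" by simp
   have "sqrt (\<theta> k) * sqrt \<tau> \<le> sqrt (\<theta> k) * sqrt (\<theta> k)" using th[OF k] thp[OF k] by (intro mult_left_mono) auto
   then have "sqrt (\<theta> k) \<le> \<theta> k / sqrt \<tau>" using tau thp[OF k] by (simp add: pos_le_divide_eq)
   then have "sqrt (\<theta> k) * sqrt (l k) \<le> \<theta> k / sqrt \<tau> * sqrt (l k)" using lp[OF k] by (intro mult_right_mono) auto
   then have "A k \<le> sqrt (S * exp 1 * (real (card (cell d)) / real n * ld)) * (\<theta> k / sqrt \<tau> * sqrt (l k))"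
    using A3[OF k] S p by (smt (verit) divide_nonneg_nonneg exp_ge_zero mult_left_mono mult_nonneg_nonneg of_nat_0_le_iff real_sqrt_ge_zero real_sqrt_mult)
   then have "A k * X c k \<le> sqrt (S * exp 1 * (real (card (cell d)) / real n * ld)) * (\<theta> k / sqrt \<tau> * sqrt (l k)) * X c k"
    using X0[OF c k] by (intro mult_right_mono)
   then show "A k * X c k \<le> sqrt (S * exp 1 * (real (card (cell d)) / real n * ld)) / sqrt \<tau> * (\<theta> k * sqrt (l k) * X c k)"
    by (simp add: mult_ac)
  qed
  also have "\<dots> = sqrt (S * exp 1 * (real (card (cell d)) / real n * ld)) / sqrt \<tau> * (\<Sum>k<n. \<theta> k * sqrt (l k) * X c k)"
   by (simp add: sum_distrib_left)
  also have "\<dots> \<le> sqrt (S * exp 1 * (real (card (cell d)) / real n * ld)) / sqrt \<tau> * (2 * M c / sqrt lc)"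
   using ct_sqrt[OF X' p(1) lclow] S p tau by (intro mult_left_mono) (auto simp: M_def)
  also have "\<dots> = 2 * sqrt (S * exp 1 / \<tau>) * sqrt t2 * M c"
   by (simp add: t2_def real_sqrt_mult real_sqrt_divide mult_ac)
  also have "\<dots> \<le> 2 * sqrt (S * exp 1 / \<tau>) * w * M c"
  proof -
   have "w ^ 3 \<le> w ^ 2" using w by (intro power_decreasing) auto
   then have "sqrt t2 \<le> sqrt (w ^ 2)" using t2w by (intro real_sqrt_le_mono) auto
   then have "sqrt t2 \<le> w" using w by simp
   then show ?thesis using S tau Mc by (intro mult_right_mono mult_left_mono) auto
  qed
  finally show ?thesis .
 qed
 \<comment> \<open>Mass that stops on the backward flow of \<open>d\<close>; the threshold \<open>K\<close> separates the two bounds.\<close>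
 define K2 where "K2 = 2 * S * sqrt \<beta> / \<tau>"
 define Q where "Q = K2 * M c / (real n * sqrt lc)"
 define K where "K = sqrt rd * (w * (M c / M d))"
 have Kp: "K > 0" using p w Mc Md by (simp add: K_def)
 have Q0: "Q \<ge> 0" using S tau be0 Mc p by (simp add: Q_def K2_def)
 have pt: "Y d i * outflow (X c) i \<le> K * (Y d i * sqrt (r i)) + \<Theta> * Q\<^sup>2 / K\<^sup>2" if i: "i < n" for i
 proof (cases "outflow (X c) i \<le> K * sqrt (r i)")
  case True
  then have "Y d i * outflow (X c) i \<le> Y d i * (K * sqrt (r i))" using Y0[OF d i] by (intro mult_left_mono)
  moreover have "0 \<le> \<Theta> * Q\<^sup>2 / K\<^sup>2" using Theta_pos by simp
  ultimately show ?thesis by (simp add: mult_ac)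
 next
  case False
  define o' where "o' = outflow (X c) i"
  have ri: "r i > 0" and li: "l i > 0" using rp lp i by auto
  have o1: "o' \<le> Q / sqrt (l i)"
   using outflow_bound2[OF X' p(1) lclow i] by (simp add: o'_def Q_def K2_def M_def mult_ac)
  have o2: "o' \<le> \<Theta> * r i"
  proof -
   have "o' \<le> \<theta> i * r i" unfolding o'_def by (rule outflow_le_r[OF X' i])
   also have "\<dots> \<le> \<Theta> * r i" using th[OF i] ri by (intro mult_right_mono) auto
   finally show ?thesis .
  qed
  have o3: "K * sqrt (r i) < o'" using False by (simp add: o'_def)
  have a: "K < \<Theta> * sqrt (r i)"
  proof -
   have "K * sqrt (r i) < (\<Theta> * sqrt (r i)) * sqrt (r i)" using o2 o3 ri by (simp add: mult.assoc)
   then show ?thesis using ri by (simp add: mult_less_cancel_right)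
  qed
  have b: "sqrt (l i) * (K * sqrt (r i)) \<le> Q"
  proof -
   have "K * sqrt (r i) \<le> Q / sqrt (l i)" using o1 o3 by linarith
   then show ?thesis using li by (simp add: pos_le_divide_eq mult.commute)
  qed
  have "sqrt (l i) * K * K \<le> sqrt (l i) * K * (\<Theta> * sqrt (r i))"
   using a li Kp by (intro mult_left_mono) auto
  also have "\<dots> = \<Theta> * (sqrt (l i) * (K * sqrt (r i)))" by simp
  also have "\<dots> \<le> \<Theta> * Q" using b Theta_pos by (intro mult_left_mono) auto
  finally have c': "sqrt (l i) \<le> \<Theta> * Q / K\<^sup>2" using Kp by (simp add: pos_le_divide_eq power2_eq_square mult.assoc)
  have "Y d i * o' \<le> l i * (Q / sqrt (l i))"
   using dual.ct_bd[OF Y' i] o1 li outflow0[OF X' i] by (intro mult_mono) (auto simp: o'_def)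
  also have "\<dots> = Q * sqrt (l i)" using li by (simp add: real_div_sqrt field_simps)
  also have "\<dots> \<le> Q * (\<Theta> * Q / K\<^sup>2)" using c' Q0 by (intro mult_left_mono)
  also have "\<dots> = \<Theta> * Q\<^sup>2 / K\<^sup>2" by (simp add: power2_eq_square)
  finally show ?thesis using Y0[OF d i] Kp ri by (simp add: o'_def add_increasing)
 qed
 have "(\<Sum>i\<in>{..<n}-U. Y d i * outflow (X c) i) \<le> (\<Sum>i<n. Y d i * outflow (X c) i)"
  using Y0[OF d] outflow0[OF X'] by (intro sum_mono2 mult_nonneg_nonneg) auto
 also have "\<dots> \<le> (\<Sum>i<n. K * (Y d i * sqrt (r i)) + \<Theta> * Q\<^sup>2 / K\<^sup>2)" using pt by (intro sum_mono) auto
 also have "\<dots> = K * (\<Sum>i<n. Y d i * sqrt (r i)) + real n * (\<Theta> * Q\<^sup>2 / K\<^sup>2)"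
  by (simp add: sum.distrib sum_distrib_left)
 also have "(\<Sum>i<n. Y d i * sqrt (r i)) \<le> 2 * M d / sqrt rd / \<tau>"
 proof -
  have "\<tau> * (\<Sum>i<n. Y d i * sqrt (r i)) \<le> (\<Sum>k<n. \<theta> k * sqrt (r k) * Y d k)"
   unfolding sum_distrib_left
  proof (rule sum_mono)
   fix k assume "k \<in> {..<n}" then have k: "k < n" by simp
   have "\<tau> * (Y d k * sqrt (r k)) \<le> \<theta> k * (Y d k * sqrt (r k))"
    using th[OF k] Y0[OF d k] rp[OF k] by (intro mult_right_mono) auto
   then show "\<tau> * (Y d k * sqrt (r k)) \<le> \<theta> k * sqrt (r k) * Y d k" by (simp add: mult_ac)
  qed
  also have "\<dots> \<le> 2 * M d / sqrt rd"
   using dual.ct_sqrt[OF Y' p(3) rdlow] by (simp add: dual_mass M_def)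
  finally have "(\<Sum>i<n. Y d i * sqrt (r i)) * \<tau> \<le> 2 * M d / sqrt rd" by (simp only: mult.commute)
  then show ?thesis using tau by (simp only: pos_le_divide_eq)
 qed
 finally have "(\<Sum>i\<in>{..<n}-U. Y d i * outflow (X c) i) \<le> K * (2 * M d / sqrt rd / \<tau>) + real n * (\<Theta> * Q\<^sup>2 / K\<^sup>2)"
  using Kp by simp
 also have "K * (2 * M d / sqrt rd / \<tau>) = 2 / \<tau> * w * M c" using Md p by (simp add: K_def)
 also have "real n * (\<Theta> * Q\<^sup>2 / K\<^sup>2) = \<Theta> * K2\<^sup>2 * (M d * (M d / (real n * lc * rd))) / w\<^sup>2"
  using Mc Md p n w by (simp add: Q_def K_def power_mult_distrib power_divide field_simps power2_eq_square)
 also have "\<dots> \<le> \<Theta> * K2\<^sup>2 * (M d * (\<Theta> * exp 2 * t2)) / w\<^sup>2"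
 proof -
  have "M d / (real n * lc * rd) \<le> \<Theta> * exp 2 * t2"
   using M_upper[OF d] n p by (simp add: t2_def ld_def[symmetric] rd_def[symmetric] field_simps)
  then show ?thesis using Theta_pos Md by (intro divide_right_mono mult_left_mono) auto
 qed
 also have "\<dots> \<le> \<Theta> * K2\<^sup>2 * (M d * (\<Theta> * exp 2 * w ^ 3)) / w\<^sup>2"
  using t2w Theta_pos Md by (intro divide_right_mono mult_left_mono) auto
 also have "\<dots> = \<Theta>\<^sup>2 * exp 2 * K2\<^sup>2 * w * M d" using w by (simp add: power2_eq_square power3_eq_cube)
 finally have second: "(\<Sum>i\<in>{..<n}-U. Y d i * outflow (X c) i) \<le> 2 / \<tau> * w * M c + \<Theta>\<^sup>2 * exp 2 * K2\<^sup>2 * w * M d" by simp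
 let ?m = "max (M c) (M d)"
 have 1: "2 * sqrt (S * exp 1 / \<tau>) * w * M c \<le> 2 * sqrt (S * exp 1 / \<tau>) * w * ?m"
  using w S tau by (intro mult_left_mono) auto
 have 2: "2 / \<tau> * w * M c \<le> 2 / \<tau> * w * ?m" using w tau by (intro mult_left_mono) auto
 have 3: "\<Theta>\<^sup>2 * exp 2 * K2\<^sup>2 * w * M d \<le> \<Theta>\<^sup>2 * exp 2 * K2\<^sup>2 * w * ?m" using w by (intro mult_left_mono) auto
 have "K5 * w * ?m = 2 * sqrt (S * exp 1 / \<tau>) * w * ?m + (2 / \<tau> * w * ?m + \<Theta>\<^sup>2 * exp 2 * K2\<^sup>2 * w * ?m)"
  unfolding K5_def K2_def[symmetric] by (simp only: distrib_right)
 then show ?thesis unfolding B_split[OF d c] using first second 1 2 3 by linarith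
qed

end

section \<open>The distance to the frequent values\<close>

lemma sum_exp_dist_le:
 fixes x \<theta> :: real and A :: "int set"
 assumes A: "finite A" and th: "\<theta> > 0"
 shows "(\<Sum>a\<in>A. exp (- \<theta> * \<bar>x - real_of_int a\<bar>)) \<le> 2 * exp \<theta> / (1 - exp (- \<theta>))"
proof -
 define q where "q = exp (- \<theta>)"
 have q: "0 < q" "q < 1" using th by (auto simp: q_def)
 define m where "m = \<lfloor>x\<rfloor>"
 have geo: "(\<Sum>k\<in>K. q ^ k) \<le> 1 / (1 - q)" if "finite K" for K :: "nat set"
 proof -
  have "(\<Sum>k\<in>K. q ^ k) \<le> (\<Sum>k. q ^ k)"
   using q that by (intro sum_le_suminf summable_geometric) auto
  also have "\<dots> = 1 / (1 - q)" using q by (intro suminf_geometric) auto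
  finally show ?thesis .
 qed
 have pt: "exp (- \<theta> * \<bar>x - real_of_int a\<bar>) \<le> exp \<theta> * q ^ nat \<bar>a - m\<bar>" for a
 proof -
  have xm: "real_of_int m \<le> x" "x < real_of_int m + 1" by (auto simp: m_def)
  have "real (nat \<bar>a - m\<bar>) - 1 \<le> \<bar>x - real_of_int a\<bar>" using xm by linarith
  then have "- \<theta> * \<bar>x - real_of_int a\<bar> \<le> \<theta> + real (nat \<bar>a - m\<bar>) * (- \<theta>)"
   using mult_left_mono[of "real (nat \<bar>a - m\<bar>) - 1" "\<bar>x - real_of_int a\<bar>" \<theta>] th by (simp add: algebra_simps)
  then have "exp (- \<theta> * \<bar>x - real_of_int a\<bar>) \<le> exp (\<theta> + real (nat \<bar>a - m\<bar>) * (- \<theta>))" by simp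
  also have "\<dots> = exp \<theta> * q ^ nat \<bar>a - m\<bar>" unfolding q_def exp_add exp_of_nat_mult ..
  finally show ?thesis .
 qed
 have part: "(\<Sum>a\<in>A'. q ^ nat \<bar>a - m\<bar>) \<le> 1 / (1 - q)" if "finite A'" and inj: "inj_on (\<lambda>a. nat \<bar>a - m\<bar>) A'" for A'
 proof -
  have "(\<Sum>a\<in>A'. q ^ nat \<bar>a - m\<bar>) = (\<Sum>k\<in>(\<lambda>a. nat \<bar>a - m\<bar>) ` A'. q ^ k)"
   using inj by (simp add: sum.reindex)
  then show ?thesis using geo that(1) by simp
 qed
 have "(\<Sum>a\<in>A. exp (- \<theta> * \<bar>x - real_of_int a\<bar>)) \<le> (\<Sum>a\<in>A. exp \<theta> * q ^ nat \<bar>a - m\<bar>)"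
  using pt by (intro sum_mono)
 also have "\<dots> = exp \<theta> * ((\<Sum>a\<in>{a\<in>A. a \<ge> m}. q ^ nat \<bar>a - m\<bar>) + (\<Sum>a\<in>{a\<in>A. a < m}. q ^ nat \<bar>a - m\<bar>))"
 proof -
  have "(\<Sum>a\<in>A. q ^ nat \<bar>a - m\<bar>) = (\<Sum>a\<in>{a\<in>A. a \<ge> m} \<union> {a\<in>A. a < m}. q ^ nat \<bar>a - m\<bar>)"
   by (rule sum.cong) auto
  also have "\<dots> = (\<Sum>a\<in>{a\<in>A. a \<ge> m}. q ^ nat \<bar>a - m\<bar>) + (\<Sum>a\<in>{a\<in>A. a < m}. q ^ nat \<bar>a - m\<bar>)"
   using A by (intro sum.union_disjoint) auto
  finally show ?thesis by (simp flip: sum_distrib_left)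
 qed
 also have "\<dots> \<le> exp \<theta> * (1 / (1 - q) + 1 / (1 - q))"
  using A by (intro mult_left_mono add_mono part) (auto simp: inj_on_def)
 finally show ?thesis by (simp add: q_def mult.commute)
qed

context perron_pair
begin

text \<open>Otherwise no edge would be halting, and the contraction would contradict the existence of the positive
 vectors.\<close>
lemma frequent_exists: "\<exists>i<n. frequent i"
proof (rule ccontr)
 assume no: "\<not> (\<exists>i<n. frequent i)"
 have "(\<Sum>k<n. r k * (\<theta> k * sqrt (l k))) = (\<Sum>i<n. sqrt (l i) * (\<Sum>k<n. V i k * r k))"
  using req by (intro sum.cong) (auto simp: mult_ac)
 also have "\<dots> = (\<Sum>k<n. r k * (\<Sum>i<n. V i k * sqrt (l i)))"
  unfolding sum_distrib_left by (subst sum.swap) (simp add: mult_ac)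
 also have "\<dots> = (\<Sum>k<n. r k * (\<Sum>i<n. Vc i k * sqrt (l i)))"
  using no by (intro sum.cong refl arg_cong2[where f="(*)"]) (auto simp: Vc_def halting_def)
 also have "\<dots> \<le> (\<Sum>k<n. r k * (\<theta> k * sqrt (l k) / 2))"
  using contraction rp by (intro sum_mono mult_left_mono) (auto intro: less_imp_le)
 also have "\<dots> = (\<Sum>k<n. r k * (\<theta> k * sqrt (l k))) / 2" by (simp add: sum_divide_distrib)
 finally have "(\<Sum>k<n. r k * (\<theta> k * sqrt (l k))) \<le> 0" by simp
 moreover have "(\<Sum>k<n. r k * (\<theta> k * sqrt (l k))) > 0"
  using n rp thp lp by (intro sum_pos) auto
 ultimately show False by simp
qed

text \<open>The distance of a logarithmic level to the nearest frequent one.\<close>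
definition gap :: "real \<Rightarrow> real" where "gap a = Min ((\<lambda>i. \<bar>ln (l i) - a\<bar>) ` {i. i < n \<and> frequent i})"

lemma gap_le: "i < n \<Longrightarrow> frequent i \<Longrightarrow> gap a \<le> \<bar>ln (l i) - a\<bar>"
 unfolding gap_def by (intro Min_le) auto

lemma gap_attained: "\<exists>i<n. frequent i \<and> gap a = \<bar>ln (l i) - a\<bar>"
proof -
 have "gap a \<in> (\<lambda>i. \<bar>ln (l i) - a\<bar>) ` {i. i < n \<and> frequent i}"
  unfolding gap_def using frequent_exists by (intro Min_in) auto
 then show ?thesis by blast
qed

lemma gap0: "0 \<le> gap a" using gap_attained[of a] by auto

lemma gap_lipschitz: "gap a \<le> gap b + \<bar>a - b\<bar>"
proof -
 obtain i where i: "i < n" "frequent i" "gap b = \<bar>ln (l i) - b\<bar>" using gap_attained by blast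
 have "gap a \<le> \<bar>ln (l i) - a\<bar>" using gap_le i by blast
 then show ?thesis using i(3) by linarith
qed

text \<open>The bound in the next lemma; it depends on \<open>\<beta>\<close> and \<open>c0\<close> but not on \<open>n\<close>.\<close>
definition gapsum :: "real \<Rightarrow> real" where
 "gapsum \<kappa> = exp (2 * \<kappa> * ln \<beta>) / c0 * (2 * exp \<kappa> / (1 - exp (- \<kappa>)))"

text \<open>Every frequent level is within \<open>2 ln \<beta>\<close> of the levels of \<open>c0 * n\<close> sites. So the distance to the nearest frequent
 level can be replaced by an average over all sites of the distance to their levels, and for a single site
 the sum over the integers is a geometric series.\<close>
lemma sum_gap_le:
 assumes A: "finite A" and ka: "\<kappa> > 0"
 shows "(\<Sum>a\<in>A. exp (- \<kappa> * gap (real_of_int a))) \<le> gapsum \<kappa>"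
proof -
 have nc: "c0 * real n > 0" using c0 n by simp
 have pt: "exp (- \<kappa> * gap a) \<le> exp (2 * \<kappa> * ln \<beta>) / (c0 * real n) * (\<Sum>j<n. exp (- \<kappa> * \<bar>ln (l j) - a\<bar>))" for a
 proof -
  obtain i where i: "i < n" "frequent i" "gap a = \<bar>ln (l i) - a\<bar>" using gap_attained by blast
  define J where "J = {j. j < n \<and> l i \<le> \<beta>\<^sup>2 * l j \<and> l j \<le> \<beta>\<^sup>2 * l i}"
  have J: "finite J" "J \<subseteq> {..<n}" by (auto simp: J_def)
  have e: "exp (- \<kappa> * gap a) * exp (- (2 * \<kappa> * ln \<beta>)) \<le> exp (- \<kappa> * \<bar>ln (l j) - a\<bar>)" if "j \<in> J" for j
  proof -
   have j: "j < n" using that by (simp add: J_def)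
   have "ln (l i) \<le> ln (\<beta>\<^sup>2 * l j)" "ln (l j) \<le> ln (\<beta>\<^sup>2 * l i)"
    using that lp[OF i(1)] lp[OF j] by (auto simp: J_def intro!: ln_mono)
   then have "\<bar>ln (l j) - ln (l i)\<bar> \<le> 2 * ln \<beta>"
    using lp[OF i(1)] lp[OF j] be0 by (simp add: ln_mult ln_realpow abs_le_iff)
   then have "\<bar>ln (l j) - a\<bar> \<le> gap a + 2 * ln \<beta>" using i(3) by linarith
   then have "\<kappa> * \<bar>ln (l j) - a\<bar> \<le> \<kappa> * (gap a + 2 * ln \<beta>)" using ka by (intro mult_left_mono) auto
   then show ?thesis by (simp add: algebra_simps flip: exp_add)
  qed
  have "c0 * real n * (exp (- \<kappa> * gap a) * exp (- (2 * \<kappa> * ln \<beta>)))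
    \<le> real (card J) * (exp (- \<kappa> * gap a) * exp (- (2 * \<kappa> * ln \<beta>)))"
   using i(2) by (intro mult_right_mono) (auto simp: frequent_def J_def)
  also have "\<dots> \<le> (\<Sum>j\<in>J. exp (- \<kappa> * \<bar>ln (l j) - a\<bar>))"
   using sum_mono[OF e, of J] by simp
  also have "\<dots> \<le> (\<Sum>j<n. exp (- \<kappa> * \<bar>ln (l j) - a\<bar>))" using J by (intro sum_mono2) auto
  finally have "exp (- \<kappa> * gap a) * (c0 * real n) \<le> exp (2 * \<kappa> * ln \<beta>) * (\<Sum>j<n. exp (- \<kappa> * \<bar>ln (l j) - a\<bar>))"
   by (simp add: exp_minus field_simps)
  then show ?thesis using nc by (simp add: pos_le_divide_eq)
 qed
 have "(\<Sum>a\<in>A. exp (- \<kappa> * gap (real_of_int a)))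
   \<le> (\<Sum>a\<in>A. exp (2 * \<kappa> * ln \<beta>) / (c0 * real n) * (\<Sum>j<n. exp (- \<kappa> * \<bar>ln (l j) - real_of_int a\<bar>)))"
  using pt by (intro sum_mono)
 also have "\<dots> = exp (2 * \<kappa> * ln \<beta>) / (c0 * real n) * (\<Sum>j<n. \<Sum>a\<in>A. exp (- \<kappa> * \<bar>ln (l j) - real_of_int a\<bar>))"
  by (subst sum.swap) (simp add: sum_distrib_left)
 also have "\<dots> \<le> exp (2 * \<kappa> * ln \<beta>) / (c0 * real n) * (\<Sum>j<n. 2 * exp \<kappa> / (1 - exp (- \<kappa>)))"
  using sum_exp_dist_le[OF A ka] nc by (intro mult_left_mono sum_mono) auto
 also have "\<dots> = gapsum \<kappa>" using n by (simp add: gapsum_def)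
 finally show ?thesis .
qed

end

context cell_family
begin

interpretation dual: perron_pair n "\<lambda>i j. V j i" r l \<theta> S \<tau> \<Theta> \<beta> c0 by (rule dual_pair)
interpretation D: cell_family n "\<lambda>i j. V j i" r l \<theta> S \<tau> \<Theta> \<beta> c0 I cell er el \<eta> Y X by (rule dual_family)

lemma D_M: "D.M = M" by (rule ext) (simp add: M_def D.M_def dual_mass)
lemma D_B: "c \<in> I \<Longrightarrow> d \<in> I \<Longrightarrow> D.B c d = B d c" by (simp only: B_dual D.B_def)
lemma D_lft: "D.lft = rgt" and D_rgt: "D.rgt = lft" by (rule ext, simp add: D.lft_def rgt_def D.rgt_def lft_def)+

definition R' where "R' = D.R"
lemma R'_eq: "d \<in> I \<Longrightarrow> R' d = M d - (\<Sum>c\<in>I. B d c)"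
 unfolding R'_def by (subst D.R_eq) (simp_all add: D_M D_B)

lemma R'0: "c \<in> I \<Longrightarrow> 0 \<le> R' c" unfolding R'_def by (rule D.R0)
definition total where "total = (\<Sum>c\<in>I. R c)"

lemma total_alt: "total = (\<Sum>c\<in>I. R' c)"
proof -
 have "total = (\<Sum>c\<in>I. M c) - (\<Sum>c\<in>I. \<Sum>d\<in>I. B d c)" unfolding total_def by (simp add: R_eq sum_subtractf)
 also have "(\<Sum>c\<in>I. \<Sum>d\<in>I. B d c) = (\<Sum>d\<in>I. \<Sum>c\<in>I. B d c)" by (rule sum.swap)
 finally show ?thesis by (simp add: R'_eq sum_subtractf)
qed

lemma total0: "0 \<le> total" unfolding total_def using R0 by (rule sum_nonneg)

section \<open>Removing a family of cells\<close>

text \<open>Weights of the cells. They decrease with the distance to the frequent values slowly enough not to spoil the entropy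
 estimate and are summable over the integer levels.\<close>
definition sr where "sr c = exp (- (1/8) * dual.gap (real_of_int (er c)))"
definition sl where "sl c = exp (- (1/8) * gap (real_of_int (el c)))"
definition Gr where "Gr = (\<Sum>c\<in>I. sr c * M c)"
definition Gl where "Gl = (\<Sum>c\<in>I. sl c * M c)"
definition allmass where "allmass = (\<Sum>c\<in>I. M c)"

lemma sr01: "0 < sr c" "sr c \<le> 1" and sl01: "0 < sl c" "sl c \<le> 1"
 using dual.gap0 gap0 by (auto simp: sr_def sl_def)

lemma B_bound_r: assumes d: "d \<in> I" and c: "c \<in> I" and w: "0 < w" "w \<le> 1"
  and t: "\<eta> * exp (real_of_int (er c) - real_of_int (er d)) \<le> w ^ 3"
 shows "B d c \<le> K5 * w * (M c + M d)"
proof -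
 have "D.B c d \<le> K5 * w * max (D.M d) (D.M c)" by (rule D.B_bound[OF c d w t])
 also have "\<dots> \<le> K5 * w * (M c + M d)"
  unfolding D_M using M_pos[OF c] M_pos[OF d] K5_pos w by (intro mult_left_mono) auto
 finally show ?thesis using D_B[OF c d] by simp
qed

lemma sum_pairs: "(\<Sum>d\<in>I. \<Sum>c\<in>I. M c + M d) = 2 * real (card I) * allmass"
proof -
 have "(\<Sum>d\<in>I. \<Sum>c\<in>I. M c + M d) = (\<Sum>d\<in>I. allmass + real (card I) * M d)"
  by (simp add: sum.distrib allmass_def)
 also have "\<dots> = real (card I) * allmass + real (card I) * allmass"
  by (simp add: sum.distrib allmass_def flip: sum_distrib_left)
 finally show ?thesis by simp
qed

text \<open>The weighted mass of the cells is controlled by the mass that leaves them. Mass exchanged inside the family moves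
 to lower values of \<open>er\<close> except for a small part, by \<open>B_bound\<close> for the transposed matrix. The cumulative weight \<open>W\<close>, a bounded function of the
 level whose increments dominate \<open>sr\<close>, therefore pays for every exchange.\<close>
lemma Gr_bound:
 assumes w: "0 < w" "w \<le> 1" "\<eta> \<le> w ^ 3" and e0: "\<eta> \<ge> 0"
  and small: "(1 + dual.gapsum (1/8)) * (2 * K5 * w * real (card I) * allmass) \<le> Gr / 2"
 shows "Gr \<le> 2 * (1 + dual.gapsum (1/8)) * total"
proof -
 define W where "W c = (\<Sum>a\<in>{a\<in>er ` I. a \<le> er c}. exp (- (1/8) * dual.gap (real_of_int a)))" for c
 let ?K = "dual.gapsum (1/8)"
 have fin: "finite (er ` I)" using I by simp
 have W0: "0 \<le> W c" for c unfolding W_def by (intro sum_nonneg) simp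
 have WK: "W c \<le> ?K" for c unfolding W_def using fin by (intro dual.sum_gap_le) auto
 have K0: "0 \<le> ?K" using W0 WK order_trans by blast
 \<comment> \<open>\<open>W\<close> increases by at least \<open>sr c\<close> when \<open>er\<close> reaches the level of \<open>c\<close>.\<close>
 have Wup: "sr c \<le> W c - W d" if c: "c \<in> I" and lt: "er d < er c" for c d
 proof -
  have "W d + sr c = (\<Sum>a\<in>insert (er c) {a\<in>er ` I. a \<le> er d}. exp (- (1/8) * dual.gap (real_of_int a)))"
   using lt fin by (subst sum.insert) (auto simp: W_def sr_def)
  also have "\<dots> \<le> W c" unfolding W_def using fin c lt by (intro sum_mono2) auto
  finally show ?thesis by simp
 qed
 define e where "e = 2 * K5 * w * real (card I) * allmass"
 define Bd where "Bd d c = (if er d < er c then 0 else B d c)" for d c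
 have Bd: "Bd d c \<le> K5 * w * (M c + M d)" if d: "d \<in> I" and c: "c \<in> I" for d c
 proof (cases "er d < er c")
  case False
  then have "exp (real_of_int (er c) - real_of_int (er d)) \<le> 1" by simp
  then have "\<eta> * exp (real_of_int (er c) - real_of_int (er d)) \<le> \<eta> * 1" using e0 by (intro mult_left_mono) auto
  then show ?thesis using B_bound_r[OF d c w(1,2)] w(3) False by (simp add: Bd_def)
 next
  case True then show ?thesis using K5_pos w M_pos[OF c] M_pos[OF d] by (simp add: Bd_def)
 qed
 have "(\<Sum>d\<in>I. \<Sum>c\<in>I. Bd d c) \<le> (\<Sum>d\<in>I. \<Sum>c\<in>I. K5 * w * (M c + M d))"
  using Bd by (intro sum_mono) auto
 also have "\<dots> = K5 * w * (\<Sum>d\<in>I. \<Sum>c\<in>I. M c + M d)" by (simp only: sum_distrib_left)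
 finally have Be: "(\<Sum>d\<in>I. \<Sum>c\<in>I. Bd d c) \<le> e" unfolding sum_pairs e_def by (simp add: mult_ac)
 have bal: "(\<Sum>d\<in>I. \<Sum>c\<in>I. B d c * (W c - W d)) = (\<Sum>d\<in>I. W d * R' d) - (\<Sum>c\<in>I. W c * R c)"
 proof -
  have "(\<Sum>d\<in>I. \<Sum>c\<in>I. B d c * (W c - W d)) = (\<Sum>d\<in>I. \<Sum>c\<in>I. B d c * W c) - (\<Sum>d\<in>I. \<Sum>c\<in>I. B d c * W d)"
   by (simp add: right_diff_distrib sum_subtractf)
  also have "(\<Sum>d\<in>I. \<Sum>c\<in>I. B d c * W c) = (\<Sum>c\<in>I. W c * (\<Sum>d\<in>I. B d c))"
   by (subst sum.swap) (simp add: sum_distrib_left mult.commute)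
  also have "\<dots> = (\<Sum>c\<in>I. W c * (M c - R c))" by (intro sum.cong) (auto simp: R_eq)
  also have "(\<Sum>d\<in>I. \<Sum>c\<in>I. B d c * W d) = (\<Sum>d\<in>I. W d * (\<Sum>c\<in>I. B d c))"
   by (simp add: sum_distrib_left mult.commute)
  also have "\<dots> = (\<Sum>d\<in>I. W d * (M d - R' d))" by (intro sum.cong) (auto simp: R'_eq)
  finally show ?thesis by (simp add: right_diff_distrib sum_subtractf)
 qed
 have "(\<Sum>d\<in>I. \<Sum>c\<in>I. (B d c - Bd d c) * sr c) \<le> (\<Sum>d\<in>I. \<Sum>c\<in>I. B d c * (W c - W d) + ?K * Bd d c)"
 proof (intro sum_mono)
  fix d c assume d: "d \<in> I" and c: "c \<in> I"
  show "(B d c - Bd d c) * sr c \<le> B d c * (W c - W d) + ?K * Bd d c"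
  proof (cases "er d < er c")
   case True
   then show ?thesis using Wup[OF c True] B0[OF d c] by (simp add: Bd_def mult_left_mono)
  next
   case False
   have "- ?K \<le> W c - W d" using W0[of c] WK[of d] by linarith
   then have "B d c * (- ?K) \<le> B d c * (W c - W d)" using B0[OF d c] by (rule mult_left_mono)
   then show ?thesis using False by (simp add: Bd_def mult.commute)
  qed
 qed
 also have "\<dots> = (\<Sum>d\<in>I. W d * R' d) - (\<Sum>c\<in>I. W c * R c) + ?K * (\<Sum>d\<in>I. \<Sum>c\<in>I. Bd d c)"
  unfolding bal[symmetric] by (simp add: sum.distrib sum_distrib_left)
 also have "\<dots> \<le> ?K * total + ?K * e"
 proof -
  have "(\<Sum>d\<in>I. W d * R' d) \<le> (\<Sum>d\<in>I. ?K * R' d)" using WK R'0 by (intro sum_mono mult_right_mono) auto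
  moreover have "0 \<le> (\<Sum>c\<in>I. W c * R c)" using W0 R0 by (intro sum_nonneg mult_nonneg_nonneg) auto
  moreover have "?K * (\<Sum>d\<in>I. \<Sum>c\<in>I. Bd d c) \<le> ?K * e" using Be K0 by (rule mult_left_mono)
  ultimately show ?thesis by (simp add: total_alt sum_distrib_left)
 qed
 finally have 1: "(\<Sum>d\<in>I. \<Sum>c\<in>I. (B d c - Bd d c) * sr c) \<le> ?K * total + ?K * e" .
 have "Gr = (\<Sum>c\<in>I. sr c * R c) + (\<Sum>c\<in>I. sr c * (\<Sum>d\<in>I. B d c))"
  unfolding Gr_def by (simp add: R_eq algebra_simps flip: sum.distrib)
 also have "(\<Sum>c\<in>I. sr c * (\<Sum>d\<in>I. B d c)) = (\<Sum>d\<in>I. \<Sum>c\<in>I. sr c * B d c)"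
  unfolding sum_distrib_left by (rule sum.swap)
 also have "\<dots> = (\<Sum>d\<in>I. \<Sum>c\<in>I. (B d c - Bd d c) * sr c) + (\<Sum>d\<in>I. \<Sum>c\<in>I. sr c * Bd d c)"
  by (simp add: algebra_simps flip: sum.distrib)
 also have "(\<Sum>d\<in>I. \<Sum>c\<in>I. sr c * Bd d c) \<le> (\<Sum>d\<in>I. \<Sum>c\<in>I. Bd d c)"
  using sr01 B0 by (intro sum_mono) (simp add: Bd_def mult_left_le_one_le less_imp_le)
 also have "(\<Sum>c\<in>I. sr c * R c) \<le> total" unfolding total_def
  using sr01 R0 by (intro sum_mono) (simp add: mult_left_le_one_le less_imp_le)
 finally have "Gr \<le> (1 + ?K) * total + (1 + ?K) * e" using 1 Be by (simp add: algebra_simps)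
 also have "(1 + ?K) * e \<le> Gr / 2" using small by (simp add: e_def)
 finally show ?thesis by (simp add: algebra_simps)
qed

text \<open>The total sources in the equations for the remainders \<open>rgt\<close> and \<open>lft\<close>.\<close>
definition bb where "bb i = (\<Sum>c\<in>I. outflow (X c) i)"
definition bb' where "bb' j = (\<Sum>c\<in>I. dual.outflow (Y c) j)"

lemma sum_lft_bb: "(\<Sum>i<n. lft i * bb i) = total"
 unfolding bb_def total_def R_def sum_distrib_left by (rule sum.swap)

lemma bb0: "i < n \<Longrightarrow> 0 \<le> bb i" unfolding bb_def using outflow0[OF ctX'] by (intro sum_nonneg) auto

lemma rgt_eq: assumes i: "i < n" "i \<notin> U" shows "rgt i * \<theta> i = (\<Sum>j<n. V i j * rgt j) + bb i"
proof -
 have "(\<Sum>j<n. V i j * rgt j) = \<theta> i * r i - (\<Sum>c\<in>I. \<Sum>j<n. V i j * X c j)"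
  unfolding rgt_def right_diff_distrib sum_subtractf req[OF i(1)] sum_distrib_left by (subst sum.swap) simp
 also have "(\<Sum>c\<in>I. \<Sum>j<n. V i j * X c j) = (\<Sum>c\<in>I. outflow (X c) i + \<theta> i * X c i)"
  using flow_off i by (intro sum.cong) auto
 also have "\<dots> = bb i + \<theta> i * (\<Sum>c\<in>I. X c i)" by (simp add: sum.distrib bb_def sum_distrib_left)
 finally show ?thesis by (simp add: rgt_def algebra_simps)
qed

text \<open>The entropy of the sources, each of which is a superposition of the contributions of the cells. The logarithm of the sum is
 compared with those of the parts by means of the weights \<open>sl c * M c / Gl\<close>, at the price \<open>gap / 8\<close> from \<open>ln (sl c)\<close>.
 The flow stops at frequent sites, which are at distance at least \<open>gap\<close> from the level of the cell. Stopping above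
 gains \<open>gap\<close>, and stopping below is rare by \<open>outflow_moment\<close>. The net gain is \<open>7/8\<close> of \<open>gap\<close>.\<close>
lemma out_entropy:
 shows "(\<Sum>i<n. lft i * (bb i * ln (bb i))) \<le>
   (\<Sum>c\<in>I. R c * (ln ((2 * S * \<beta> / \<tau>) * Gl / real n) - 7/8 * gap (real_of_int (el c)) - real_of_int (el c)))
    + 32 * sqrt \<beta> * Gl"
proof -
 define K1 where "K1 = 2 * S * \<beta> / \<tau>"
 have K1: "K1 > 0" using S tau be0 by (simp add: K1_def)
 have Gl: "Gl > 0" unfolding Gl_def using I M_pos sl01 by (intro sum_pos) auto
 have nn: "real n > 0" using n by simp
 define b where "b c i = outflow (X c) i" for c i
 have b0: "0 \<le> b c i" if "c \<in> I" "i < n" for c i using outflow0[OF ctX'] that by (simp add: b_def)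
 have pt: "bb i * ln (bb i) \<le> (\<Sum>c\<in>I. b c i * (ln (K1 * Gl / real n) + 1/8 * gap (real_of_int (el c)) - ln (l i)))"
  if i: "i < n" for i
 proof -
  define s where "s c = sl c * M c / Gl" for c
  have s: "s c > 0" if "c \<in> I" for c using that Gl sl01 M_pos by (simp add: s_def)
  have s1: "(\<Sum>c\<in>I. s c) = 1" using Gl by (simp add: s_def Gl_def flip: sum_divide_distrib)
  have li: "l i > 0" using lp[OF i] .
  have "b c i * ln (bb i) \<le> b c i * (ln (K1 * Gl / real n) + 1/8 * gap (real_of_int (el c)) - ln (l i)) + (s c * bb i - b c i)"
   if c: "c \<in> I" for c
  proof (cases "b c i = 0")
   case True then show ?thesis using s[OF c] bb0[OF i] by simp
  next
   case False
   then have bp: "b c i > 0" using b0[OF c i] by simp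
   moreover have "b c i \<le> bb i" unfolding bb_def b_def[symmetric]
    using I b0 i c by (intro member_le_sum) auto
   ultimately have bbp: "bb i > 0" by simp
   have "ln (bb i) = ln (s c * bb i / b c i) + ln (b c i / s c)"
    using bp bbp s[OF c] by (simp add: ln_div ln_mult)
   also have "ln (s c * bb i / b c i) \<le> s c * bb i / b c i - 1"
    using bp bbp s[OF c] by (intro ln_le_minus_one) auto
   also have "ln (b c i / s c) \<le> ln (K1 * Gl / real n) + 1/8 * gap (real_of_int (el c)) - ln (l i)"
   proof -
    have "b c i \<le> K1 * M c / (real n * l i)"
     using outflow_bound1[OF ctX'[OF c] i] by (simp add: b_def K1_def M_def)
    then have "b c i / s c \<le> K1 * M c / (real n * l i) / s c" using s[OF c] by (intro divide_right_mono) auto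
    also have "\<dots> = K1 * Gl / real n / sl c / l i"
     using M_pos[OF c] sl01[of c] Gl by (simp add: s_def field_simps)
    finally have "ln (b c i / s c) \<le> ln (K1 * Gl / real n / sl c / l i)"
     using bp s[OF c] by (intro ln_mono) auto
    also have "\<dots> = ln (K1 * Gl / real n) - ln (sl c) - ln (l i)"
     using K1 Gl nn sl01[of c] li by (simp add: ln_div ln_mult)
    finally show ?thesis by (simp add: sl_def)
   qed
   finally have "b c i * ln (bb i) \<le> b c i * (s c * bb i / b c i - 1 + (ln (K1 * Gl / real n) + 1/8 * gap (real_of_int (el c)) - ln (l i)))"
    using bp by (intro mult_left_mono) auto
   then show ?thesis using bp by (simp add: algebra_simps)
  qed
  then have "(\<Sum>c\<in>I. b c i * ln (bb i)) \<le> (\<Sum>c\<in>I. b c i * (ln (K1 * Gl / real n) + 1/8 * gap (real_of_int (el c)) - ln (l i)) + (s c * bb i - b c i))"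
   by (intro sum_mono)
  also have "\<dots> = (\<Sum>c\<in>I. b c i * (ln (K1 * Gl / real n) + 1/8 * gap (real_of_int (el c)) - ln (l i))) + ((\<Sum>c\<in>I. s c) * bb i - (\<Sum>c\<in>I. b c i))"
   by (simp add: sum.distrib sum_subtractf sum_distrib_right)
  finally show ?thesis unfolding s1 by (simp add: bb_def b_def sum_distrib_right)
 qed
 have key: "b c i * (real_of_int (el c) - ln (l i)) \<le> b c i * (- gap (real_of_int (el c))
   + 16 * (sl c)\<^sup>2 * sqrt (exp (real_of_int (el c)) / l i))" if c: "c \<in> I" and i: "i < n" for c i
 proof (cases "frequent i")
  case False then show ?thesis using outflow_frequent[OF ctX'[OF c]] by (simp add: b_def)
 next
  case True
  define g where "g = gap (real_of_int (el c))"
  define u where "u = real_of_int (el c) - ln (l i)"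
  have g: "g \<le> \<bar>u\<bar>" "0 \<le> g" using gap_le[OF i True, of "real_of_int (el c)"] gap0 by (auto simp: g_def u_def)
  have "u \<le> - g + 16 * exp (- g / 4) * exp (u / 2)"
  proof (cases "u \<le> 0")
   case True
   have "0 \<le> 16 * exp (- g / 4) * exp (u / 2)" by simp
   then show ?thesis using g True by linarith
  next
   case False
   have "u + g \<le> 16 * (1 + u / 4)" using g False by simp
   also have "1 + u / 4 \<le> exp (u / 4)" by (rule exp_ge_add_one_self)
   also have "exp (u / 4) \<le> exp (- g / 4 + u / 2)" using g False by simp
   finally show ?thesis by (simp only: exp_add) simp
  qed
  moreover have "exp (- g / 4) = (sl c)\<^sup>2" by (simp add: sl_def g_def power2_eq_square flip: exp_add)
  moreover have "sqrt (exp (real_of_int (el c)) / l i) = exp (u / 2)"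
  proof (rule real_sqrt_unique)
   have "(exp (u / 2))\<^sup>2 = exp u" by (simp add: power2_eq_square flip: exp_add)
   then show "(exp (u / 2))\<^sup>2 = exp (real_of_int (el c)) / l i"
    using lp[OF i] by (simp add: u_def exp_diff)
  qed simp
  ultimately show ?thesis using b0[OF c i] by (intro mult_left_mono) (auto simp: u_def g_def)
 qed
 have "(\<Sum>i<n. lft i * (bb i * ln (bb i)))
   \<le> (\<Sum>i<n. lft i * (\<Sum>c\<in>I. b c i * (ln (K1 * Gl / real n) + 1/8 * gap (real_of_int (el c)) - ln (l i))))"
  using pt lft_props by (intro sum_mono mult_left_mono) auto
 also have "\<dots> = (\<Sum>c\<in>I. \<Sum>i<n. lft i * (b c i * (ln (K1 * Gl / real n) + 1/8 * gap (real_of_int (el c)) - ln (l i))))"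
  unfolding sum_distrib_left by (rule sum.swap)
 also have "\<dots> \<le> (\<Sum>c\<in>I. R c * (ln (K1 * Gl / real n) - 7/8 * gap (real_of_int (el c)) - real_of_int (el c)) + 32 * sqrt \<beta> * (sl c * M c))"
 proof (rule sum_mono)
  fix c assume c: "c \<in> I"
  let ?g = "gap (real_of_int (el c))" and ?e = "real_of_int (el c)"
  have "(\<Sum>i<n. lft i * (b c i * (ln (K1 * Gl / real n) + 1/8 * ?g - ln (l i))))
    \<le> (\<Sum>i<n. lft i * (b c i * (ln (K1 * Gl / real n) - 7/8 * ?g - ?e)) + 16 * (sl c)\<^sup>2 * (l i * b c i * sqrt (exp ?e / l i)))"
  proof (rule sum_mono)
   fix i assume "i \<in> {..<n}" then have i: "i < n" by simp
   have "lft i * (b c i * (?e - ln (l i))) \<le> lft i * (b c i * (- ?g + 16 * (sl c)\<^sup>2 * sqrt (exp ?e / l i)))"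
    by (rule mult_left_mono[OF key[OF c i] lft_props(1)[OF i]])
   moreover have "lft i * (b c i * (16 * (sl c)\<^sup>2 * sqrt (exp ?e / l i))) \<le> l i * (b c i * (16 * (sl c)\<^sup>2 * sqrt (exp ?e / l i)))"
    using lft_props[OF i] b0[OF c i] lp[OF i] by (intro mult_right_mono) auto
   ultimately show "lft i * (b c i * (ln (K1 * Gl / real n) + 1/8 * ?g - ln (l i)))
    \<le> lft i * (b c i * (ln (K1 * Gl / real n) - 7/8 * ?g - ?e)) + 16 * (sl c)\<^sup>2 * (l i * b c i * sqrt (exp ?e / l i))"
    by (simp add: algebra_simps)
  qed
  also have "\<dots> = R c * (ln (K1 * Gl / real n) - 7/8 * ?g - ?e) + 16 * (sl c)\<^sup>2 * (\<Sum>i<n. l i * b c i * sqrt (exp ?e / l i))"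
   unfolding sum.distrib R_def b_def[symmetric] by (simp only: sum_distrib_left sum_distrib_right mult.assoc)
  also have "16 * (sl c)\<^sup>2 * (\<Sum>i<n. l i * b c i * sqrt (exp ?e / l i)) \<le> 16 * (sl c)\<^sup>2 * (2 * sqrt \<beta> * M c)"
   using outflow_moment[OF ctX'[OF c], of "exp ?e"] cl[OF c] by (intro mult_left_mono) (auto simp: b_def M_def)
  also have "\<dots> \<le> 32 * sqrt \<beta> * (sl c * M c)"
  proof -
   have "(sl c)\<^sup>2 \<le> sl c" using sl01[of c] by (simp add: power2_eq_square mult_left_le)
   then have "(sl c)\<^sup>2 * (32 * (sqrt \<beta> * M c)) \<le> sl c * (32 * (sqrt \<beta> * M c))"
    using be0 M_pos[OF c] by (intro mult_right_mono) auto
   then show ?thesis by (simp add: mult_ac)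
  qed
  finally show "(\<Sum>i<n. lft i * (b c i * (ln (K1 * Gl / real n) + 1/8 * ?g - ln (l i)))) \<le> R c * (ln (K1 * Gl / real n) - 7/8 * ?g - ?e) + 32 * sqrt \<beta> * (sl c * M c)"
   by simp
 qed
 also have "\<dots> = (\<Sum>c\<in>I. R c * (ln (K1 * Gl / real n) - 7/8 * gap (real_of_int (el c)) - real_of_int (el c))) + 32 * sqrt \<beta> * Gl"
  by (simp add: sum.distrib Gl_def sum_distrib_left)
 finally show ?thesis by (simp add: K1_def)
qed

end

context perron_pair
begin

lemma gapsum_pos: "\<kappa> > 0 \<Longrightarrow> gapsum \<kappa> > 0"
 unfolding gapsum_def using c0 by simp

text \<open>The ratio between weighted cell mass and outgoing mass.\<close>
definition CW where "CW = 2 * (1 + gapsum (1/8))"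
text \<open>How large \<open>t\<close> must be, relative to the heights of the removed cells, for the entropy produced at the sources to
 exceed the outgoing mass. It collects the constants of the estimates of sources, levels and cell sizes.\<close>
definition K8 where "K8 \<zeta> = \<zeta> * (2 * S * \<beta> / \<tau> * CW)\<^sup>2 * (\<Theta> * exp 2) * (gapsum (3/8))\<^sup>2 * exp ((32 * sqrt \<beta> + 1) * (2 * CW) + 1)"

lemma CW_pos: "CW > 0" using gapsum_pos[of "1/8"] by (simp add: CW_def)

lemma K8_pos: assumes "\<zeta> > 0" shows "K8 \<zeta> > 0"
proof -
 have "2 * S * \<beta> / \<tau> * CW > 0" using S tau be0 CW_pos by (intro mult_pos_pos divide_pos_pos) auto
 then have "0 < (2 * S * \<beta> / \<tau> * CW)\<^sup>2" by (rule zero_less_power)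
 then show ?thesis unfolding K8_def using assms Theta_pos gapsum_pos[of "3/8"]
  by (intro mult_pos_pos) auto
qed

end

context cell_family
begin

interpretation dual: perron_pair n "\<lambda>i j. V j i" r l \<theta> S \<tau> \<Theta> \<beta> c0 by (rule dual_pair)
interpretation D: cell_family n "\<lambda>i j. V j i" r l \<theta> S \<tau> \<Theta> \<beta> c0 I cell er el \<eta> Y X by (rule dual_family)

lemma D_bb: "D.bb = bb'" by (rule ext) (simp only: bb'_def D.bb_def)
lemma D_total: "D.total = total" unfolding D.total_def total_alt R'_def ..
lemma D_G: "D.Gr = Gl" "D.Gl = Gr"
 by (simp_all only: D.Gr_def Gl_def D.Gl_def Gr_def D_M D.sr_def sl_def D.sl_def sr_def)
lemma D_allmass: "D.allmass = allmass" by (simp add: D.allmass_def allmass_def D_M)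

text \<open>The entropy estimates for the two sides weigh a function of \<open>er\<close> with \<open>R\<close> and with \<open>R'\<close>. The difference is an
 exchange between cells at different values of \<open>er\<close>. Exchange towards lower \<open>er\<close> has the favourable sign, and the exchange
 in the other direction decays exponentially in the difference of levels.\<close>
lemma mismatch:
 assumes w: "0 < w" "w \<le> 1" "\<eta> \<le> w ^ 3"
  and small: "12 * K5 * w * real (card I) * allmass \<le> Gl"
  and e: "e = (\<lambda>c. 7/8 * dual.gap (real_of_int (er c)) + real_of_int (er c))"
 shows "(\<Sum>c\<in>I. R c * e c) - Gl \<le> (\<Sum>c\<in>I. R' c * e c)"
proof -
 have pt: "B d c * (e d - e c) \<le> 6 * K5 * w * (M c + M d)" if d: "d \<in> I" and c: "c \<in> I" for d c
 proof (cases "e c < e d")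
  case False
  then have "B d c * (e d - e c) \<le> 0" using B0[OF d c] by (intro mult_nonneg_nonpos) auto
  also have "0 \<le> 6 * K5 * w * (M c + M d)" using K5_pos w M_pos[OF c] M_pos[OF d] by simp
  finally show ?thesis .
 next
  case True
  define x where "x = real_of_int (er d) - real_of_int (er c)"
  have lip: "\<bar>dual.gap (real_of_int (er d)) - dual.gap (real_of_int (er c))\<bar> \<le> \<bar>x\<bar>"
   using dual.gap_lipschitz[of "real_of_int (er d)" "real_of_int (er c)"]
    dual.gap_lipschitz[of "real_of_int (er c)" "real_of_int (er d)"] by (simp add: x_def abs_le_iff abs_minus_commute)
  have x0: "x > 0"
  proof (rule ccontr)
   assume "\<not> 0 < x"
   then have "e d - e c \<le> 0" using lip by (simp add: e x_def)
   then show False using True by simp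
  qed
  have ex: "e d - e c \<le> 2 * x" using lip x0 by (simp add: e x_def)
  define w' where "w' = w * exp (- x / 3)"
  have w': "0 < w'" "w' \<le> 1" using w x0 by (auto simp: w'_def intro!: mult_le_one)
  have "\<eta> * exp (- x) \<le> w ^ 3 * exp (- x)" using w by (intro mult_right_mono) auto
  also have "\<dots> = w' ^ 3" by (simp add: w'_def power_mult_distrib flip: exp_of_nat_mult)
  finally have "\<eta> * exp (real_of_int (er c) - real_of_int (er d)) \<le> w' ^ 3" by (simp add: x_def)
  then have "B d c \<le> K5 * w' * (M c + M d)" by (rule B_bound_r[OF d c w'])
  then have "B d c * (e d - e c) \<le> (K5 * w' * (M c + M d)) * (2 * x)"
   using ex x0 True B0[OF d c] K5_pos w' M_pos[OF c] M_pos[OF d] by (intro mult_mono) auto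
  also have "\<dots> = 6 * K5 * w * (M c + M d) * ((x / 3) * exp (- (x / 3)))" by (simp add: w'_def)
  also have "\<dots> \<le> 6 * K5 * w * (M c + M d) * 1"
  proof (intro mult_left_mono)
   have "x / 3 \<le> exp (x / 3)" using exp_ge_add_one_self[of "x / 3"] by linarith
   then show "(x / 3) * exp (- (x / 3)) \<le> 1" by (simp add: exp_minus field_simps)
  qed (use K5_pos w M_pos[OF c] M_pos[OF d] in auto)
  finally show ?thesis by simp
 qed
 have "(\<Sum>c\<in>I. R c * e c) - (\<Sum>c\<in>I. R' c * e c) = (\<Sum>d\<in>I. \<Sum>c\<in>I. B d c * (e d - e c))"
 proof -
  have "(\<Sum>c\<in>I. R c * e c) = (\<Sum>c\<in>I. M c * e c) - (\<Sum>c\<in>I. \<Sum>d\<in>I. B d c * e c)"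
   by (simp add: R_eq left_diff_distrib sum_subtractf sum_distrib_right)
  also have "(\<Sum>c\<in>I. \<Sum>d\<in>I. B d c * e c) = (\<Sum>d\<in>I. \<Sum>c\<in>I. B d c * e c)" by (rule sum.swap)
  finally have 1: "(\<Sum>c\<in>I. R c * e c) = (\<Sum>c\<in>I. M c * e c) - (\<Sum>d\<in>I. \<Sum>c\<in>I. B d c * e c)" .
  have 2: "(\<Sum>d\<in>I. R' d * e d) = (\<Sum>d\<in>I. M d * e d) - (\<Sum>d\<in>I. \<Sum>c\<in>I. B d c * e d)"
   by (simp add: R'_eq left_diff_distrib sum_subtractf sum_distrib_right)
  show ?thesis unfolding 1 2 by (simp add: right_diff_distrib sum_subtractf)
 qed
 also have "\<dots> \<le> (\<Sum>d\<in>I. \<Sum>c\<in>I. 6 * K5 * w * (M c + M d))" using pt by (intro sum_mono)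
 also have "\<dots> = 6 * K5 * w * (\<Sum>d\<in>I. \<Sum>c\<in>I. M c + M d)" by (simp only: sum_distrib_left)
 also have "\<dots> \<le> Gl" unfolding sum_pairs using small by (simp add: mult_ac)
 finally show ?thesis by simp
qed

lemma sum_gap_pairs:
 assumes inj: "inj_on (\<lambda>c. (el c, er c)) I"
 shows "(\<Sum>c\<in>I. exp (- (3/8) * (gap (real_of_int (el c)) + dual.gap (real_of_int (er c))))) \<le> (gapsum (3/8))\<^sup>2"
proof -
 define f g where "f a = exp (- (3/8) * gap (real_of_int a))" and "g b = exp (- (3/8) * dual.gap (real_of_int b))" for a b
 have "(\<Sum>c\<in>I. exp (- (3/8) * (gap (real_of_int (el c)) + dual.gap (real_of_int (er c))))) = (\<Sum>c\<in>I. f (el c) * g (er c))"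
  by (simp add: f_def g_def algebra_simps flip: exp_add)
 also have "\<dots> = (\<Sum>p\<in>(\<lambda>c. (el c, er c)) ` I. f (fst p) * g (snd p))"
  using inj by (simp add: sum.reindex)
 also have "\<dots> \<le> (\<Sum>p\<in>(el ` I) \<times> (er ` I). f (fst p) * g (snd p))"
  using I by (intro sum_mono2) (auto simp: f_def g_def)
 also have "\<dots> = (\<Sum>a\<in>el ` I. f a) * (\<Sum>b\<in>er ` I. g b)"
  by (simp add: sum_product sum.cartesian_product case_prod_unfold)
 also have "\<dots> \<le> gapsum (3/8) * gapsum (3/8)"
 proof (intro mult_mono)
  show "sum f (el ` I) \<le> gapsum (3/8)" unfolding f_def using I by (intro sum_gap_le) auto
  show "sum g (er ` I) \<le> gapsum (3/8)" unfolding g_def using I by (intro dual.sum_gap_le) auto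
  show "0 \<le> sum g (er ` I)" unfolding g_def by (intro sum_nonneg) simp
  then show "0 \<le> gapsum (3/8)" using \<open>sum g (er ` I) \<le> gapsum (3/8)\<close> by linarith
 qed
 finally show ?thesis by (simp add: power2_eq_square)
qed

text \<open>The entropy inequality for the remainders \<open>lft\<close>, \<open>rgt\<close> against a solution at \<open>t\<close>. If \<open>t\<close> exceeds the heights of the
 cells by the factor \<open>K8\<close>, its left side is at least the outgoing mass \<open>total\<close>. The right side involves only sites outside
 the cells, since \<open>lft\<close> and \<open>rgt\<close> vanish on the cells, and is bounded by the assumed closeness of \<open>\<theta>'\<close> to \<open>\<theta>\<close>.\<close>
lemma removal_core:
 assumes Z: "\<And>j. j < n \<Longrightarrow> 0 < Z j" and th': "\<And>i. i < n \<Longrightarrow> 0 < \<theta>' i"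
  and eZ: "\<And>i. i < n \<Longrightarrow> \<theta>' i * Z i = (\<Sum>j<n. V i j * Z j) + t"
  and ze: "\<zeta> > 0" "(\<Sum>j<n. Z j) \<le> \<zeta> * real n"
  and v: "(\<Sum>i<n. (ln (\<theta>' i / \<theta> i))\<^sup>2) \<le> Cv * real n * t"
  and Yb: "Yb > 0" "\<And>c. c \<in> I \<Longrightarrow> real (card (cell c)) / real n * exp (- (1/2) * (gap (real_of_int (el c)) + dual.gap (real_of_int (er c)))) \<le> Yb"
  and t: "K8 \<zeta> * Yb \<le> t"
  and inj: "inj_on (\<lambda>c. (el c, er c)) I"
  and GrT: "Gr \<le> CW * total" and GlT: "Gl \<le> CW * total"
  and mm': "(\<Sum>c\<in>I. R c * (7/8 * dual.gap (real_of_int (er c)) + real_of_int (er c))) - Gl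
    \<le> (\<Sum>c\<in>I. R' c * (7/8 * dual.gap (real_of_int (er c)) + real_of_int (er c)))"
 shows "Gr\<^sup>2 \<le> CW\<^sup>2 * ((\<Sum>i\<in>{..<n}-U. (mass i)\<^sup>2) * (Cv * real n * t))"
proof -
 have nn: "real n > 0" using n by simp
 have Glp: "Gl > 0" unfolding Gl_def using I M_pos sl01 by (intro sum_pos) auto
 have Grp: "Gr > 0" unfolding Gr_def using I M_pos sr01 by (intro sum_pos) auto
 define T where "T = total"
 have Tp: "T > 0" using GrT Grp CW_pos by (smt (verit) T_def mult_nonneg_nonpos)
 define K1 where "K1 = 2 * S * \<beta> / \<tau>"
 have K1: "K1 > 0" using S tau be0 by (simp add: K1_def)
 define gl gr where "gl c = gap (real_of_int (el c))" and "gr c = dual.gap (real_of_int (er c))" for c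
 define ee where "ee c = 7/8 * gr c + real_of_int (er c)" for c
 have E: "(\<Sum>i<n. lft i * bb i * ln (t / bb i)) - (\<Sum>j<n. rgt j * bb' j * ln (Z j / rgt j))
   \<le> (\<Sum>i<n. lft i * rgt i * \<theta> i * ln (\<theta>' i / \<theta> i))"
 proof (rule circulation_entropy)
  have K8p: "K8 \<zeta> > 0" using K8_pos ze by blast
  then have "t > 0" using t Yb(1) by (meson less_le_trans mult_pos_pos)
  then show "0 < t \<or> t = 0 \<and> (\<forall>i<n. 0 < lft i \<longrightarrow> bb i = 0)" by simp
  show "rgt i * \<theta> i = (\<Sum>j<n. V i j * rgt j) + bb i" if "i < n" "0 < lft i" for i
   using rgt_eq[OF that(1)] lft_props(3)[OF that(1)] that(2) by force
  show "lft j * \<theta> j = (\<Sum>i<n. V i j * lft i) + bb' j" if "j < n" "0 < rgt j" for j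
   using D.rgt_eq[OF that(1)] rgt_props(3)[OF that(1)] that(2) unfolding D_rgt D_bb by force
 qed (use V0 lft_props rgt_props bb0 thp th' Z eZ in auto)
 have tp: "t > 0"
 proof -
  have K8p: "K8 \<zeta> > 0" using K8_pos ze by blast
  then show ?thesis using t Yb(1) by (meson less_le_trans mult_pos_pos)
 qed
 have bb'0: "0 \<le> bb' j" if "j < n" for j using D.bb0[OF that] unfolding D_bb .
 have sumr: "(\<Sum>j<n. rgt j * bb' j) = T" using D.sum_lft_bb unfolding D_lft D_bb D_total T_def .
 have suml: "(\<Sum>i<n. lft i * bb i) = T" using sum_lft_bb by (simp add: T_def)
 have out1: "(\<Sum>i<n. lft i * bb i * ln (t / bb i)) = T * ln t - (\<Sum>i<n. lft i * (bb i * ln (bb i)))"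
 proof -
  have "lft i * bb i * ln (t / bb i) = lft i * bb i * ln t - lft i * (bb i * ln (bb i))" if "i < n" for i
   using bb0[OF that] tp by (cases "bb i = 0") (simp_all add: ln_div algebra_simps)
  then show ?thesis by (simp add: sum_subtractf suml flip: sum_distrib_right)
 qed
 have in1: "(\<Sum>j<n. rgt j * bb' j * ln (Z j / rgt j)) \<le> T * ln (\<zeta> * real n / T) + (\<Sum>j<n. rgt j * (bb' j * ln (bb' j)))"
 proof -
  define A where "A = {j. j < n \<and> rgt j * bb' j > 0}"
  have A: "finite A" "A \<subseteq> {..<n}" by (auto simp: A_def)
  have z: "rgt j * bb' j = 0" if "j < n" "j \<notin> A" for j
   using that mult_nonneg_nonneg[OF rgt_props(1)[OF that(1)] bb'0[OF that(1)]] unfolding A_def by auto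
  have pos: "rgt j > 0" "bb' j > 0" if "j \<in> A" for j
  proof -
   have j: "j < n" "rgt j * bb' j > 0" using that by (auto simp: A_def)
   then show "rgt j > 0" "bb' j > 0" using rgt_props(1)[OF j(1)] bb'0[OF j(1)] by (auto simp: zero_less_mult_iff)
  qed
  have sA: "(\<Sum>j\<in>A. rgt j * bb' j) = T"
   unfolding sumr[symmetric] using A z by (intro sum.mono_neutral_left) auto
  have s1: "(\<Sum>j<n. rgt j * bb' j * ln (Z j / rgt j)) = (\<Sum>j\<in>A. rgt j * bb' j * ln (Z j / rgt j))"
   using A z by (intro sum.mono_neutral_right) auto
  have s2: "(\<Sum>j\<in>A. rgt j * bb' j * ln (Z j / rgt j)) = (\<Sum>j\<in>A. rgt j * bb' j * ln (Z j / (rgt j * bb' j))) + (\<Sum>j\<in>A. rgt j * (bb' j * ln (bb' j)))"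
   unfolding sum.distrib[symmetric]
  proof (rule sum.cong[OF refl])
   fix j assume j: "j \<in> A"
   then have "Z j > 0" using A Z by auto
   then show "rgt j * bb' j * ln (Z j / rgt j) = rgt j * bb' j * ln (Z j / (rgt j * bb' j)) + rgt j * (bb' j * ln (bb' j))"
    using pos[OF j] by (simp add: ln_div ln_mult algebra_simps)
  qed
  have s3: "(\<Sum>j\<in>A. rgt j * (bb' j * ln (bb' j))) = (\<Sum>j<n. rgt j * (bb' j * ln (bb' j)))"
   using A z by (intro sum.mono_neutral_left) (auto simp: mult.assoc[symmetric])
  have s4: "(\<Sum>j\<in>A. rgt j * bb' j * ln (Z j / (rgt j * bb' j)))
    \<le> (\<Sum>j\<in>A. rgt j * bb' j) * ln ((\<Sum>j\<in>A. rgt j * bb' j * (Z j / (rgt j * bb' j))) / (\<Sum>j\<in>A. rgt j * bb' j))"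
  proof (rule weighted_ln_le[OF A(1)])
   show "0 \<le> rgt j * bb' j" if "j \<in> A" for j using pos[OF that] by simp
   show "0 < Z j / (rgt j * bb' j)" if "j \<in> A" for j using pos[OF that] that A Z by auto
   show "(\<Sum>j\<in>A. rgt j * bb' j) \<noteq> 0" using sA Tp by simp
  qed
  have s5: "(\<Sum>j\<in>A. rgt j * bb' j * (Z j / (rgt j * bb' j))) = (\<Sum>j\<in>A. Z j)"
  proof (rule sum.cong[OF refl])
   fix j assume "j \<in> A"
   then show "rgt j * bb' j * (Z j / (rgt j * bb' j)) = Z j" using pos[of j] by simp
  qed
  have s6: "(\<Sum>j\<in>A. rgt j * bb' j) * ln ((\<Sum>j\<in>A. Z j) / (\<Sum>j\<in>A. rgt j * bb' j)) \<le> T * ln (\<zeta> * real n / T)"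
   unfolding sA
  proof (intro mult_left_mono ln_mono divide_right_mono)
   have "A \<noteq> {}" using sA Tp by auto
   then have "0 < sum Z A" using A Z by (intro sum_pos) auto
   then show "0 < sum Z A / T" using Tp by simp
   have "sum Z A \<le> (\<Sum>j<n. Z j)" using A Z by (intro sum_mono2) (auto intro: less_imp_le)
   then show "sum Z A \<le> \<zeta> * real n" using ze by linarith
  qed (use Tp in auto)
  show ?thesis using s4 s6 unfolding s1 s2 s3 s5 by linarith
 qed
 have out2: "(\<Sum>i<n. lft i * (bb i * ln (bb i))) \<le> (\<Sum>c\<in>I. R c * (ln (K1 * Gl / real n) - 7/8 * gl c - real_of_int (el c))) + 32 * sqrt \<beta> * Gl"
  using out_entropy unfolding K1_def gl_def .
 have in2: "(\<Sum>j<n. rgt j * (bb' j * ln (bb' j))) \<le> (\<Sum>c\<in>I. R' c * (ln (K1 * Gr / real n) - 7/8 * gr c - real_of_int (er c))) + 32 * sqrt \<beta> * Gr"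
  using D.out_entropy unfolding D_lft D_bb D_G R'_def K1_def gr_def .
 have mm: "(\<Sum>c\<in>I. R c * ee c) - Gl \<le> (\<Sum>c\<in>I. R' c * ee c)"
  using mm' by (simp only: ee_def gr_def)
 \<comment> \<open>Large cells have large \<open>el + er\<close>. Of the gain \<open>7/8\<close> the definition of height uses \<open>1/2\<close>; the remaining \<open>3/8\<close> make Jensen over the cells summable.\<close>
 have lev: "T * (ln (T / (real n * Yb * (\<Theta> * exp 2))) - ln ((gapsum (3/8))\<^sup>2)) \<le> (\<Sum>c\<in>I. R c * (7/8 * gl c + real_of_int (el c) + ee c))"
 proof -
  define u where "u c = T * exp (- (3/8) * (gl c + gr c)) / M c" for c
  have up: "u c > 0" if "c \<in> I" for c using that M_pos Tp by (simp add: u_def)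
  have "(\<Sum>c\<in>I. R c * ln (u c)) \<le> (\<Sum>c\<in>I. R c) * ln ((\<Sum>c\<in>I. R c * u c) / (\<Sum>c\<in>I. R c))"
   using I R0 up Tp by (intro weighted_ln_le) (auto simp: T_def total_def)
  also have "\<dots> \<le> T * ln ((gapsum (3/8))\<^sup>2)"
   unfolding total_def[symmetric] T_def[symmetric]
  proof (intro mult_left_mono ln_mono)
   have "(\<Sum>c\<in>I. R c * u c) \<le> (\<Sum>c\<in>I. T * exp (- (3/8) * (gl c + gr c)))"
   proof (rule sum_mono)
    fix c assume c: "c \<in> I"
    have "R c * u c \<le> M c * u c" using R_le_M[OF c] up[OF c] by (intro mult_right_mono) auto
    then show "R c * u c \<le> T * exp (- (3/8) * (gl c + gr c))" using M_pos[OF c] by (simp add: u_def)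
   qed
   also have "\<dots> = T * (\<Sum>c\<in>I. exp (- (3/8) * (gl c + gr c)))" by (simp add: sum_distrib_left)
   also have "\<dots> \<le> T * (gapsum (3/8))\<^sup>2"
    using sum_gap_pairs[OF inj] Tp by (intro mult_left_mono) (auto simp: gl_def gr_def)
   finally show "(\<Sum>c\<in>I. R c * u c) / T \<le> (gapsum (3/8))\<^sup>2" using Tp by (simp add: pos_divide_le_eq mult.commute)
   have "\<exists>c\<in>I. R c \<noteq> 0" using Tp by (metis T_def order_less_irrefl sum.neutral total_def)
   then obtain c where c: "c \<in> I" "R c > 0" using R0 by (metis order_less_le)
   then have "0 < (\<Sum>c\<in>I. R c * u c)" using I c(1) R0 up mult_pos_pos[OF c(2) up[OF c(1)]] by (intro sum_pos2[of I c] mult_nonneg_nonneg) (auto simp: order_less_imp_le)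
   then show "0 < (\<Sum>c\<in>I. R c * u c) / T" using Tp by simp
  qed (use Tp in auto)
  finally have J: "(\<Sum>c\<in>I. R c * ln (u c)) \<le> T * ln ((gapsum (3/8))\<^sup>2)" .
  have "(\<Sum>c\<in>I. R c * (ln (T / (real n * Yb * (\<Theta> * exp 2))) - ln (u c))) \<le> (\<Sum>c\<in>I. R c * (7/8 * gl c + real_of_int (el c) + ee c))"
  proof (intro sum_mono mult_left_mono R0)
   fix c assume c: "c \<in> I"
   have Mp: "M c > 0" using M_pos[OF c] .
   have cp: "real (card (cell c)) > 0" using card_pos[OF c] by simp
   have TE: "\<Theta> * exp 2 > 0" using Theta_pos by simp
   have "real (card (cell c)) \<le> real n * Yb * exp (1/2 * (gl c + gr c))"
    using Yb(2)[OF c] nn by (simp add: gl_def gr_def exp_minus field_simps)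
   then have "M c \<le> real n * Yb * exp (1/2 * (gl c + gr c)) * (\<Theta> * exp 2 * exp (real_of_int (el c)) * exp (real_of_int (er c)))"
    using M_upper[OF c] Theta_pos by (smt (verit) exp_gt_zero mult_pos_pos mult_right_mono)
   then have "ln (M c) \<le> ln (real n * Yb * exp (1/2 * (gl c + gr c)) * (\<Theta> * exp 2 * exp (real_of_int (el c)) * exp (real_of_int (er c))))"
    using Mp by (intro ln_mono) auto
   also have "\<dots> = ln (real n * Yb * (\<Theta> * exp 2)) + 1/2 * (gl c + gr c) + real_of_int (el c) + real_of_int (er c)"
    using nn Yb(1) TE Theta_pos by (simp add: ln_mult)
   finally have "ln (M c) \<le> ln (real n * Yb * (\<Theta> * exp 2)) + 1/2 * (gl c + gr c) + real_of_int (el c) + real_of_int (er c)" .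
   moreover have "ln (u c) = ln T - 3/8 * (gl c + gr c) - ln (M c)" using Mp Tp by (simp add: u_def ln_div ln_mult)
   moreover have "ln (T / (real n * Yb * (\<Theta> * exp 2))) = ln T - ln (real n * Yb * (\<Theta> * exp 2))"
    using Tp nn Yb(1) TE Theta_pos by (intro ln_divide_pos mult_pos_pos) auto
   moreover have "z - uu \<le> 7/8 * a + e1 + (7/8 * b + e2)"
    if "m \<le> L + 1/2 * (a + b) + e1 + e2" "uu = lt - 3/8 * (a + b) - m" "z = lt - L" for m L a b e1 e2 uu lt z :: real
    using that by (simp add: field_simps)
   ultimately show "ln (T / (real n * Yb * (\<Theta> * exp 2))) - ln (u c) \<le> 7/8 * gl c + real_of_int (el c) + ee c"
    unfolding ee_def by blast
  qed
  moreover have "(\<Sum>c\<in>I. R c * (ln (T / (real n * Yb * (\<Theta> * exp 2))) - ln (u c))) = T * ln (T / (real n * Yb * (\<Theta> * exp 2))) - (\<Sum>c\<in>I. R c * ln (u c))"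
   by (simp add: right_diff_distrib sum_subtractf T_def total_def sum_distrib_right)
  ultimately show ?thesis using J by (simp add: right_diff_distrib)
 qed
 define Lo Li where "Lo = ln (K1 * Gl / real n)" and "Li = ln (K1 * Gr / real n)"
 have expand: "(\<Sum>c\<in>I. R c * (Lo - 7/8 * gl c - real_of_int (el c))) = T * Lo - (\<Sum>c\<in>I. R c * (7/8 * gl c + real_of_int (el c)))"
  "(\<Sum>c\<in>I. R' c * (Li - 7/8 * gr c - real_of_int (er c))) = T * Li - (\<Sum>c\<in>I. R' c * ee c)"
 proof -
  have sR: "(\<Sum>c\<in>I. R c * x) = T * x" "(\<Sum>c\<in>I. R' c * x) = T * x" for x
   by (simp add: T_def total_def sum_distrib_right) (simp add: T_def total_alt sum_distrib_right)
  have "(\<Sum>c\<in>I. R c * (Lo - 7/8 * gl c - real_of_int (el c))) = (\<Sum>c\<in>I. R c * Lo - R c * (7/8 * gl c + real_of_int (el c)))"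
   by (simp add: algebra_simps)
  then show "(\<Sum>c\<in>I. R c * (Lo - 7/8 * gl c - real_of_int (el c))) = T * Lo - (\<Sum>c\<in>I. R c * (7/8 * gl c + real_of_int (el c)))"
   by (simp only: sum_subtractf sR)
  have "(\<Sum>c\<in>I. R' c * (Li - 7/8 * gr c - real_of_int (er c))) = (\<Sum>c\<in>I. R' c * Li - R' c * ee c)"
   by (simp add: algebra_simps ee_def)
  then show "(\<Sum>c\<in>I. R' c * (Li - 7/8 * gr c - real_of_int (er c))) = T * Li - (\<Sum>c\<in>I. R' c * ee c)"
   by (simp only: sum_subtractf sR)
 qed
 have split: "(\<Sum>c\<in>I. R c * (7/8 * gl c + real_of_int (el c) + ee c)) = (\<Sum>c\<in>I. R c * (7/8 * gl c + real_of_int (el c))) + (\<Sum>c\<in>I. R c * ee c)"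
  by (simp add: distrib_left sum.distrib)
 define C3 where "C3 = 32 * sqrt \<beta> + 1"
 define Q where "Q = (\<Sum>i<n. lft i * rgt i * \<theta> i * ln (\<theta>' i / \<theta> i))"
 have main: "T * (ln t - ln (\<zeta> * real n / T) - Lo - Li + ln (T / (real n * Yb * (\<Theta> * exp 2))) - ln ((gapsum (3/8))\<^sup>2)) - C3 * (Gl + Gr) \<le> Q"
  using E out1 in1 out2 in2 mm lev expand split Grp unfolding Lo_def[symmetric] Li_def[symmetric] Q_def C3_def
  by (simp add: algebra_simps)
 have "1 + C3 * (2 * CW) \<le> ln t - ln (\<zeta> * real n / T) - Lo - Li + ln (T / (real n * Yb * (\<Theta> * exp 2))) - ln ((gapsum (3/8))\<^sup>2)"
 proof -
  have g3: "gapsum (3/8) > 0" by (rule gapsum_pos) simp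
  have TE: "\<Theta> * exp 2 > 0" using Theta_pos by simp
  have "ln (K8 \<zeta> * Yb) \<le> ln t" using t K8_pos[OF ze(1)] Yb(1) by (intro ln_mono) auto
  moreover have "ln (K8 \<zeta> * Yb) = ln \<zeta> + 2 * ln (K1 * CW) + ln (\<Theta> * exp 2) + ln ((gapsum (3/8))\<^sup>2) + (C3 * (2 * CW) + 1) + ln Yb"
   using ze K1 CW_pos Theta_pos g3 Yb(1) unfolding K8_def K1_def[symmetric] C3_def by (simp add: ln_mult ln_realpow)
  moreover have "Lo \<le> ln (K1 * CW) + ln T - ln (real n)"
  proof -
   have "K1 * Gl / real n \<le> K1 * CW * T / real n"
    using GlT K1 nn by (simp add: T_def divide_right_mono mult.assoc)
   then have "Lo \<le> ln (K1 * CW * T / real n)" unfolding Lo_def using K1 Glp nn by (intro ln_mono) auto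
   also have "\<dots> = ln (K1 * CW) + ln T - ln (real n)" using K1 CW_pos Tp nn by (simp add: ln_div ln_mult)
   finally show ?thesis .
  qed
  moreover have "Li \<le> ln (K1 * CW) + ln T - ln (real n)"
  proof -
   have "K1 * Gr / real n \<le> K1 * CW * T / real n"
    using GrT K1 nn by (simp add: T_def divide_right_mono mult.assoc)
   then have "Li \<le> ln (K1 * CW * T / real n)" unfolding Li_def using K1 Grp nn by (intro ln_mono) auto
   also have "\<dots> = ln (K1 * CW) + ln T - ln (real n)" using K1 CW_pos Tp nn by (simp add: ln_div ln_mult)
   finally show ?thesis .
  qed
  moreover have "ln (\<zeta> * real n / T) = ln \<zeta> + ln (real n) - ln T" using ze nn Tp by (simp add: ln_div ln_mult)
  moreover have "ln (T / (real n * Yb * (\<Theta> * exp 2))) = ln T - ln (real n) - ln Yb - ln (\<Theta> * exp 2)"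
  proof -
   have "ln (T / (real n * Yb * (\<Theta> * exp 2))) = ln T - ln (real n * Yb * (\<Theta> * exp 2))"
    using Tp nn Yb(1) TE Theta_pos by (intro ln_divide_pos mult_pos_pos) auto
   moreover have "ln (real n * Yb * (\<Theta> * exp 2)) = ln (real n * Yb) + ln (\<Theta> * exp 2)"
    using nn Yb(1) TE by (intro ln_mult_pos) auto
   moreover have "ln (real n * Yb) = ln (real n) + ln Yb" using nn Yb(1) by (intro ln_mult_pos) auto
   ultimately show ?thesis by simp
  qed
  ultimately show ?thesis by linarith
 qed
 then have "T * (1 + C3 * (2 * CW)) - C3 * (Gl + Gr) \<le> Q"
  using main mult_left_mono[of _ _ T] Tp by (smt (verit))
 moreover have "C3 * (Gl + Gr) \<le> T * (C3 * (2 * CW))"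
 proof -
  have "Gl + Gr \<le> 2 * CW * T" using GlT GrT by (simp add: T_def)
  then have "C3 * (Gl + Gr) \<le> C3 * (2 * CW * T)" using be0 by (intro mult_left_mono) (auto simp: C3_def)
  then show ?thesis by (simp add: mult_ac)
 qed
 ultimately have TQ: "T \<le> Q" by (simp add: distrib_left)
 have "Q \<le> (\<Sum>i\<in>{..<n}-U. mass i * \<bar>ln (\<theta>' i / \<theta> i)\<bar>)"
 proof -
  have "Q = (\<Sum>i\<in>{..<n}-U. lft i * rgt i * \<theta> i * ln (\<theta>' i / \<theta> i))"
   unfolding Q_def using lft_props(3) by (intro sum.mono_neutral_right) auto
  also have "\<dots> \<le> (\<Sum>i\<in>{..<n}-U. mass i * \<bar>ln (\<theta>' i / \<theta> i)\<bar>)"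
  proof (rule sum_mono)
   fix i assume "i \<in> {..<n} - U" then have i: "i < n" by simp
   have "lft i * rgt i * \<theta> i \<le> mass i" unfolding mass_def
    using lft_props[OF i] rgt_props[OF i] thp[OF i] lp[OF i] by (intro mult_right_mono mult_mono) auto
   moreover have "0 \<le> lft i * rgt i * \<theta> i" using lft_props[OF i] rgt_props[OF i] thp[OF i] by simp
   ultimately have "lft i * rgt i * \<theta> i * \<bar>ln (\<theta>' i / \<theta> i)\<bar> \<le> mass i * \<bar>ln (\<theta>' i / \<theta> i)\<bar>"
    and "lft i * rgt i * \<theta> i * ln (\<theta>' i / \<theta> i) \<le> lft i * rgt i * \<theta> i * \<bar>ln (\<theta>' i / \<theta> i)\<bar>"
    by (auto intro!: mult_right_mono mult_left_mono)
   then show "lft i * rgt i * \<theta> i * ln (\<theta>' i / \<theta> i) \<le> mass i * \<bar>ln (\<theta>' i / \<theta> i)\<bar>" by linarith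
  qed
  finally show ?thesis .
 qed
 then have "T \<le> (\<Sum>i\<in>{..<n}-U. mass i * \<bar>ln (\<theta>' i / \<theta> i)\<bar>)" using TQ by linarith
 then have "T\<^sup>2 \<le> (\<Sum>i\<in>{..<n}-U. mass i * \<bar>ln (\<theta>' i / \<theta> i)\<bar>)\<^sup>2" using Tp by (intro power_mono) auto
 also have "\<dots> \<le> (\<Sum>i\<in>{..<n}-U. (mass i)\<^sup>2) * (\<Sum>i\<in>{..<n}-U. \<bar>ln (\<theta>' i / \<theta> i)\<bar>\<^sup>2)"
  by (rule Cauchy_Schwarz_ineq_sum)
 also have "\<dots> \<le> (\<Sum>i\<in>{..<n}-U. (mass i)\<^sup>2) * (Cv * real n * t)"
 proof (rule mult_left_mono)
  have "(\<Sum>i\<in>{..<n}-U. \<bar>ln (\<theta>' i / \<theta> i)\<bar>\<^sup>2) \<le> (\<Sum>i<n. (ln (\<theta>' i / \<theta> i))\<^sup>2)"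
   unfolding power2_abs by (intro sum_mono2) auto
  then show "(\<Sum>i\<in>{..<n}-U. \<bar>ln (\<theta>' i / \<theta> i)\<bar>\<^sup>2) \<le> Cv * real n * t" using v by linarith
 qed (simp add: sum_nonneg)
 finally have T2: "T\<^sup>2 \<le> (\<Sum>i\<in>{..<n}-U. (mass i)\<^sup>2) * (Cv * real n * t)" .
 have "Gr\<^sup>2 \<le> (CW * T)\<^sup>2" using GrT Grp by (intro power_mono) (auto simp: T_def)
 also have "\<dots> = CW\<^sup>2 * T\<^sup>2" by (simp add: power_mult_distrib)
 also have "\<dots> \<le> CW\<^sup>2 * ((\<Sum>i\<in>{..<n}-U. (mass i)\<^sup>2) * (Cv * real n * t))"
  using T2 by (intro mult_left_mono) auto
 finally show ?thesis .
qed

text \<open>For a family in a bounded range all weights are at least \<open>smin\<close>, and the exchange between cells is negligible if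
 \<open>w\<close> is small in comparison.\<close>
theorem removal_many:
 assumes Z: "\<And>j. j < n \<Longrightarrow> 0 < Z j" and th': "\<And>i. i < n \<Longrightarrow> 0 < \<theta>' i"
  and eZ: "\<And>i. i < n \<Longrightarrow> \<theta>' i * Z i = (\<Sum>j<n. V i j * Z j) + t"
  and ze: "\<zeta> > 0" "(\<Sum>j<n. Z j) \<le> \<zeta> * real n"
  and v: "(\<Sum>i<n. (ln (\<theta>' i / \<theta> i))\<^sup>2) \<le> Cv * real n * t"
  and Yb: "Yb > 0" "\<And>c. c \<in> I \<Longrightarrow> real (card (cell c)) / real n * exp (- (1/2) * (gap (real_of_int (el c)) + dual.gap (real_of_int (er c)))) \<le> Yb"
  and t: "K8 \<zeta> * Yb \<le> t"
  and inj: "inj_on (\<lambda>c. (el c, er c)) I"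
  and w: "0 < w" "w \<le> 1" "\<eta> \<le> w ^ 3" "0 \<le> \<eta>"
  and smin: "0 < smin" "\<And>c. c \<in> I \<Longrightarrow> smin \<le> sl c" "\<And>c. c \<in> I \<Longrightarrow> smin \<le> sr c"
  and small: "CW * (12 * K5 * w * real (card I)) \<le> smin"
 shows "Gr\<^sup>2 \<le> CW\<^sup>2 * ((\<Sum>i\<in>{..<n}-U. (mass i)\<^sup>2) * (Cv * real n * t))"
proof -
 have nn: "real n > 0" using n by simp
 have am: "allmass > 0" unfolding allmass_def using I M_pos by (intro sum_pos) auto
 have Gls: "smin * allmass \<le> Gl" unfolding Gl_def allmass_def sum_distrib_left
  using smin M_pos by (intro sum_mono mult_right_mono) (auto intro: less_imp_le)
 have Grs: "smin * allmass \<le> Gr" unfolding Gr_def allmass_def sum_distrib_left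
  using smin M_pos by (intro sum_mono mult_right_mono) (auto intro: less_imp_le)
 have Glp: "Gl > 0" and Grp: "Gr > 0" using Gls Grs smin am by (auto intro: less_le_trans mult_pos_pos)
 define q where "q = 12 * K5 * w * real (card I) * allmass"
 have q0: "q \<ge> 0" using K5_pos w am by (simp add: q_def)
 have sm: "CW * q \<le> smin * allmass" unfolding q_def using mult_right_mono[OF small, of allmass] am by (simp add: mult_ac)
 have CW2: "CW \<ge> 2" using gapsum_pos[of "1/8"] by (simp add: CW_def)
 have qs: "q \<le> smin * allmass" using sm mult_right_mono[OF CW2 q0] q0 by linarith
 have GrT: "Gr \<le> CW * total"
 proof -
  have "(1 + gapsum (1/8)) * (2 * K5 * w * real (card I) * allmass) = CW * q / 12" by (simp add: CW_def q_def)
  also have "\<dots> \<le> Gr / 2" using sm Grs Grp by linarith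
  finally show ?thesis using Gr_bound[OF w] unfolding CW_def by simp
 qed
 have GlT: "Gl \<le> CW * total"
 proof -
  have "(1 + gapsum (1/8)) * (2 * K5 * w * real (card I) * allmass) = CW * q / 12" by (simp add: CW_def q_def)
  also have "\<dots> \<le> Gl / 2" using sm Gls Glp by linarith
  finally show ?thesis using D.Gr_bound[OF w] unfolding D_G D_total D_allmass CW_def by simp
 qed
 show ?thesis
 proof (rule removal_core[OF Z th' eZ ze v Yb t inj GrT GlT])
  show "(\<Sum>c\<in>I. R c * (7/8 * dual.gap (real_of_int (er c)) + real_of_int (er c))) - Gl
    \<le> (\<Sum>c\<in>I. R' c * (7/8 * dual.gap (real_of_int (er c)) + real_of_int (er c)))"
   using mismatch[OF w(1-3) _ refl] qs Gls by (simp add: q_def)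
 qed
qed

text \<open>For one cell the exchange is that with itself, which is a small part of its own mass regardless of its weight. So the
 smallness of \<open>w\<close> does not depend on the distance of the cell to the frequent levels.\<close>
theorem removal_single:
 assumes Z: "\<And>j. j < n \<Longrightarrow> 0 < Z j" and th': "\<And>i. i < n \<Longrightarrow> 0 < \<theta>' i"
  and eZ: "\<And>i. i < n \<Longrightarrow> \<theta>' i * Z i = (\<Sum>j<n. V i j * Z j) + t"
  and ze: "\<zeta> > 0" "(\<Sum>j<n. Z j) \<le> \<zeta> * real n"
  and v: "(\<Sum>i<n. (ln (\<theta>' i / \<theta> i))\<^sup>2) \<le> Cv * real n * t"
  and Yb: "Yb > 0" "\<And>c. c \<in> I \<Longrightarrow> real (card (cell c)) / real n * exp (- (1/2) * (gap (real_of_int (el c)) + dual.gap (real_of_int (er c)))) \<le> Yb"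
  and t: "K8 \<zeta> * Yb \<le> t"
  and Ic: "I = {c}"
  and w: "0 < w" "w \<le> 1" "\<eta> \<le> w ^ 3" and small: "4 * K5 * w \<le> 1"
 shows "Gr\<^sup>2 \<le> CW\<^sup>2 * ((\<Sum>i\<in>{..<n}-U. (mass i)\<^sup>2) * (Cv * real n * t))"
proof (rule removal_core[OF Z th' eZ ze v Yb t])
 have c: "c \<in> I" using Ic by simp
 have sI: "(\<Sum>c\<in>I. f c) = f c" for f :: "_ \<Rightarrow> real" by (simp add: Ic)
 have Mp: "M c > 0" using M_pos[OF c] .
 have "B c c \<le> K5 * w * (M c + M c)" by (rule B_bound_r[OF c c w(1,2)]) (use w in simp)
 also have "\<dots> = (4 * K5 * w) * (M c / 2)" by simp
 also have "\<dots> \<le> 1 * (M c / 2)" using small Mp by (intro mult_right_mono) auto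
 finally have "M c \<le> 2 * R c" using R_eq[OF c] by (simp add: sI)
 then have 1: "M c \<le> 2 * total" unfolding total_def by (simp only: sI)
 have 2: "2 * total \<le> CW * total" using total0 gapsum_pos[of "1/8"] by (intro mult_right_mono) (auto simp: CW_def)
 have "sr c * M c \<le> 1 * M c" "sl c * M c \<le> 1 * M c" using sr01 sl01 Mp by (auto intro!: mult_right_mono)
 then show "Gr \<le> CW * total" "Gl \<le> CW * total" using 1 2 unfolding Gr_def Gl_def sI by linarith+
 have "R c = R' c" using total_alt unfolding total_def by (simp only: sI)
 moreover have "Gl > 0" unfolding Gl_def using I M_pos sl01 by (intro sum_pos) auto
 ultimately show "(\<Sum>c\<in>I. R c * (7/8 * dual.gap (real_of_int (er c)) + real_of_int (er c))) - Gl
    \<le> (\<Sum>c\<in>I. R' c * (7/8 * dual.gap (real_of_int (er c)) + real_of_int (er c)))"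
  unfolding sI by simp
 show "inj_on (\<lambda>c. (el c, er c)) I" unfolding Ic by simp
qed

end

section \<open>Balance of the masses\<close>

text \<open>Gronwall's inequality over a finite set ordered by decreasing \<open>y\<close>; values of \<open>y\<close> may coincide.\<close>
lemma gronwall_finite:
 fixes \<mu> w y :: "'a \<Rightarrow> real"
 assumes "finite P" "\<And>c. c \<in> P \<Longrightarrow> 0 \<le> w c" "\<And>c. c \<in> P \<Longrightarrow> 0 \<le> \<mu> c"
  and "\<And>c. c \<in> P \<Longrightarrow> \<mu> c \<le> w c * (L + (\<Sum>p\<in>{p\<in>P. y p > y c}. \<mu> p))"
 shows "L + (\<Sum>c\<in>P. \<mu> c) \<le> L * (\<Prod>c\<in>P. 1 + w c)"
 using assms
proof (induction "card P" arbitrary: P)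
 case 0 then show ?case by simp
next
 case (Suc k)
 then have "P \<noteq> {}" by auto
 define c where "c = arg_min_on y P"
 have c: "c \<in> P" "\<And>p. p \<in> P \<Longrightarrow> y c \<le> y p"
  using arg_min_if_finite[OF Suc.prems(1) \<open>P \<noteq> {}\<close>, of y] by (auto simp: c_def not_less)
 have IH: "L + (\<Sum>c\<in>P - {c}. \<mu> c) \<le> L * (\<Prod>c\<in>P - {c}. 1 + w c)"
 proof (rule Suc.hyps(1))
  show "k = card (P - {c})" using Suc.hyps(2) c Suc.prems(1) by simp
  fix d assume d: "d \<in> P - {c}"
  have "{p \<in> P - {c}. y d < y p} = {p \<in> P. y d < y p}" using c d by force
  then show "\<mu> d \<le> w d * (L + (\<Sum>p\<in>{p \<in> P - {c}. y d < y p}. \<mu> p))" using Suc.prems(4)[of d] d by simp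
 qed (use Suc.prems in auto)
 have "(\<Sum>p\<in>{p\<in>P. y p > y c}. \<mu> p) \<le> (\<Sum>p\<in>P - {c}. \<mu> p)"
  using Suc.prems by (intro sum_mono2) auto
 then have "w c * (L + (\<Sum>p\<in>{p\<in>P. y p > y c}. \<mu> p)) \<le> w c * (L + (\<Sum>p\<in>P - {c}. \<mu> p))"
  using Suc.prems(2)[OF c(1)] by (intro mult_left_mono) auto
 then have "\<mu> c \<le> w c * (L + (\<Sum>p\<in>P - {c}. \<mu> p))" using Suc.prems(4)[OF c(1)] by linarith
 moreover have "(\<Sum>p\<in>P. \<mu> p) = \<mu> c + (\<Sum>p\<in>P - {c}. \<mu> p)" using Suc.prems(1) c(1) by (rule sum.remove)
 ultimately have "L + (\<Sum>p\<in>P. \<mu> p) \<le> (1 + w c) * (L + (\<Sum>p\<in>P - {c}. \<mu> p))" by (simp add: algebra_simps)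
 also have "\<dots> \<le> (1 + w c) * (L * (\<Prod>c\<in>P - {c}. 1 + w c))"
  using IH Suc.prems(2)[OF c(1)] by (intro mult_left_mono) auto
 also have "\<dots> = L * (\<Prod>c\<in>P. 1 + w c)" using Suc.prems(1) c(1) by (simp add: prod.remove)
 finally show ?case .
qed

context perron_pair
begin

interpretation dual: perron_pair n "\<lambda>i j. V j i" r l \<theta> S \<tau> \<Theta> \<beta> c0 by (rule dual_pair)

definition key :: "nat \<Rightarrow> int \<times> int" where "key k = (\<lfloor>ln (l k)\<rfloor>, \<lfloor>ln (r k)\<rfloor>)"
definition bin :: "nat set \<Rightarrow> int \<times> int \<Rightarrow> nat set" where "bin H p = {k\<in>H. key k = p}"
text \<open>Distance of a logarithmic box from the frequent values, forward and backward.\<close>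
definition away :: "int \<times> int \<Rightarrow> real" where
 "away p = gap (real_of_int (fst p)) + dual.gap (real_of_int (snd p))"
text \<open>The value of \<open>t\<close>, up to the factor \<open>K8\<close>, at which the removal of a bin becomes effective.\<close>
definition height :: "nat set \<Rightarrow> int \<times> int \<Rightarrow> real" where
 "height H p = real (card (bin H p)) / real n * exp (- (1/2) * away p)"
text \<open>There are test vectors for every \<open>t \<le> 1\<close>, of bounded mean and with levels at mean square distance of order \<open>t\<close>
 from \<open>\<theta>\<close>.\<close>
definition solvable :: "real \<Rightarrow> real \<Rightarrow> bool" where
 "solvable \<zeta> Cv \<longleftrightarrow> (\<forall>t. 0 < t \<and> t \<le> 1 \<longrightarrow> (\<exists>Z \<theta>'. (\<forall>j<n. 0 < Z j \<and> 0 < \<theta>' j \<and> \<theta>' j * Z j = (\<Sum>k<n. V j k * Z k) + t) \<and>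
   (\<Sum>j<n. Z j) \<le> \<zeta> * real n \<and> (\<Sum>j<n. (ln (\<theta>' j / \<theta> j))\<^sup>2) \<le> Cv * real n * t))"
definition CE where "CE \<zeta> Cv = (\<Theta> * exp 2 / \<tau>)\<^sup>2 * (CW\<^sup>2 * Cv * K8 \<zeta>)"

lemma solvableD:
 assumes "solvable \<zeta> Cv" "0 < t" "t \<le> 1"
 obtains Z \<theta>' where "\<And>j. j < n \<Longrightarrow> 0 < Z j" "\<And>j. j < n \<Longrightarrow> 0 < \<theta>' j" "\<And>j. j < n \<Longrightarrow> \<theta>' j * Z j = (\<Sum>k<n. V j k * Z k) + t"
  "(\<Sum>j<n. Z j) \<le> \<zeta> * real n" "(\<Sum>j<n. (ln (\<theta>' j / \<theta> j))\<^sup>2) \<le> Cv * real n * t"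
proof -
 have "\<exists>Z \<theta>'. (\<forall>j<n. 0 < Z j \<and> 0 < \<theta>' j \<and> \<theta>' j * Z j = (\<Sum>k<n. V j k * Z k) + t) \<and>
   (\<Sum>j<n. Z j) \<le> \<zeta> * real n \<and> (\<Sum>j<n. (ln (\<theta>' j / \<theta> j))\<^sup>2) \<le> Cv * real n * t"
  using assms unfolding solvable_def by simp
 then show ?thesis using that by blast
qed

lemma away0: "0 \<le> away p" using gap0 dual.gap0 by (simp add: away_def add_nonneg_nonneg)

lemma sum_away_le:
 assumes P: "finite P" and ka: "\<kappa> > 0"
 shows "(\<Sum>p\<in>P. exp (- \<kappa> * away p)) \<le> (gapsum \<kappa>)\<^sup>2"
proof -
 define f g where "f a = exp (- \<kappa> * gap (real_of_int a))" and "g b = exp (- \<kappa> * dual.gap (real_of_int b))" for a b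
 have "(\<Sum>p\<in>P. exp (- \<kappa> * away p)) = (\<Sum>p\<in>P. f (fst p) * g (snd p))"
  by (simp add: f_def g_def away_def algebra_simps flip: exp_add)
 also have "\<dots> \<le> (\<Sum>p\<in>(fst ` P) \<times> (snd ` P). f (fst p) * g (snd p))"
  using P by (intro sum_mono2) (force simp: f_def g_def)+
 also have "\<dots> = (\<Sum>a\<in>fst ` P. f a) * (\<Sum>b\<in>snd ` P. g b)"
  by (simp add: sum_product sum.cartesian_product case_prod_unfold)
 also have "\<dots> \<le> gapsum \<kappa> * gapsum \<kappa>"
 proof (intro mult_mono)
  show "sum f (fst ` P) \<le> gapsum \<kappa>" unfolding f_def using P ka by (intro sum_gap_le) auto
  show "sum g (snd ` P) \<le> gapsum \<kappa>" unfolding g_def using P ka by (intro dual.sum_gap_le) auto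
  show "0 \<le> sum g (snd ` P)" unfolding g_def by (intro sum_nonneg) simp
  show "0 \<le> gapsum \<kappa>" using gapsum_pos[OF ka] by simp
 qed
 finally show ?thesis by (simp add: power2_eq_square)
qed

lemma bin_bounds:
 assumes H: "H \<subseteq> {..<n}" and k: "k \<in> bin H p"
 shows "exp (real_of_int (fst p)) \<le> l k" "l k \<le> exp (real_of_int (fst p) + 1)"
  "exp (real_of_int (snd p)) \<le> r k" "r k \<le> exp (real_of_int (snd p) + 1)"
proof -
 have kn: "k < n" and p: "p = (\<lfloor>ln (l k)\<rfloor>, \<lfloor>ln (r k)\<rfloor>)" using H k by (auto simp: bin_def key_def)
 have *: "exp (real_of_int \<lfloor>ln x\<rfloor>) \<le> x \<and> x \<le> exp (real_of_int \<lfloor>ln x\<rfloor> + 1)" if "x > 0" for x :: real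
 proof -
  have "exp (real_of_int \<lfloor>ln x\<rfloor>) \<le> exp (ln x)" "exp (ln x) \<le> exp (real_of_int \<lfloor>ln x\<rfloor> + 1)"
   by (simp_all del: exp_ln)
  then show ?thesis using that by simp
 qed
 show "exp (real_of_int (fst p)) \<le> l k" "l k \<le> exp (real_of_int (fst p) + 1)"
  "exp (real_of_int (snd p)) \<le> r k" "r k \<le> exp (real_of_int (snd p) + 1)"
  using *[OF lp[OF kn]] *[OF rp[OF kn]] p by auto
qed

lemma bins_family:
 assumes H: "H \<subseteq> {..<n}" and P: "P \<subseteq> key ` H" "P \<noteq> {}"
  and eta: "real (card H) \<le> \<eta> * real n"
 obtains X Y where "cell_family n V l r \<theta> S \<tau> \<Theta> \<beta> c0 P (bin H) fst snd \<eta> X Y"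
proof -
 have fH: "finite H" using H finite_subset by blast
 have sub: "bin H c \<subseteq> (\<Union>c\<in>P. bin H c)" "bin H c \<subseteq> {..<n}" if "c \<in> P" for c
  using that H by (auto simp: bin_def)
 define X where "X c = (SOME x. cell_tube (\<Union>c\<in>P. bin H c) (bin H c) x)" for c
 have X: "cell_tube (\<Union>c\<in>P. bin H c) (bin H c) (X c)" if "c \<in> P" for c
  unfolding X_def by (rule someI_ex[OF cell_tube_exists[OF sub[OF that]]])
 define Y where "Y c = (SOME x. dual.cell_tube (\<Union>c\<in>P. bin H c) (bin H c) x)" for c
 have Y: "dual.cell_tube (\<Union>c\<in>P. bin H c) (bin H c) (Y c)" if "c \<in> P" for c
  unfolding Y_def by (rule someI_ex[OF dual.cell_tube_exists[OF sub[OF that]]])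
 have "cell_family n V l r \<theta> S \<tau> \<Theta> \<beta> c0 P (bin H) fst snd \<eta> X Y"
 proof unfold_locales
  show "finite P" using P fH finite_surj by blast
  show "bin H c \<noteq> {}" if "c \<in> P" for c using that P by (auto simp: bin_def)
  show "bin H c \<inter> bin H d = {}" if "c \<noteq> d" for c d using that by (auto simp: bin_def)
  show "real (card (bin H c)) \<le> \<eta> * real n" for c
  proof -
   have "card (bin H c) \<le> card H" using fH by (intro card_mono) (auto simp: bin_def)
   then show ?thesis using eta by linarith
  qed
 qed (use P X Y sub bin_bounds[OF H] in auto)
 then show ?thesis by (rule that)
qed

text \<open>Masses within a bin are comparable, so the sum of their squares is that of a constant mass.\<close>
lemma bin_squares:
 assumes H: "H \<subseteq> {..<n}" and p: "p \<in> key ` H"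
 shows "(\<Sum>k\<in>bin H p. (mass k)\<^sup>2) \<le> (\<Theta> * exp 2 / \<tau>)\<^sup>2 * (cellmass (bin H p))\<^sup>2 / real (card (bin H p))"
proof -
 define C where "C = bin H p"
 have C: "finite C" "C \<noteq> {}" "C \<subseteq> {..<n}" using H p finite_subset[OF H] by (auto simp: C_def bin_def)
 define N where "N = real (card C)"
 have N: "N > 0" using C by (simp add: N_def card_gt_0_iff)
 define e where "e = exp (real_of_int (fst p)) * exp (real_of_int (snd p))"
 have e: "e > 0" by (simp add: e_def)
 have mk: "e * \<tau> \<le> mass k" "mass k \<le> e * (\<Theta> * exp 2)" if k: "k \<in> C" for k
 proof -
  note b = bin_bounds[OF H k[unfolded C_def]]
  have kn: "k < n" using k C by auto
  show "e * \<tau> \<le> mass k" unfolding e_def mass_def using b th[OF kn] tau lp[OF kn] rp[OF kn]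
   by (intro mult_mono) auto
  have "mass k \<le> (exp (real_of_int (fst p) + 1) * exp (real_of_int (snd p) + 1)) * \<Theta>"
   unfolding mass_def using b th[OF kn] tau lp[OF kn] rp[OF kn] by (intro mult_mono) auto
  also have "\<dots> = e * (\<Theta> * exp 2)" by (simp add: e_def algebra_simps flip: exp_add)
  finally show "mass k \<le> e * (\<Theta> * exp 2)" .
 qed
 have "N * (e * \<tau>) \<le> cellmass C" unfolding cellmass_def N_def using mk(1) by (intro sum_bounded_below) auto
 then have eN: "e \<le> cellmass C / (N * \<tau>)" using N tau by (simp add: field_simps)
 have "(\<Sum>k\<in>C. (mass k)\<^sup>2) \<le> N * (e * (\<Theta> * exp 2))\<^sup>2"
  unfolding N_def using mk C order_less_imp_le[OF mass_pos] by (intro sum_bounded_above power_mono) auto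
 also have "\<dots> \<le> N * (cellmass C / (N * \<tau>) * (\<Theta> * exp 2))\<^sup>2"
  using N e eN Theta_pos by (intro mult_left_mono power_mono mult_right_mono) auto
 also have "\<dots> = (\<Theta> * exp 2 / \<tau>)\<^sup>2 * (cellmass C)\<^sup>2 / N"
  using N tau by (simp add: power2_eq_square field_simps)
 finally show ?thesis by (simp add: C_def N_def)
qed

text \<open>The removal inequality at \<open>t = K8 * height\<close>. The number of sites in \<open>height\<close> cancels against that in \<open>bin_squares\<close>, and
 of the decay \<open>1/2\<close> in \<open>height\<close> the weight \<open>sr\<close> consumes one half.\<close>
lemma bin_from_gain:
 assumes H: "H \<subseteq> {..<n}" and p: "p \<in> key ` H" and Cv: "Cv > 0" and ze: "\<zeta> > 0"
  and G: "exp (- (1/8) * dual.gap (real_of_int (snd p))) * cellmass (bin H p) \<le> G"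
  and G2: "G\<^sup>2 \<le> CW\<^sup>2 * (Q * (Cv * real n * (K8 \<zeta> * height H p)))" and Q: "Q \<ge> 0"
 shows "(\<Sum>k\<in>bin H p. (mass k)\<^sup>2) \<le> CE \<zeta> Cv * exp (- (1/4) * away p) * Q"
proof -
 define N where "N = real (card (bin H p))"
 have "finite (bin H p)" using finite_subset[OF H] by (auto simp: bin_def)
 then have N: "N > 0" using p by (auto simp: N_def card_gt_0_iff bin_def)
 have nn: "real n > 0" using n by simp
 define g where "g = dual.gap (real_of_int (snd p))"
 define m where "m = cellmass (bin H p)"
 have m0: "m \<ge> 0" unfolding m_def cellmass_def using H mass_pos by (intro sum_nonneg) (auto simp: bin_def order_less_imp_le)
 have ga: "g \<le> away p" using gap0 by (simp add: g_def away_def)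
 have K: "K8 \<zeta> > 0" using K8_pos ze by blast
 have "(exp (- (1/8) * g) * m)\<^sup>2 \<le> G\<^sup>2" using G m0 by (intro power_mono) (auto simp: g_def m_def)
 also have "\<dots> \<le> CW\<^sup>2 * (Q * (Cv * real n * (K8 \<zeta> * height H p)))" by (rule G2)
 also have "\<dots> = (CW\<^sup>2 * Cv * K8 \<zeta>) * Q * N * exp (- (1/2) * away p)" using nn by (simp add: height_def N_def)
 finally have *: "(exp (- (1/8) * g) * m)\<^sup>2 \<le> (CW\<^sup>2 * Cv * K8 \<zeta>) * Q * N * exp (- (1/2) * away p)" .
 have 1: "exp (- (1/4) * g) * m\<^sup>2 \<le> (CW\<^sup>2 * Cv * K8 \<zeta>) * Q * N * exp (- (1/2) * away p)"
 proof -
  have "(exp (- (1/8) * g) * m)\<^sup>2 = (exp (- (1/8) * g) * exp (- (1/8) * g)) * m\<^sup>2" by (simp only: power2_eq_square mult_ac)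
  also have "exp (- (1/8) * g) * exp (- (1/8) * g) = exp (- (1/4) * g)" by (simp flip: exp_add)
  finally show ?thesis using * by simp
 qed
 have "m\<^sup>2 = exp (1/4 * g) * (exp (- (1/4) * g) * m\<^sup>2)" by (simp add: mult.assoc[symmetric] flip: exp_add)
 also have "\<dots> \<le> exp (1/4 * away p) * ((CW\<^sup>2 * Cv * K8 \<zeta>) * Q * N * exp (- (1/2) * away p))"
  by (rule mult_mono) (use 1 ga in simp_all)
 also have "\<dots> = (CW\<^sup>2 * Cv * K8 \<zeta>) * Q * N * (exp (1/4 * away p) * exp (- (1/2) * away p))" by (simp only: mult_ac)
 also have "exp (1/4 * away p) * exp (- (1/2) * away p) = exp (- (1/4) * away p)" by (simp flip: exp_add)
 finally have 2: "m\<^sup>2 \<le> (CW\<^sup>2 * Cv * K8 \<zeta>) * Q * N * exp (- (1/4) * away p)" .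
 have "(\<Sum>k\<in>bin H p. (mass k)\<^sup>2) \<le> (\<Theta> * exp 2 / \<tau>)\<^sup>2 * m\<^sup>2 / N"
  using bin_squares[OF H p] by (simp add: m_def N_def)
 also have "\<dots> \<le> (\<Theta> * exp 2 / \<tau>)\<^sup>2 * ((CW\<^sup>2 * Cv * K8 \<zeta>) * Q * N * exp (- (1/4) * away p)) / N"
  using 2 N by (intro divide_right_mono mult_left_mono) auto
 also have "\<dots> = CE \<zeta> Cv * exp (- (1/4) * away p) * Q" using N by (simp add: CE_def)
 finally show ?thesis .
qed

lemma height_pos: "H \<subseteq> {..<n} \<Longrightarrow> p \<in> key ` H \<Longrightarrow> height H p > 0"
proof -
 assume H: "H \<subseteq> {..<n}" and p: "p \<in> key ` H"
 have "finite (bin H p)" using finite_subset[OF H] by (auto simp: bin_def)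
 then have "card (bin H p) > 0" using p by (auto simp: card_gt_0_iff bin_def)
 then show ?thesis using n by (simp add: height_def)
qed

lemma height_le: assumes H: "H \<subseteq> {..<n}" and e: "real (card H) \<le> \<eta> * real n" shows "height H p \<le> \<eta>"
proof -
 have nn: "real n > 0" using n by simp
 have "card (bin H p) \<le> card H" using finite_subset[OF H] by (intro card_mono) (auto simp: bin_def)
 then have "real (card (bin H p)) / real n \<le> \<eta>" using e nn by (simp add: divide_le_eq)
 moreover have "real (card (bin H p)) / real n * exp (- (1/2) * away p) \<le> real (card (bin H p)) / real n * 1"
  using away0[of p] by (intro mult_left_mono) auto
 ultimately show ?thesis by (simp add: height_def)
qed

text \<open>Removing all bins of smaller height together with the bin itself leaves on the right only higher bins and
 the sites in no bin.\<close>
lemma bin_decay_many: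
 assumes H: "H \<subseteq> {..<n}" and P: "P \<subseteq> key ` H" and c: "c \<in> P" and Cv: "Cv > 0" and ze: "\<zeta> > 0"
  and top: "\<And>p. p \<in> P \<Longrightarrow> height H p \<le> height H c"
  and e: "real (card H) \<le> \<eta> * real n" and Ke: "K8 \<zeta> * \<eta> \<le> 1"
  and sv: "solvable \<zeta> Cv"
  and w: "0 < w" "w \<le> 1" "\<eta> \<le> w ^ 3"
  and d: "\<And>p. p \<in> P \<Longrightarrow> away p \<le> d"
  and small: "CW * (12 * K5 * w * real (card P)) \<le> exp (- (1/8) * d)"
 shows "(\<Sum>k\<in>bin H c. (mass k)\<^sup>2) \<le> CE \<zeta> Cv * exp (- (1/4) * away c) * (\<Sum>k\<in>{..<n} - (\<Union>p\<in>P. bin H p). (mass k)\<^sup>2)"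
proof -
 obtain X Y where "cell_family n V l r \<theta> S \<tau> \<Theta> \<beta> c0 P (bin H) fst snd \<eta> X Y"
  using bins_family[OF H P _ e] c by blast
 then interpret F: cell_family n V l r \<theta> S \<tau> \<Theta> \<beta> c0 P "bin H" fst snd \<eta> X Y .
 define t where "t = K8 \<zeta> * height H c"
 have hp: "height H c > 0" using height_pos[OF H] P c by blast
 have "t \<le> K8 \<zeta> * \<eta>" unfolding t_def using height_le[OF H e] K8_pos[OF ze] by (intro mult_left_mono) auto
 then have t: "0 < t" "t \<le> 1" using mult_pos_pos[OF K8_pos[OF ze] hp] Ke by (auto simp only: t_def)
 obtain Z \<theta>' where Z: "\<And>j. j < n \<Longrightarrow> 0 < Z j" "\<And>j. j < n \<Longrightarrow> 0 < \<theta>' j" "\<And>j. j < n \<Longrightarrow> \<theta>' j * Z j = (\<Sum>k<n. V j k * Z k) + t"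
  "(\<Sum>j<n. Z j) \<le> \<zeta> * real n" "(\<Sum>j<n. (ln (\<theta>' j / \<theta> j))\<^sup>2) \<le> Cv * real n * t"
  using solvableD[OF sv t] by blast
 have "F.Gr\<^sup>2 \<le> CW\<^sup>2 * ((\<Sum>i\<in>{..<n}-F.U. (mass i)\<^sup>2) * (Cv * real n * t))"
 proof (rule F.removal_many[OF Z(1-3) ze Z(4,5) hp _ _ _ w _ _ _ _ small])
  show "real (card (bin H p)) / real n * exp (- (1/2) * (gap (real_of_int (fst p)) + dual.gap (real_of_int (snd p)))) \<le> height H c"
   if "p \<in> P" for p using top[OF that] by (simp only: height_def away_def)
  show "K8 \<zeta> * height H c \<le> t" by (simp add: t_def)
  show "inj_on (\<lambda>c. (fst c, snd c)) P" by simp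
  have "0 \<le> real (card H)" by simp
  then show "0 \<le> \<eta>" using e n by (metis dual_order.trans mult_neg_pos not_le of_nat_0_less_iff)
  show "exp (- (1/8) * d) \<le> F.sl p" "exp (- (1/8) * d) \<le> F.sr p" if "p \<in> P" for p
   using d[OF that] gap0[of "real_of_int (fst p)"] dual.gap0[of "real_of_int (snd p)"]
   by (auto simp: F.sl_def F.sr_def away_def)
 qed simp_all
 moreover have "exp (- (1/8) * dual.gap (real_of_int (snd c))) * cellmass (bin H c) \<le> F.Gr"
 proof -
  have "F.sr c * F.M c \<le> F.Gr" unfolding F.Gr_def using c F.I F.M_pos F.sr01
   by (intro member_le_sum) (auto simp: order_less_imp_le)
  then show ?thesis by (simp add: F.sr_def F.M_def)
 qed
 ultimately show ?thesis
  using bin_from_gain[OF H _ Cv ze, of c F.Gr "\<Sum>k\<in>{..<n} - (\<Union>p\<in>P. bin H p). (mass k)\<^sup>2"] P c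
  unfolding F.U_def t_def by (auto simp: sum_nonneg)
qed

lemma bin_decay_single:
 assumes H: "H \<subseteq> {..<n}" and c: "c \<in> key ` H" and Cv: "Cv > 0" and ze: "\<zeta> > 0"
  and e: "real (card H) \<le> \<eta> * real n" and Ke: "K8 \<zeta> * \<eta> \<le> 1"
  and sv: "solvable \<zeta> Cv"
  and w: "0 < w" "w \<le> 1" "\<eta> \<le> w ^ 3" and small: "4 * K5 * w \<le> 1"
 shows "(\<Sum>k\<in>bin H c. (mass k)\<^sup>2) \<le> CE \<zeta> Cv * exp (- (1/4) * away c) * (\<Sum>k<n. (mass k)\<^sup>2)"
proof -
 obtain X Y where "cell_family n V l r \<theta> S \<tau> \<Theta> \<beta> c0 {c} (bin H) fst snd \<eta> X Y"
  using bins_family[OF H _ _ e, of "{c}"] c by blast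
 then interpret F: cell_family n V l r \<theta> S \<tau> \<Theta> \<beta> c0 "{c}" "bin H" fst snd \<eta> X Y .
 define t where "t = K8 \<zeta> * height H c"
 have hp: "height H c > 0" using height_pos[OF H c] .
 have "t \<le> K8 \<zeta> * \<eta>" unfolding t_def using height_le[OF H e] K8_pos[OF ze] by (intro mult_left_mono) auto
 then have t: "0 < t" "t \<le> 1" using mult_pos_pos[OF K8_pos[OF ze] hp] Ke by (auto simp only: t_def)
 obtain Z \<theta>' where Z: "\<And>j. j < n \<Longrightarrow> 0 < Z j" "\<And>j. j < n \<Longrightarrow> 0 < \<theta>' j" "\<And>j. j < n \<Longrightarrow> \<theta>' j * Z j = (\<Sum>k<n. V j k * Z k) + t"
  "(\<Sum>j<n. Z j) \<le> \<zeta> * real n" "(\<Sum>j<n. (ln (\<theta>' j / \<theta> j))\<^sup>2) \<le> Cv * real n * t"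
  using solvableD[OF sv t] by blast
 have G: "F.Gr\<^sup>2 \<le> CW\<^sup>2 * ((\<Sum>i\<in>{..<n}-F.U. (mass i)\<^sup>2) * (Cv * real n * t))"
 proof (rule F.removal_single[OF Z(1-3) ze Z(4,5) hp _ _ refl w small])
  show "real (card (bin H p)) / real n * exp (- (1/2) * (gap (real_of_int (fst p)) + dual.gap (real_of_int (snd p)))) \<le> height H c"
   if "p \<in> {c}" for p using that by (simp add: height_def away_def)
  show "K8 \<zeta> * height H c \<le> t" by (simp add: t_def)
 qed
 have sub: "(\<Sum>i\<in>{..<n}-F.U. (mass i)\<^sup>2) \<le> (\<Sum>i<n. (mass i)\<^sup>2)" by (intro sum_mono2) auto
 have "CW\<^sup>2 * ((\<Sum>i\<in>{..<n}-F.U. (mass i)\<^sup>2) * (Cv * real n * t)) \<le> CW\<^sup>2 * ((\<Sum>i<n. (mass i)\<^sup>2) * (Cv * real n * t))"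
  using Cv t by (intro mult_left_mono mult_right_mono sub) auto
 then have "F.Gr\<^sup>2 \<le> CW\<^sup>2 * ((\<Sum>i<n. (mass i)\<^sup>2) * (Cv * real n * (K8 \<zeta> * height H c)))" using G unfolding t_def by linarith
 moreover have "exp (- (1/8) * dual.gap (real_of_int (snd c))) * cellmass (bin H c) \<le> F.Gr"
  by (simp add: F.Gr_def F.sr_def F.M_def)
 ultimately show ?thesis
  using bin_from_gain[OF H c Cv ze, of F.Gr "\<Sum>k<n. (mass k)\<^sup>2"] by (auto simp: sum_nonneg)
qed

text \<open>\<open>exp Wt\<close> bounds the Gronwall product. Bins with \<open>away\<close> beyond \<open>reach\<close> contribute a total that can be absorbed. The
 other bins are bounded in number; \<open>width\<close> is small enough for the removal of any family of them, and sites whose mass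
 is below \<open>cut\<close> times the mean need no cells.\<close>
definition Wt where "Wt \<zeta> Cv = CE \<zeta> Cv * (gapsum (1/4))\<^sup>2"
definition reach where "reach \<zeta> Cv = 8 * ln (1 + 2 * CE \<zeta> Cv * (gapsum (1/8))\<^sup>2 * exp (Wt \<zeta> Cv))"
definition width where "width \<zeta> Cv = min 1 (min (1 / (4 * K5))
  (exp (- (1/8) * reach \<zeta> Cv) / (CW * (12 * K5 * ((gapsum (1/8))\<^sup>2 * exp (1/8 * reach \<zeta> Cv))))))"
definition cut where "cut \<zeta> Cv = max 1 (max (1 / width \<zeta> Cv ^ 3) (K8 \<zeta>))"
definition Cbal where "Cbal \<zeta> Cv = 2 * exp (Wt \<zeta> Cv) * (cut \<zeta> Cv)\<^sup>2"

lemma CE_pos: assumes "\<zeta> > 0" "Cv > 0" shows "CE \<zeta> Cv > 0"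
proof -
 have "\<Theta> * exp 2 / \<tau> > 0" using Theta_pos tau by simp
 then show ?thesis unfolding CE_def using K8_pos[OF assms(1)] assms(2) CW_pos
  by (intro mult_pos_pos zero_less_power) auto
qed

lemma width_props: "0 < width \<zeta> Cv" "width \<zeta> Cv \<le> 1" "4 * K5 * width \<zeta> Cv \<le> 1"
 "CW * (12 * K5 * ((gapsum (1/8))\<^sup>2 * exp (1/8 * reach \<zeta> Cv))) * width \<zeta> Cv \<le> exp (- (1/8) * reach \<zeta> Cv)"
proof -
 define Q where "Q = CW * (12 * K5 * ((gapsum (1/8))\<^sup>2 * exp (1/8 * reach \<zeta> Cv)))"
 define E where "E = exp (- (1/8) * reach \<zeta> Cv)"
 have E: "E > 0" by (simp add: E_def)
 have Q: "Q > 0" unfolding Q_def using CW_pos K5_pos gapsum_pos[of "1/8"] by (intro mult_pos_pos zero_less_power) auto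
 have wd: "width \<zeta> Cv = min 1 (min (1 / (4 * K5)) (E / Q))" unfolding width_def Q_def E_def ..
 show "0 < width \<zeta> Cv" "width \<zeta> Cv \<le> 1" using E Q K5_pos by (auto simp: wd)
 have "width \<zeta> Cv \<le> 1 / (4 * K5)" "width \<zeta> Cv \<le> E / Q" by (auto simp: wd)
 then show "4 * K5 * width \<zeta> Cv \<le> 1"
  "CW * (12 * K5 * ((gapsum (1/8))\<^sup>2 * exp (1/8 * reach \<zeta> Cv))) * width \<zeta> Cv \<le> exp (- (1/8) * reach \<zeta> Cv)"
  using Q K5_pos unfolding Q_def[symmetric] E_def[symmetric] by (simp_all add: field_simps)
qed

text \<open>The sites whose mass exceeds \<open>cut\<close> times the mean are few, hence their bins are sparse. Single removal makes the bins beyond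
 \<open>reach\<close> negligible. The others are removed together in families of all bins up to a given height, and Gronwall's
 inequality along decreasing heights bounds their squared masses by those of the sites of small mass.\<close>
theorem mass_balance:
 assumes ze: "\<zeta> > 0" and Cv: "Cv > 0" and sv: "solvable \<zeta> Cv"
 shows "(\<Sum>i<n. (mass i)\<^sup>2) \<le> Cbal \<zeta> Cv / real n * (\<Sum>i<n. mass i)\<^sup>2"
proof -
 have nn: "real n > 0" using n by simp
 define W where "W = Wt \<zeta> Cv"
 define \<rho> where "\<rho> = reach \<zeta> Cv"
 define w where "w = width \<zeta> Cv"
 define T where "T = cut \<zeta> Cv"
 define C where "C = CE \<zeta> Cv"
 have C: "C > 0" using CE_pos[OF ze Cv] by (simp add: C_def)
 have w: "0 < w" "w \<le> 1" "4 * K5 * w \<le> 1" using width_props by (auto simp: w_def)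
 have T: "T \<ge> 1" "1 / T \<le> w ^ 3" "K8 \<zeta> * (1 / T) \<le> 1"
 proof -
  show T1: "T \<ge> 1" by (simp add: T_def cut_def)
  have "1 / w ^ 3 \<le> T" "K8 \<zeta> \<le> T" by (auto simp: T_def cut_def w_def)
  then show "1 / T \<le> w ^ 3" "K8 \<zeta> * (1 / T) \<le> 1" using T1 w by (simp_all add: field_simps)
 qed
 define mb where "mb = (\<Sum>i<n. mass i) / real n"
 have sm: "(\<Sum>i<n. mass i) = real n * mb" using nn by (simp add: mb_def)
 have "(\<Sum>i<n. mass i) > 0" using n mass_pos by (intro sum_pos) auto
 then have mb: "mb > 0" using nn by (simp add: mb_def)
 define H where "H = {i. i < n \<and> T * mb < mass i}"
 have H: "H \<subseteq> {..<n}" and fH: "finite H" by (auto simp: H_def)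
 have cH: "real (card H) \<le> (1 / T) * real n"
 proof -
  have "real (card H) * (T * mb) \<le> (\<Sum>i\<in>H. mass i)"
   using sum_bounded_below[of H "T * mb" mass] by (auto simp: H_def)
  also have "\<dots> \<le> (\<Sum>i<n. mass i)" using H mass_pos by (intro sum_mono2) (auto simp: order_less_imp_le)
  finally have "(real (card H) * T) * mb \<le> real n * mb" by (simp add: sm mult_ac)
  then have "real (card H) * T \<le> real n" using mb by simp
  then show ?thesis using T(1) by (simp add: field_simps)
 qed
 define N2 where "N2 = (\<Sum>i<n. (mass i)\<^sup>2)"
 define low where "low = (\<Sum>i\<in>{..<n}-H. (mass i)\<^sup>2)"
 define mu where "mu p = (\<Sum>k\<in>bin H p. (mass k)\<^sup>2)" for p
 have mu0: "0 \<le> mu p" for p by (simp add: mu_def sum_nonneg)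
 have low: "low \<le> real n * (T * mb)\<^sup>2"
 proof -
  have "low \<le> (\<Sum>i\<in>{..<n}-H. (T * mb)\<^sup>2)"
   unfolding low_def using order_less_imp_le[OF mass_pos] by (intro sum_mono power_mono) (auto simp: H_def)
  also have "\<dots> \<le> (\<Sum>i<n. (T * mb)\<^sup>2)" by (intro sum_mono2) auto
  finally show ?thesis by simp
 qed
 define CI where "CI = key ` H"
 have fC: "finite CI" using fH by (simp add: CI_def)
 have rest: "(\<Sum>i\<in>{..<n} - (\<Union>p\<in>P. bin H p). (mass i)\<^sup>2) = low + (\<Sum>p\<in>CI - P. mu p)" if P: "P \<subseteq> CI" for P
 proof -
  define HP where "HP = {k\<in>H. key k \<in> CI - P}"
  have "{..<n} - (\<Union>p\<in>P. bin H p) = ({..<n} - H) \<union> HP" using H by (auto simp: HP_def bin_def CI_def)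
  then have "(\<Sum>i\<in>{..<n} - (\<Union>p\<in>P. bin H p). (mass i)\<^sup>2) = low + (\<Sum>i\<in>HP. (mass i)\<^sup>2)"
   unfolding low_def using fH by (subst sum.union_disjoint[symmetric]) (auto simp: HP_def)
  also have "(\<Sum>i\<in>HP. (mass i)\<^sup>2) = (\<Sum>p\<in>CI - P. \<Sum>i\<in>{i\<in>HP. key i = p}. (mass i)\<^sup>2)"
   using fH fC by (intro sum.group[symmetric]) (auto simp: HP_def)
  also have "\<dots> = (\<Sum>p\<in>CI - P. mu p)" unfolding mu_def
   by (intro sum.cong) (auto simp: HP_def bin_def)
  finally show ?thesis .
 qed
 have N2eq: "N2 = low + (\<Sum>p\<in>CI. mu p)" using rest[of "{}"] by (simp add: N2_def)
 define P1 where "P1 = {p\<in>CI. away p \<le> \<rho>}"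
 \<comment> \<open>The part of all squared masses that the bins beyond \<open>reach\<close> may carry.\<close>
 define \<epsilon> where "\<epsilon> = C * exp (- (1/8) * \<rho>) * (gapsum (1/8))\<^sup>2"
 have g8: "gapsum (1/8) > 0" by (rule gapsum_pos) simp
 have tail: "(\<Sum>p\<in>CI - P1. mu p) \<le> \<epsilon> * N2"
 proof -
  have "mu p \<le> C * exp (- (1/8) * \<rho>) * N2 * exp (- (1/8) * away p)" if p: "p \<in> CI - P1" for p
  proof -
   have "mu p \<le> C * exp (- (1/4) * away p) * N2" unfolding mu_def C_def N2_def
    by (rule bin_decay_single[OF H _ Cv ze cH T(3) sv w(1,2) T(2) w(3)]) (use p in \<open>simp add: CI_def\<close>)
   also have "exp (- (1/4) * away p) \<le> exp (- (1/8) * \<rho>) * exp (- (1/8) * away p)"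
    using p by (auto simp: P1_def simp flip: exp_add)
   finally show ?thesis using C by (simp add: N2_def sum_nonneg mult_left_mono mult_right_mono mult_ac)
  qed
  then have "(\<Sum>p\<in>CI - P1. mu p) \<le> (\<Sum>p\<in>CI - P1. C * exp (- (1/8) * \<rho>) * N2 * exp (- (1/8) * away p))"
   by (rule sum_mono)
  also have "\<dots> = C * exp (- (1/8) * \<rho>) * N2 * (\<Sum>p\<in>CI - P1. exp (- (1/8) * away p))" by (simp add: sum_distrib_left)
  also have "\<dots> \<le> C * exp (- (1/8) * \<rho>) * N2 * (gapsum (1/8))\<^sup>2"
   using fC C by (intro mult_left_mono sum_away_le) (auto simp: N2_def sum_nonneg)
  finally show ?thesis by (simp add: \<epsilon>_def mult_ac)
 qed
 have fP: "finite P1" using fC by (simp add: P1_def)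
 have cP: "real (card P1) \<le> (gapsum (1/8))\<^sup>2 * exp (1/8 * \<rho>)"
 proof -
  have "real (card P1) * exp (- (1/8) * \<rho>) \<le> (\<Sum>p\<in>P1. exp (- (1/8) * away p))"
   using sum_bounded_below[of P1 "exp (- (1/8) * \<rho>)" "\<lambda>p. exp (- (1/8) * away p)"] by (auto simp: P1_def)
  also have "\<dots> \<le> (gapsum (1/8))\<^sup>2" using fP by (intro sum_away_le) auto
  finally have "real (card P1) * exp (- (1/8) * \<rho>) * exp (1/8 * \<rho>) \<le> (gapsum (1/8))\<^sup>2 * exp (1/8 * \<rho>)"
   by (intro mult_right_mono) auto
  then show ?thesis by (simp add: mult.assoc flip: exp_add)
 qed
 define L where "L = low + \<epsilon> * N2"
 have e0: "\<epsilon> > 0" using C g8 by (simp add: \<epsilon>_def)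
 have L0: "0 \<le> L" using e0 by (simp add: L_def low_def N2_def sum_nonneg)
 \<comment> \<open>For a bin \<open>c\<close> remove all near bins which are not higher than \<open>c\<close>.\<close>
 have core: "L + (\<Sum>p\<in>P1. mu p) \<le> L * (\<Prod>p\<in>P1. 1 + C * exp (- (1/4) * away p))"
 proof (rule gronwall_finite[where y = "height H", OF fP])
  show "0 \<le> C * exp (- (1/4) * away c)" for c using C by simp
  fix c assume c: "c \<in> P1"
  define P where "P = {p\<in>P1. height H p \<le> height H c}"
  have P: "P \<subseteq> CI" "P \<subseteq> P1" by (auto simp: P_def P1_def)
  have "mu c \<le> C * exp (- (1/4) * away c) * (\<Sum>i\<in>{..<n} - (\<Union>p\<in>P. bin H p). (mass i)\<^sup>2)"
   unfolding mu_def C_def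
  proof (rule bin_decay_many[OF H _ _ Cv ze _ cH T(3) sv w(1,2) T(2), where d = \<rho>])
   have "CW * (12 * K5 * w * real (card P)) = CW * 12 * K5 * w * real (card P)" by simp
   also have "\<dots> \<le> CW * 12 * K5 * w * ((gapsum (1/8))\<^sup>2 * exp (1/8 * \<rho>))"
   proof (rule mult_left_mono)
    have "card P \<le> card P1" using P fP by (intro card_mono) auto
    then show "real (card P) \<le> (gapsum (1/8))\<^sup>2 * exp (1/8 * \<rho>)" using cP by linarith
   qed (use CW_pos K5_pos w in simp)
   also have "\<dots> \<le> exp (- (1/8) * \<rho>)"
    using width_props(4)[of \<zeta> Cv] unfolding w_def[symmetric] \<rho>_def[symmetric] by (simp add: mult_ac)
   finally show "CW * (12 * K5 * w * real (card P)) \<le> exp (- (1/8) * \<rho>)" .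
  qed (use c in \<open>auto simp: P_def P1_def CI_def\<close>)
  also have "(\<Sum>i\<in>{..<n} - (\<Union>p\<in>P. bin H p). (mass i)\<^sup>2) = low + (\<Sum>p\<in>CI - P. mu p)" by (rule rest[OF P(1)])
  also have "(\<Sum>p\<in>CI - P. mu p) = (\<Sum>p\<in>CI - P1. mu p) + (\<Sum>p\<in>{p\<in>P1. height H c < height H p}. mu p)"
  proof -
   have "CI - P = (CI - P1) \<union> {p\<in>P1. height H c < height H p}" by (auto simp: P_def P1_def)
   then show ?thesis using fC fP by (simp only:) (rule sum.union_disjoint, auto)
  qed
  finally have 1: "mu c \<le> C * exp (- (1/4) * away c) * (low + ((\<Sum>p\<in>CI - P1. mu p) + (\<Sum>p\<in>{p\<in>P1. height H c < height H p}. mu p)))" .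
  also have "\<dots> \<le> C * exp (- (1/4) * away c) * (L + (\<Sum>p\<in>{p\<in>P1. height H c < height H p}. mu p))"
   using tail C by (intro mult_left_mono) (auto simp: L_def)
  finally show "mu c \<le> C * exp (- (1/4) * away c) * (L + (\<Sum>p\<in>{p\<in>P1. height H c < height H p}. mu p))" .
 qed (use mu0 in auto)
 have "(\<Prod>p\<in>P1. 1 + C * exp (- (1/4) * away p)) \<le> (\<Prod>p\<in>P1. exp (C * exp (- (1/4) * away p)))"
  using C by (intro prod_mono) (auto intro: exp_ge_add_one_self)
 also have "\<dots> = exp (C * (\<Sum>p\<in>P1. exp (- (1/4) * away p)))" using fP by (simp add: exp_sum sum_distrib_left)
 also have "\<dots> \<le> exp W"
 proof -
  have "C * (\<Sum>p\<in>P1. exp (- (1/4) * away p)) \<le> C * (gapsum (1/4))\<^sup>2"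
   using fP C by (intro mult_left_mono sum_away_le) auto
  then show ?thesis by (simp add: W_def Wt_def C_def)
 qed
 finally have "L * (\<Prod>p\<in>P1. 1 + C * exp (- (1/4) * away p)) \<le> L * exp W" using L0 by (intro mult_left_mono)
 then have 2: "L + (\<Sum>p\<in>P1. mu p) \<le> L * exp W" using core by linarith
 have "(\<Sum>p\<in>CI. mu p) = (\<Sum>p\<in>CI - P1. mu p) + (\<Sum>p\<in>P1. mu p)"
  using fC by (intro sum.subset_diff) (auto simp: P1_def)
 then have "N2 \<le> L + (\<Sum>p\<in>P1. mu p)" using N2eq tail by (simp add: L_def)
 then have "N2 \<le> L * exp W" using 2 by linarith
 also have "\<dots> = low * exp W + N2 * (\<epsilon> * exp W)" by (simp add: L_def algebra_simps)
 also have "N2 * (\<epsilon> * exp W) \<le> N2 * (1/2)"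
 proof (rule mult_left_mono)
  define x where "x = 2 * C * (gapsum (1/8))\<^sup>2 * exp W"
  have x: "x > 0" using C g8 by (simp add: x_def)
  have "exp (- (1/8) * \<rho>) = 1 / (1 + x)" using x unfolding \<rho>_def reach_def C_def[symmetric] W_def[symmetric] x_def[symmetric]
   by (simp add: exp_minus inverse_eq_divide)
  then have "\<epsilon> * exp W = (x / 2) / (1 + x)" by (simp add: \<epsilon>_def x_def)
  also have "\<dots> \<le> 1/2" using x by (simp add: field_simps)
  finally show "\<epsilon> * exp W \<le> 1/2" .
 qed (simp add: N2_def sum_nonneg)
 finally have "N2 \<le> 2 * (low * exp W)" by linarith
 then have "N2 \<le> 2 * exp W * low" by (simp add: mult_ac)
 also have "\<dots> \<le> 2 * exp W * (real n * (T * mb)\<^sup>2)" using low by (intro mult_left_mono) auto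
 also have "\<dots> = Cbal \<zeta> Cv / real n * (\<Sum>i<n. mass i)\<^sup>2"
  unfolding sm Cbal_def using nn by (simp add: W_def T_def power2_eq_square)
 finally show ?thesis by (simp add: N2_def)
qed

end

section \<open>Solutions of the regularized and of the limiting equations\<close>

lemma ln_ratio_sign: "0 < x \<Longrightarrow> 0 < y \<Longrightarrow> 0 \<le> (x - y) * ln (x / y)" for x y :: real
 by (cases "x \<ge> y") (auto simp: ln_div intro: mult_nonneg_nonneg mult_nonpos_nonpos)

lemma ln_ratio_zero: "0 < x \<Longrightarrow> 0 < y \<Longrightarrow> (x - y) * ln (x / y) = 0 \<Longrightarrow> x = y" for x y :: real
 by (auto simp: ln_div)

text \<open>Finitely many bounded sequences converge along one common subsequence.\<close>
lemma finite_bolzano: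
 fixes f :: "nat \<Rightarrow> 'i \<Rightarrow> real"
 assumes "finite A" and "\<And>i k. i \<in> A \<Longrightarrow> \<bar>f k i\<bar> \<le> B"
 shows "\<exists>r. strict_mono r \<and> (\<forall>i\<in>A. \<exists>l. (\<lambda>k. f (r k) i) \<longlonglongrightarrow> l)"
 using assms
proof (induction A rule: finite_induct)
 case empty
 have "strict_mono (id :: nat \<Rightarrow> nat)" by (simp add: strict_mono_def)
 then show ?case by auto
next
 case (insert a A)
 then obtain r where r: "strict_mono r" "\<And>i. i \<in> A \<Longrightarrow> \<exists>l. (\<lambda>k. f (r k) i) \<longlonglongrightarrow> l" by auto
 have "bounded (range (\<lambda>k. f (r k) a))" using insert.prems by (intro boundedI[of _ B]) auto
 from bounded_imp_convergent_subsequence[OF this]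
 obtain g :: "nat \<Rightarrow> nat" and l where g: "strict_mono g" "(\<lambda>k. f (r (g k)) a) \<longlonglongrightarrow> l"
  by (auto simp: o_def)
 have "\<exists>l. (\<lambda>k. f (r (g k)) i) \<longlonglongrightarrow> l" if i: "i \<in> insert a A" for i
 proof (cases "i = a")
  case False
  then obtain l' where "(\<lambda>k. f (r k) i) \<longlonglongrightarrow> l'" using r(2)[of i] i by blast
  from LIMSEQ_subseq_LIMSEQ[OF this g(1)] show ?thesis by (auto simp: o_def)
 qed (use g in auto)
 moreover have "strict_mono (r \<circ> g)" using r g by (intro strict_mono_o)
 ultimately show ?case by (intro exI[of _ "r \<circ> g"]) (simp only: o_def simp_thms, blast)
qed

lemma LIMSEQ_subseq_criterion:
 fixes X :: "nat \<Rightarrow> real"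
 assumes X: "\<And>g. strict_mono g \<Longrightarrow> \<exists>r. strict_mono (r :: nat \<Rightarrow> nat) \<and> (\<lambda>k. X (g (r k))) \<longlonglongrightarrow> l"
 shows "X \<longlonglongrightarrow> l"
proof (rule ccontr)
 assume "\<not> X \<longlonglongrightarrow> l"
 then obtain e where e: "e > 0" "\<And>N. \<exists>k\<ge>N. \<not> dist (X k) l < e" unfolding lim_sequentially by blast
 then have "infinite {k. \<not> dist (X k) l < e}" unfolding infinite_nat_iff_unbounded_le by auto
 then obtain g :: "nat \<Rightarrow> nat" where g: "strict_mono g" "\<And>k. g k \<in> {k. \<not> dist (X k) l < e}"
  using infinite_enumerate by metis
 obtain r :: "nat \<Rightarrow> nat" where "strict_mono r" "(\<lambda>k. X (g (r k))) \<longlonglongrightarrow> l" using X[OF g(1)] by blast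
 then show False using e(1) g(2) unfolding lim_sequentially by (metis (mono_tags, lifting) le_refl mem_Collect_eq)
qed

text \<open>An irreducible nonnegative matrix with entries of order \<open>1/n\<close>.\<close>
locale profile =
 fixes n :: nat and V :: "nat \<Rightarrow> nat \<Rightarrow> real" and S :: real
 assumes n: "n > 0" and S: "S > 0" and V: "\<And>i j. i < n \<Longrightarrow> j < n \<Longrightarrow> 0 \<le> V i j \<and> V i j \<le> S / real n"
  and irr: "\<And>I. I \<noteq> {} \<Longrightarrow> I \<subset> {..<n} \<Longrightarrow> \<exists>i\<in>I. \<exists>j\<in>{..<n} - I. V i j > 0"
begin

lemma V0: "i < n \<Longrightarrow> j < n \<Longrightarrow> 0 \<le> V i j" and VS: "i < n \<Longrightarrow> j < n \<Longrightarrow> V i j \<le> S / real n"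
 using V by blast+

lemma dual_profile: "profile n (\<lambda>i j. V j i) S"
proof
 fix I :: "nat set" assume I: "I \<noteq> {}" "I \<subset> {..<n}"
 then have "{..<n} - I \<noteq> {}" "{..<n} - I \<subset> {..<n}" by auto
 from irr[OF this] obtain i j where "i \<in> {..<n} - I" "j \<in> {..<n} - ({..<n} - I)" "V i j > 0" by blast
 then show "\<exists>i\<in>I. \<exists>j\<in>{..<n} - I. 0 < V j i" by blast
qed (use n S V in auto)

text \<open>By irreducibility the zero set of a nonnegative vector cannot be closed under the edges unless it is everything or
 empty.\<close>
lemma irr_zero:
 assumes y: "\<And>i. i < n \<Longrightarrow> 0 \<le> y i" and z: "\<And>i. i < n \<Longrightarrow> y i = 0 \<Longrightarrow> (\<Sum>j<n. V i j * y j) \<le> 0"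
  and k: "k < n" "y k = 0" and i: "i < n"
 shows "y i = 0"
proof -
 define I where "I = {i. i < n \<and> y i = 0}"
 have "I = {..<n}"
 proof (rule ccontr)
  assume "I \<noteq> {..<n}"
  then have "I \<subset> {..<n}" "I \<noteq> {}" using k by (auto simp: I_def)
  then obtain a b where ab: "a \<in> I" "b \<in> {..<n} - I" "V a b > 0" using irr by blast
  then have "y b > 0" using y[of b] by (auto simp: I_def order_less_le)
  then have "0 < V a b * y b" using ab by simp
  also have "V a b * y b \<le> (\<Sum>j<n. V a j * y j)"
   using ab V0 y by (intro member_le_sum) (auto simp: I_def)
  finally show False using z[of a] ab by (auto simp: I_def)
 qed
 then show ?thesis using i by (auto simp: I_def)
qed

text \<open>Subtract the largest multiple of \<open>z\<close> below \<open>z'\<close> and look at a zero of the difference.\<close>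
lemma proportional:
 assumes "\<And>i. i < n \<Longrightarrow> 0 < z i" "\<And>i. i < n \<Longrightarrow> 0 < z' i"
  and "\<And>i. i < n \<Longrightarrow> \<theta> i * z i = (\<Sum>j<n. V i j * z j)" "\<And>i. i < n \<Longrightarrow> \<theta> i * z' i = (\<Sum>j<n. V i j * z' j)"
 obtains c where "c > 0" "\<And>i. i < n \<Longrightarrow> z' i = c * z i"
proof -
 define k where "k = arg_min_on (\<lambda>i. z' i / z i) {..<n}"
 have ne: "finite {..<n}" "{..<n} \<noteq> {}" using n by auto
 have k: "k < n" "\<And>i. i < n \<Longrightarrow> z' k / z k \<le> z' i / z i"
  using arg_min_if_finite[OF ne, of "\<lambda>i. z' i / z i"] by (auto simp: k_def not_less)
 define c where "c = z' k / z k"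
 have c: "c > 0" using assms k by (simp add: c_def)
 define y where "y i = z' i - c * z i" for i
 have "y i = 0" if "i < n" for i
 proof (rule irr_zero[OF _ _ k(1) _ that])
  show "0 \<le> y i" if "i < n" for i using k(2)[OF that] assms(1)[OF that] by (simp add: y_def c_def field_simps)
  show "y k = 0" using assms(1)[OF k(1)] by (simp add: y_def c_def)
  fix i assume i: "i < n" "y i = 0"
  have "(\<Sum>j<n. V i j * y j) = \<theta> i * z' i - c * (\<theta> i * z i)"
   using i assms(3,4) unfolding assms(3)[OF i(1)] assms(4)[OF i(1)] sum_distrib_left sum_subtractf[symmetric]
   by (intro sum.cong) (auto simp: y_def algebra_simps)
  also have "\<dots> = \<theta> i * y i" by (simp add: y_def algebra_simps)
  finally show "(\<Sum>j<n. V i j * y j) \<le> 0" using i by simp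
 qed
 then have "z' i = c * z i" if "i < n" for i using that by (simp add: y_def)
 with c show ?thesis by (rule that)
qed

text \<open>The master equations, regularized by \<open>t\<close>, in terms of the levels \<open>\<theta>\<close>. For \<open>t = 0\<close> they are invariant under
 multiplying \<open>q\<close> and dividing \<open>z\<close> by the same number.\<close>
definition sol :: "real \<Rightarrow> real \<Rightarrow> (nat \<Rightarrow> real) \<Rightarrow> (nat \<Rightarrow> real) \<Rightarrow> (nat \<Rightarrow> real) \<Rightarrow> bool" where
 "sol \<tau> t q z \<theta> \<longleftrightarrow> (\<forall>i<n. 0 < q i \<and> 0 < z i \<and> 0 < \<theta> i \<and> \<theta> i * q i = (\<Sum>j<n. V j i * q j) + t \<and>
   \<theta> i * z i = (\<Sum>j<n. V i j * z j) + t \<and> q i * z i * \<theta> i = 1 - \<tau> / \<theta> i)"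

lemma solD:
 assumes "sol \<tau> t q z \<theta>" "i < n"
 shows "0 < q i" "0 < z i" "0 < \<theta> i" "\<theta> i * q i = (\<Sum>j<n. V j i * q j) + t"
  "\<theta> i * z i = (\<Sum>j<n. V i j * z j) + t" "q i * z i * \<theta> i = 1 - \<tau> / \<theta> i"
  "0 < 1 - \<tau> / \<theta> i" "\<tau> < \<theta> i"
proof -
 show *: "0 < q i" "0 < z i" "0 < \<theta> i" "\<theta> i * q i = (\<Sum>j<n. V j i * q j) + t"
  "\<theta> i * z i = (\<Sum>j<n. V i j * z j) + t" "q i * z i * \<theta> i = 1 - \<tau> / \<theta> i" using assms by (auto simp: sol_def)
 show "0 < 1 - \<tau> / \<theta> i" using * by (metis mult_pos_pos)
 then show "\<tau> < \<theta> i" using *(3) by (simp add: field_simps)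
qed

lemma sol_star:
 assumes s: "sol \<tau> t q z \<theta>" and t: "0 \<le> t"
  and Z: "\<And>j. j < n \<Longrightarrow> 0 < Z j" "\<And>i. i < n \<Longrightarrow> 0 < \<theta>' i" "\<And>i. i < n \<Longrightarrow> \<theta>' i * Z i = (\<Sum>j<n. V i j * Z j) + t'"
  and t': "t' > 0 \<or> t' = 0 \<and> t = 0"
 shows "t * (\<Sum>i<n. q i * ln (t' / t)) - t * (\<Sum>j<n. z j * ln (Z j / z j)) \<le> (\<Sum>i<n. (1 - \<tau> / \<theta> i) * ln (\<theta>' i / \<theta> i))"
proof -
 have "(\<Sum>i<n. q i * t * ln (t' / t)) - (\<Sum>j<n. z j * t * ln (Z j / z j))
      \<le> (\<Sum>i<n. q i * z i * \<theta> i * ln (\<theta>' i / \<theta> i))"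
 proof (rule circulation_entropy)
  show "t' > 0 \<or> (t' = 0 \<and> (\<forall>i<n. 0 < q i \<longrightarrow> t = 0))" using t' by auto
 qed (use solD[OF s] V0 t Z in \<open>auto simp: mult.commute less_imp_le\<close>)
 moreover have "(\<Sum>i<n. q i * z i * \<theta> i * ln (\<theta>' i / \<theta> i)) = (\<Sum>i<n. (1 - \<tau> / \<theta> i) * ln (\<theta>' i / \<theta> i))"
  by (intro sum.cong) (use solD(6)[OF s] in auto)
 ultimately show ?thesis by (simp add: sum_distrib_left mult_ac)
qed

text \<open>For \<open>t > 0\<close> the equality of the sums follows from the equations, by pairing each of them with the other vector; for
 \<open>t = 0\<close> it is the normalization that breaks the invariance.\<close>
lemma sol_sum: assumes s: "sol \<tau> t q z \<theta>" and t: "t > 0" shows "(\<Sum>i<n. q i) = (\<Sum>i<n. z i)"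
proof -
 have "(\<Sum>i<n. \<theta> i * q i * z i) = (\<Sum>i<n. (\<Sum>j<n. V j i * q j) * z i) + t * (\<Sum>i<n. z i)"
  using solD(4)[OF s] by (simp add: sum.distrib distrib_right sum_distrib_left)
 also have "(\<Sum>i<n. (\<Sum>j<n. V j i * q j) * z i) = (\<Sum>i<n. (\<Sum>j<n. V i j * z j) * q i)"
  unfolding sum_distrib_right by (subst sum.swap) (simp add: mult_ac)
 finally have 1: "(\<Sum>i<n. \<theta> i * q i * z i) = (\<Sum>i<n. (\<Sum>j<n. V i j * z j) * q i) + t * (\<Sum>i<n. z i)" .
 have "(\<Sum>i<n. \<theta> i * z i * q i) = (\<Sum>i<n. (\<Sum>j<n. V i j * z j) * q i) + t * (\<Sum>i<n. q i)"
  using solD(5)[OF s] by (simp add: sum.distrib distrib_right sum_distrib_left)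
 moreover have "(\<Sum>i<n. \<theta> i * z i * q i) = (\<Sum>i<n. \<theta> i * q i * z i)" by (simp add: mult_ac)
 ultimately have "t * (\<Sum>i<n. q i) = t * (\<Sum>i<n. z i)" using 1 by linarith
 then show ?thesis using t by simp
qed

text \<open>Adding the entropy inequalities of each solution against the other gives a sum of terms \<open>(x - y) * ln (x / y)\<close> that is
 at most zero, so all of them vanish.\<close>
lemma sol_compare:
 assumes s: "sol \<tau> t q z \<theta>" "sol \<tau> t q' z' \<theta>'" and t: "0 \<le> t" and tau: "\<tau> > 0" and i: "i < n"
 shows "\<theta> i = \<theta>' i \<and> (t > 0 \<longrightarrow> z i = z' i)"
proof -
 note D = solD[OF s(1)] and D' = solD[OF s(2)]
 have A: "t * (\<Sum>i<n. q i * ln (t / t)) - t * (\<Sum>j<n. z j * ln (z' j / z j)) \<le> (\<Sum>i<n. (1 - \<tau> / \<theta> i) * ln (\<theta>' i / \<theta> i))"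
  by (rule sol_star[OF s(1) t]) (use D' t in auto)
 have B: "t * (\<Sum>i<n. q' i * ln (t / t)) - t * (\<Sum>j<n. z' j * ln (z j / z' j)) \<le> (\<Sum>i<n. (1 - \<tau> / \<theta>' i) * ln (\<theta> i / \<theta>' i))"
  by (rule sol_star[OF s(2) t]) (use D t in auto)
 have tt: "ln (t / t) = 0" by (cases "t = 0") auto
 define u v where "u j = t * ((z' j - z j) * ln (z' j / z j))" and "v j = \<tau> / (\<theta> j * \<theta>' j) * ((\<theta>' j - \<theta> j) * ln (\<theta>' j / \<theta> j))" for j
 have u0: "0 \<le> u j" if "j < n" for j unfolding u_def using t ln_ratio_sign[OF D'(2)[OF that] D(2)[OF that]] by (rule mult_nonneg_nonneg)
 have v0: "0 \<le> v j" if "j < n" for j unfolding v_def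
  using tau ln_ratio_sign[OF D'(3)[OF that] D(3)[OF that]] D(3)[OF that] D'(3)[OF that] by (intro mult_nonneg_nonneg[OF divide_nonneg_pos]) auto
 have "(\<Sum>j<n. u j) = - t * (\<Sum>j<n. z j * ln (z' j / z j)) - t * (\<Sum>j<n. z' j * ln (z j / z' j))"
  using D(2) D'(2) unfolding u_def sum_distrib_left sum_subtractf[symmetric]
  by (intro sum.cong) (auto simp: ln_div algebra_simps)
 moreover have "(\<Sum>j<n. v j) = - (\<Sum>i<n. (1 - \<tau> / \<theta> i) * ln (\<theta>' i / \<theta> i)) - (\<Sum>i<n. (1 - \<tau> / \<theta>' i) * ln (\<theta> i / \<theta>' i))"
  unfolding sum_negf[symmetric] sum_subtractf[symmetric]
 proof (rule sum.cong[OF refl])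
  fix j assume "j \<in> {..<n}" then have j: "0 < \<theta> j" "0 < \<theta>' j" using D(3) D'(3) by auto
  have "\<tau> / (\<theta> j * \<theta>' j) * (\<theta>' j - \<theta> j) = \<tau> / \<theta> j - \<tau> / \<theta>' j" using j by (simp add: field_simps)
  then have "v j = (\<tau> / \<theta> j - \<tau> / \<theta>' j) * ln (\<theta>' j / \<theta> j)" unfolding v_def by (metis mult.assoc)
  then show "v j = - ((1 - \<tau> / \<theta> j) * ln (\<theta>' j / \<theta> j)) - (1 - \<tau> / \<theta>' j) * ln (\<theta> j / \<theta>' j)"
   using j by (simp add: ln_div algebra_simps)
 qed
 ultimately have "(\<Sum>j<n. u j) + (\<Sum>j<n. v j) \<le> 0" using A B tt by simp
 moreover have "0 \<le> (\<Sum>j<n. u j)" "0 \<le> (\<Sum>j<n. v j)" using u0 v0 by (auto intro!: sum_nonneg)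
 ultimately have "(\<Sum>j<n. u j) = 0" "(\<Sum>j<n. v j) = 0" by linarith+
 then have "u i = 0" "v i = 0"
  using sum_nonneg_eq_0_iff[of "{..<n}" u] sum_nonneg_eq_0_iff[of "{..<n}" v] u0 v0 i by auto
 then show ?thesis
  using ln_ratio_zero[OF D'(3) D(3), OF i i] ln_ratio_zero[OF D'(2) D(2), OF i i] tau D(3)[OF i] D'(3)[OF i]
  by (auto simp: u_def v_def)
qed

lemma sol_unique:
 assumes s: "sol \<tau> t q z \<theta>" "sol \<tau> t q' z' \<theta>'" and t: "0 < t" and tau: "\<tau> > 0" and i: "i < n"
 shows "q i = q' i \<and> z i = z' i \<and> \<theta> i = \<theta>' i"
proof -
 have e: "\<theta> i = \<theta>' i" "z i = z' i" using sol_compare[OF s _ tau i] t by auto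
 then have "q i * (z i * \<theta> i) = q' i * (z i * \<theta> i)" using solD(6)[OF s(1) i] solD(6)[OF s(2) i] by (simp add: mult.assoc)
 then show ?thesis using e solD(2,3)[OF s(1) i] by simp
qed

lemma sol_unique0:
 assumes s: "sol \<tau> 0 q z \<theta>" "sol \<tau> 0 q' z' \<theta>'" and tau: "\<tau> > 0"
  and su: "(\<Sum>i<n. q i) = (\<Sum>i<n. z i)" "(\<Sum>i<n. q' i) = (\<Sum>i<n. z' i)" and i: "i < n"
 shows "q i = q' i \<and> z i = z' i \<and> \<theta> i = \<theta>' i"
proof -
 interpret dual: profile n "\<lambda>i j. V j i" S by (rule dual_profile)
 note D = solD[OF s(1)] and D' = solD[OF s(2)]
 have th: "\<theta> i = \<theta>' i" if "i < n" for i using sol_compare[OF s _ tau that] by auto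
 obtain c where c: "c > 0" "\<And>i. i < n \<Longrightarrow> z' i = c * z i"
  by (rule proportional[of z z' \<theta>]) (use D D' th in auto)
 obtain d where d: "d > 0" "\<And>i. i < n \<Longrightarrow> q' i = d * q i"
  by (rule dual.proportional[of q q' \<theta>]) (use D D' th in auto)
 have "(\<Sum>i<n. q i) > 0" using n D(1) by (intro sum_pos) auto
 moreover have "d * (\<Sum>i<n. q i) = c * (\<Sum>i<n. z i)" using su(2) c(2) d(2) unfolding sum_distrib_left by simp
 ultimately have "c = d" using su by simp
 have "q' i * z' i * \<theta>' i = q i * z i * \<theta> i" using D(6)[OF i] D'(6)[OF i] th[OF i] by simp
 then have "(c * d) * (q i * z i * \<theta> i) = 1 * (q i * z i * \<theta> i)" using c(2)[OF i] d(2)[OF i] th[OF i] by (simp add: mult_ac)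
 moreover have "q i * z i * \<theta> i \<noteq> 0" using D(1,2,3)[OF i] by auto
 ultimately have "c * d = 1" by (simp only: mult_cancel_right) blast
 then have "c\<^sup>2 = 1" using \<open>c = d\<close> by (simp add: power2_eq_square)
 then have "c = 1" using c(1) by (simp add: power2_eq_1_iff)
 then show ?thesis using c d \<open>c = d\<close> i th by simp
qed

text \<open>The right hand sides increase in one vector and decrease in the other. So the iteration from the extreme
 pair \<open>q = 0\<close>, \<open>z = 1/t\<close> is monotone in both components.\<close>
lemma sol_exists:
 assumes tau: "\<tau> > 0" and t: "t > 0"
 shows "\<exists>q z \<theta>. sol \<tau> t q z \<theta>"
proof -
 define a b where "a q i = (\<Sum>j<n. V j i * q j) + t" and "b z i = (\<Sum>j<n. V i j * z j) + t" for q z :: "nat \<Rightarrow> real" and i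
 define g where "g x y = x / (\<tau> + x * y)" for x y
 \<comment> \<open>The iteration map; with \<open>x = V^T q + t\<close> and \<open>y = V z + t\<close> it is \<open>x / (\<tau> + x * y)\<close> and its mirror image.\<close>
 define G where "G p = (\<lambda>i. g (a (fst p) i) (b (snd p) i), \<lambda>i. g (b (snd p) i) (a (fst p) i))" for p
 define P where "P k = (G ^^ k) (\<lambda>_. 0, \<lambda>_. 1 / t)" for k
 define Q Y where "Q k = fst (P k)" and "Y k = snd (P k)" for k
 have Q0: "Q 0 = (\<lambda>_. 0)" "Y 0 = (\<lambda>_. 1 / t)" by (simp_all add: Q_def Y_def P_def)
 have QS: "Q (Suc k) i = g (a (Q k) i) (b (Y k) i)" "Y (Suc k) i = g (b (Y k) i) (a (Q k) i)" for k i
  by (simp_all add: Q_def Y_def P_def G_def)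
 have g0: "0 \<le> g x y" if "0 \<le> x" "0 \<le> y" for x y using that tau by (simp add: g_def)
 have gt: "g x y \<le> 1 / t" if "0 \<le> x" "t \<le> y" for x y
 proof -
  have "x * t \<le> x * y" using that by (intro mult_left_mono) auto
  then have "x * t \<le> \<tau> + x * y" "0 < \<tau> + x * y" using tau that t by (auto intro!: add_pos_nonneg mult_nonneg_nonneg)
  then show ?thesis using t by (simp add: g_def divide_le_eq le_divide_eq mult.commute)
 qed
 have gm: "g x y \<le> g x' y'" if "0 \<le> x" "x \<le> x'" "y' \<le> y" "0 \<le> y'" for x y x' y'
 proof -
  have "x * \<tau> \<le> x' * \<tau>" using that tau by (intro mult_right_mono) auto
  moreover have "(x * x') * y' \<le> (x * x') * y" using that by (intro mult_left_mono) auto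
  ultimately have "x * (\<tau> + x' * y') \<le> x' * (\<tau> + x * y)" by (simp add: algebra_simps)
  moreover have "\<tau> + x' * y' > 0" "\<tau> + x * y > 0" using that tau by (auto intro!: add_pos_nonneg mult_nonneg_nonneg)
  ultimately show ?thesis unfolding g_def by (simp add: divide_le_eq le_divide_eq mult.commute)
 qed
 have a0: "t \<le> a q i" if "\<And>j. j < n \<Longrightarrow> 0 \<le> q j" "i < n" for q i
  unfolding a_def using that V0 by (auto intro!: sum_nonneg mult_nonneg_nonneg)
 have b0: "t \<le> b q i" if "\<And>j. j < n \<Longrightarrow> 0 \<le> q j" "i < n" for q i
  unfolding b_def using that V0 by (auto intro!: sum_nonneg mult_nonneg_nonneg)
 have am: "a q i \<le> a q' i" if "\<And>j. j < n \<Longrightarrow> q j \<le> q' j" "i < n" for q q' i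
  unfolding a_def using that V0 by (auto intro!: sum_mono mult_left_mono)
 have bm: "b q i \<le> b q' i" if "\<And>j. j < n \<Longrightarrow> q j \<le> q' j" "i < n" for q q' i
  unfolding b_def using that V0 by (auto intro!: sum_mono mult_left_mono)
 have bd: "\<forall>i<n. 0 \<le> Q k i \<and> Q k i \<le> 1 / t \<and> 0 \<le> Y k i \<and> Y k i \<le> 1 / t" for k
 proof (induction k)
  case 0 then show ?case using t by (simp add: Q0)
 next
  case (Suc k)
  show ?case
  proof (intro allI impI)
   fix i assume i: "i < n"
   have "t \<le> a (Q k) i" "t \<le> b (Y k) i" using a0[of "Q k" i] b0[of "Y k" i] Suc i by auto
   then show "0 \<le> Q (Suc k) i \<and> Q (Suc k) i \<le> 1 / t \<and> 0 \<le> Y (Suc k) i \<and> Y (Suc k) i \<le> 1 / t"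
    unfolding QS using g0 gt t by auto
  qed
 qed
 have mono: "\<forall>i<n. Q k i \<le> Q (Suc k) i \<and> Y (Suc k) i \<le> Y k i" for k
 proof (induction k)
  case 0 then show ?case using bd[of "Suc 0"] by (simp add: Q0)
 next
  case (Suc k)
  show ?case
  proof (intro allI impI)
   fix i assume i: "i < n"
   have "a (Q k) i \<le> a (Q (Suc k)) i" "b (Y (Suc k)) i \<le> b (Y k) i" using am bm Suc i by auto
   moreover have "t \<le> a (Q k) i" "t \<le> b (Y (Suc k)) i" "t \<le> a (Q (Suc k)) i" "t \<le> b (Y k) i" using a0 b0 bd i by auto
   ultimately show "Q (Suc k) i \<le> Q (Suc (Suc k)) i \<and> Y (Suc (Suc k)) i \<le> Y (Suc k) i"
    unfolding QS(1)[of "Suc k"] QS(2)[of "Suc k"] QS(1)[of k] QS(2)[of k] using gm t by auto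
  qed
 qed
 have "\<exists>l. (\<lambda>k. Q k i) \<longlonglongrightarrow> l" if "i < n" for i
 proof -
  have "incseq (\<lambda>k. Q k i)" using mono that by (intro incseq_SucI) auto
  then show ?thesis using incseq_convergent[of "\<lambda>k. Q k i" "1 / t"] bd that by metis
 qed
 then obtain q where q: "\<And>i. i < n \<Longrightarrow> (\<lambda>k. Q k i) \<longlonglongrightarrow> q i" by metis
 have "\<exists>l. (\<lambda>k. Y k i) \<longlonglongrightarrow> l" if "i < n" for i
 proof -
  have "decseq (\<lambda>k. Y k i)" using mono that by (intro decseq_SucI) auto
  then show ?thesis using decseq_convergent[of "\<lambda>k. Y k i" 0] bd that by metis
 qed
 then obtain z where z: "\<And>i. i < n \<Longrightarrow> (\<lambda>k. Y k i) \<longlonglongrightarrow> z i" by metis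
 have q0: "0 \<le> q i" if "i < n" for i by (rule LIMSEQ_le_const[OF q[OF that]]) (use bd that in auto)
 have z0: "0 \<le> z i" if "i < n" for i by (rule LIMSEQ_le_const[OF z[OF that]]) (use bd that in auto)
 have la: "(\<lambda>k. a (Q k) i) \<longlonglongrightarrow> a q i" "(\<lambda>k. b (Y k) i) \<longlonglongrightarrow> b z i" if "i < n" for i
  unfolding a_def b_def using q z by (auto intro!: tendsto_intros)
 have ab: "t \<le> a q i" "t \<le> b z i" "\<tau> + a q i * b z i > 0" if "i < n" for i
 proof -
  show "t \<le> a q i" "t \<le> b z i" using a0 b0 q0 z0 that by auto
  then show "\<tau> + a q i * b z i > 0" using tau t by (intro add_pos_nonneg mult_nonneg_nonneg) auto
 qed
 have fix1: "q i = g (a q i) (b z i)" if i: "i < n" for i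
 proof -
  have "(\<lambda>k. g (a (Q k) i) (b (Y k) i)) \<longlonglongrightarrow> g (a q i) (b z i)"
   unfolding g_def using la[OF i] ab[OF i] by (intro tendsto_intros) auto
  then have "(\<lambda>k. Q (Suc k) i) \<longlonglongrightarrow> g (a q i) (b z i)" by (simp add: QS)
  moreover have "(\<lambda>k. Q (Suc k) i) \<longlonglongrightarrow> q i" using q[OF i] by (rule LIMSEQ_Suc)
  ultimately show ?thesis using LIMSEQ_unique by blast
 qed
 have fix2: "z i = g (b z i) (a q i)" if i: "i < n" for i
 proof -
  have "(\<lambda>k. g (b (Y k) i) (a (Q k) i)) \<longlonglongrightarrow> g (b z i) (a q i)"
   unfolding g_def using la[OF i] ab[OF i] by (intro tendsto_intros) (auto simp: mult.commute)
  then have "(\<lambda>k. Y (Suc k) i) \<longlonglongrightarrow> g (b z i) (a q i)" by (simp add: QS)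
  moreover have "(\<lambda>k. Y (Suc k) i) \<longlonglongrightarrow> z i" using z[OF i] by (rule LIMSEQ_Suc)
  ultimately show ?thesis using LIMSEQ_unique by blast
 qed
 define \<theta> where "\<theta> i = \<tau> + a q i * b z i" for i
 have "sol \<tau> t q z \<theta>" unfolding sol_def
 proof (intro allI impI)
  fix i assume i: "i < n"
  have pa: "a q i > 0" "b z i > 0" "\<theta> i > 0" using ab[OF i] t by (auto simp: \<theta>_def)
  have e: "q i = a q i / \<theta> i" "z i = b z i / \<theta> i" using fix1[OF i] fix2[OF i] by (simp_all add: g_def \<theta>_def mult.commute)
  have "q i * z i * \<theta> i = a q i * b z i / \<theta> i" using e pa by simp
  also have "\<dots> = 1 - \<tau> / \<theta> i" using pa by (simp add: \<theta>_def field_simps)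
  finally have "q i * z i * \<theta> i = 1 - \<tau> / \<theta> i" .
  moreover have "0 < q i" "0 < z i" using e pa by (metis divide_pos_pos)+
  moreover have "\<theta> i * q i = a q i" "\<theta> i * z i = b z i" using e pa by auto
  ultimately show "0 < q i \<and> 0 < z i \<and> 0 < \<theta> i \<and> \<theta> i * q i = (\<Sum>j<n. V j i * q j) + t \<and>
   \<theta> i * z i = (\<Sum>j<n. V i j * z j) + t \<and> q i * z i * \<theta> i = 1 - \<tau> / \<theta> i" using pa by (simp add: a_def b_def)
 qed
 then show ?thesis by blast
qed

text \<open>The test vector is constant; its levels are the row sums of \<open>V\<close>.\<close>
lemma theta_sum:
 assumes s: "sol \<tau> t q z \<theta>" and t: "0 \<le> t"
 shows "(\<Sum>i<n. (1 - \<tau> / \<theta> i) * ln (\<theta> i)) \<le> (\<Sum>i<n. 1 - \<tau> / \<theta> i) * ln (S + t) + real n * t"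
proof -
 note D = solD[OF s]
 define \<theta>' where "\<theta>' i = (\<Sum>j<n. V i j) + t" for i
 have p: "\<theta>' i > 0" if i: "i < n" for i
 proof (rule ccontr)
  assume "\<not> \<theta>' i > 0"
  moreover have r: "0 \<le> (\<Sum>j<n. V i j)" using V0 i by (intro sum_nonneg) auto
  ultimately have "(\<Sum>j<n. V i j) = 0" "t = 0" using t by (auto simp: \<theta>'_def)
  then have "\<forall>j<n. V i j = 0" using V0 i by (subst (asm) sum_nonneg_eq_0_iff) auto
  then have "\<theta> i * z i = 0" using D(5)[OF i] \<open>t = 0\<close> by simp
  then show False using D(2,3)[OF i] by simp
 qed
 have up: "\<theta>' i \<le> S + t" if i: "i < n" for i
 proof -
  have "(\<Sum>j<n. V i j) \<le> (\<Sum>j<n. S / real n)" using VS i by (intro sum_mono) auto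
  then show ?thesis using n by (simp add: \<theta>'_def)
 qed
 have "t * (\<Sum>i<n. q i * ln (t / t)) - t * (\<Sum>j<n. z j * ln (1 / z j)) \<le> (\<Sum>i<n. (1 - \<tau> / \<theta> i) * ln (\<theta>' i / \<theta> i))"
  by (rule sol_star[OF s t]) (use p t in \<open>auto simp: \<theta>'_def\<close>)
 moreover have "ln (t / t) = 0" by (cases "t = 0") auto
 moreover have "(\<Sum>j<n. z j * ln (1 / z j)) \<le> (\<Sum>j<n. 1)"
 proof (intro sum_mono)
  fix j assume "j \<in> {..<n}" then have zj: "z j > 0" using D(2) by auto
  have "z j * ln (1 / z j) \<le> z j * (1 / z j - 1)" using zj by (intro mult_left_mono ln_le_minus_one) auto
  also have "\<dots> \<le> 1" using zj by (simp add: field_simps)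
  finally show "z j * ln (1 / z j) \<le> 1" .
 qed
 then have "t * (\<Sum>j<n. z j * ln (1 / z j)) \<le> t * real n" using t by (intro mult_left_mono) auto
 moreover have "(\<Sum>i<n. (1 - \<tau> / \<theta> i) * ln (\<theta>' i / \<theta> i)) = (\<Sum>i<n. (1 - \<tau> / \<theta> i) * ln (\<theta>' i)) - (\<Sum>i<n. (1 - \<tau> / \<theta> i) * ln (\<theta> i))"
  unfolding sum_subtractf[symmetric] right_diff_distrib[symmetric] using D(3) p by (intro sum.cong) (auto simp: ln_divide_pos)
 moreover have "(\<Sum>i<n. (1 - \<tau> / \<theta> i) * ln (\<theta>' i)) \<le> (\<Sum>i<n. (1 - \<tau> / \<theta> i) * ln (S + t))"
  using up p D(7) by (intro sum_mono mult_left_mono ln_mono) (auto simp: less_imp_le)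
 moreover have "(\<Sum>i<n. (1 - \<tau> / \<theta> i) * ln (S + t)) = (\<Sum>i<n. 1 - \<tau> / \<theta> i) * ln (S + t)"
  by (simp only: sum_distrib_right)
 moreover have "t * (\<Sum>i<n. q i * ln (t / t)) = 0" using \<open>ln (t / t) = 0\<close> by simp
 ultimately show ?thesis by (simp only: mult.commute[of t "real n"])
qed

text \<open>A crude bound that grows with \<open>n\<close>, sufficient for compactness at fixed \<open>n\<close>.\<close>
lemma theta_bound:
 assumes s: "sol \<tau> t q z \<theta>" and t: "0 \<le> t" "t \<le> 1" and tau: "\<tau> > 0" "\<bar>ln \<tau>\<bar> \<le> L" and i: "i < n"
 shows "\<theta> i \<le> 2 * exp L + exp (2 * (real n * (\<bar>ln (S + 1)\<bar> + 1 + L)))"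
proof (cases "\<theta> i \<le> 2 * \<tau> \<or> \<theta> i \<le> 1")
 case True
 have "\<tau> = exp (ln \<tau>)" using tau by simp
 also have "\<dots> \<le> exp L" using tau(2) by (subst exp_le_cancel_iff) linarith
 finally have "\<tau> \<le> exp L" .
 moreover have "1 \<le> exp L" using tau(2) by (simp add: order_trans[OF abs_ge_zero tau(2)])
 moreover have "0 \<le> exp (2 * (real n * (\<bar>ln (S + 1)\<bar> + 1 + L)))" by simp
 ultimately show ?thesis using True by linarith
next
 case False
 note D = solD[OF s]
 have L0: "0 \<le> L" using tau(2) by linarith
 define B where "B = real n * (\<bar>ln (S + 1)\<bar> + 1 + L)"
 define m where "m j = 1 - \<tau> / \<theta> j" for j
 have m: "0 < m j" "m j \<le> 1" if "j < n" for j using D(3,7)[OF that] tau by (auto simp: m_def)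
 have "(\<Sum>j<n. m j) * ln (S + t) \<le> real n * \<bar>ln (S + 1)\<bar>"
 proof -
  have "ln (S + t) \<le> \<bar>ln (S + 1)\<bar>" using S t by (smt (verit) ln_mono)
  then have "(\<Sum>j<n. m j) * ln (S + t) \<le> (\<Sum>j<n. m j) * \<bar>ln (S + 1)\<bar>"
   using m by (intro mult_left_mono sum_nonneg) (auto simp: less_imp_le)
  also have "\<dots> \<le> real n * \<bar>ln (S + 1)\<bar>"
   using m sum_bounded_above[of "{..<n}" m 1] by (intro mult_right_mono) auto
  finally show ?thesis .
 qed
 then have 1: "(\<Sum>j<n. m j * ln (\<theta> j)) \<le> real n * (\<bar>ln (S + 1)\<bar> + 1)"
  using theta_sum[OF s t(1)] mult_left_mono[OF t(2), of "real n"] unfolding m_def by (simp add: distrib_left)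
 have low: "- L \<le> m j * ln (\<theta> j)" if j: "j < n" for j
 proof (cases "ln (\<theta> j) \<ge> 0")
  case True then have "0 \<le> m j * ln (\<theta> j)" using m[OF j] by simp
  then show ?thesis using L0 by linarith
 next
  case False
  then have "1 * ln (\<theta> j) \<le> m j * ln (\<theta> j)" using m[OF j] by (intro mult_right_mono_neg) auto
  moreover have "ln \<tau> \<le> ln (\<theta> j)" using D(8)[OF j] tau by (intro ln_mono) auto
  ultimately show ?thesis using tau(2) by linarith
 qed
 have "(\<Sum>j<n. m j * ln (\<theta> j)) = m i * ln (\<theta> i) + (\<Sum>j\<in>{..<n} - {i}. m j * ln (\<theta> j))"
  using i by (intro sum.remove) auto
 moreover have "(\<Sum>j\<in>{..<n} - {i}. - L) \<le> (\<Sum>j\<in>{..<n} - {i}. m j * ln (\<theta> j))" using low by (intro sum_mono) auto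
 moreover have "(\<Sum>j\<in>{..<n} - {i}. - L) \<ge> - (real n * L)"
  using i L0 mult_right_mono[of "real (n - 1)" "real n" L] by simp
 ultimately have "m i * ln (\<theta> i) \<le> B" using 1 by (simp add: B_def distrib_left)
 moreover have "1/2 * ln (\<theta> i) \<le> m i * ln (\<theta> i)"
 proof (rule mult_right_mono)
  show "1/2 \<le> m i" using False D(3)[OF i] tau by (simp add: m_def field_simps)
  show "0 \<le> ln (\<theta> i)" using False by simp
 qed
 ultimately have "ln (\<theta> i) \<le> 2 * B" by linarith
 then have "\<theta> i \<le> exp (2 * B)" using D(3)[OF i] by (metis exp_le_cancel_iff exp_ln)
 moreover have "0 \<le> 2 * exp L" by simp
 ultimately show ?thesis unfolding B_def by linarith
qed

text \<open>Below the spectral radius no positive vector is a subsolution at level \<open>\<tau>\<close> (Collatz and Wielandt). In this form the condition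
 excludes that solutions shrink to zero.\<close>
definition supercritical :: "real \<Rightarrow> bool" where
 "supercritical \<tau> \<longleftrightarrow> \<tau> > 0 \<and> (\<forall>u. (\<forall>i<n. 0 < u i) \<longrightarrow> (\<exists>i<n. \<tau> * u i < (\<Sum>j<n. V i j * u j)))"

text \<open>Normalized by their sum, the vectors converge along a subsequence, and by irreducibility the limits are positive. The
 third equation determines the limit of the square of the sums. If it were zero, all levels would be \<open>\<tau>\<close>, contrary to
 supercriticality.\<close>
lemma sol_compact:
 assumes sc: "supercritical \<tau>" and lt: "\<tau>k \<longlonglongrightarrow> \<tau>" "tk \<longlonglongrightarrow> 0" and tk: "\<And>k. 0 \<le> tk k" "\<And>k. tk k \<le> 1"
  and s: "\<And>k. sol (\<tau>k k) (tk k) (q k) (z k) (\<theta> k)" and su: "\<And>k. (\<Sum>i<n. q k i) = (\<Sum>i<n. z k i)"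
  and pk: "\<And>k. \<tau>k k > 0"
 shows "\<exists>r qs zs ths. strict_mono r \<and> sol \<tau> 0 qs zs ths \<and> (\<Sum>i<n. qs i) = (\<Sum>i<n. zs i) \<and>
  (\<forall>i<n. (\<lambda>k. q (r k) i) \<longlonglongrightarrow> qs i \<and> (\<lambda>k. z (r k) i) \<longlonglongrightarrow> zs i \<and> (\<lambda>k. \<theta> (r k) i) \<longlonglongrightarrow> ths i)"
proof -
 interpret dual: profile n "\<lambda>i j. V j i" S by (rule dual_profile)
 have tau: "\<tau> > 0" using sc by (simp add: supercritical_def)
 note D = solD[OF s]
 have Dq: "0 \<le> q k i" and Dz: "0 \<le> z k i" and Dth: "0 \<le> \<theta> k i" if "i < n" for k i
  using D(1,2,3)[OF that, of k] by linarith+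
 have "(\<lambda>k. ln (\<tau>k k)) \<longlonglongrightarrow> ln \<tau>" using lt(1) tau by (intro tendsto_intros) auto
 then have "Bseq (\<lambda>k. ln (\<tau>k k))" by (intro convergent_imp_Bseq convergentI)
 then obtain L where L: "\<And>k. \<bar>ln (\<tau>k k)\<bar> \<le> L" by (metis BseqE real_norm_def)
 define \<Theta> where "\<Theta> = 2 * exp L + exp (2 * (real n * (\<bar>ln (S + 1)\<bar> + 1 + L)))"
 have Th: "\<theta> k i \<le> \<Theta>" if "i < n" for k i
  unfolding \<Theta>_def by (rule theta_bound[OF s tk pk L that])
 have Th0: "\<Theta> \<ge> 0" by (simp add: \<Theta>_def)
 define N where "N k = (\<Sum>i<n. q k i)" for k
 have N: "N k > 0" for k unfolding N_def using n D(1) by (intro sum_pos) auto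
 define f where "f k p = (if fst p = (0::nat) then q k (snd p) / N k else if fst p = 1 then z k (snd p) / N k
  else if fst p = 2 then \<theta> k (snd p) else tk k / N k)" for k p
 have q1: "q k i / N k \<le> 1" "z k i / N k \<le> 1" if "i < n" for k i
 proof -
  have "q k i \<le> (\<Sum>i<n. q k i)" using that Dq by (intro member_le_sum) auto
  then show "q k i / N k \<le> 1" using N[of k] by (simp add: N_def)
  have "z k i \<le> (\<Sum>i<n. z k i)" using that Dz by (intro member_le_sum) auto
  then show "z k i / N k \<le> 1" using N[of k] su[of k] by (simp add: N_def)
 qed
 have hq: "\<theta> k i * (q k i / N k) = (\<Sum>j<n. V j i * (q k j / N k)) + tk k / N k"
  "\<theta> k i * (z k i / N k) = (\<Sum>j<n. V i j * (z k j / N k)) + tk k / N k" if "i < n" for k i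
  using D(4,5)[OF that, of k] by (simp_all add: sum_divide_distrib[symmetric] add_divide_distrib[symmetric])
 have sN: "tk k / N k \<le> \<Theta>" for k
 proof -
  have "tk k / N k \<le> \<theta> k 0 * (q k 0 / N k)" unfolding hq(1)[OF n]
   using V0 n Dq N[of k] by (auto intro!: sum_nonneg mult_nonneg_nonneg divide_nonneg_pos)
  also have "\<dots> \<le> \<Theta> * 1" using Th[OF n] q1[OF n] Dq[OF n] N[of k] Th0 by (intro mult_mono divide_nonneg_pos) auto
  finally show ?thesis by simp
 qed
 have sN0: "0 \<le> tk k / N k" for k using tk(1)[of k] N[of k] by simp
 have nn: "0 \<le> q k i / N k" "0 \<le> z k i / N k" if "i < n" for k i
  using Dq[OF that] Dz[OF that] N[of k] by (auto intro!: divide_nonneg_pos)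
 have "\<bar>f k p\<bar> \<le> \<Theta> + 1" if p: "p \<in> {..<4} \<times> {..<n}" for k p
 proof -
  have "snd p < n" using p by auto
  then have "\<bar>q k (snd p) / N k\<bar> \<le> \<Theta> + 1" "\<bar>z k (snd p) / N k\<bar> \<le> \<Theta> + 1" "\<bar>\<theta> k (snd p)\<bar> \<le> \<Theta> + 1"
   using q1[of "snd p" k] nn[of "snd p" k] Th[of "snd p" k] Dth[of "snd p" k] Th0 by linarith+
  moreover have "\<bar>tk k / N k\<bar> \<le> \<Theta> + 1" using sN[of k] sN0[of k] by linarith
  ultimately show ?thesis by (simp add: f_def)
 qed
 then obtain r where r: "strict_mono r" and rl: "\<forall>p\<in>{..<4} \<times> {..<n}. \<exists>l. (\<lambda>k. f (r k) p) \<longlonglongrightarrow> l"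
  using finite_bolzano[of "{..<4::nat} \<times> {..<n}" f "\<Theta> + 1"] by blast
 from rl have "\<exists>l. \<forall>p\<in>{..<4} \<times> {..<n}. (\<lambda>k. f (r k) p) \<longlonglongrightarrow> l p" by (rule bchoice)
 then obtain l where l: "\<And>p. p \<in> {..<4} \<times> {..<n} \<Longrightarrow> (\<lambda>k. f (r k) p) \<longlonglongrightarrow> l p" by blast
 define qh zh ths \<sigma> where "qh i = l (0, i)" and "zh i = l (1, i)" and "ths i = l (2, i)" and "\<sigma> = l (3, 0)" for i
 have lq: "(\<lambda>k. q (r k) i / N (r k)) \<longlonglongrightarrow> qh i" and lz: "(\<lambda>k. z (r k) i / N (r k)) \<longlonglongrightarrow> zh i"
  and lth: "(\<lambda>k. \<theta> (r k) i) \<longlonglongrightarrow> ths i" if "i < n" for i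
  using l[of "(0,i)"] l[of "(1,i)"] l[of "(2,i)"] that by (auto simp: f_def qh_def zh_def ths_def)
 have ls: "(\<lambda>k. tk (r k) / N (r k)) \<longlonglongrightarrow> \<sigma>" using l[of "(3,0)"] n by (auto simp: f_def \<sigma>_def)
 have s0: "0 \<le> \<sigma>" by (rule LIMSEQ_le_const[OF ls]) (use sN0 in blast)
 have ltr: "(\<lambda>k. \<tau>k (r k)) \<longlonglongrightarrow> \<tau>" using LIMSEQ_subseq_LIMSEQ[OF lt(1) r] by (simp add: o_def)
 have ltt: "(\<lambda>k. tk (r k)) \<longlonglongrightarrow> 0" using LIMSEQ_subseq_LIMSEQ[OF lt(2) r] by (simp add: o_def)
 have thp: "\<tau> \<le> ths i" if i: "i < n" for i
  by (rule LIMSEQ_le[OF ltr lth[OF i]]) (use less_imp_le[OF D(8)[OF i]] in blast)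
 have q0: "0 \<le> qh i" "0 \<le> zh i" if "i < n" for i
  using LIMSEQ_le_const[OF lq[OF that], of 0] LIMSEQ_le_const[OF lz[OF that], of 0] nn[OF that] by blast+
 have eq: "ths i * qh i = (\<Sum>j<n. V j i * qh j) + \<sigma>" if i: "i < n" for i
 proof (rule LIMSEQ_unique)
  show "(\<lambda>k. \<theta> (r k) i * (q (r k) i / N (r k))) \<longlonglongrightarrow> ths i * qh i" by (intro tendsto_mult lth lq i)
  show "(\<lambda>k. \<theta> (r k) i * (q (r k) i / N (r k))) \<longlonglongrightarrow> (\<Sum>j<n. V j i * qh j) + \<sigma>"
   unfolding hq(1)[OF i] using lq ls by (intro tendsto_add tendsto_sum tendsto_mult tendsto_const) auto
 qed
 have ez: "ths i * zh i = (\<Sum>j<n. V i j * zh j) + \<sigma>" if i: "i < n" for i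
 proof (rule LIMSEQ_unique)
  show "(\<lambda>k. \<theta> (r k) i * (z (r k) i / N (r k))) \<longlonglongrightarrow> ths i * zh i" by (intro tendsto_mult lth lz i)
  show "(\<lambda>k. \<theta> (r k) i * (z (r k) i / N (r k))) \<longlonglongrightarrow> (\<Sum>j<n. V i j * zh j) + \<sigma>"
   unfolding hq(2)[OF i] using lz ls by (intro tendsto_add tendsto_sum tendsto_mult tendsto_const) auto
 qed
 have sq: "(\<Sum>i<n. qh i) = 1"
 proof (rule LIMSEQ_unique)
  show "(\<lambda>k. \<Sum>i<n. q (r k) i / N (r k)) \<longlonglongrightarrow> (\<Sum>i<n. qh i)" using lq by (intro tendsto_sum) auto
  have "(\<Sum>i<n. q (r k) i / N (r k)) = 1" for k
   using N[of "r k"] by (simp add: N_def flip: sum_divide_distrib)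
  then show "(\<lambda>k. \<Sum>i<n. q (r k) i / N (r k)) \<longlonglongrightarrow> 1" by simp
 qed
 have sz: "(\<Sum>i<n. zh i) = 1"
 proof (rule LIMSEQ_unique)
  show "(\<lambda>k. \<Sum>i<n. z (r k) i / N (r k)) \<longlonglongrightarrow> (\<Sum>i<n. zh i)" using lz by (intro tendsto_sum) auto
  have "(\<Sum>i<n. z (r k) i / N (r k)) = 1" for k
   using N[of "r k"] su[of "r k"] by (simp add: N_def flip: sum_divide_distrib)
  then show "(\<lambda>k. \<Sum>i<n. z (r k) i / N (r k)) \<longlonglongrightarrow> 1" by simp
 qed
 have qp: "0 < qh i" if i: "i < n" for i
 proof (rule ccontr)
  assume "\<not> 0 < qh i"
  then have "qh i = 0" using q0[OF i] by simp
  then have "qh j = 0" if "j < n" for j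
   using dual.irr_zero[OF q0(1) _ i _ that] eq s0 by force
  then show False using sq by simp
 qed
 have zp: "0 < zh i" if i: "i < n" for i
 proof (rule ccontr)
  assume "\<not> 0 < zh i"
  then have "zh i = 0" using q0[OF i] by simp
  then have "zh j = 0" if "j < n" for j
   using irr_zero[OF q0(2) _ i _ that] ez s0 by force
  then show False using sz by simp
 qed
 have thp': "0 < ths i" if "i < n" for i using thp[OF that] tau by linarith
 define N2 where "N2 = (1 - \<tau> / ths 0) / (qh 0 * zh 0 * ths 0)"
 have sqN: "(N k)\<^sup>2 = (1 - \<tau>k k / \<theta> k i) / (q k i / N k * (z k i / N k) * \<theta> k i)" if i: "i < n" for i k
  unfolding D(6)[OF i, of k, symmetric] using D(1,2,3)[OF i, of k] N[of k] by (simp add: field_simps power2_eq_square)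
 have lim2: "(\<lambda>k. (N (r k))\<^sup>2) \<longlonglongrightarrow> (1 - \<tau> / ths i) / (qh i * zh i * ths i)" if i: "i < n" for i
  unfolding sqN[OF i] using qp[OF i] zp[OF i] thp'[OF i]
  by (intro tendsto_divide tendsto_diff tendsto_mult tendsto_const ltr lq lz lth i) auto
 have N2eq: "N2 = (1 - \<tau> / ths i) / (qh i * zh i * ths i)" if i: "i < n" for i
  using LIMSEQ_unique[OF lim2[OF n] lim2[OF i]] by (simp add: N2_def)
 have N2: "(\<lambda>k. (N (r k))\<^sup>2) \<longlonglongrightarrow> N2" using lim2[OF n] by (simp add: N2_def)
 have "N2 \<noteq> 0"
 proof
  assume "N2 = 0"
  then have "ths i = \<tau>" if "i < n" for i
   using N2eq[OF that] qp[OF that] zp[OF that] thp'[OF that] by auto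
  then have "(\<Sum>j<n. V i j * zh j) \<le> \<tau> * zh i" if "i < n" for i using ez[OF that] s0 that by simp
  then show False using sc zp unfolding supercritical_def by (meson not_le)
 qed
 moreover have "0 \<le> N2" by (rule LIMSEQ_le_const[OF N2]) auto
 ultimately have N2p: "N2 > 0" by simp
 have lN: "(\<lambda>k. N (r k)) \<longlonglongrightarrow> sqrt N2"
  using tendsto_real_sqrt[OF N2] by (simp only: real_sqrt_abs abs_of_pos[OF N])
 have "(\<lambda>k. tk (r k) / N (r k)) \<longlonglongrightarrow> 0 / sqrt N2" using N2p by (intro tendsto_divide ltt lN) auto
 then have sig: "\<sigma> = 0" using ls LIMSEQ_unique by fastforce
 have N0: "N k \<noteq> 0" for k using N[of k] by simp
 define qs zs where "qs i = sqrt N2 * qh i" and "zs i = sqrt N2 * zh i" for i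
 have "(\<lambda>k. N (r k) * (q (r k) i / N (r k))) \<longlonglongrightarrow> qs i" if "i < n" for i
  unfolding qs_def by (intro tendsto_mult lN lq that)
 then have cq: "(\<lambda>k. q (r k) i) \<longlonglongrightarrow> qs i" if "i < n" for i using that by (simp add: N0)
 have "(\<lambda>k. N (r k) * (z (r k) i / N (r k))) \<longlonglongrightarrow> zs i" if "i < n" for i
  unfolding zs_def by (intro tendsto_mult lN lz that)
 then have cz: "(\<lambda>k. z (r k) i) \<longlonglongrightarrow> zs i" if "i < n" for i using that by (simp add: N0)
 have "sol \<tau> 0 qs zs ths" unfolding sol_def
 proof (intro allI impI)
  fix i assume i: "i < n"
  have "qs i * zs i * ths i = N2 * (qh i * zh i * ths i)" using N2p by (simp add: qs_def zs_def)
  also have "\<dots> = 1 - \<tau> / ths i" unfolding N2eq[OF i] using qp[OF i] zp[OF i] thp'[OF i] by simp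
  finally have "qs i * zs i * ths i = 1 - \<tau> / ths i" .
  moreover have "ths i * qs i = (\<Sum>j<n. V j i * qs j)" "ths i * zs i = (\<Sum>j<n. V i j * zs j)"
   using eq[OF i] ez[OF i] sig by (simp_all add: qs_def zs_def mult.left_commute sum_distrib_left[symmetric])
  ultimately show "0 < qs i \<and> 0 < zs i \<and> 0 < ths i \<and> ths i * qs i = (\<Sum>j<n. V j i * qs j) + 0 \<and>
   ths i * zs i = (\<Sum>j<n. V i j * zs j) + 0 \<and> qs i * zs i * ths i = 1 - \<tau> / ths i"
   using N2p qp[OF i] zp[OF i] thp'[OF i] by (simp add: qs_def zs_def)
 qed
 moreover have "(\<Sum>i<n. qs i) = (\<Sum>i<n. zs i)" by (simp add: qs_def zs_def sq sz flip: sum_distrib_left)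
 ultimately show ?thesis using r cq cz lth by blast
qed

lemma sol_exists0:
 assumes sc: "supercritical \<tau>"
 shows "\<exists>q z \<theta>. sol \<tau> 0 q z \<theta> \<and> (\<Sum>i<n. q i) = (\<Sum>i<n. z i)"
proof -
 have tau: "\<tau> > 0" using sc by (simp add: supercritical_def)
 define tk where "tk k = 1 / (real k + 1)" for k
 have tk: "0 < tk k" "tk k \<le> 1" for k by (auto simp: tk_def)
 have "\<exists>p. sol \<tau> (tk k) (fst p) (fst (snd p)) (snd (snd p))" for k
  using sol_exists[OF tau tk(1)[of k]] by auto
 then obtain p where p: "\<And>k. sol \<tau> (tk k) (fst (p k)) (fst (snd (p k))) (snd (snd (p k)))" by metis
 have "tk \<longlonglongrightarrow> 0" unfolding tk_def using LIMSEQ_inverse_real_of_nat by (simp add: inverse_eq_divide add.commute)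
 from sol_compact[OF sc tendsto_const this _ tk(2) p sol_sum[OF p tk(1)] tau] tk(1)
 show ?thesis by (force simp: less_imp_le)
qed

lemma sol_converges:
 assumes sc: "supercritical \<tau>" and lt: "\<tau>k \<longlonglongrightarrow> \<tau>" "tk \<longlonglongrightarrow> 0" and tk: "\<And>k. 0 \<le> tk k" "\<And>k. tk k \<le> 1"
  and s: "\<And>k. sol (\<tau>k k) (tk k) (q k) (z k) (\<theta> k)" and su: "\<And>k. (\<Sum>i<n. q k i) = (\<Sum>i<n. z k i)"
  and pk: "\<And>k. \<tau>k k > 0"
  and s0: "sol \<tau> 0 q0 z0 \<theta>0" "(\<Sum>i<n. q0 i) = (\<Sum>i<n. z0 i)" and i: "i < n"
 shows "(\<lambda>k. q k i) \<longlonglongrightarrow> q0 i" "(\<lambda>k. z k i) \<longlonglongrightarrow> z0 i" "(\<lambda>k. \<theta> k i) \<longlonglongrightarrow> \<theta>0 i"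
proof -
 have tau: "\<tau> > 0" using sc by (simp add: supercritical_def)
 have key: "\<exists>r. strict_mono (r :: nat \<Rightarrow> nat) \<and> (\<lambda>k. q (g (r k)) i) \<longlonglongrightarrow> q0 i \<and> (\<lambda>k. z (g (r k)) i) \<longlonglongrightarrow> z0 i
   \<and> (\<lambda>k. \<theta> (g (r k)) i) \<longlonglongrightarrow> \<theta>0 i" if g: "strict_mono g" for g
 proof -
  have "\<exists>r qs zs ths. strict_mono (r :: nat \<Rightarrow> nat) \<and> sol \<tau> 0 qs zs ths \<and> (\<Sum>i<n. qs i) = (\<Sum>i<n. zs i) \<and>
   (\<forall>i<n. (\<lambda>k. q (g (r k)) i) \<longlonglongrightarrow> qs i \<and> (\<lambda>k. z (g (r k)) i) \<longlonglongrightarrow> zs i \<and> (\<lambda>k. \<theta> (g (r k)) i) \<longlonglongrightarrow> ths i)"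
   by (rule sol_compact[OF sc LIMSEQ_subseq_LIMSEQ[OF lt(1) g, unfolded o_def] LIMSEQ_subseq_LIMSEQ[OF lt(2) g, unfolded o_def]])
     (use tk s su pk in auto)
  then obtain r qs zs ths where r: "strict_mono (r :: nat \<Rightarrow> nat)" "sol \<tau> 0 qs zs ths" "(\<Sum>i<n. qs i) = (\<Sum>i<n. zs i)"
   "\<forall>i<n. (\<lambda>k. q (g (r k)) i) \<longlonglongrightarrow> qs i \<and> (\<lambda>k. z (g (r k)) i) \<longlonglongrightarrow> zs i \<and> (\<lambda>k. \<theta> (g (r k)) i) \<longlonglongrightarrow> ths i" by blast
  then show ?thesis using sol_unique0[OF r(2) s0(1) tau r(3) s0(2) i] i by metis
 qed
 show "(\<lambda>k. q k i) \<longlonglongrightarrow> q0 i" by (rule LIMSEQ_subseq_criterion) (use key in blast)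
 show "(\<lambda>k. z k i) \<longlonglongrightarrow> z0 i" by (rule LIMSEQ_subseq_criterion) (use key in blast)
 show "(\<lambda>k. \<theta> k i) \<longlonglongrightarrow> \<theta>0 i" by (rule LIMSEQ_subseq_criterion) (use key in blast)
qed

end

section \<open>Differentiability in the spectral parameter\<close>

text \<open>The chain rule along a sequence, for quotients by a sequence \<open>R\<close> which need not be an increment of the argument.\<close>
lemma chain_seq:
 fixes f :: "real \<Rightarrow> real"
 assumes f: "(f has_real_derivative d) (at 0)" "f 0 = 0" and x: "x \<longlonglongrightarrow> 0" "(\<lambda>k. x k / R k) \<longlonglongrightarrow> y"
 shows "(\<lambda>k. f (x k) / R k) \<longlonglongrightarrow> d * y"
proof -
 obtain g where g: "\<And>z. f z - f 0 = g z * (z - 0)" "isCont g 0" "g 0 = d"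
  using f(1) unfolding CARAT_DERIV by blast
 have "(\<lambda>k. g (x k)) \<longlonglongrightarrow> d" using isCont_tendsto_compose[OF g(2) x(1)] g(3) by simp
 then have "(\<lambda>k. g (x k) * (x k / R k)) \<longlonglongrightarrow> d * y" using x(2) by (rule tendsto_mult)
 then show ?thesis using g(1) f(2) by simp
qed

context profile
begin

definition canon :: "real \<Rightarrow> (nat \<Rightarrow> real) \<times> (nat \<Rightarrow> real) \<times> (nat \<Rightarrow> real)" where
 "canon \<tau> = (SOME p. sol \<tau> 0 (fst p) (fst (snd p)) (snd (snd p)) \<and> (\<Sum>i<n. fst p i) = (\<Sum>i<n. fst (snd p) i))"
definition gq where "gq \<tau> = fst (canon \<tau>)"
definition gz where "gz \<tau> = fst (snd (canon \<tau>))"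
definition gth where "gth \<tau> = snd (snd (canon \<tau>))"

lemma canon: assumes "supercritical \<tau>"
 shows "sol \<tau> 0 (gq \<tau>) (gz \<tau>) (gth \<tau>)" "(\<Sum>i<n. gq \<tau> i) = (\<Sum>i<n. gz \<tau> i)"
proof -
 have "\<exists>p. sol \<tau> 0 (fst p) (fst (snd p)) (snd (snd p)) \<and> (\<Sum>i<n. fst p i) = (\<Sum>i<n. fst (snd p) i)"
  using sol_exists0[OF assms] by auto
 then have "sol \<tau> 0 (gq \<tau>) (gz \<tau>) (gth \<tau>) \<and> (\<Sum>i<n. gq \<tau> i) = (\<Sum>i<n. gz \<tau> i)"
  unfolding gq_def gz_def gth_def canon_def by (rule someI_ex)
 then show "sol \<tau> 0 (gq \<tau>) (gz \<tau>) (gth \<tau>)" "(\<Sum>i<n. gq \<tau> i) = (\<Sum>i<n. gz \<tau> i)" by auto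
qed

text \<open>The equations differentiated in \<open>ln \<tau>\<close>: \<open>D\<close>, \<open>\<xi>\<close>, \<open>\<eta>\<close> stand for the derivatives of \<open>ln (\<tau> / \<theta>)\<close>, \<open>ln z\<close>, \<open>ln q\<close>, and \<open>h\<close> for that
 of \<open>ln \<tau>\<close>. The derivative corresponds to \<open>h = 1\<close>, and \<open>h = 0\<close> is the homogeneous system.\<close>
definition lin where "lin q z \<theta> \<tau> h D \<xi> \<eta> \<longleftrightarrow> (\<forall>i<n.
  (\<Sum>j<n. V i j * z j * \<xi> j) = z i * \<theta> i * (\<xi> i + h - D i) \<and>
  (\<Sum>j<n. V j i * q j * \<eta> j) = q i * \<theta> i * (\<eta> i + h - D i) \<and>
  \<xi> i + \<eta> i = D i - h - (\<tau> / \<theta> i) / (1 - \<tau> / \<theta> i) * D i)"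

lemma linD:
 assumes "lin q z \<theta> \<tau> h D \<xi> \<eta>" "i < n"
 shows "(\<Sum>j<n. V i j * z j * \<xi> j) = z i * \<theta> i * (\<xi> i + h - D i)"
  "(\<Sum>j<n. V j i * q j * \<eta> j) = q i * \<theta> i * (\<eta> i + h - D i)"
  "\<xi> i + \<eta> i = D i - h - (\<tau> / \<theta> i) / (1 - \<tau> / \<theta> i) * D i"
 using assms by (auto simp: lin_def)

text \<open>The weights \<open>q i * V i j * z j\<close> have row and column sums \<open>m\<close>. Summing the first equation against \<open>q\<close> gives
 the first claim. For the second, the bilinear form of \<open>\<eta>\<close> and \<open>\<xi>\<close> is evaluated by rows and by columns, which shows that
 \<open>m (D - h)\<close> has the same pairing with \<open>\<xi>\<close> and \<open>\<eta>\<close>; the third equation provides the sum of the two pairings.\<close>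
lemma lin_energy:
 assumes s: "sol \<tau> 0 q z \<theta>" and l: "lin q z \<theta> \<tau> h D \<xi> \<eta>"
 shows "(\<Sum>i<n. (1 - \<tau> / \<theta> i) * (D i - h)) = 0"
  "(\<Sum>i<n. \<Sum>j<n. q i * V i j * z j * (\<xi> j - (\<xi> i + h - D i))\<^sup>2) = - (\<Sum>i<n. \<tau> / \<theta> i * D i * (D i - h))"
proof -
 note D = solD[OF s] and L = linD[OF l]
 define m where "m i = q i * z i * \<theta> i" for i
 have m: "m i = 1 - \<tau> / \<theta> i" "0 < m i" if "i < n" for i using D(6,7)[OF that] by (auto simp: m_def)
 define u where "u i = D i - h" for i
 have row: "(\<Sum>j<n. q i * V i j * z j) = m i" if "i < n" for i
 proof -
  have "(\<Sum>j<n. q i * V i j * z j) = q i * (\<Sum>j<n. V i j * z j)" by (simp add: sum_distrib_left mult.assoc)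
  then show ?thesis using D(5)[OF that] by (simp add: m_def mult_ac)
 qed
 have col: "(\<Sum>i<n. q i * V i j * z j) = m j" if "j < n" for j
 proof -
  have "(\<Sum>i<n. q i * V i j * z j) = z j * (\<Sum>i<n. V i j * q i)" by (simp add: sum_distrib_left mult_ac)
  then show ?thesis using D(4)[OF that] by (simp add: m_def mult_ac)
 qed
 have r1: "(\<Sum>j<n. q i * V i j * z j * \<xi> j) = m i * (\<xi> i - u i)" if "i < n" for i
 proof -
  have "(\<Sum>j<n. q i * V i j * z j * \<xi> j) = q i * (\<Sum>j<n. V i j * z j * \<xi> j)" by (simp add: sum_distrib_left mult.assoc)
  then show ?thesis using L(1)[OF that] by (simp add: m_def u_def mult_ac)
 qed
 have c1: "(\<Sum>i<n. q i * V i j * z j * f i * g j) = (\<Sum>i<n. q i * V i j * z j * f i) * g j" for f g :: "nat \<Rightarrow> real" and j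
  by (simp add: sum_distrib_right)
 have c2: "(\<Sum>i<n. q i * V i j * z j * \<eta> i) = m j * (\<eta> j - u j)" if "j < n" for j
 proof -
  have "(\<Sum>i<n. q i * V i j * z j * \<eta> i) = z j * (\<Sum>i<n. V i j * q i * \<eta> i)" by (simp add: sum_distrib_left mult_ac)
  then show ?thesis using L(2)[OF that] by (simp add: m_def u_def mult_ac)
 qed
 have S1: "(\<Sum>i<n. \<Sum>j<n. q i * V i j * z j * f j) = (\<Sum>j<n. m j * f j)" for f
 proof -
  have "(\<Sum>i<n. q i * V i j * z j * f j) = m j * f j" if "j < n" for j
   unfolding col[OF that, symmetric] by (simp only: sum_distrib_right)
  then show ?thesis by (subst sum.swap) simp
 qed
 have "(\<Sum>i<n. m i * (\<xi> i - u i)) = (\<Sum>j<n. m j * \<xi> j)" using S1[of \<xi>] r1 by simp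
 then have mu: "(\<Sum>i<n. m i * u i) = 0" by (simp add: right_diff_distrib sum_subtractf)
 then show "(\<Sum>i<n. (1 - \<tau> / \<theta> i) * (D i - h)) = 0" using m by (simp add: u_def)
 have "(\<Sum>i<n. \<Sum>j<n. q i * V i j * z j * \<xi> j * \<eta> i) = (\<Sum>i<n. m i * (\<xi> i - u i) * \<eta> i)"
  using r1 by (simp flip: sum_distrib_right)
 moreover have "(\<Sum>i<n. \<Sum>j<n. q i * V i j * z j * \<xi> j * \<eta> i) = (\<Sum>j<n. \<Sum>i<n. q i * V i j * z j * \<eta> i * \<xi> j)"
  by (subst sum.swap) (simp add: mult_ac)
 moreover have "\<dots> = (\<Sum>j<n. m j * (\<eta> j - u j) * \<xi> j)" using c2 by (simp flip: sum_distrib_right)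
 ultimately have "(\<Sum>i<n. m i * (\<xi> i - u i) * \<eta> i) = (\<Sum>j<n. m j * (\<eta> j - u j) * \<xi> j)" by simp
 then have "(\<Sum>i<n. m i * (\<xi> i - u i) * \<eta> i - m i * (\<eta> i - u i) * \<xi> i) = 0" by (simp add: sum_subtractf)
 then have cross: "(\<Sum>i<n. m i * u i * \<xi> i - m i * u i * \<eta> i) = 0" by (simp add: algebra_simps)
 have L3: "m i * u i * (\<xi> i + \<eta> i) = m i * (u i)\<^sup>2 - \<tau> / \<theta> i * D i * u i" if i: "i < n" for i
 proof -
  have "m i * (\<xi> i + \<eta> i) = m i * u i - m i * ((\<tau> / \<theta> i) / m i * D i)"
   unfolding L(3)[OF i] m(1)[OF i, symmetric] by (simp add: u_def right_diff_distrib)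
  also have "m i * ((\<tau> / \<theta> i) / m i * D i) = \<tau> / \<theta> i * D i" using m(2)[OF i] by simp
  finally have "(m i * (\<xi> i + \<eta> i)) * u i = (m i * u i - \<tau> / \<theta> i * D i) * u i" by simp
  then show ?thesis by (simp add: algebra_simps power2_eq_square)
 qed
 have "(\<Sum>i<n. m i * u i * \<xi> i) = (\<Sum>i<n. m i * u i * \<eta> i)" using cross by (simp add: sum_subtractf)
 moreover have "(\<Sum>i<n. m i * u i * \<xi> i) + (\<Sum>i<n. m i * u i * \<eta> i) = (\<Sum>i<n. m i * (u i)\<^sup>2) - (\<Sum>i<n. \<tau> / \<theta> i * D i * u i)"
  unfolding sum.distrib[symmetric] sum_subtractf[symmetric] distrib_left[symmetric] using L3 by (intro sum.cong) auto
 ultimately have two: "2 * (\<Sum>i<n. m i * u i * \<xi> i) - (\<Sum>i<n. m i * (u i)\<^sup>2) = - (\<Sum>i<n. \<tau> / \<theta> i * D i * u i)" by linarith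
 have "(\<Sum>i<n. \<Sum>j<n. q i * V i j * z j * (\<xi> j - (\<xi> i - u i))\<^sup>2)
   = (\<Sum>i<n. \<Sum>j<n. q i * V i j * z j * (\<xi> j)\<^sup>2) - (\<Sum>i<n. m i * (\<xi> i - u i)\<^sup>2)"
  unfolding sum_subtractf[symmetric]
 proof (rule sum.cong[OF refl])
  fix i assume "i \<in> {..<n}" then have i: "i < n" by simp
  define a where "a = \<xi> i - u i"
  have "(\<Sum>j<n. q i * V i j * z j * (\<xi> j - a)\<^sup>2) = (\<Sum>j<n. q i * V i j * z j * (\<xi> j)\<^sup>2 - 2 * a * (q i * V i j * z j * \<xi> j) + a\<^sup>2 * (q i * V i j * z j))"
   by (intro sum.cong) (auto simp: power2_eq_square algebra_simps)
  also have "\<dots> = (\<Sum>j<n. q i * V i j * z j * (\<xi> j)\<^sup>2) - 2 * a * (m i * a) + a\<^sup>2 * m i"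
   unfolding sum.distrib sum_subtractf sum_distrib_left[symmetric] r1[OF i] row[OF i] a_def ..
  finally show "(\<Sum>j<n. q i * V i j * z j * (\<xi> j - (\<xi> i - u i))\<^sup>2) = (\<Sum>j<n. q i * V i j * z j * (\<xi> j)\<^sup>2) - m i * (\<xi> i - u i)\<^sup>2"
   by (simp add: a_def power2_eq_square)
 qed
 also have "\<dots> = (\<Sum>i<n. m i * (\<xi> i)\<^sup>2 - m i * (\<xi> i - u i)\<^sup>2)" unfolding S1 sum_subtractf ..
 also have "\<dots> = (\<Sum>i<n. 2 * (m i * u i * \<xi> i) - m i * (u i)\<^sup>2)" by (simp add: power2_eq_square algebra_simps)
 also have "\<dots> = - (\<Sum>i<n. \<tau> / \<theta> i * D i * u i)" using two by (simp add: sum_subtractf sum_distrib_left)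
 finally show "(\<Sum>i<n. \<Sum>j<n. q i * V i j * z j * (\<xi> j - (\<xi> i + h - D i))\<^sup>2) = - (\<Sum>i<n. \<tau> / \<theta> i * D i * (D i - h))"
  by (simp add: u_def algebra_simps)
qed

lemma lin_energy_le:
 assumes s: "sol \<tau> 0 q z \<theta>" and l: "lin q z \<theta> \<tau> h D \<xi> \<eta>"
 shows "(\<Sum>i<n. \<tau> / \<theta> i * D i * (D i - h)) \<le> 0"
proof -
 have "0 \<le> (\<Sum>i<n. \<Sum>j<n. q i * V i j * z j * (\<xi> j - (\<xi> i + h - D i))\<^sup>2)"
  using solD(1,2)[OF s] V0 by (intro sum_nonneg mult_nonneg_nonneg) (auto simp: order_less_imp_le)
 then show ?thesis using lin_energy(2)[OF s l] by linarith
qed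

text \<open>For \<open>h = 0\<close> the energy inequality forces \<open>D = 0\<close>. Then \<open>z * \<xi>\<close> is a second eigenvector at the same levels, hence \<open>\<xi>\<close>
 is constant, and the normalization \<open>\<xi> 0 = 0\<close> fixes the invariance of the equations.\<close>
lemma lin_zero:
 assumes s: "sol \<tau> 0 q z \<theta>" and tau: "\<tau> > 0" and l: "lin q z \<theta> \<tau> 0 D \<xi> \<eta>" and g: "\<xi> 0 = 0" and i: "i < n"
 shows "D i = 0 \<and> \<xi> i = 0 \<and> \<eta> i = 0"
proof -
 note D = solD[OF s] and L = linD[OF l]
 have nn: "0 \<le> \<tau> / \<theta> i * D i * D i" if "i < n" for i
  using mult_nonneg_nonneg[of "\<tau> / \<theta> i" "D i * D i"] tau D(3)[OF that] by (simp add: mult.assoc)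
 have "(\<Sum>i<n. \<tau> / \<theta> i * D i * D i) \<le> 0" using lin_energy_le[OF s l] by simp
 then have "(\<Sum>i<n. \<tau> / \<theta> i * D i * D i) = 0" using nn by (intro antisym sum_nonneg) auto
 then have D0: "D i = 0" if "i < n" for i
  using sum_nonneg_eq_0_iff[of "{..<n}" "\<lambda>i. \<tau> / \<theta> i * D i * D i"] nn that tau D(3)[OF that] by auto
 define k where "k = arg_min_on (\<lambda>i. - \<xi> i) {..<n}"
 have ne: "finite {..<n}" "{..<n} \<noteq> {}" using n by auto
 have k: "k < n" "\<And>i. i < n \<Longrightarrow> \<xi> i \<le> \<xi> k"
  using arg_min_if_finite[OF ne, of "\<lambda>i. - \<xi> i"] by (auto simp: k_def not_less)
 define y where "y i = z i * (\<xi> k - \<xi> i)" for i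
 have y0: "y i = 0" if "i < n" for i
 proof (rule irr_zero[OF _ _ k(1) _ that])
  show "0 \<le> y i" if "i < n" for i using k(2)[OF that] D(2)[OF that] by (simp add: y_def)
  show "y k = 0" by (simp add: y_def)
  fix i assume i: "i < n" "y i = 0"
  have "(\<Sum>j<n. V i j * y j) = (\<Sum>j<n. V i j * z j) * \<xi> k - (\<Sum>j<n. V i j * z j * \<xi> j)"
   unfolding sum_distrib_right sum_subtractf[symmetric] by (intro sum.cong) (auto simp: y_def algebra_simps)
  also have "(\<Sum>j<n. V i j * z j) = \<theta> i * z i" using D(5)[OF i(1)] by simp
  also have "\<theta> i * z i * \<xi> k - (\<Sum>j<n. V i j * z j * \<xi> j) = \<theta> i * y i"
   unfolding L(1)[OF i(1)] D0[OF i(1)] by (simp add: y_def algebra_simps)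
  finally show "(\<Sum>j<n. V i j * y j) \<le> 0" using i by simp
 qed
 have "\<xi> j = \<xi> k" if "j < n" for j using y0[OF that] D(2)[OF that] by (simp add: y_def)
 then have xi: "\<xi> j = 0" if "j < n" for j using that g n by metis
 show ?thesis using D0[OF i] xi[OF i] L(3)[OF i] by simp
qed

lemma lin_unique:
 assumes s: "sol \<tau> 0 q z \<theta>" and tau: "\<tau> > 0" and l: "lin q z \<theta> \<tau> h D \<xi> \<eta>" "lin q z \<theta> \<tau> h D' \<xi>' \<eta>'"
  and g: "\<xi> 0 = 0" "\<xi>' 0 = 0" and i: "i < n"
 shows "D i = D' i"
proof -
 have "lin q z \<theta> \<tau> 0 (\<lambda>i. D i - D' i) (\<lambda>i. \<xi> i - \<xi>' i) (\<lambda>i. \<eta> i - \<eta>' i)"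
  unfolding lin_def
 proof (intro allI impI conjI)
  fix i assume i: "i < n"
  note L = linD[OF l(1) i] and L' = linD[OF l(2) i]
  show "(\<Sum>j<n. V i j * z j * (\<xi> j - \<xi>' j)) = z i * \<theta> i * (\<xi> i - \<xi>' i + 0 - (D i - D' i))"
   using L(1) L'(1) by (simp add: right_diff_distrib sum_subtractf) (simp add: algebra_simps)
  show "(\<Sum>j<n. V j i * q j * (\<eta> j - \<eta>' j)) = q i * \<theta> i * (\<eta> i - \<eta>' i + 0 - (D i - D' i))"
   using L(2) L'(2) by (simp add: right_diff_distrib sum_subtractf) (simp add: algebra_simps)
  define w where "w = (\<tau> / \<theta> i) / (1 - \<tau> / \<theta> i)"
  show "\<xi> i - \<xi>' i + (\<eta> i - \<eta>' i) = D i - D' i - 0 - (\<tau> / \<theta> i) / (1 - \<tau> / \<theta> i) * (D i - D' i)"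
   using L(3) L'(3) unfolding w_def[symmetric] by (simp add: algebra_simps)
 qed
 from lin_zero[OF s tau this _ i] show ?thesis using g by simp
qed

text \<open>All increments are divided by the sum \<open>R\<close> of their absolute values and that of \<open>ln \<tau>\<close>. Along a subsequence the quotients converge to a
 nonzero solution of the linear system, whose \<open>h\<close> cannot vanish by \<open>lin_zero\<close>; dividing by \<open>h\<close> gives the derivative.\<close>
lemma lin_subsequence:
 assumes sc: "supercritical \<tau>" and x: "\<And>k. supercritical (x k)" "\<And>k. x k \<noteq> \<tau>" "x \<longlonglongrightarrow> \<tau>"
 shows "\<exists>r D \<xi> \<eta>. strict_mono (r :: nat \<Rightarrow> nat) \<and> lin (gq \<tau>) (gz \<tau>) (gth \<tau>) \<tau> 1 D \<xi> \<eta> \<and> \<xi> 0 = 0 \<and>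
  (\<forall>i<n. (\<lambda>k. (ln (x (r k) / gth (x (r k)) i) - ln (\<tau> / gth \<tau> i)) / (ln (x (r k)) - ln \<tau>)) \<longlonglongrightarrow> D i)"
proof -
 have tau: "\<tau> > 0" and xp: "x k > 0" for k using sc x by (auto simp: supercritical_def)
 define q z \<theta> where "q = gq \<tau>" and "z = gz \<tau>" and "\<theta> = gth \<tau>"
 have s: "sol \<tau> 0 q z \<theta>" and su: "(\<Sum>i<n. q i) = (\<Sum>i<n. z i)" using canon[OF sc] by (auto simp: q_def z_def \<theta>_def)
 note B = solD[OF s]
 define qk zk tk where "qk k = gq (x k)" and "zk k = gz (x k)" and "tk k = gth (x k)" for k
 have sk: "sol (x k) 0 (qk k) (zk k) (tk k)" and suk: "(\<Sum>i<n. qk k i) = (\<Sum>i<n. zk k i)" for k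
  using canon[OF x(1)[of k]] by (auto simp: qk_def zk_def tk_def)
 note K = solD[OF sk]
 have conv: "(\<lambda>k. qk k i) \<longlonglongrightarrow> q i" "(\<lambda>k. zk k i) \<longlonglongrightarrow> z i" "(\<lambda>k. tk k i) \<longlonglongrightarrow> \<theta> i" if "i < n" for i
  using sol_converges[OF sc x(3) tendsto_const order_refl zero_le_one sk suk xp s su that] by auto
 define h where "h k = ln (x k) - ln \<tau>" for k
 define P where "P k i = ln (x k / tk k i) - ln (\<tau> / \<theta> i)" for k i
 define \<xi> where "\<xi> k i = ln (zk k i / z i) - ln (zk k 0 / z 0)" for k i
 define \<eta> where "\<eta> k i = ln (qk k i / q i) + ln (zk k 0 / z 0)" for k i
 have h0: "h k \<noteq> 0" for k using x(2)[of k] xp[of k] tau by (simp add: h_def)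
 have ch: "h \<longlonglongrightarrow> 0"
 proof -
  have "h \<longlonglongrightarrow> ln \<tau> - ln \<tau>" unfolding h_def using tau by (intro tendsto_intros x(3)) auto
  then show ?thesis by simp
 qed
 have cP: "(\<lambda>k. P k i) \<longlonglongrightarrow> 0" if i: "i < n" for i
 proof -
  have "(\<lambda>k. P k i) \<longlonglongrightarrow> ln (\<tau> / \<theta> i) - ln (\<tau> / \<theta> i)" unfolding P_def
   using B(3)[OF i] tau by (intro tendsto_intros x(3) conv(3)[OF i]) auto
  then show ?thesis by simp
 qed
 have cx: "(\<lambda>k. \<xi> k i) \<longlonglongrightarrow> 0" if i: "i < n" for i
 proof -
  have "(\<lambda>k. \<xi> k i) \<longlonglongrightarrow> ln (z i / z i) - ln (z 0 / z 0)" unfolding \<xi>_def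
   using B(2)[OF i] B(2)[OF n] by (intro tendsto_intros conv(2) i n) auto
  then show ?thesis using B(2)[OF i] B(2)[OF n] by simp
 qed
 have ce: "(\<lambda>k. \<eta> k i) \<longlonglongrightarrow> 0" if i: "i < n" for i
 proof -
  have "(\<lambda>k. \<eta> k i) \<longlonglongrightarrow> ln (q i / q i) + ln (z 0 / z 0)" unfolding \<eta>_def
   using B(1)[OF i] B(2)[OF n] by (intro tendsto_intros conv(1,2) i n) (auto simp: B(1)[OF i, THEN less_imp_neq, symmetric])
  then show ?thesis using B(1)[OF i] B(2)[OF n] by simp
 qed
 define R where "R k = \<bar>h k\<bar> + (\<Sum>i<n. \<bar>P k i\<bar> + \<bar>\<xi> k i\<bar> + \<bar>\<eta> k i\<bar>)" for k
 have Rp: "R k > 0" for k unfolding R_def using h0[of k] by (intro add_pos_nonneg sum_nonneg) auto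
 define f where "f k p = (if fst p = (0::nat) then P k (snd p) else if fst p = 1 then \<xi> k (snd p)
  else if fst p = 2 then \<eta> k (snd p) else h k) / R k" for k p
 have "\<bar>f k p\<bar> \<le> 1" if p: "p \<in> {..<4} \<times> {..<n}" for k p
 proof -
  have i: "snd p \<in> {..<n}" using p by auto
  have "\<bar>P k (snd p)\<bar> + \<bar>\<xi> k (snd p)\<bar> + \<bar>\<eta> k (snd p)\<bar> \<le> (\<Sum>i<n. \<bar>P k i\<bar> + \<bar>\<xi> k i\<bar> + \<bar>\<eta> k i\<bar>)"
   using i by (intro member_le_sum[of "snd p" "{..<n}" "\<lambda>i. \<bar>P k i\<bar> + \<bar>\<xi> k i\<bar> + \<bar>\<eta> k i\<bar>"]) auto
  then have "\<bar>P k (snd p)\<bar> \<le> R k" "\<bar>\<xi> k (snd p)\<bar> \<le> R k" "\<bar>\<eta> k (snd p)\<bar> \<le> R k" "\<bar>h k\<bar> \<le> R k"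
   unfolding R_def by linarith+
  then show ?thesis using Rp[of k] by (simp add: f_def abs_divide)
 qed
 then obtain r where r: "strict_mono r" and rl: "\<forall>p\<in>{..<4} \<times> {..<n}. \<exists>l. (\<lambda>k. f (r k) p) \<longlonglongrightarrow> l"
  using finite_bolzano[of "{..<4::nat} \<times> {..<n}" f 1] by blast
 from rl have "\<exists>l. \<forall>p\<in>{..<4} \<times> {..<n}. (\<lambda>k. f (r k) p) \<longlonglongrightarrow> l p" by (rule bchoice)
 then obtain l where l: "\<And>p. p \<in> {..<4} \<times> {..<n} \<Longrightarrow> (\<lambda>k. f (r k) p) \<longlonglongrightarrow> l p" by blast
 define Ph xh eh hh where "Ph i = l (0, i)" and "xh i = l (1, i)" and "eh i = l (2, i)" and "hh = l (3, 0)" for i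
 have lP: "(\<lambda>k. P (r k) i / R (r k)) \<longlonglongrightarrow> Ph i" and lx: "(\<lambda>k. \<xi> (r k) i / R (r k)) \<longlonglongrightarrow> xh i"
  and le: "(\<lambda>k. \<eta> (r k) i / R (r k)) \<longlonglongrightarrow> eh i" if "i < n" for i
  using l[of "(0,i)"] l[of "(1,i)"] l[of "(2,i)"] that by (auto simp: f_def Ph_def xh_def eh_def)
 have lh: "(\<lambda>k. h (r k) / R (r k)) \<longlonglongrightarrow> hh" using l[of "(3,0)"] n by (auto simp: f_def hh_def)
 have rch: "(\<lambda>k. h (r k)) \<longlonglongrightarrow> 0" using LIMSEQ_subseq_LIMSEQ[OF ch r] by (simp add: o_def)
 have rcP: "(\<lambda>k. P (r k) i) \<longlonglongrightarrow> 0" and rcx: "(\<lambda>k. \<xi> (r k) i) \<longlonglongrightarrow> 0" and rce: "(\<lambda>k. \<eta> (r k) i) \<longlonglongrightarrow> 0" if "i < n" for i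
  using LIMSEQ_subseq_LIMSEQ[OF cP[OF that] r] LIMSEQ_subseq_LIMSEQ[OF cx[OF that] r] LIMSEQ_subseq_LIMSEQ[OF ce[OF that] r]
  by (simp_all add: o_def)
 have dexp: "((\<lambda>x. exp x - 1) has_real_derivative 1) (at 0)" by (auto intro!: derivative_eq_intros)
 have expl: "(\<lambda>k. (exp (y k) - 1) / R (r k)) \<longlonglongrightarrow> c" if "y \<longlonglongrightarrow> 0" "(\<lambda>k. y k / R (r k)) \<longlonglongrightarrow> c" for y c
  using chain_seq[OF dexp _ that] by simp
 have tke: "tk k i = \<theta> i * exp (h k - P k i)" if i: "i < n" for k i
 proof -
  have "h k - P k i = ln (tk k i) - ln (\<theta> i)" using B(3)[OF i] K(3)[OF i] xp[of k] tau by (simp add: h_def P_def ln_divide_pos)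
  then show ?thesis using B(3)[OF i] K(3)[OF i] by (simp add: exp_diff)
 qed
 define g where "g k = zk k 0 / z 0" for k
 have gp: "g k > 0" for k using B(2)[OF n] K(2)[OF n] by (simp add: g_def)
 have zke: "zk k i = g k * (z i * exp (\<xi> k i))" and qke: "qk k i = (q i * exp (\<eta> k i)) / g k" if i: "i < n" for k i
  using gp[of k] B(1,2)[OF i] K(1,2)[OF i, of k] by (simp_all add: \<xi>_def \<eta>_def exp_diff exp_add flip: g_def)
 have "lin q z \<theta> \<tau> hh Ph xh eh" unfolding lin_def
 proof (intro allI impI conjI)
  fix i assume i: "i < n"
  have "(\<Sum>j<n. V i j * z j * (exp (\<xi> k j) - 1)) = z i * \<theta> i * (exp (\<xi> k i + h k - P k i) - 1)" for k
  proof -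
   have "tk k i * zk k i = (\<Sum>j<n. V i j * zk k j)" using K(5)[OF i] by simp
   also have "\<dots> = g k * (\<Sum>j<n. V i j * z j * exp (\<xi> k j))" unfolding sum_distrib_left using zke by (intro sum.cong) auto
   also have "tk k i * zk k i = g k * (z i * \<theta> i * exp (\<xi> k i + h k - P k i))"
    unfolding tke[OF i] zke[OF i] by (simp add: exp_add exp_diff)
   finally have "(\<Sum>j<n. V i j * z j * exp (\<xi> k j)) = z i * \<theta> i * exp (\<xi> k i + h k - P k i)" using gp[of k] by simp
   moreover have "(\<Sum>j<n. V i j * z j) = z i * \<theta> i" using B(5)[OF i] by (simp add: mult.commute)
   ultimately show ?thesis by (simp only: right_diff_distrib sum_subtractf mult_1_right)
  qed
  then have e: "(\<Sum>j<n. V i j * z j * ((exp (\<xi> (r k) j) - 1) / R (r k))) = z i * \<theta> i * ((exp (\<xi> (r k) i + h (r k) - P (r k) i) - 1) / R (r k))" for k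
   by (simp flip: sum_divide_distrib)
  show "(\<Sum>j<n. V i j * z j * xh j) = z i * \<theta> i * (xh i + hh - Ph i)"
  proof (rule LIMSEQ_unique)
   show "(\<lambda>k. \<Sum>j<n. V i j * z j * ((exp (\<xi> (r k) j) - 1) / R (r k))) \<longlonglongrightarrow> (\<Sum>j<n. V i j * z j * xh j)"
    using rcx lx by (intro tendsto_sum tendsto_mult tendsto_const expl) auto
   have "(\<lambda>k. \<xi> (r k) i + h (r k) - P (r k) i) \<longlonglongrightarrow> 0 + 0 - 0" by (intro tendsto_intros rcx rch rcP i)
   moreover have "(\<lambda>k. \<xi> (r k) i / R (r k) + h (r k) / R (r k) - P (r k) i / R (r k)) \<longlonglongrightarrow> xh i + hh - Ph i" by (intro tendsto_intros lx lh lP i)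
   ultimately show "(\<lambda>k. \<Sum>j<n. V i j * z j * ((exp (\<xi> (r k) j) - 1) / R (r k))) \<longlonglongrightarrow> z i * \<theta> i * (xh i + hh - Ph i)"
    unfolding e by (intro tendsto_mult tendsto_const expl) (simp_all add: add_divide_distrib diff_divide_distrib)
  qed
  have "(\<Sum>j<n. V j i * q j * (exp (\<eta> k j) - 1)) = q i * \<theta> i * (exp (\<eta> k i + h k - P k i) - 1)" for k
  proof -
   have "tk k i * qk k i = (\<Sum>j<n. V j i * qk k j)" using K(4)[OF i] by simp
   also have "\<dots> = (\<Sum>j<n. V j i * q j * exp (\<eta> k j)) / g k" unfolding sum_divide_distrib using qke by (intro sum.cong) auto
   also have "tk k i * qk k i = (q i * \<theta> i * exp (\<eta> k i + h k - P k i)) / g k"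
    unfolding tke[OF i] qke[OF i] by (simp add: exp_add exp_diff)
   finally have "(\<Sum>j<n. V j i * q j * exp (\<eta> k j)) = q i * \<theta> i * exp (\<eta> k i + h k - P k i)" using gp[of k] by simp
   moreover have "(\<Sum>j<n. V j i * q j) = q i * \<theta> i" using B(4)[OF i] by (simp add: mult.commute)
   ultimately show ?thesis by (simp only: right_diff_distrib sum_subtractf mult_1_right)
  qed
  then have e: "(\<Sum>j<n. V j i * q j * ((exp (\<eta> (r k) j) - 1) / R (r k))) = q i * \<theta> i * ((exp (\<eta> (r k) i + h (r k) - P (r k) i) - 1) / R (r k))" for k
   by (simp flip: sum_divide_distrib)
  show "(\<Sum>j<n. V j i * q j * eh j) = q i * \<theta> i * (eh i + hh - Ph i)"
  proof (rule LIMSEQ_unique)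
   show "(\<lambda>k. \<Sum>j<n. V j i * q j * ((exp (\<eta> (r k) j) - 1) / R (r k))) \<longlonglongrightarrow> (\<Sum>j<n. V j i * q j * eh j)"
    using rce le by (intro tendsto_sum tendsto_mult tendsto_const expl) auto
   have "(\<lambda>k. \<eta> (r k) i + h (r k) - P (r k) i) \<longlonglongrightarrow> 0 + 0 - 0" by (intro tendsto_intros rce rch rcP i)
   moreover have "(\<lambda>k. \<eta> (r k) i / R (r k) + h (r k) / R (r k) - P (r k) i / R (r k)) \<longlonglongrightarrow> eh i + hh - Ph i" by (intro tendsto_intros le lh lP i)
   ultimately show "(\<lambda>k. \<Sum>j<n. V j i * q j * ((exp (\<eta> (r k) j) - 1) / R (r k))) \<longlonglongrightarrow> q i * \<theta> i * (eh i + hh - Ph i)"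
    unfolding e by (intro tendsto_mult tendsto_const expl) (simp_all add: add_divide_distrib diff_divide_distrib)
  qed
  define e0 where "e0 = \<tau> / \<theta> i"
  have e0: "0 < e0" "e0 < 1" using B(3,7)[OF i] tau by (auto simp: e0_def)
  define F where "F y = ln (1 - e0 * exp y) - ln (1 - e0)" for y
  have F: "(F has_real_derivative - (e0 / (1 - e0))) (at 0)" unfolding F_def using e0
   by (auto intro!: derivative_eq_intros simp: field_simps)
  have "\<xi> k i + \<eta> k i + h k - P k i = F (P k i)" for k
  proof -
   have "e0 * exp (P k i) = x k / tk k i" using e0 tau B(3)[OF i] K(3)[OF i, of k] xp[of k] by (simp add: P_def e0_def exp_diff)
   then have "1 - e0 * exp (P k i) = qk k i * zk k i * tk k i" using K(6)[OF i, of k] by simp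
   also have "\<dots> = (q i * z i * \<theta> i) * exp (\<xi> k i + \<eta> k i + h k - P k i)"
    unfolding tke[OF i] zke[OF i] qke[OF i] using gp[of k] by (simp add: exp_add exp_diff)
   also have "q i * z i * \<theta> i = 1 - e0" using B(6)[OF i] by (simp add: e0_def)
   finally have "1 - e0 * exp (P k i) = (1 - e0) * exp (\<xi> k i + \<eta> k i + h k - P k i)" .
   then show ?thesis using e0 by (simp add: F_def ln_mult)
  qed
  then have eq: "(\<xi> (r k) i + \<eta> (r k) i + h (r k) - P (r k) i) / R (r k) = F (P (r k) i) / R (r k)" for k by simp
  have "xh i + eh i + hh - Ph i = - (e0 / (1 - e0)) * Ph i"
  proof (rule LIMSEQ_unique)
   have "(\<lambda>k. \<xi> (r k) i / R (r k) + \<eta> (r k) i / R (r k) + h (r k) / R (r k) - P (r k) i / R (r k)) \<longlonglongrightarrow> xh i + eh i + hh - Ph i"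
    by (intro tendsto_intros lx le lh lP i)
   then show "(\<lambda>k. (\<xi> (r k) i + \<eta> (r k) i + h (r k) - P (r k) i) / R (r k)) \<longlonglongrightarrow> xh i + eh i + hh - Ph i"
    by (simp add: add_divide_distrib diff_divide_distrib)
   show "(\<lambda>k. (\<xi> (r k) i + \<eta> (r k) i + h (r k) - P (r k) i) / R (r k)) \<longlonglongrightarrow> - (e0 / (1 - e0)) * Ph i"
    unfolding eq by (rule chain_seq[OF F _ rcP[OF i] lP[OF i]]) (simp add: F_def)
  qed
  then show "xh i + eh i = Ph i - hh - (\<tau> / \<theta> i) / (1 - \<tau> / \<theta> i) * Ph i" unfolding e0_def[symmetric] by simp
 qed
 note lin = this
 have xh0: "xh 0 = 0"
 proof -
  have "(\<lambda>k. \<xi> (r k) 0 / R (r k)) = (\<lambda>k. 0)" by (simp add: \<xi>_def)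
  then show ?thesis using lx[OF n] LIMSEQ_unique tendsto_const by metis
 qed
 have one: "\<bar>hh\<bar> + (\<Sum>i<n. \<bar>Ph i\<bar> + \<bar>xh i\<bar> + \<bar>eh i\<bar>) = 1"
 proof (rule LIMSEQ_unique)
  show "(\<lambda>k. \<bar>h (r k) / R (r k)\<bar> + (\<Sum>i<n. \<bar>P (r k) i / R (r k)\<bar> + \<bar>\<xi> (r k) i / R (r k)\<bar> + \<bar>\<eta> (r k) i / R (r k)\<bar>)) \<longlonglongrightarrow> \<bar>hh\<bar> + (\<Sum>i<n. \<bar>Ph i\<bar> + \<bar>xh i\<bar> + \<bar>eh i\<bar>)"
   using lh lP lx le by (intro tendsto_add tendsto_sum tendsto_rabs) auto
  have "\<bar>h k / R k\<bar> + (\<Sum>i<n. \<bar>P k i / R k\<bar> + \<bar>\<xi> k i / R k\<bar> + \<bar>\<eta> k i / R k\<bar>) = R k / R k" for k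
   using Rp[of k] unfolding R_def[of k] abs_divide
   by (simp add: add_divide_distrib[symmetric] sum_divide_distrib[symmetric] flip: R_def)
  then show "(\<lambda>k. \<bar>h (r k) / R (r k)\<bar> + (\<Sum>i<n. \<bar>P (r k) i / R (r k)\<bar> + \<bar>\<xi> (r k) i / R (r k)\<bar> + \<bar>\<eta> (r k) i / R (r k)\<bar>)) \<longlonglongrightarrow> 1"
   using Rp by (simp add: order_less_imp_not_eq2)
 qed
 have hh: "hh \<noteq> 0"
 proof
  assume "hh = 0"
  then have "lin q z \<theta> \<tau> 0 Ph xh eh" using lin by simp
  then have "Ph i = 0 \<and> xh i = 0 \<and> eh i = 0" if "i < n" for i using lin_zero[OF s tau _ _ that] xh0 by blast
  then show False using one \<open>hh = 0\<close> by simp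
 qed
 define D \<xi>' \<eta>' where "D i = Ph i / hh" and "\<xi>' i = xh i / hh" and "\<eta>' i = eh i / hh" for i
 have "lin q z \<theta> \<tau> 1 D \<xi>' \<eta>'" unfolding lin_def
 proof (intro allI impI conjI)
  fix i assume i: "i < n"
  note L = linD[OF lin i]
  show "(\<Sum>j<n. V i j * z j * \<xi>' j) = z i * \<theta> i * (\<xi>' i + 1 - D i)"
  proof -
   have "(\<Sum>j<n. V i j * z j * \<xi>' j) = (\<Sum>j<n. V i j * z j * xh j) / hh" by (simp add: \<xi>'_def sum_divide_distrib)
   also have "\<dots> = z i * \<theta> i * (xh i + hh - Ph i) / hh" by (simp only: L(1))
   also have "\<dots> = z i * \<theta> i * (\<xi>' i + 1 - D i)" using hh by (simp add: \<xi>'_def D_def field_simps)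
   finally show ?thesis .
  qed
  show "(\<Sum>j<n. V j i * q j * \<eta>' j) = q i * \<theta> i * (\<eta>' i + 1 - D i)"
  proof -
   have "(\<Sum>j<n. V j i * q j * \<eta>' j) = (\<Sum>j<n. V j i * q j * eh j) / hh" by (simp add: \<eta>'_def sum_divide_distrib)
   also have "\<dots> = q i * \<theta> i * (eh i + hh - Ph i) / hh" by (simp only: L(2))
   also have "\<dots> = q i * \<theta> i * (\<eta>' i + 1 - D i)" using hh by (simp add: \<eta>'_def D_def field_simps)
   finally show ?thesis .
  qed
  define w where "w = (\<tau> / \<theta> i) / (1 - \<tau> / \<theta> i)"
  show "\<xi>' i + \<eta>' i = D i - 1 - (\<tau> / \<theta> i) / (1 - \<tau> / \<theta> i) * D i"
  proof -
   have "\<xi>' i + \<eta>' i = (xh i + eh i) / hh" by (simp add: \<xi>'_def \<eta>'_def add_divide_distrib)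
   also have "\<dots> = (Ph i - hh - w * Ph i) / hh" by (simp only: L(3) w_def)
   also have "\<dots> = D i - 1 - w * D i" using hh by (simp add: D_def diff_divide_distrib)
   finally show ?thesis by (simp only: w_def)
  qed
 qed
 moreover have "(\<lambda>k. P (r k) i / h (r k)) \<longlonglongrightarrow> D i" if "i < n" for i
 proof -
  have "(\<lambda>k. (P (r k) i / R (r k)) / (h (r k) / R (r k))) \<longlonglongrightarrow> D i" unfolding D_def by (intro tendsto_divide lP lh hh that)
  moreover have "(P (r k) i / R (r k)) / (h (r k) / R (r k)) = P (r k) i / h (r k)" for k using Rp[of "r k"] by simp
  ultimately show ?thesis by (simp only:)
 qed
 moreover have "\<xi>' 0 = 0" using xh0 by (simp add: \<xi>'_def)
 ultimately show ?thesis using r unfolding P_def h_def q_def z_def \<theta>_def tk_def by blast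
qed

text \<open>Every sequence has a subsequence along which the difference quotients converge to the \<open>D\<close> of a solution of the linear
 system, and that \<open>D\<close> is unique.\<close>
theorem level_derivative:
 assumes T: "\<And>s. 0 < s \<Longrightarrow> s < T \<Longrightarrow> supercritical s" and tau: "0 < \<tau>" "\<tau> < T"
 obtains D \<xi> \<eta> where "lin (gq \<tau>) (gz \<tau>) (gth \<tau>) \<tau> 1 D \<xi> \<eta>"
  "\<And>i. i < n \<Longrightarrow> ((\<lambda>s. ln (s / gth s i)) has_real_derivative D i / \<tau>) (at \<tau>)"
proof -
 have sc: "supercritical \<tau>" using T tau by auto
 have s: "sol \<tau> 0 (gq \<tau>) (gz \<tau>) (gth \<tau>)" by (rule canon(1)[OF sc])
 have seq: "\<exists>r D \<xi> \<eta>. strict_mono (r :: nat \<Rightarrow> nat) \<and> lin (gq \<tau>) (gz \<tau>) (gth \<tau>) \<tau> 1 D \<xi> \<eta> \<and> \<xi> 0 = 0 \<and>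
  (\<forall>i<n. (\<lambda>k. (ln (x (r k) / gth (x (r k)) i) - ln (\<tau> / gth \<tau> i)) / (ln (x (r k)) - ln \<tau>)) \<longlonglongrightarrow> D i)"
  if "\<And>k. x k \<in> {0<..<T} - {\<tau>}" "x \<longlonglongrightarrow> \<tau>" for x
  by (rule lin_subsequence[OF sc _ _ that(2)]) (use that(1) T in \<open>auto simp: set_eq_iff\<close>)
 define x0 where "x0 k = \<tau> + (- \<tau> / 2) * (1 / (real k + 1))" for k
 have "(\<lambda>k. 1 / (real k + 1)) \<longlonglongrightarrow> 0" using LIMSEQ_inverse_real_of_nat by (simp add: inverse_eq_divide add.commute)
 then have "x0 \<longlonglongrightarrow> \<tau> + (- \<tau> / 2) * 0" unfolding x0_def by (intro tendsto_intros)
 then have x0: "x0 \<longlonglongrightarrow> \<tau>" by simp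
 have x0in: "x0 k \<in> {0<..<T} - {\<tau>}" for k
 proof -
  define y where "y = 1 / (real k + 1)"
  have "0 < y" "y \<le> 1" by (auto simp: y_def)
  then have "0 < \<tau> * y" "\<tau> * y \<le> \<tau>" using tau by (auto simp: mult_left_le)
  moreover have "x0 k = \<tau> - (\<tau> * y) / 2" by (simp add: x0_def y_def)
  ultimately show ?thesis using tau by (simp only: greaterThanLessThan_iff Diff_iff singleton_iff) linarith
 qed
 obtain D \<xi> \<eta> where D: "lin (gq \<tau>) (gz \<tau>) (gth \<tau>) \<tau> 1 D \<xi> \<eta>" "\<xi> 0 = 0" using seq[OF x0in x0] by blast
 have "((\<lambda>s. ln (s / gth s i)) has_real_derivative D i / \<tau>) (at \<tau>)" if i: "i < n" for i
 proof -
  have "((\<lambda>s. ln (s / gth s i)) has_real_derivative D i / \<tau>) (at \<tau> within {0<..<T})"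
   unfolding has_field_derivative_iff tendsto_at_iff_sequentially
  proof (intro allI impI)
   fix x :: "nat \<Rightarrow> real" assume x: "\<forall>k. x k \<in> {0<..<T} - {\<tau>}" "x \<longlonglongrightarrow> \<tau>"
   have "(\<lambda>k. (ln (x k / gth (x k) i) - ln (\<tau> / gth \<tau> i)) / (ln (x k) - ln \<tau>)) \<longlonglongrightarrow> D i"
   proof (rule LIMSEQ_subseq_criterion)
    fix g :: "nat \<Rightarrow> nat" assume g: "strict_mono g"
    have "\<exists>r D \<xi> \<eta>. strict_mono (r :: nat \<Rightarrow> nat) \<and> lin (gq \<tau>) (gz \<tau>) (gth \<tau>) \<tau> 1 D \<xi> \<eta> \<and> \<xi> 0 = 0 \<and>
      (\<forall>i<n. (\<lambda>k. (ln (x (g (r k)) / gth (x (g (r k))) i) - ln (\<tau> / gth \<tau> i)) / (ln (x (g (r k))) - ln \<tau>)) \<longlonglongrightarrow> D i)"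
     by (rule seq[of "\<lambda>k. x (g k)"]) (use x LIMSEQ_subseq_LIMSEQ[OF x(2) g] in \<open>auto simp: o_def\<close>)
    then obtain r D' \<xi>' \<eta>' where r: "strict_mono (r :: nat \<Rightarrow> nat)" "lin (gq \<tau>) (gz \<tau>) (gth \<tau>) \<tau> 1 D' \<xi>' \<eta>'" "\<xi>' 0 = 0"
      "(\<lambda>k. (ln (x (g (r k)) / gth (x (g (r k))) i) - ln (\<tau> / gth \<tau> i)) / (ln (x (g (r k))) - ln \<tau>)) \<longlonglongrightarrow> D' i" using i by blast
    have "D' i = D i" by (rule lin_unique[OF s tau(1) r(2) D(1) r(3) D(2) i])
    then show "\<exists>r. strict_mono (r :: nat \<Rightarrow> nat) \<and> (\<lambda>k. (ln (x (g (r k)) / gth (x (g (r k))) i) - ln (\<tau> / gth \<tau> i)) / (ln (x (g (r k))) - ln \<tau>)) \<longlonglongrightarrow> D i"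
     using r(1,4) by (intro exI[of _ r]) simp
   qed
   moreover have "(\<lambda>k. (ln (x k) - ln \<tau>) / (x k - \<tau>)) \<longlonglongrightarrow> 1 / \<tau>"
   proof -
    have "(ln has_real_derivative 1 / \<tau>) (at \<tau> within {0<..<T})" using tau by (auto intro!: derivative_eq_intros)
    then show ?thesis unfolding has_field_derivative_iff tendsto_at_iff_sequentially o_def using x by blast
   qed
   ultimately have "(\<lambda>k. (ln (x k / gth (x k) i) - ln (\<tau> / gth \<tau> i)) / (ln (x k) - ln \<tau>) * ((ln (x k) - ln \<tau>) / (x k - \<tau>))) \<longlonglongrightarrow> D i * (1 / \<tau>)"
    by (rule tendsto_mult)
   moreover have "(ln (x k / gth (x k) i) - ln (\<tau> / gth \<tau> i)) / (ln (x k) - ln \<tau>) * ((ln (x k) - ln \<tau>) / (x k - \<tau>))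
     = (ln (x k / gth (x k) i) - ln (\<tau> / gth \<tau> i)) / (x k - \<tau>)" for k
   proof -
    have "x k > 0" "x k \<noteq> \<tau>" using x(1) by auto
    then have "ln (x k) - ln \<tau> \<noteq> 0" using tau by simp
    then show ?thesis by simp
   qed
   ultimately show "((\<lambda>y. (ln (y / gth y i) - ln (\<tau> / gth \<tau> i)) / (y - \<tau>)) \<circ> x) \<longlonglongrightarrow> D i / \<tau>" by (simp only: o_def times_divide_eq_right mult_1_right)
  qed
  moreover have "at \<tau> within {0<..<T} = at \<tau>" using tau by (intro at_within_open) auto
  ultimately show ?thesis by simp
 qed
 with D(1) show ?thesis by (rule that)
qed

definition cdf where "cdf \<tau> = (\<Sum>i<n. \<tau> / gth \<tau> i) / real n"

theorem cdf_derivative: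
 assumes T: "\<And>s. 0 < s \<Longrightarrow> s < T \<Longrightarrow> supercritical s" and tau: "0 < \<tau>" "\<tau> < T"
 obtains D \<xi> \<eta> where "lin (gq \<tau>) (gz \<tau>) (gth \<tau>) \<tau> 1 D \<xi> \<eta>"
  "(cdf has_real_derivative (\<Sum>i<n. \<tau> / gth \<tau> i * D i) / (real n * \<tau>)) (at \<tau>)"
  "((\<lambda>s. \<Sum>i<n. 1 / gth s i) has_real_derivative (\<Sum>i<n. 1 / gth \<tau> i * (D i - 1)) / \<tau>) (at \<tau>)"
proof -
 obtain D \<xi> \<eta> where D: "lin (gq \<tau>) (gz \<tau>) (gth \<tau>) \<tau> 1 D \<xi> \<eta>"
  and d: "\<And>i. i < n \<Longrightarrow> ((\<lambda>s. ln (s / gth s i)) has_real_derivative D i / \<tau>) (at \<tau>)"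
  using level_derivative[OF T tau] by blast
 have pos: "0 < gth s i" if "0 < s" "s < T" "i < n" for s i using solD(3)[OF canon(1)[OF T[OF that(1,2)]] that(3)] .
 have ev: "\<forall>\<^sub>F s in nhds \<tau>. 0 < s \<and> s < T"
  using eventually_nhds_in_open[of "{0<..<T}" \<tau>] tau by simp
 have d1: "((\<lambda>s. s / gth s i) has_real_derivative \<tau> / gth \<tau> i * D i / \<tau>) (at \<tau>)" if i: "i < n" for i
 proof -
  have "((\<lambda>s. exp (ln (s / gth s i))) has_real_derivative exp (ln (\<tau> / gth \<tau> i)) * (D i / \<tau>)) (at \<tau>)"
   by (rule DERIV_fun_exp[OF d[OF i]])
  moreover have "\<forall>\<^sub>F s in nhds \<tau>. exp (ln (s / gth s i)) = s / gth s i"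
   using ev by eventually_elim (use pos i in simp)
  ultimately show ?thesis
   using DERIV_cong_ev[OF refl _ refl, of "\<lambda>s. exp (ln (s / gth s i))" "\<lambda>s. s / gth s i" \<tau> ]
    pos[OF tau i] tau by simp
 qed
 have "((\<lambda>s. (\<Sum>i<n. s / gth s i) / real n) has_real_derivative (\<Sum>i<n. \<tau> / gth \<tau> i * D i / \<tau>) / real n) (at \<tau>)"
  using d1 by (intro DERIV_cdivide DERIV_sum) auto
 then have c: "(cdf has_real_derivative (\<Sum>i<n. \<tau> / gth \<tau> i * D i) / (real n * \<tau>)) (at \<tau>)"
  unfolding cdf_def[abs_def] by (simp only: sum_divide_distrib[symmetric] divide_divide_eq_left mult.commute[of \<tau>])
 have d2: "((\<lambda>s. 1 / gth s i) has_real_derivative 1 / gth \<tau> i * (D i - 1) / \<tau>) (at \<tau>)" if i: "i < n" for i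
 proof -
  have "((\<lambda>s. (s / gth s i) / s) has_real_derivative ((\<tau> / gth \<tau> i * D i / \<tau>) * \<tau> - (\<tau> / gth \<tau> i) * 1) / (\<tau> * \<tau>)) (at \<tau>)"
   using tau by (intro DERIV_divide d1 i DERIV_ident) auto
  moreover have "\<forall>\<^sub>F s in nhds \<tau>. (s / gth s i) / s = 1 / gth s i"
   using ev by eventually_elim (use pos i in simp)
  moreover have "((\<tau> / gth \<tau> i * D i / \<tau>) * \<tau> - (\<tau> / gth \<tau> i) * 1) / (\<tau> * \<tau>) = 1 / gth \<tau> i * (D i - 1) / \<tau>"
   using tau pos[OF tau i] by (simp add: field_simps)
  ultimately show ?thesis
   using DERIV_cong_ev[OF refl, of "\<lambda>s. (s / gth s i) / s" "\<lambda>s. 1 / gth s i" \<tau>] by metis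
 qed
 then have "((\<lambda>s. \<Sum>i<n. 1 / gth s i) has_real_derivative (\<Sum>i<n. 1 / gth \<tau> i * (D i - 1) / \<tau>)) (at \<tau>)"
  by (intro DERIV_sum) auto
 then have "((\<lambda>s. \<Sum>i<n. 1 / gth s i) has_real_derivative (\<Sum>i<n. 1 / gth \<tau> i * (D i - 1)) / \<tau>) (at \<tau>)"
  by (simp only: sum_divide_distrib)
 with D c show ?thesis by (rule that)
qed

text \<open>The energy inequality gives \<open>\<Sum> \<tau>/\<theta> D^2 \<le> \<Sum> \<tau>/\<theta> D\<close>, and Cauchy's inequality compares this with \<open>\<Sum> m D = \<Sum> m\<close>.\<close>
lemma cdf_slope:
 assumes s: "sol \<tau> 0 q z \<theta>" and tau: "\<tau> > 0" and l: "lin q z \<theta> \<tau> 1 D \<xi> \<eta>"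
 shows "(\<Sum>i<n. 1 - \<tau> / \<theta> i)\<^sup>2 \<le> (\<Sum>i<n. (1 - \<tau> / \<theta> i)\<^sup>2 * \<theta> i) / \<tau> * (\<Sum>i<n. \<tau> / \<theta> i * D i)"
  "(\<Sum>i<n. 1 / \<theta> i * (D i - 1)) \<le> 0" "0 \<le> (\<Sum>i<n. \<tau> / \<theta> i * D i)"
proof -
 note B = solD[OF s]
 have e: "(\<Sum>i<n. \<tau> / \<theta> i * (D i)\<^sup>2) \<le> (\<Sum>i<n. \<tau> / \<theta> i * D i)"
  using lin_energy_le[OF s l] by (simp add: right_diff_distrib sum_subtractf power2_eq_square mult.assoc)
 have e0: "0 \<le> (\<Sum>i<n. \<tau> / \<theta> i * (D i)\<^sup>2)" using tau B(3) by (intro sum_nonneg mult_nonneg_nonneg) (auto simp: order_less_imp_le)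
 with e show "0 \<le> (\<Sum>i<n. \<tau> / \<theta> i * D i)" by linarith
 have "(\<Sum>i<n. 1 - \<tau> / \<theta> i) = (\<Sum>i<n. (1 - \<tau> / \<theta> i) * D i)"
  using lin_energy(1)[OF s l] by (simp add: right_diff_distrib sum_subtractf)
 also have "\<dots> = (\<Sum>i<n. ((1 - \<tau> / \<theta> i) * sqrt (\<theta> i / \<tau>)) * (sqrt (\<tau> / \<theta> i) * D i))"
 proof (rule sum.cong[OF refl])
  fix i assume "i \<in> {..<n}"
  then have "sqrt (\<theta> i / \<tau>) * sqrt (\<tau> / \<theta> i) = 1" using tau B(3)[of i] by (simp flip: real_sqrt_mult)
  moreover have "((1 - \<tau> / \<theta> i) * sqrt (\<theta> i / \<tau>)) * (sqrt (\<tau> / \<theta> i) * D i)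
    = (1 - \<tau> / \<theta> i) * D i * (sqrt (\<theta> i / \<tau>) * sqrt (\<tau> / \<theta> i))" by (simp only: mult_ac)
  ultimately show "(1 - \<tau> / \<theta> i) * D i = ((1 - \<tau> / \<theta> i) * sqrt (\<theta> i / \<tau>)) * (sqrt (\<tau> / \<theta> i) * D i)" by simp
 qed
 finally have "(\<Sum>i<n. 1 - \<tau> / \<theta> i)\<^sup>2 = (\<Sum>i<n. ((1 - \<tau> / \<theta> i) * sqrt (\<theta> i / \<tau>)) * (sqrt (\<tau> / \<theta> i) * D i))\<^sup>2" by simp
 also have "\<dots> \<le> (\<Sum>i<n. ((1 - \<tau> / \<theta> i) * sqrt (\<theta> i / \<tau>))\<^sup>2) * (\<Sum>i<n. (sqrt (\<tau> / \<theta> i) * D i)\<^sup>2)" by (rule Cauchy_Schwarz_ineq_sum)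
 also have "(\<Sum>i<n. (sqrt (\<tau> / \<theta> i) * D i)\<^sup>2) = (\<Sum>i<n. \<tau> / \<theta> i * (D i)\<^sup>2)"
  using tau B(3) by (intro sum.cong) (auto simp: power_mult_distrib order_less_imp_le)
 also have "(\<Sum>i<n. ((1 - \<tau> / \<theta> i) * sqrt (\<theta> i / \<tau>))\<^sup>2) = (\<Sum>i<n. (1 - \<tau> / \<theta> i)\<^sup>2 * \<theta> i) / \<tau>"
  unfolding sum_divide_distrib using tau B(3) by (intro sum.cong) (auto simp: power_mult_distrib order_less_imp_le)
 also have "(\<Sum>i<n. (1 - \<tau> / \<theta> i)\<^sup>2 * \<theta> i) / \<tau> * (\<Sum>i<n. \<tau> / \<theta> i * (D i)\<^sup>2) \<le> (\<Sum>i<n. (1 - \<tau> / \<theta> i)\<^sup>2 * \<theta> i) / \<tau> * (\<Sum>i<n. \<tau> / \<theta> i * D i)"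
  using e tau B(3) by (intro mult_left_mono divide_nonneg_pos sum_nonneg) (auto simp: order_less_imp_le)
 finally show "(\<Sum>i<n. 1 - \<tau> / \<theta> i)\<^sup>2 \<le> (\<Sum>i<n. (1 - \<tau> / \<theta> i)\<^sup>2 * \<theta> i) / \<tau> * (\<Sum>i<n. \<tau> / \<theta> i * D i)" .
 have "(\<Sum>i<n. \<tau> / \<theta> i * (D i - 1)) \<le> (\<Sum>i<n. \<tau> / \<theta> i * D i * (D i - 1))"
 proof (rule sum_mono)
  fix i assume "i \<in> {..<n}"
  then have "0 \<le> \<tau> / \<theta> i * (D i - 1)\<^sup>2" using tau B(3)[of i] by simp
  moreover have *: "w * D i * (D i - 1) = w * (D i - 1) + w * (D i - 1)\<^sup>2" for w :: real by (simp add: power2_eq_square algebra_simps)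
  ultimately show "\<tau> / \<theta> i * (D i - 1) \<le> \<tau> / \<theta> i * D i * (D i - 1)" unfolding * by linarith
 qed
 also have "\<dots> \<le> 0" by (rule lin_energy_le[OF s l])
 finally have "\<tau> * (\<Sum>i<n. 1 / \<theta> i * (D i - 1)) \<le> 0" by (simp add: sum_distrib_left)
 then show "(\<Sum>i<n. 1 / \<theta> i * (D i - 1)) \<le> 0" using tau by (simp add: mult_le_0_iff)
qed

end

section \<open>Admissible profiles\<close>

lemma exp_quadratic_gap:
 fixes v :: real
 assumes "\<bar>v\<bar> \<le> B"
 shows "v\<^sup>2 / 2 * exp (- B) \<le> v - 1 + exp (- v)"
proof -
 obtain t where t: "\<bar>t\<bar> \<le> \<bar>- v\<bar>" "exp (- v) = (\<Sum>m<2. (- v) ^ m / fact m) + exp t / fact 2 * (- v) ^ 2"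
  using Maclaurin_exp_le[of "- v" 2] by blast
 have "exp (- B) \<le> exp t" using t(1) assms by simp
 then have "v\<^sup>2 / 2 * exp (- B) \<le> v\<^sup>2 / 2 * exp t" by (intro mult_left_mono) auto
 then show ?thesis using t(2) by (simp add: numeral_2_eq_2 mult.commute)
qed

text \<open>The bounds for the levels and for the balance of masses at \<open>\<tau>\<close> under an admissibility constant \<open>C\<close>. In the second, \<open>\<beta>\<close> and \<open>c0\<close>
 have been chosen as simple expressions that meet the requirements on a \<open>perron_pair\<close>.\<close>
definition Theta_adm :: "real \<Rightarrow> real \<Rightarrow> real \<Rightarrow> real" where "Theta_adm S \<tau> C = \<tau> + (S * C + 1)\<^sup>2"
definition K_adm :: "real \<Rightarrow> real \<Rightarrow> real \<Rightarrow> real" where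
 "K_adm S \<tau> C = perron_pair.Cbal S \<tau> (Theta_adm S \<tau> C) ((6 + 6 * S / \<tau>)\<^sup>2) (\<tau> / (6 * S * (6 + 6 * S / \<tau>))) C
   (8 * C * (Theta_adm S \<tau> C / \<tau>)\<^sup>2)"

context profile
begin

lemma sol_theta:
 assumes s: "sol \<tau> t q z \<theta>" and i: "i < n"
 shows "\<theta> i = \<tau> + ((\<Sum>j<n. V j i * q j) + t) * ((\<Sum>j<n. V i j * z j) + t)"
proof -
 note D = solD[OF s i]
 have "(\<theta> i * q i) * (\<theta> i * z i) = \<theta> i * (q i * z i * \<theta> i)" by simp
 also have "\<dots> = \<theta> i - \<tau>" unfolding D(6) using D(3) by (simp add: right_diff_distrib)
 finally show ?thesis unfolding D(4,5) by simp
qed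

lemma sol_theta_le:
 assumes s: "sol \<tau> t q z \<theta>" and t: "0 \<le> t" "t \<le> 1" and su: "(\<Sum>i<n. q i) = (\<Sum>i<n. z i)" "(\<Sum>i<n. q i) \<le> C * real n" and i: "i < n"
 shows "\<theta> i \<le> Theta_adm S \<tau> C"
proof -
 note D = solD[OF s]
 have "(\<Sum>j<n. V j i * q j) \<le> (\<Sum>j<n. S / real n * q j)"
  using VS i D(1) by (intro sum_mono mult_right_mono) (auto simp: order_less_imp_le)
 also have "\<dots> = S / real n * (\<Sum>j<n. q j)" by (simp add: sum_distrib_left)
 also have "\<dots> \<le> S / real n * (C * real n)" using su S by (intro mult_left_mono) auto
 finally have 1: "(\<Sum>j<n. V j i * q j) + t \<le> S * C + 1" using n t by simp
 have "(\<Sum>j<n. V i j * z j) \<le> (\<Sum>j<n. S / real n * z j)"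
  using VS i D(2) by (intro sum_mono mult_right_mono) (auto simp: order_less_imp_le)
 also have "\<dots> = S / real n * (\<Sum>j<n. z j)" by (simp add: sum_distrib_left)
 also have "\<dots> \<le> S / real n * (C * real n)" using su S by (intro mult_left_mono) auto
 finally have 2: "(\<Sum>j<n. V i j * z j) + t \<le> S * C + 1" using n t by simp
 have 3: "0 \<le> (\<Sum>j<n. V j i * q j) + t" "0 \<le> (\<Sum>j<n. V i j * z j) + t"
  using V0 D(1,2) i t by (auto intro!: add_nonneg_nonneg sum_nonneg mult_nonneg_nonneg simp: order_less_imp_le)
 then have "((\<Sum>j<n. V j i * q j) + t) * ((\<Sum>j<n. V i j * z j) + t) \<le> (S * C + 1) * (S * C + 1)"
  using 1 2 by (intro mult_mono) auto
 then show ?thesis unfolding sol_theta[OF s i] Theta_adm_def power2_eq_square by simp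
qed

text \<open>With \<open>hh = \<Sum> - ln \<theta> - \<tau>/\<theta>\<close>, the entropy inequality from \<open>t\<close> to \<open>t/2\<close> bounds the increase of \<open>hh\<close> by
 a multiple of \<open>C * n * t\<close>, and the increases over \<open>t, t/2, t/4, ...\<close> add up to the same order. On the other hand \<open>hh\<close> is strictly
 convex in \<open>ln \<theta>\<close> up to a linear term, which the entropy inequality from \<open>0\<close> to \<open>t\<close> shows to have the right sign.
 So \<open>ln (\<theta>_t / \<theta>_0)\<close> is of order \<open>sqrt t\<close> in quadratic mean, and the masses are balanced.\<close>
theorem admissible_balance:
 assumes sc: "supercritical \<tau>" and C: "C > 0"
  and adm: "\<And>t q z \<theta>. 0 < t \<Longrightarrow> t \<le> 1 \<Longrightarrow> sol \<tau> t q z \<theta> \<Longrightarrow> (\<Sum>i<n. q i) \<le> C * real n"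
  and s0: "sol \<tau> 0 q z \<theta>" "(\<Sum>i<n. q i) = (\<Sum>i<n. z i)"
 shows "(\<Sum>i<n. (1 - \<tau> / \<theta> i)\<^sup>2) \<le> K_adm S \<tau> C / real n * (\<Sum>i<n. 1 - \<tau> / \<theta> i)\<^sup>2"
  "\<And>i. i < n \<Longrightarrow> \<theta> i \<le> Theta_adm S \<tau> C"
proof -
 have tau: "\<tau> > 0" using sc by (simp add: supercritical_def)
 have nn: "real n > 0" using n by simp
 define \<Theta> where "\<Theta> = Theta_adm S \<tau> C"
 have "\<exists>p. sol \<tau> t (fst p) (fst (snd p)) (snd (snd p))" if "t > 0" for t
  using sol_exists[OF tau that] by auto
 then obtain p where p: "\<And>t. t > 0 \<Longrightarrow> sol \<tau> t (fst (p t)) (fst (snd (p t))) (snd (snd (p t)))" by metis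
 define Q Z H where "Q t = fst (p t)" and "Z t = fst (snd (p t))" and "H t = snd (snd (p t))" for t
 have st: "sol \<tau> t (Q t) (Z t) (H t)" if "t > 0" for t using p[OF that] by (simp add: Q_def Z_def H_def)
 have Qs: "(\<Sum>i<n. Q t i) \<le> C * real n" if "0 < t" "t \<le> 1" for t using adm[OF that st[OF that(1)]] .
 have Qz: "(\<Sum>i<n. Q t i) = (\<Sum>i<n. Z t i)" if "0 < t" for t using sol_sum[OF st[OF that] that] .
 have Hb: "\<tau> < H t i" "H t i \<le> \<Theta>" if "0 < t" "t \<le> 1" "i < n" for t i
  using solD(8)[OF st[OF that(1)] that(3)] sol_theta_le[OF st[OF that(1)] _ that(2) Qz[OF that(1)] Qs[OF that(1,2)] that(3)] that
  by (auto simp: \<Theta>_def)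
 have conv: "(\<lambda>k. H (t / 2 ^ k) i) \<longlonglongrightarrow> \<theta> i" if t: "0 < t" "t \<le> 1" and i: "i < n" for t i
 proof -
  have tp: "0 < t / 2 ^ k" "t / 2 ^ k \<le> 1" for k :: nat
  proof -
   show "0 < t / 2 ^ k" using t by simp
   have "t / 2 ^ k \<le> t / 1" using t by (intro divide_left_mono) auto
   then show "t / 2 ^ k \<le> 1" using t(2) unfolding div_by_1 by linarith
  qed
  have "(\<lambda>k. t * (1 / 2) ^ k) \<longlonglongrightarrow> t * 0" by (intro tendsto_mult tendsto_const LIMSEQ_realpow_zero) auto
  then have l: "(\<lambda>k. t / 2 ^ k) \<longlonglongrightarrow> 0" by (simp add: power_divide)
  show ?thesis
   by (rule sol_converges(3)[OF sc tendsto_const l _ tp(2) st[OF tp(1)] Qz[OF tp(1)] tau s0 i])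
     (use tp in \<open>simp add: order_less_imp_le\<close>)
 qed
 have thb: "\<tau> < \<theta> i" "\<theta> i \<le> \<Theta>" if i: "i < n" for i
 proof -
  show "\<tau> < \<theta> i" using solD(8)[OF s0(1) i] .
  show "\<theta> i \<le> \<Theta>"
  proof (rule LIMSEQ_le_const2[OF conv[of 1 i]])
   have "H (1 / 2 ^ k) i \<le> \<Theta>" for k :: nat by (rule Hb(2)) (use i in \<open>auto simp: field_simps\<close>)
   then show "\<exists>N. \<forall>k\<ge>N. H (1 / 2 ^ k) i \<le> \<Theta>" by blast
  qed (use i in auto)
 qed
 then show "\<And>i. i < n \<Longrightarrow> \<theta> i \<le> Theta_adm S \<tau> C" by (simp add: \<Theta>_def)
 define hh where "hh f = (\<Sum>i<n. - ln (f i) - \<tau> / f i)" for f :: "nat \<Rightarrow> real"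
 have step: "hh (H (t / 2)) - hh (H t) \<le> 2 * C * real n * t" if t: "0 < t" "t \<le> 1" for t
 proof -
  have t2: "0 < t / 2" "t / 2 \<le> 1" using t by auto
  note D = solD[OF st[OF t(1)]] and D2 = solD[OF st[OF t2(1)]]
  have "t * (\<Sum>i<n. Q t i * ln ((t / 2) / t)) - t * (\<Sum>j<n. Z t j * ln (Z (t / 2) j / Z t j)) \<le> (\<Sum>i<n. (1 - \<tau> / H t i) * ln (H (t / 2) i / H t i))"
   by (rule sol_star[OF st[OF t(1)]]) (use t D2 in auto)
  moreover have "t * (\<Sum>i<n. Q t i * ln ((t / 2) / t)) \<ge> - (t * (C * real n))"
  proof -
   have "ln ((t / 2) / t) = - ln 2" using t by (simp add: ln_div)
   then have "(\<Sum>i<n. Q t i * ln ((t / 2) / t)) = - (ln 2 * (\<Sum>i<n. Q t i))" by (simp add: sum_negf sum_distrib_left mult.commute)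
   moreover have "ln 2 * (\<Sum>i<n. Q t i) \<le> 1 * (\<Sum>i<n. Q t i)"
    using D(1) ln_2_less_1 by (intro mult_right_mono sum_nonneg) (auto simp: order_less_imp_le)
   ultimately have "- (C * real n) \<le> (\<Sum>i<n. Q t i * ln ((t / 2) / t))" using Qs[OF t] by linarith
   then have "t * (- (C * real n)) \<le> t * (\<Sum>i<n. Q t i * ln ((t / 2) / t))" using t by (intro mult_left_mono) auto
   then show ?thesis by simp
  qed
  moreover have "t * (\<Sum>j<n. Z t j * ln (Z (t / 2) j / Z t j)) \<le> t * (C * real n)"
  proof (rule mult_left_mono)
   have "(\<Sum>j<n. Z t j * ln (Z (t / 2) j / Z t j)) \<le> (\<Sum>j<n. Z (t / 2) j - Z t j)"
   proof (rule sum_mono)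
    fix j assume "j \<in> {..<n}" then have z: "0 < Z t j" "0 < Z (t / 2) j" using D(2) D2(2) by auto
    have "Z t j * ln (Z (t / 2) j / Z t j) \<le> Z t j * (Z (t / 2) j / Z t j - 1)" using z by (intro mult_left_mono ln_le_minus_one) auto
    also have "\<dots> = Z (t / 2) j - Z t j" using z by (simp add: field_simps)
    finally show "Z t j * ln (Z (t / 2) j / Z t j) \<le> Z (t / 2) j - Z t j" .
   qed
   also have "\<dots> \<le> (\<Sum>j<n. Z (t / 2) j)" using D(2) by (intro sum_mono) (auto simp: order_less_imp_le)
   finally show "(\<Sum>j<n. Z t j * ln (Z (t / 2) j / Z t j)) \<le> C * real n" using Qs[OF t2] Qz[OF t2(1)] by linarith
  qed (use t in simp)
  moreover have lin_step: "- a - w * e - (- b - w) \<le> - ((1 - w) * v)" if "v = a - b" "w * (1 - v) \<le> w * e" for a b v w e :: real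
   using that by (simp add: algebra_simps)
  moreover have "hh (H (t / 2)) - hh (H t) \<le> - (\<Sum>i<n. (1 - \<tau> / H t i) * ln (H (t / 2) i / H t i))"
   unfolding hh_def sum_subtractf[symmetric] sum_negf[symmetric]
  proof (rule sum_mono)
   fix i assume "i \<in> {..<n}" then have x: "0 < H t i" "0 < H (t / 2) i" using D(3) D2(3) by auto
   define v where "v = ln (H (t / 2) i / H t i)"
   have v: "v = ln (H (t / 2) i) - ln (H t i)" using x by (simp add: v_def ln_div)
   have "exp (- v) = H t i / H (t / 2) i" using x by (simp add: v_def exp_minus)
   then have e: "\<tau> / H (t / 2) i = \<tau> / H t i * exp (- v)" using x by simp
   have "\<tau> / H t i * (1 - v) \<le> \<tau> / H t i * exp (- v)" using tau x exp_ge_add_one_self[of "- v"] by (intro mult_left_mono) auto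
   then show "- ln (H (t / 2) i) - \<tau> / H (t / 2) i - (- ln (H t i) - \<tau> / H t i) \<le> - ((1 - \<tau> / H t i) * ln (H (t / 2) i / H t i))"
    unfolding v_def[symmetric] e using lin_step[OF v] by blast
  qed
  ultimately show ?thesis by (simp add: mult_ac)
 qed
 have tele: "hh (H (t / 2 ^ k)) - hh (H t) \<le> 2 * C * real n * t * (2 - 2 / 2 ^ k)" if t: "0 < t" "t \<le> 1" for t k
 proof (induction k)
  case 0 then show ?case by simp
 next
  case (Suc k)
  have "t / 2 ^ k \<le> t / 1" using t by (intro divide_left_mono) auto
  then have "t / 2 ^ k \<le> 1" using t(2) unfolding div_by_1 by linarith
  moreover have "0 < t / 2 ^ k" using t by simp
  ultimately have "0 < t / 2 ^ k" "t / 2 ^ k \<le> 1" by blast+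
  from step[OF this] have "hh (H (t / 2 ^ Suc k)) - hh (H (t / 2 ^ k)) \<le> 2 * C * real n * (t / 2 ^ k)" by (simp add: mult.commute)
  then have "hh (H (t / 2 ^ Suc k)) - hh (H t) \<le> 2 * C * real n * t * (2 - 2 / 2 ^ k) + 2 * C * real n * (t / 2 ^ k)" using Suc by linarith
  also have "\<dots> = 2 * C * real n * t * (2 - 2 / 2 ^ Suc k)" by (simp add: field_simps)
  finally show ?case .
 qed
 have h0: "hh \<theta> - hh (H t) \<le> 4 * C * real n * t" if t: "0 < t" "t \<le> 1" for t
 proof (rule LIMSEQ_le_const2)
  show "(\<lambda>k. hh (H (t / 2 ^ k)) - hh (H t)) \<longlonglongrightarrow> hh \<theta> - hh (H t)"
   unfolding hh_def using conv[OF t] thb tau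
   by (intro tendsto_diff tendsto_sum tendsto_minus tendsto_ln tendsto_divide tendsto_const) force+
  have "hh (H (t / 2 ^ k)) - hh (H t) \<le> 4 * C * real n * t" for k
  proof -
   have "2 * C * real n * t * (2 - 2 / 2 ^ k) \<le> 2 * C * real n * t * 2" using C t by (intro mult_left_mono) auto
   then show ?thesis using tele[OF t, of k] by linarith
  qed
  then show "\<exists>N. \<forall>k\<ge>N. hh (H (t / 2 ^ k)) - hh (H t) \<le> 4 * C * real n * t" by blast
 qed
 have Tp: "\<Theta> > 0" using thb[OF n] tau by linarith
 have sq: "(\<Sum>i<n. (ln (H t i / \<theta> i))\<^sup>2) \<le> 8 * C * (\<Theta> / \<tau>)\<^sup>2 * real n * t" if t: "0 < t" "t \<le> 1" for t
 proof -
  define v where "v i = ln (H t i / \<theta> i)" for i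
  note D = solD[OF st[OF t(1)]] and D0 = solD[OF s0(1)]
  have "0 * (\<Sum>i<n. q i * ln (t / 0)) - 0 * (\<Sum>j<n. z j * ln (Z t j / z j)) \<le> (\<Sum>i<n. (1 - \<tau> / \<theta> i) * ln (H t i / \<theta> i))"
   by (rule sol_star[OF s0(1)]) (use t D in auto)
  then have mv: "0 \<le> (\<Sum>i<n. (1 - \<tau> / \<theta> i) * v i)" by (simp add: v_def)
  have "hh \<theta> - hh (H t) = (\<Sum>i<n. (1 - \<tau> / \<theta> i) * v i) + (\<Sum>i<n. \<tau> / \<theta> i * (v i - 1 + exp (- v i)))"
   unfolding hh_def sum_subtractf[symmetric] sum.distrib[symmetric]
  proof (rule sum.cong[OF refl])
   fix i assume "i \<in> {..<n}" then have x: "0 < \<theta> i" "0 < H t i" using D(3) D0(3) by auto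
   have v: "v i = ln (H t i) - ln (\<theta> i)" using x by (simp add: v_def ln_div)
   have "exp (- v i) = \<theta> i / H t i" using x by (simp add: v_def exp_minus)
   then have e: "\<tau> / H t i = \<tau> / \<theta> i * exp (- v i)" using x by simp
   show "- ln (\<theta> i) - \<tau> / \<theta> i - (- ln (H t i) - \<tau> / H t i) = (1 - \<tau> / \<theta> i) * v i + \<tau> / \<theta> i * (v i - 1 + exp (- v i))"
    unfolding e v by (simp add: algebra_simps)
  qed
  moreover have "(\<Sum>i<n. (\<tau> / \<Theta>) * ((v i)\<^sup>2 / 2 * (\<tau> / \<Theta>))) \<le> (\<Sum>i<n. \<tau> / \<theta> i * (v i - 1 + exp (- v i)))"
  proof (rule sum_mono)
   fix i assume "i \<in> {..<n}" then have i: "i < n" by simp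
   have x: "0 < \<theta> i" "0 < H t i" using D(3) D0(3) i by auto
   have ln4: "ln \<tau> \<le> ln (\<theta> i)" "ln (\<theta> i) \<le> ln \<Theta>" "ln \<tau> \<le> ln (H t i)" "ln (H t i) \<le> ln \<Theta>"
    using thb[OF i] Hb[OF t i] tau by (auto intro!: ln_mono)
   have "v i = ln (H t i) - ln (\<theta> i)" using x by (simp add: v_def ln_div)
   then have "\<bar>v i\<bar> \<le> ln (\<Theta> / \<tau>)" using ln4 Tp tau by (simp add: ln_div)
   from exp_quadratic_gap[OF this] have "(v i)\<^sup>2 / 2 * (\<tau> / \<Theta>) \<le> v i - 1 + exp (- v i)"
    using Tp tau by (simp add: exp_minus)
   moreover have "\<tau> / \<Theta> \<le> \<tau> / \<theta> i" using thb[OF i] tau x by (intro divide_left_mono) auto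
   moreover have "0 \<le> (v i)\<^sup>2 / 2 * (\<tau> / \<Theta>)" using tau Tp by simp
   ultimately show "(\<tau> / \<Theta>) * ((v i)\<^sup>2 / 2 * (\<tau> / \<Theta>)) \<le> \<tau> / \<theta> i * (v i - 1 + exp (- v i))"
    using tau Tp x by (intro mult_mono) auto
  qed
  ultimately have "(\<Sum>i<n. (\<tau> / \<Theta>) * ((v i)\<^sup>2 / 2 * (\<tau> / \<Theta>))) \<le> 4 * C * real n * t" using h0[OF t] mv by linarith
  moreover have "(\<Sum>i<n. (\<tau> / \<Theta>) * ((v i)\<^sup>2 / 2 * (\<tau> / \<Theta>))) = (\<tau> / \<Theta>)\<^sup>2 / 2 * (\<Sum>i<n. (v i)\<^sup>2)"
  proof -
   have "r * (y / 2 * r) = r\<^sup>2 / 2 * y" for r y :: real by (simp add: power2_eq_square)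
   then show ?thesis by (simp only: sum_distrib_left)
  qed
  ultimately have "(\<tau> / \<Theta>)\<^sup>2 / 2 * (\<Sum>i<n. (v i)\<^sup>2) \<le> 4 * C * real n * t" by simp
  then have "2 * (\<Theta> / \<tau>)\<^sup>2 * ((\<tau> / \<Theta>)\<^sup>2 / 2 * (\<Sum>i<n. (v i)\<^sup>2)) \<le> 2 * (\<Theta> / \<tau>)\<^sup>2 * (4 * C * real n * t)"
   by (intro mult_left_mono) auto
  moreover have "2 * (\<Theta> / \<tau>)\<^sup>2 * ((\<tau> / \<Theta>)\<^sup>2 / 2 * (\<Sum>i<n. (v i)\<^sup>2)) = (\<Sum>i<n. (v i)\<^sup>2)"
   using tau Tp by (simp add: power_divide field_simps)
  ultimately have "(\<Sum>i<n. (v i)\<^sup>2) \<le> 2 * (\<Theta> / \<tau>)\<^sup>2 * (4 * C * real n * t)" by linarith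
  then show ?thesis by (simp add: v_def mult_ac)
 qed
 define b where "b = 6 + 6 * S / \<tau>"
 have b: "b > 0" "b \<ge> 6" "6 * S / \<tau> \<le> b" using S tau by (auto simp: b_def intro: add_pos_pos)
 define \<beta> c0 where "\<beta> = b\<^sup>2" and "c0 = \<tau> / (6 * S * b)"
 interpret P: perron_pair n V q z \<theta> S \<tau> \<Theta> \<beta> c0
 proof
  show "sqrt \<beta> \<ge> 6" "sqrt \<beta> \<ge> 6 * S / \<tau>" using b by (simp_all add: \<beta>_def)
  have "1 * 1 \<le> b * b" using b by (intro mult_mono) auto
  then show "\<beta> \<ge> 1" by (simp add: \<beta>_def power2_eq_square)
  show "c0 > 0" using tau S b by (simp add: c0_def)
  show "S * c0 * sqrt \<beta> \<le> \<tau> / 6" using tau S b by (simp add: c0_def \<beta>_def)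
 qed (use n S tau V solD[OF s0(1)] thb in \<open>auto simp: order_less_imp_le\<close>)
 have "P.solvable C (8 * C * (\<Theta> / \<tau>)\<^sup>2)" unfolding P.solvable_def
 proof (intro allI impI)
  fix t :: real assume t: "0 < t \<and> t \<le> 1"
  note D = solD[OF st[of t]]
  show "\<exists>Z \<theta>'. (\<forall>j<n. 0 < Z j \<and> 0 < \<theta>' j \<and> \<theta>' j * Z j = (\<Sum>k<n. V j k * Z k) + t) \<and> sum Z {..<n} \<le> C * real n \<and>
    (\<Sum>j<n. (ln (\<theta>' j / \<theta> j))\<^sup>2) \<le> 8 * C * (\<Theta> / \<tau>)\<^sup>2 * real n * t"
   using t D sq Qs[of t] Qz[of t] by (intro exI[of _ "Z t"] exI[of _ "H t"]) auto
 qed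
 then have "(\<Sum>i<n. (P.mass i)\<^sup>2) \<le> P.Cbal C (8 * C * (\<Theta> / \<tau>)\<^sup>2) / real n * (\<Sum>i<n. P.mass i)\<^sup>2"
  using C tau Tp by (intro P.mass_balance) auto
 moreover have "P.mass i = 1 - \<tau> / \<theta> i" if "i < n" for i using solD(6)[OF s0(1) that] by (simp add: P.mass_def)
 ultimately show "(\<Sum>i<n. (1 - \<tau> / \<theta> i)\<^sup>2) \<le> K_adm S \<tau> C / real n * (\<Sum>i<n. 1 - \<tau> / \<theta> i)\<^sup>2"
  by (simp add: K_adm_def \<Theta>_def \<beta>_def b_def c0_def)
qed

end

section \<open>Profiles with a fully indecomposable block structure\<close>

lemma level_has_integral:
 fixes a b c :: real
 assumes "a \<le> c" "c \<le> b"
 shows "((\<lambda>x. if x \<le> c then 1 else 0) has_integral (c - a)) {a..b}"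
proof -
 have "((\<lambda>x. 1) has_integral (c - a)) {a..c}" using has_integral_const_real[of "1::real" a c] assms by simp
 then have "((\<lambda>x. if x \<in> {a..c} then 1 else 0) has_integral (c - a)) {a..b}"
  using assms by (subst has_integral_restrict) auto
 then show ?thesis by (rule has_integral_eq[rotated]) auto
qed

text \<open>Compare level sets. Strictly between the extreme values of \<open>L\<close>, the superlevel set \<open>J\<close> of \<open>L\<close> is a nonempty proper subset, and by full
 indecomposability it has strictly more neighbours than elements. All these neighbours lie in the superlevel set of \<open>M\<close>.
 Integrating over the levels makes the excess of one element into the difference of the extreme values.\<close>
lemma fully_indecomposable_spread:
 fixes N :: "nat \<Rightarrow> nat \<Rightarrow> bool" and L M :: "nat \<Rightarrow> real"
 assumes FI: "\<And>I J. I \<noteq> {} \<Longrightarrow> J \<noteq> {} \<Longrightarrow> I \<subseteq> {..<K} \<Longrightarrow> J \<subseteq> {..<K} \<Longrightarrow> K \<le> card I + card J \<Longrightarrow> \<exists>i\<in>I. \<exists>j\<in>J. N i j"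
  and M: "\<And>i j. i < K \<Longrightarrow> j < K \<Longrightarrow> N i j \<Longrightarrow> L j \<le> M i" and a: "a < K" and b: "b < K"
 shows "(\<Sum>i<K. L i) + (L a - L b) \<le> (\<Sum>i<K. M i)"
proof -
 define mn mx where "mn = Min (L ` {..<K})" and "mx = Max (L ` {..<K})"
 have ne: "L ` {..<K} \<noteq> {}" using a by auto
 have Lb: "mn \<le> L j" "L j \<le> mx" if "j < K" for j using that by (auto simp: mn_def mx_def)
 have mm: "mn \<le> mx" using Lb[OF a] by linarith
 have Mn: "mn \<le> M i" if i: "i < K" for i
 proof -
  have "\<exists>i'\<in>{i}. \<exists>j\<in>{..<K}. N i' j" using i by (intro FI) auto
  then show ?thesis using M[OF i] Lb by force
 qed
 have count: "(if x = mn then 0 else 1) + (\<Sum>j<K. if x \<le> L j then 1 else 0) \<le> (\<Sum>i<K. if x \<le> min (M i) mx then 1 else (0::real))"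
  if x: "x \<in> {mn..mx}" for x
 proof (cases "x = mn")
  case True
  then show ?thesis using Lb Mn mm by (simp)
 next
  case False
  define J where "J = {j. j < K \<and> x \<le> L j}"
  define I where "I = {i. i < K \<and> (\<forall>j\<in>J. \<not> N i j)}"
  have fin: "finite I" "finite J" "I \<subseteq> {..<K}" "J \<subseteq> {..<K}" by (auto simp: I_def J_def)
  have "mx \<in> L ` {..<K}" "mn \<in> L ` {..<K}" unfolding mn_def mx_def by (rule Max_in Min_in, simp, rule ne)+
  then obtain j0 j1 where j: "j0 < K" "mx = L j0" "j1 < K" "mn = L j1" unfolding image_iff lessThan_iff by blast
  have "x \<le> L j0" "\<not> x \<le> L j1" using j(2,4) x False unfolding atLeastAtMost_iff by linarith+
  then have "j0 \<in> J" "j1 \<notin> J" using j by (simp_all add: J_def)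
  then have J: "J \<noteq> {}" "J \<noteq> {..<K}" using j(3) by auto
  then have cJ: "card J < K" using fin psubset_card_mono[of "{..<K}" J] by auto
  have cI: "card I + card J < K"
  proof (cases "I = {}")
   case True then show ?thesis using cJ by simp
  next
   case I: False
   show ?thesis
   proof (rule ccontr)
    assume "\<not> card I + card J < K"
    then have "\<exists>i\<in>I. \<exists>j\<in>J. N i j" using I J fin by (intro FI) auto
    then show False by (auto simp: I_def)
   qed
  qed
  have sJ: "(\<Sum>j<K. if x \<le> L j then 1 else 0) = real (card J)"
  proof -
   have "{..<K} \<inter> {j. x \<le> L j} = J" by (auto simp: J_def)
   then show ?thesis by (simp add: sum.If_cases)
  qed
  have "real (card ({..<K} - I)) = (\<Sum>i\<in>{..<K} - I. 1)" by simp
  also have "\<dots> \<le> (\<Sum>i\<in>{..<K} - I. if x \<le> min (M i) mx then 1 else 0)"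
  proof (rule sum_mono)
   fix i assume "i \<in> {..<K} - I"
   then obtain j where "i < K" "j \<in> J" "N i j" by (auto simp: I_def)
   then have "x \<le> M i" using M[of i j] by (auto simp: J_def)
   then show "1 \<le> (if x \<le> min (M i) mx then 1 else (0::real))" using x by simp
  qed
  also have "\<dots> \<le> (\<Sum>i<K. if x \<le> min (M i) mx then 1 else 0)" by (intro sum_mono2) auto
  also have "card ({..<K} - I) = K - card I" using fin by (simp add: card_Diff_subset)
  finally show ?thesis using cI False unfolding sJ by simp
 qed
 have "(mx - mn) + (\<Sum>j<K. L j - mn) \<le> (\<Sum>i<K. min (M i) mx - mn)"
 proof (rule has_integral_le[OF _ _ count])
  have "((\<lambda>x. 1) has_integral (mx - mn)) {mn..mx}" using has_integral_const_real[of "1::real" mn mx] mm by simp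
  then have "((\<lambda>x. if x = mn then 0 else 1) has_integral (mx - mn)) {mn..mx}"
   by (rule has_integral_spike[of "{mn}", rotated 2]) auto
  then show "((\<lambda>x. (if x = mn then 0 else 1) + (\<Sum>j<K. if x \<le> L j then 1 else 0)) has_integral (mx - mn) + (\<Sum>j<K. L j - mn)) {mn..mx}"
   using Lb by (intro has_integral_add has_integral_sum level_has_integral) auto
  show "((\<lambda>x. \<Sum>i<K. if x \<le> min (M i) mx then 1 else 0) has_integral (\<Sum>i<K. min (M i) mx - mn)) {mn..mx}"
   using Mn mm by (intro has_integral_sum level_has_integral) auto
 qed
 also have "\<dots> \<le> (\<Sum>i<K. M i - mn)" by (intro sum_mono) auto
 finally have "(mx - mn) + (\<Sum>j<K. L j) \<le> (\<Sum>i<K. M i)" by (simp add: sum_subtractf)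
 moreover have "L a \<le> mx" "mn \<le> L b" using Lb a b by auto
 ultimately show ?thesis by linarith
qed

text \<open>The pattern is a relation \<open>N\<close> between block indices rather than a zero-one matrix.\<close>
locale block_profile = profile +
 fixes \<phi> :: real and K :: nat and B :: "nat \<Rightarrow> nat set" and N :: "nat \<Rightarrow> nat \<Rightarrow> bool"
 assumes phi: "\<phi> > 0" and K: "K \<ge> 1" and Kn: "K dvd n"
  and FI: "\<And>I J. I \<noteq> {} \<Longrightarrow> J \<noteq> {} \<Longrightarrow> I \<subseteq> {..<K} \<Longrightarrow> J \<subseteq> {..<K} \<Longrightarrow> K \<le> card I + card J \<Longrightarrow> \<exists>i\<in>I. \<exists>j\<in>J. N i j"
  and UB: "(\<Union>i<K. B i) = {..<n}" and dB: "disjoint_family_on B {..<K}" and cB: "\<And>i. i < K \<Longrightarrow> card (B i) = n div K"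
  and low: "\<And>i j x y. i < K \<Longrightarrow> j < K \<Longrightarrow> N i j \<Longrightarrow> x \<in> B i \<Longrightarrow> y \<in> B j \<Longrightarrow> \<phi> / real n \<le> V x y"
begin

lemma dual_block: "block_profile n (\<lambda>i j. V j i) S \<phi> K B (\<lambda>i j. N j i)"
proof -
 interpret dual: profile n "\<lambda>i j. V j i" S by (rule dual_profile)
 show ?thesis
 proof
  fix I J :: "nat set" assume "I \<noteq> {}" "J \<noteq> {}" "I \<subseteq> {..<K}" "J \<subseteq> {..<K}" "K \<le> card I + card J"
  then have "\<exists>i\<in>J. \<exists>j\<in>I. N i j" by (intro FI) auto
  then show "\<exists>i\<in>I. \<exists>j\<in>J. N j i" by blast
 qed (use phi K Kn UB dB cB low in auto)
qed

lemma Kp: "real K > 0" using K by simp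
lemma block_size: "real (n div K) = real n / real K" using Kn by (simp add: real_of_nat_div)
lemma block_sub: "i < K \<Longrightarrow> B i \<subseteq> {..<n}" using UB by blast
lemma block_fin: "i < K \<Longrightarrow> finite (B i)" using block_sub finite_subset by blast
lemma block_card: "i < K \<Longrightarrow> real (card (B i)) = real n / real K" using cB block_size by simp
lemma block_ne: "i < K \<Longrightarrow> B i \<noteq> {}" using block_card[of i] n Kp by auto

lemma sum_blocks: "(\<Sum>i<K. \<Sum>x\<in>B i. f x) = (\<Sum>x<n. f x)" for f :: "nat \<Rightarrow> real"
 unfolding UB[symmetric] using block_fin dB by (intro sum.UNION_disjoint[symmetric]) (auto simp: disjoint_family_on_def)

lemma neighbour: "i < K \<Longrightarrow> \<exists>j<K. N i j"
 using FI[of "{i}" "{..<K}"] by auto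

text \<open>Full indecomposability passes from the pattern to \<open>V\<close>. Since the blocks have equal size, the sets of blocks met by \<open>I\<close> and by \<open>J\<close> are
 large enough together for the pattern to have an entry between them.\<close>
lemma FI_n:
 assumes I: "I \<noteq> {}" "I \<subseteq> {..<n}" and J: "J \<noteq> {}" "J \<subseteq> {..<n}" and c: "n \<le> card I + card J"
 shows "\<exists>x\<in>I. \<exists>y\<in>J. V x y > 0"
proof -
 define P where "P I = {a. a < K \<and> B a \<inter> I \<noteq> {}}" for I
 have P: "real (card I) \<le> real (card (P I)) * (real n / real K)" "P I \<noteq> {}" if "I \<noteq> {}" "I \<subseteq> {..<n}" for I
 proof -
  have sub: "I \<subseteq> (\<Union>a\<in>P I. B a)" using that UB by (auto simp: P_def)
  then show "P I \<noteq> {}" using that by auto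
  have fP: "finite (P I)" by (simp add: P_def)
  have "card I \<le> card (\<Union>a\<in>P I. B a)" using sub fP block_fin by (intro card_mono) (auto simp: P_def)
  also have "\<dots> \<le> (\<Sum>a\<in>P I. card (B a))" using fP by (rule card_UN_le)
  also have "\<dots> = card (P I) * (n div K)" using cB by (simp add: P_def)
  finally have "real (card I) \<le> real (card (P I) * (n div K))" by (rule of_nat_mono)
  then show "real (card I) \<le> real (card (P I)) * (real n / real K)" by (simp add: block_size)
 qed
 have "real n \<le> real (card I) + real (card J)" using c by simp
 also have "\<dots> \<le> real (card (P I) + card (P J)) * (real n / real K)"
  using P(1)[OF I] P(1)[OF J] unfolding of_nat_add distrib_right by linarith
 finally have "real K * real n \<le> real (card (P I) + card (P J)) * real n" using Kp by (simp add: field_simps)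
 then have "K \<le> card (P I) + card (P J)" using n by simp
 then have "\<exists>i\<in>P I. \<exists>j\<in>P J. N i j" using P(2)[OF I] P(2)[OF J] by (intro FI) (auto simp: P_def)
 then obtain a b x y where "a < K" "b < K" "N a b" "x \<in> B a" "x \<in> I" "y \<in> B b" "y \<in> J" by (auto simp: P_def)
 moreover from this have "\<phi> / real n \<le> V x y" using low by blast
 moreover have "\<phi> / real n > 0" using phi n by simp
 ultimately show ?thesis by (metis less_le_trans)
qed

text \<open>To the mass weighted bound \<open>theta_sum\<close> add \<open>\<tau>/\<theta> * ln \<theta> \<le> \<tau>\<close>.\<close>
lemma theta_log:
 assumes s: "sol \<tau> 0 q z \<theta>" and tau: "\<tau> > 0"
 shows "(\<Sum>i<n. ln (\<theta> i)) \<le> real n * (\<bar>ln S\<bar> + \<tau>)"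
proof -
 note D = solD[OF s]
 have "(\<Sum>i<n. ln (\<theta> i)) = (\<Sum>i<n. (1 - \<tau> / \<theta> i) * ln (\<theta> i)) + (\<Sum>i<n. \<tau> / \<theta> i * ln (\<theta> i))"
  by (simp add: left_diff_distrib flip: sum.distrib)
 also have "(\<Sum>i<n. (1 - \<tau> / \<theta> i) * ln (\<theta> i)) \<le> (\<Sum>i<n. 1 - \<tau> / \<theta> i) * ln S" using theta_sum[OF s] by simp
 also have "\<dots> \<le> (\<Sum>i<n. 1 - \<tau> / \<theta> i) * \<bar>ln S\<bar>" using D(7) by (intro mult_left_mono sum_nonneg) (auto simp: order_less_imp_le)
 also have "\<dots> \<le> real n * \<bar>ln S\<bar>"
  using sum_bounded_above[of "{..<n}" "\<lambda>i. 1 - \<tau> / \<theta> i" 1] D(3) tau by (intro mult_right_mono) (auto simp: order_less_imp_le)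
 also have "(\<Sum>i<n. \<tau> / \<theta> i * ln (\<theta> i)) \<le> (\<Sum>i<n. \<tau>)"
 proof (rule sum_mono)
  fix i assume "i \<in> {..<n}" then have t: "\<theta> i > 0" using D(3) by simp
  have "\<tau> / \<theta> i * ln (\<theta> i) \<le> \<tau> / \<theta> i * \<theta> i" using t tau ln_le_minus_one[OF t] by (intro mult_left_mono) auto
  then show "\<tau> / \<theta> i * ln (\<theta> i) \<le> \<tau>" using t by simp
 qed
 finally show ?thesis by (simp add: distrib_left)
qed

text \<open>Bounds that are uniform for \<open>\<tau> \<le> T\<close> and independent of \<open>n\<close>: for ratios of block means, for \<open>\<theta> z\<close> relative to the mean of \<open>z\<close>, for ratios
 of levels and masses, and for the levels from above and below.\<close>
definition E where "E T = exp (real K * (\<bar>ln S\<bar> + T + \<bar>ln (\<phi> / real K)\<bar>))"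
definition lo where "lo T = \<phi> / (real K * E T)"
definition rat where "rat T = (S / lo T)\<^sup>2"
definition Tup where "Tup T = rat T * exp (\<bar>ln S\<bar> + T)"
definition Tlo where "Tlo T = \<phi> / (real K * (E T)\<^sup>2 * rat T)"

lemma E_pos: "E T > 0" by (simp add: E_def)
lemma lo_pos: "lo T > 0" using phi Kp E_pos by (simp add: lo_def)
lemma rat_pos: "rat T > 0" using S lo_pos[of T] by (simp add: rat_def)

text \<open>For \<open>N i j\<close> every row in block \<open>i\<close> dominates the mean of \<open>z\<close> over block \<open>j\<close>. The logarithms, averaged over block \<open>i\<close>, give the
 hypothesis of \<open>fully_indecomposable_spread\<close> with an excess of at most the mean of \<open>ln \<theta>\<close>.\<close>
lemma block_means:
 assumes s: "sol \<tau> 0 q z \<theta>" and tau: "0 < \<tau>" "\<tau> \<le> T" and i: "i < K"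
 shows "(\<Sum>x\<in>B i. z x) \<le> E T * ((\<Sum>x<n. z x) / real K)" "(\<Sum>x<n. z x) / real K \<le> E T * (\<Sum>x\<in>B i. z x)"
proof -
 note D = solD[OF s]
 have nn: "real n > 0" using n by simp
 define c where "c = real n / real K"
 have c: "c > 0" using nn Kp by (simp add: c_def)
 define \<zeta> where "\<zeta> i = (\<Sum>x\<in>B i. z x) / c" for i
 have zp: "0 < \<zeta> i" if "i < K" for i unfolding \<zeta>_def
  using c D(2) block_sub[OF that] block_ne[OF that] block_fin[OF that] by (intro divide_pos_pos sum_pos) auto
 define L where "L i = ln (\<zeta> i)" for i
 define M where "M i = (\<Sum>x\<in>B i. ln (\<theta> x)) / c + L i - ln (\<phi> / real K)" for i
 have LM: "L j \<le> M i" if ij: "i < K" "j < K" "N i j" for i j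
 proof -
  have "c * (ln (\<phi> / real K) + L j) = (\<Sum>x\<in>B i. ln (\<phi> / real K) + L j)" using block_card[OF ij(1)] by (simp add: c_def)
  also have "\<dots> \<le> (\<Sum>x\<in>B i. ln (\<theta> x) + ln (z x))"
  proof (rule sum_mono)
   fix x assume x: "x \<in> B i" then have xn: "x < n" using block_sub[OF ij(1)] by auto
   have "\<phi> / real K * \<zeta> j = (\<Sum>y\<in>B j. \<phi> / real n * z y)"
    unfolding sum_distrib_left[symmetric] using nn Kp by (simp add: \<zeta>_def c_def)
   also have "\<dots> \<le> (\<Sum>y\<in>B j. V x y * z y)"
    using low[OF ij x] D(2) block_sub[OF ij(2)] by (intro sum_mono mult_right_mono) (auto simp: order_less_imp_le subset_iff)
   also have "\<dots> \<le> (\<Sum>y<n. V x y * z y)"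
    using block_sub[OF ij(2)] V0[OF xn] D(2) by (intro sum_mono2) (auto simp: order_less_imp_le)
   also have "\<dots> = \<theta> x * z x" using D(5)[OF xn] by simp
   finally have "ln (\<phi> / real K * \<zeta> j) \<le> ln (\<theta> x * z x)" using phi Kp zp[OF ij(2)] by (intro ln_mono) auto
   then show "ln (\<phi> / real K) + L j \<le> ln (\<theta> x) + ln (z x)"
    unfolding L_def using ln_mult_pos[of "\<phi> / real K" "\<zeta> j"] ln_mult_pos[of "\<theta> x" "z x"] phi Kp zp[OF ij(2)] D(2,3)[OF xn]
    by (simp del: ln_mult)
  qed
  also have "\<dots> = (\<Sum>x\<in>B i. ln (\<theta> x)) + (\<Sum>x\<in>B i. 1 * ln (z x))" by (simp add: sum.distrib)
  also have "(\<Sum>x\<in>B i. 1 * ln (z x)) \<le> (\<Sum>x\<in>B i. 1) * ln ((\<Sum>x\<in>B i. 1 * z x) / (\<Sum>x\<in>B i. 1))"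
   using block_fin[OF ij(1)] block_ne[OF ij(1)] D(2) block_sub[OF ij(1)] by (intro weighted_ln_le) auto
  also have "\<dots> = c * L i" using block_card[OF ij(1)] by (simp add: L_def \<zeta>_def c_def)
  finally have "c * (ln (\<phi> / real K) + L j) \<le> (\<Sum>x\<in>B i. ln (\<theta> x)) + c * L i" by simp
  then have "(c * (ln (\<phi> / real K) + L j)) / c \<le> ((\<Sum>x\<in>B i. ln (\<theta> x)) + c * L i) / c" using c by (intro divide_right_mono) auto
  then show ?thesis using c by (simp add: M_def add_divide_distrib)
 qed
 have diff: "L a - L b \<le> real K * (\<bar>ln S\<bar> + T + \<bar>ln (\<phi> / real K)\<bar>)" if ab: "a < K" "b < K" for a b
 proof -
  have "(\<Sum>i<K. L i) + (L a - L b) \<le> (\<Sum>i<K. M i)" by (rule fully_indecomposable_spread[OF FI LM ab])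
  also have "(\<Sum>i<K. M i) = (\<Sum>x<n. ln (\<theta> x)) / c + (\<Sum>i<K. L i) - real K * ln (\<phi> / real K)"
   by (simp add: M_def sum.distrib sum_subtractf sum_blocks flip: sum_divide_distrib)
  also have "(\<Sum>x<n. ln (\<theta> x)) / c \<le> (real n * (\<bar>ln S\<bar> + \<tau>)) / c" using theta_log[OF s tau(1)] c by (intro divide_right_mono) auto
  also have "\<dots> = real K * (\<bar>ln S\<bar> + \<tau>)" using nn by (simp add: c_def)
  finally have "L a - L b \<le> real K * (\<bar>ln S\<bar> + \<tau>) - real K * ln (\<phi> / real K)" by simp
  also have "\<dots> \<le> real K * (\<bar>ln S\<bar> + T + \<bar>ln (\<phi> / real K)\<bar>)"
   using Kp tau mult_left_mono[of "\<bar>ln S\<bar> + \<tau> - ln (\<phi> / real K)" "\<bar>ln S\<bar> + T + \<bar>ln (\<phi> / real K)\<bar>" "real K"]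
   by (simp add: right_diff_distrib)
  finally show ?thesis .
 qed
 have cmp: "\<zeta> a \<le> E T * \<zeta> b" if ab: "a < K" "b < K" for a b
 proof -
  have "\<zeta> a = exp (L a)" "\<zeta> b = exp (L b)" using zp ab by (simp_all add: L_def)
  moreover have "L a \<le> real K * (\<bar>ln S\<bar> + T + \<bar>ln (\<phi> / real K)\<bar>) + L b" using diff[OF ab] by linarith
  ultimately show ?thesis unfolding E_def by (simp only: exp_add[symmetric] exp_le_cancel_iff)
 qed
 have cmp': "(\<Sum>x\<in>B a. z x) \<le> E T * (\<Sum>x\<in>B b. z x)" if "a < K" "b < K" for a b
  using cmp[OF that] c by (simp add: \<zeta>_def divide_le_eq)
 have "(\<Sum>j<K. \<Sum>x\<in>B i. z x) \<le> (\<Sum>j<K. E T * (\<Sum>x\<in>B j. z x))" using cmp' i by (intro sum_mono) auto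
 then show "(\<Sum>x\<in>B i. z x) \<le> E T * ((\<Sum>x<n. z x) / real K)"
  unfolding sum_distrib_left[symmetric] sum_blocks using Kp by (simp add: field_simps)
 have "(\<Sum>j<K. \<Sum>x\<in>B j. z x) \<le> (\<Sum>j<K. E T * (\<Sum>x\<in>B i. z x))" using cmp' i by (intro sum_mono) auto
 then show "(\<Sum>x<n. z x) / real K \<le> E T * (\<Sum>x\<in>B i. z x)"
  using Kp by (simp add: sum_blocks field_simps)
qed

lemma flow_bounds:
 assumes s: "sol \<tau> 0 q z \<theta>" and tau: "0 < \<tau>" "\<tau> \<le> T" and x: "x < n"
 shows "lo T * ((\<Sum>y<n. z y) / real n) \<le> \<theta> x * z x" "\<theta> x * z x \<le> S * ((\<Sum>y<n. z y) / real n)"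
proof -
 note D = solD[OF s]
 have nn: "real n > 0" using n by simp
 have "\<theta> x * z x = (\<Sum>y<n. V x y * z y)" using D(5)[OF x] by simp
 also have "\<dots> \<le> (\<Sum>y<n. S / real n * z y)" using VS[OF x] D(2) by (intro sum_mono mult_right_mono) (auto simp: order_less_imp_le)
 finally show "\<theta> x * z x \<le> S * ((\<Sum>y<n. z y) / real n)" unfolding sum_distrib_left[symmetric] by simp
 obtain i where i: "i < K" "x \<in> B i" using x UB by blast
 obtain j where j: "j < K" "N i j" using neighbour[OF i(1)] by blast
 have "(\<Sum>y<n. z y) / real K / E T \<le> (\<Sum>y\<in>B j. z y)"
  using block_means(2)[OF s tau j(1)] unfolding pos_divide_le_eq[OF E_pos] by (subst mult.commute)
 then have "\<phi> / real n * ((\<Sum>y<n. z y) / real K / E T) \<le> \<phi> / real n * (\<Sum>y\<in>B j. z y)"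
  using phi nn by (intro mult_left_mono) auto
 also have "\<dots> \<le> (\<Sum>y\<in>B j. V x y * z y)" unfolding sum_distrib_left
  using low[OF i(1) j i(2)] D(2) block_sub[OF j(1)] by (intro sum_mono mult_right_mono) (auto simp: order_less_imp_le subset_iff)
 also have "\<dots> \<le> (\<Sum>y<n. V x y * z y)"
  using block_sub[OF j(1)] V0[OF x] D(2) by (intro sum_mono2) (auto simp: order_less_imp_le)
 also have "\<dots> = \<theta> x * z x" using D(5)[OF x] by simp
 finally show "lo T * ((\<Sum>y<n. z y) / real n) \<le> \<theta> x * z x" by (simp add: lo_def mult_ac)
qed

lemma sol_dual: "sol \<tau> t q z \<theta> \<Longrightarrow> profile.sol n (\<lambda>i j. V j i) \<tau> t z q \<theta>"
 unfolding sol_def profile.sol_def[OF dual_profile] by (simp add: mult.commute)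

text \<open>All \<open>\<theta> z\<close> and \<open>\<theta> q\<close> are comparable to one mean, and \<open>\<theta> - \<tau>\<close> is their product. The absolute bounds come from one site where \<open>\<theta>\<close> is at
 most its geometric mean and from one where \<open>z\<close> is at most its block mean.\<close>
lemma level_bounds:
 assumes s: "sol \<tau> 0 q z \<theta>" "(\<Sum>i<n. q i) = (\<Sum>i<n. z i)" and tau: "0 < \<tau>" "\<tau> \<le> T"
  and x: "x < n" and y: "y < n"
 shows "\<theta> x \<le> rat T * \<theta> y" "\<theta> x \<le> Tup T" "Tlo T \<le> \<theta> x" "1 - \<tau> / \<theta> x \<le> rat T * (1 - \<tau> / \<theta> y)"
  "(\<theta> x - \<tau>) \<le> (S * ((\<Sum>i<n. z i) / real n))\<^sup>2"
  "lo T * ((\<Sum>i<n. z i) / real n) \<le> \<theta> x * z x" "lo T * ((\<Sum>i<n. z i) / real n) \<le> \<theta> x * q x"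
proof -
 interpret dual: block_profile n "\<lambda>i j. V j i" S \<phi> K B "\<lambda>i j. N j i" by (rule dual_block)
 note D = solD[OF s(1)]
 have nn: "real n > 0" using n by simp
 define c where "c = (\<Sum>i<n. z i) / real n"
 have c: "c > 0" unfolding c_def using nn D(2) n by (intro divide_pos_pos sum_pos) auto
 have b: "lo T * c \<le> \<theta> x * z x" "\<theta> x * z x \<le> S * c" if "x < n" for x
  using flow_bounds[OF s(1) tau that] by (auto simp: c_def)
 have a: "lo T * c \<le> \<theta> x * q x" "\<theta> x * q x \<le> S * c" if "x < n" for x
  using dual.flow_bounds[OF sol_dual[OF s(1)] tau that] s(2) by (auto simp: c_def)
 show "lo T * ((\<Sum>i<n. z i) / real n) \<le> \<theta> x * z x" "lo T * ((\<Sum>i<n. z i) / real n) \<le> \<theta> x * q x"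
  using a b x by (auto simp: c_def)
 have w: "(lo T * c)\<^sup>2 \<le> \<theta> x - \<tau>" "\<theta> x - \<tau> \<le> (S * c)\<^sup>2" if x: "x < n" for x
 proof -
  have "(\<theta> x * q x) * (\<theta> x * z x) = \<theta> x * (q x * z x * \<theta> x)" by simp
  also have "\<dots> = \<theta> x - \<tau>" unfolding D(6)[OF x] using D(3)[OF x] by (simp add: right_diff_distrib)
  finally have e: "\<theta> x - \<tau> = (\<theta> x * q x) * (\<theta> x * z x)" by simp
  have p: "0 \<le> \<theta> x * q x" "0 \<le> \<theta> x * z x" "0 \<le> lo T * c" using D(1,2,3)[OF x] lo_pos[of T] c by (auto simp: order_less_imp_le)
  show "(lo T * c)\<^sup>2 \<le> \<theta> x - \<tau>" unfolding e power2_eq_square by (rule mult_mono[OF a(1)[OF x] b(1)[OF x] p(1,3)])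
  show "\<theta> x - \<tau> \<le> (S * c)\<^sup>2" unfolding e power2_eq_square
   by (rule mult_mono[OF a(2)[OF x] b(2)[OF x] order_trans[OF p(1) a(2)[OF x]] p(2)])
 qed
 show "(\<theta> x - \<tau>) \<le> (S * ((\<Sum>i<n. z i) / real n))\<^sup>2" using w(2)[OF x] by (simp add: c_def)
 have r1: "rat T \<ge> 1"
 proof -
  have "lo T * c \<le> S * c" using b[OF x] by linarith
  then have "1 \<le> S / lo T" using c lo_pos[of T] by simp
  then show ?thesis by (simp add: rat_def)
 qed
 have wr: "\<theta> x - \<tau> \<le> rat T * (\<theta> y - \<tau>)" if "x < n" "y < n" for x y
 proof -
  have "(S * c)\<^sup>2 = rat T * (lo T * c)\<^sup>2" using lo_pos[of T] by (simp add: rat_def power_mult_distrib power_divide)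
  also have "\<dots> \<le> rat T * (\<theta> y - \<tau>)" using w(1)[OF that(2)] rat_pos[of T] by (intro mult_left_mono) auto
  finally show ?thesis using w(2)[OF that(1)] by linarith
 qed
 have tr: "\<theta> x \<le> rat T * \<theta> y" if "x < n" "y < n" for x y
 proof -
  have "1 * \<tau> \<le> rat T * \<tau>" using r1 tau by (intro mult_right_mono) auto
  then show ?thesis using wr[OF that] by (simp add: right_diff_distrib)
 qed
 then show "\<theta> x \<le> rat T * \<theta> y" using x y by blast
 show "1 - \<tau> / \<theta> x \<le> rat T * (1 - \<tau> / \<theta> y)"
 proof (cases "\<theta> x \<le> \<theta> y")
  case True
  have "1 - \<tau> / \<theta> x \<le> 1 * (1 - \<tau> / \<theta> y)" using True D(3)[OF x] D(3)[OF y] tau by (simp add: divide_left_mono)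
  also have "\<dots> \<le> rat T * (1 - \<tau> / \<theta> y)" using r1 D(7)[OF y] by (intro mult_right_mono) auto
  finally show ?thesis .
 next
  case False
  have "1 - \<tau> / \<theta> x = (\<theta> x - \<tau>) / \<theta> x" using D(3)[OF x] by (simp add: diff_divide_distrib)
  also have "\<dots> \<le> (rat T * (\<theta> y - \<tau>)) / \<theta> x" using wr[OF x y] D(3)[OF x] by (intro divide_right_mono) auto
  also have "\<dots> \<le> (rat T * (\<theta> y - \<tau>)) / \<theta> y" using False D(3)[OF y] D(8)[OF y] rat_pos[of T] by (intro divide_left_mono) auto
  also have "\<dots> = rat T * (1 - \<tau> / \<theta> y)" using D(3)[OF y] by (simp add: field_simps)
  finally show ?thesis .
 qed
 have "\<exists>y<n. ln (\<theta> y) \<le> \<bar>ln S\<bar> + \<tau>"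
 proof (rule ccontr)
  assume "\<not> ?thesis"
  then have "(\<Sum>i<n. \<bar>ln S\<bar> + \<tau>) < (\<Sum>i<n. ln (\<theta> i))" using n by (intro sum_strict_mono) (auto simp: not_le)
  then show False using theta_log[OF s(1) tau(1)] by simp
 qed
 then obtain y0 where y0: "y0 < n" "ln (\<theta> y0) \<le> \<bar>ln S\<bar> + \<tau>" by blast
 have "\<theta> y0 = exp (ln (\<theta> y0))" using D(3)[OF y0(1)] by simp
 also have "\<dots> \<le> exp (\<bar>ln S\<bar> + T)" using y0(2) tau by simp
 finally have "rat T * \<theta> y0 \<le> rat T * exp (\<bar>ln S\<bar> + T)" using rat_pos[of T] by (intro mult_left_mono) auto
 then show "\<theta> x \<le> Tup T" using tr[OF x y0(1)] by (simp add: Tup_def)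
 have K0: "0 < K" using K by simp
 have "\<exists>y\<in>B 0. z y \<le> E T * c"
 proof (rule ccontr)
  assume "\<not> ?thesis"
  then have "(\<Sum>y\<in>B 0. E T * c) < (\<Sum>y\<in>B 0. z y)"
   using block_fin[OF K0] block_ne[OF K0] by (intro sum_strict_mono) (auto simp: not_le)
  then have "real n / real K * (E T * c) < (\<Sum>y\<in>B 0. z y)" using block_card[OF K0] by simp
  moreover have "real n / real K * (E T * c) = E T * ((\<Sum>i<n. z i) / real K)" using nn by (simp add: c_def)
  ultimately show False using block_means(1)[OF s(1) tau K0] by linarith
 qed
 then obtain y1 where y1: "y1 \<in> B 0" "z y1 \<le> E T * c" by blast
 then have y1n: "y1 < n" using block_sub[OF K0] by auto
 have "lo T * c \<le> \<theta> y1 * (E T * c)" using b(1)[OF y1n] y1(2) D(3)[OF y1n] mult_left_mono[of "z y1" "E T * c" "\<theta> y1"] by linarith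
 then have "lo T \<le> \<theta> y1 * E T" using c by simp
 also have "\<theta> y1 * E T \<le> (rat T * \<theta> x) * E T" using tr[OF y1n x] E_pos[of T] by (intro mult_right_mono) auto
 finally show "Tlo T \<le> \<theta> x" using E_pos[of T] rat_pos[of T] Kp
  by (simp add: Tlo_def lo_def divide_le_eq power2_eq_square mult_ac)
qed

theorem block_slope:
 assumes s: "sol \<tau> 0 q z \<theta>" "(\<Sum>i<n. q i) = (\<Sum>i<n. z i)" and tau: "0 < \<tau>" "\<tau> \<le> T"
  and l: "lin q z \<theta> \<tau> 1 D \<xi> \<eta>"
 shows "1 / (Tup T * (rat T)\<^sup>2) \<le> (\<Sum>i<n. \<tau> / \<theta> i * D i) / (real n * \<tau>)"
proof -
 note F = solD[OF s(1)]
 have nn: "real n > 0" using n by simp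
 define k where "k = (\<Sum>i<n. 1 - \<tau> / \<theta> i)"
 have k: "k > 0" unfolding k_def using F(7) n by (intro sum_pos) auto
 have Tp: "Tup T > 0" using rat_pos[of T] by (simp add: Tup_def)
 have mk: "1 - \<tau> / \<theta> x \<le> rat T * k / real n" if x: "x < n" for x
 proof -
  have "(\<Sum>y<n. 1 - \<tau> / \<theta> x) \<le> (\<Sum>y<n. rat T * (1 - \<tau> / \<theta> y))"
   using level_bounds(4)[OF s tau x] by (intro sum_mono) auto
  then have "real n * (1 - \<tau> / \<theta> x) \<le> rat T * k" by (simp add: k_def sum_distrib_left)
  then show ?thesis using nn by (simp add: le_divide_eq mult.commute)
 qed
 have "(\<Sum>i<n. (1 - \<tau> / \<theta> i)\<^sup>2 * \<theta> i) \<le> (\<Sum>i<n. (rat T * k / real n)\<^sup>2 * Tup T)"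
  using mk F(3,7) level_bounds(2)[OF s tau] by (intro sum_mono mult_mono power_mono) (auto simp: order_less_imp_le)
 also have "\<dots> = (rat T)\<^sup>2 * Tup T / real n * k\<^sup>2" using nn by (simp add: power2_eq_square)
 finally have "k\<^sup>2 \<le> ((rat T)\<^sup>2 * Tup T / real n * k\<^sup>2) / \<tau> * (\<Sum>i<n. \<tau> / \<theta> i * D i)"
  using cdf_slope(1)[OF s(1) tau(1) l] cdf_slope(3)[OF s(1) tau(1) l] tau unfolding k_def[symmetric]
  by (smt (verit) divide_right_mono mult_right_mono)
 then have "1 * k\<^sup>2 \<le> ((rat T)\<^sup>2 * Tup T * ((\<Sum>i<n. \<tau> / \<theta> i * D i) / (real n * \<tau>))) * k\<^sup>2"
  using nn tau by (simp add: field_simps)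
 then have "1 \<le> (rat T)\<^sup>2 * Tup T * ((\<Sum>i<n. \<tau> / \<theta> i * D i) / (real n * \<tau>))"
  using k by (metis mult_le_cancel_right_pos zero_less_power)
 then show ?thesis using Tp rat_pos[of T] by (simp add: divide_le_eq mult.commute)
qed

text \<open>Write the slope as the mean of \<open>1/\<theta>\<close> plus the mean of \<open>1/\<theta> * (D - 1)\<close>. The first is decreasing in \<open>\<tau>\<close> and bounded, so it converges.
 The energy is of order \<open>\<tau>\<close> while its weights stay bounded below, hence \<open>\<xi> j - \<xi> i + (D i - 1)\<close> tends to zero along
 every edge. Full indecomposability connects all sites through edges with a common row, so \<open>\<xi>\<close> becomes constant
 and \<open>D\<close> tends to \<open>1\<close>.\<close>
theorem slope_limit_at_zero:
 assumes T: "\<And>s. 0 < s \<Longrightarrow> s < T \<Longrightarrow> supercritical s" and Tp: "0 < T"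
 obtains l where "\<And>x :: nat \<Rightarrow> real. (\<And>k. 0 < x k \<and> x k < T) \<Longrightarrow> x \<longlonglongrightarrow> 0 \<Longrightarrow> (\<lambda>k. deriv cdf (x k)) \<longlonglongrightarrow> l"
proof -
 have nn: "real n > 0" using n by simp
 define g where "g \<tau> = (\<Sum>i<n. 1 / gth \<tau> i)" for \<tau>
 have tl: "0 < Tlo T" using phi Kp E_pos[of T] rat_pos[of T] by (simp add: Tlo_def)
 have cs: "sol s 0 (gq s) (gz s) (gth s)" "(\<Sum>i<n. gq s i) = (\<Sum>i<n. gz s i)" if "0 < s" "s < T" for s
  using canon[OF T[OF that]] by auto
 have gmono: "g t \<le> g s" if "0 < s" "s \<le> t" "t < T" for s t
 proof (rule DERIV_nonpos_imp_nonincreasing[OF that(2)])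
  fix x assume x: "s \<le> x" "x \<le> t"
  then have x': "0 < x" "x < T" using that by auto
  obtain D \<xi> \<eta> where "lin (gq x) (gz x) (gth x) x 1 D \<xi> \<eta>"
   "((\<lambda>s. \<Sum>i<n. 1 / gth s i) has_real_derivative (\<Sum>i<n. 1 / gth x i * (D i - 1)) / x) (at x)"
   using cdf_derivative[OF T x'] by blast
  moreover from cdf_slope(2)[OF cs(1)[OF x'] x'(1) this(1)] have "(\<Sum>i<n. 1 / gth x i * (D i - 1)) / x \<le> 0"
   using x' by (simp add: divide_le_0_iff)
  ultimately show "\<exists>y. (g has_real_derivative y) (at x) \<and> y \<le> 0" unfolding g_def[abs_def] by blast
 qed
 have gb: "g s \<le> real n * (1 / Tlo T)" if "0 < s" "s < T" for s
 proof -
  have "1 / gth s i \<le> 1 / Tlo T" if "i < n" for i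
   using level_bounds(3)[OF cs[OF \<open>0 < s\<close> \<open>s < T\<close>] \<open>0 < s\<close> less_imp_le[OF \<open>s < T\<close>] that that] tl by (intro divide_left_mono) auto
  then have "g s \<le> (\<Sum>i<n. 1 / Tlo T)" unfolding g_def by (intro sum_mono) auto
  then show ?thesis by simp
 qed
 define g0 where "g0 = Sup (g ` {0<..<T})"
 have bdd: "bdd_above (g ` {0<..<T})" using gb by (intro bdd_aboveI[of _ "real n * (1 / Tlo T)"]) auto
 have glim: "(\<lambda>k. g (x k)) \<longlonglongrightarrow> g0" if x: "\<And>k. 0 < x k \<and> x k < T" "x \<longlonglongrightarrow> 0" for x
 proof (rule order_tendstoI)
  fix a assume "a < g0"
  then obtain s where s: "0 < s" "s < T" "a < g s"
   unfolding g0_def using bdd Tp by (subst (asm) less_cSup_iff) auto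
  have "eventually (\<lambda>k. x k < s) sequentially" using order_tendstoD(2)[OF x(2) s(1)] .
  then show "eventually (\<lambda>k. a < g (x k)) sequentially"
  proof eventually_elim
   case (elim k)
   then have "g s \<le> g (x k)" using x(1)[of k] s by (intro gmono) auto
   then show ?case using s(3) by linarith
  qed
 next
  fix a assume a: "g0 < a"
  have "g (x k) \<le> g0" for k unfolding g0_def using bdd x(1)[of k] by (intro cSUP_upper) auto
  then show "eventually (\<lambda>k. g (x k) < a) sequentially" using a by (intro always_eventually allI) (meson le_less_trans)
 qed
 have "(\<lambda>k. deriv cdf (x k)) \<longlonglongrightarrow> g0 / real n" if x: "\<And>k. 0 < x k \<and> x k < T" "x \<longlonglongrightarrow> 0" for x :: "nat \<Rightarrow> real"
 proof -
  have ex: "\<exists>D \<xi>. (\<exists>\<eta>. lin (gq (x k)) (gz (x k)) (gth (x k)) (x k) 1 D \<xi> \<eta>) \<and>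
    (cdf has_real_derivative (\<Sum>i<n. x k / gth (x k) i * D i) / (real n * x k)) (at (x k))" for k
  proof -
   have "0 < x k" "x k < T" using x(1)[of k] by auto
   from cdf_derivative[OF T this] show ?thesis by blast
  qed
  then have "\<exists>D. \<forall>k. \<exists>\<xi>. (\<exists>\<eta>. lin (gq (x k)) (gz (x k)) (gth (x k)) (x k) 1 (D k) \<xi> \<eta>) \<and>
    (cdf has_real_derivative (\<Sum>i<n. x k / gth (x k) i * D k i) / (real n * x k)) (at (x k))"
   by (intro choice allI)
  then obtain D where Dx: "\<forall>k. \<exists>\<xi>. (\<exists>\<eta>. lin (gq (x k)) (gz (x k)) (gth (x k)) (x k) 1 (D k) \<xi> \<eta>) \<and>
    (cdf has_real_derivative (\<Sum>i<n. x k / gth (x k) i * D k i) / (real n * x k)) (at (x k))" by blast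
  from choice[OF Dx] obtain \<xi> where lin: "\<And>k. \<exists>\<eta>. lin (gq (x k)) (gz (x k)) (gth (x k)) (x k) 1 (D k) (\<xi> k) \<eta>"
   and der: "\<And>k. (cdf has_real_derivative (\<Sum>i<n. x k / gth (x k) i * D k i) / (real n * x k)) (at (x k))" by blast
  define q z \<theta> where "q k = gq (x k)" and "z k = gz (x k)" and "\<theta> k = gth (x k)" for k
  have s: "sol (x k) 0 (q k) (z k) (\<theta> k)" "(\<Sum>i<n. q k i) = (\<Sum>i<n. z k i)" for k
   using cs x(1) by (auto simp: q_def z_def \<theta>_def)
  note F = solD[OF s(1)]
  have xp: "0 < x k" "x k \<le> T" for k using x(1)[of k] by auto
  note LB = level_bounds[OF s xp]
  define \<psi> where "\<psi> k i = D k i - 1" for k i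
  define G where "G k = (\<Sum>i<n. \<Sum>j<n. q k i * V i j * z k j * (\<xi> k j - (\<xi> k i - \<psi> k i))\<^sup>2)" for k
  have G: "G k \<le> x k * (real n / (4 * Tlo T))" for k
  proof -
   obtain \<eta> where l: "lin (q k) (z k) (\<theta> k) (x k) 1 (D k) (\<xi> k) \<eta>" using lin[of k] by (auto simp: q_def z_def \<theta>_def)
   have "G k = - (\<Sum>i<n. x k / \<theta> k i * D k i * (D k i - 1))"
    using lin_energy(2)[OF s(1) l] by (simp add: G_def \<psi>_def algebra_simps)
   also have "\<dots> \<le> (\<Sum>i<n. x k / Tlo T * (1/4))" unfolding sum_negf[symmetric]
   proof (rule sum_mono)
    fix i assume "i \<in> {..<n}" then have i: "i < n" by simp
    have "- (d * (d - 1)) = 1/4 - (d - 1/2)\<^sup>2" for d :: real by (simp add: power2_eq_square algebra_simps)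
    then have "- (D k i * (D k i - 1)) \<le> 1/4" by simp
    then have "x k / \<theta> k i * (- (D k i * (D k i - 1))) \<le> x k / \<theta> k i * (1/4)"
     using xp[of k] F(3)[OF i, of k] by (intro mult_left_mono) auto
    also have "\<dots> \<le> x k / Tlo T * (1/4)" using xp[of k] tl LB(3)[OF i i, of k] F(3)[OF i, of k]
     by (intro mult_right_mono divide_left_mono) auto
    finally show "- (x k / \<theta> k i * D k i * (D k i - 1)) \<le> x k / Tlo T * (1/4)" by (simp add: mult.assoc)
   qed
   finally show ?thesis by (simp add: mult_ac)
  qed
  have G0: "0 \<le> G k" for k unfolding G_def
   using F(1,2) V0 by (intro sum_nonneg mult_nonneg_nonneg) (auto simp: order_less_imp_le)
  have Glim: "G \<longlonglongrightarrow> 0"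
  proof (rule tendsto_sandwich[OF always_eventually always_eventually tendsto_const])
   show "(\<lambda>k. x k * (real n / (4 * Tlo T))) \<longlonglongrightarrow> 0" using tendsto_mult_right[OF x(2), of "real n / (4 * Tlo T)"] by simp
  qed (use G G0 in auto)
  define c where "c k = (\<Sum>i<n. z k i) / real n" for k
  have c0: "0 < c k" for k unfolding c_def using F(2) n nn by (intro divide_pos_pos sum_pos) auto
  have Tu: "0 < Tup T" using rat_pos[of T] by (simp add: Tup_def)
  define \<kappa> where "\<kappa> = (lo T / Tup T)\<^sup>2 * (Tlo T / 2 / S\<^sup>2)"
  have kp: "\<kappa> > 0" unfolding \<kappa>_def using lo_pos[of T] Tu tl S by (intro mult_pos_pos zero_less_power divide_pos_pos) auto
  \<comment> \<open>For small \<open>\<tau>\<close> the weights are bounded below, since the levels stay above \<open>Tlo T\<close> while \<open>\<tau>\<close> vanishes.\<close>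
  have wl: "\<kappa> \<le> q k i * z k j" if small: "x k \<le> Tlo T / 2" and i: "i < n" and j: "j < n" for k i j
  proof -
   have "Tlo T / 2 \<le> \<theta> k i - x k" using LB(3)[OF i i, of k] small by linarith
   also have "\<dots> \<le> (S * c k)\<^sup>2" using LB(5)[OF i i, of k] by (simp add: c_def)
   finally have c2: "Tlo T / 2 / S\<^sup>2 \<le> (c k)\<^sup>2" using S by (simp add: power_mult_distrib divide_le_eq mult_ac)
   have "lo T * c k \<le> \<theta> k i * q k i" using LB(7)[OF i i, of k] by (simp add: c_def)
   also have "\<dots> \<le> Tup T * q k i" using LB(2)[OF i i, of k] F(1)[OF i, of k] by (intro mult_right_mono) auto
   finally have 1: "lo T / Tup T * c k \<le> q k i" using Tu by (simp add: divide_le_eq mult.commute)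
   have "lo T * c k \<le> \<theta> k j * z k j" using LB(6)[OF j j, of k] by (simp add: c_def)
   also have "\<dots> \<le> Tup T * z k j" using LB(2)[OF j j, of k] F(2)[OF j, of k] by (intro mult_right_mono) auto
   finally have 2: "lo T / Tup T * c k \<le> z k j" using Tu by (simp add: divide_le_eq mult.commute)
   have p: "0 \<le> lo T / Tup T * c k" using lo_pos[of T] Tu c0[of k] by simp
   have "\<kappa> \<le> (lo T / Tup T)\<^sup>2 * (c k)\<^sup>2" unfolding \<kappa>_def using c2 by (intro mult_left_mono) auto
   also have "\<dots> = (lo T / Tup T * c k) * (lo T / Tup T * c k)" by (simp add: power2_eq_square)
   also have "\<dots> \<le> q k i * z k j" using 1 2 p F(1)[OF i, of k] by (intro mult_mono) auto
   finally show ?thesis .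
  qed
  have edge: "(\<lambda>k. \<xi> k j - (\<xi> k i - \<psi> k i)) \<longlonglongrightarrow> 0" if ij: "i < n" "j < n" "V i j > 0" for i j
  proof -
   have "(\<lambda>k. (\<xi> k j - (\<xi> k i - \<psi> k i))\<^sup>2) \<longlonglongrightarrow> 0"
   proof (rule tendsto_sandwich[OF _ _ tendsto_const])
    show "(\<lambda>k. G k / (\<kappa> * V i j)) \<longlonglongrightarrow> 0" using tendsto_divide[OF Glim tendsto_const[of "\<kappa> * V i j"]] kp ij by simp
    have "eventually (\<lambda>k. x k < Tlo T / 2) sequentially" using order_tendstoD(2)[OF x(2), of "Tlo T / 2"] tl by simp
    then show "eventually (\<lambda>k. (\<xi> k j - (\<xi> k i - \<psi> k i))\<^sup>2 \<le> G k / (\<kappa> * V i j)) sequentially"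
    proof eventually_elim
     case (elim k)
     have nn2: "0 \<le> q k i * V i j * z k j * (\<xi> k j - (\<xi> k i - \<psi> k i))\<^sup>2" if "i < n" "j < n" for i j
      using F(1)[OF that(1), of k] F(2)[OF that(2), of k] V0[OF that] by simp
     have "\<kappa> * V i j \<le> (q k i * z k j) * V i j" using wl[OF _ ij(1,2)] elim ij by (intro mult_right_mono) auto
     then have "\<kappa> * V i j * (\<xi> k j - (\<xi> k i - \<psi> k i))\<^sup>2 \<le> (q k i * z k j) * V i j * (\<xi> k j - (\<xi> k i - \<psi> k i))\<^sup>2"
      by (rule mult_right_mono) simp
     also have "\<dots> = q k i * V i j * z k j * (\<xi> k j - (\<xi> k i - \<psi> k i))\<^sup>2" by (simp only: mult_ac)
     also have "\<dots> \<le> (\<Sum>j<n. q k i * V i j * z k j * (\<xi> k j - (\<xi> k i - \<psi> k i))\<^sup>2)"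
      using ij nn2 by (intro member_le_sum[of j "{..<n}" "\<lambda>j. q k i * V i j * z k j * (\<xi> k j - (\<xi> k i - \<psi> k i))\<^sup>2"]) auto
     also have "\<dots> \<le> G k" unfolding G_def
      using ij nn2 by (intro member_le_sum[of i "{..<n}" "\<lambda>i. \<Sum>j<n. q k i * V i j * z k j * (\<xi> k j - (\<xi> k i - \<psi> k i))\<^sup>2"] sum_nonneg) auto
     finally show ?case using kp ij by (simp add: le_divide_eq mult.commute)
    qed
   qed auto
   from tendsto_real_sqrt[OF this] have "(\<lambda>k. \<bar>\<xi> k j - (\<xi> k i - \<psi> k i)\<bar>) \<longlonglongrightarrow> 0" by simp
   then show ?thesis by (rule tendsto_rabs_zero_cancel)
  qed
  \<comment> \<open>If the sites at which \<open>\<xi>\<close> agrees with \<open>\<xi> 0\<close> in the limit were a proper subset, they and the rows leading to them would split \<open>V\<close>.\<close>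
  define Cl where "Cl = {j. j < n \<and> (\<lambda>k. \<xi> k j - \<xi> k 0) \<longlonglongrightarrow> 0}"
  define R where "R = {i. i < n \<and> (\<exists>j\<in>Cl. V i j > 0)}"
  have Cl0: "0 \<in> Cl" using n by (simp add: Cl_def)
  have RC: "V i j > 0 \<Longrightarrow> j \<in> Cl" if i: "i \<in> R" and j: "j < n" for i j
  proof -
   assume Vij: "V i j > 0"
   obtain j' where j': "j' \<in> Cl" "V i j' > 0" using i by (auto simp: R_def)
   have in': "i < n" "j' < n" using i j' by (auto simp: R_def Cl_def)
   have "(\<lambda>k. (\<xi> k j - (\<xi> k i - \<psi> k i)) - (\<xi> k j' - (\<xi> k i - \<psi> k i)) + (\<xi> k j' - \<xi> k 0)) \<longlonglongrightarrow> 0 - 0 + 0"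
    by (intro tendsto_add tendsto_diff edge in' j Vij j'(2)) (use j'(1) in \<open>simp add: Cl_def\<close>)
   then show "j \<in> Cl" using j by (simp add: Cl_def)
  qed
  have Cl_all: "Cl = {..<n}"
  proof (rule ccontr)
   assume ne: "Cl \<noteq> {..<n}"
   have sub: "Cl \<subseteq> {..<n}" "R \<subseteq> {..<n}" by (auto simp: Cl_def R_def)
   then have fin: "finite Cl" "finite R" by (auto intro: finite_subset)
   have C2: "{..<n} - Cl \<noteq> {}" using ne sub by auto
   have z1: "\<not> (\<exists>x\<in>R. \<exists>y\<in>{..<n} - Cl. V x y > 0)" using RC by auto
   have z2: "\<not> (\<exists>x\<in>{..<n} - R. \<exists>y\<in>Cl. V x y > 0)" by (auto simp: R_def)
   have cc: "card ({..<n} - Cl) = n - card Cl" "card ({..<n} - R) = n - card R" "card Cl \<le> n" "card R \<le> n" "card Cl > 0"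
    using sub fin Cl0 card_mono[of "{..<n}" Cl] card_mono[of "{..<n}" R] by (auto simp: card_Diff_subset card_gt_0_iff)
   have "R \<noteq> {}"
   proof
    assume "R = {}"
    then have "\<exists>x\<in>{..<n}. \<exists>y\<in>Cl. V x y > 0" using Cl0 sub n cc by (intro FI_n) auto
    then show False using z2 \<open>R = {}\<close> by simp
   qed
   moreover have "{..<n} - R \<noteq> {}"
   proof
    assume "{..<n} - R = {}"
    then have "R = {..<n}" using sub by auto
    moreover have "\<exists>x\<in>{..<n}. \<exists>y\<in>{..<n} - Cl. V x y > 0" using C2 n by (intro FI_n) auto
    ultimately show False using z1 by simp
   qed
   ultimately have "\<not> n \<le> card R + card ({..<n} - Cl)" "\<not> n \<le> card ({..<n} - R) + card Cl"
    using FI_n[of R "{..<n} - Cl"] FI_n[of "{..<n} - R" Cl] z1 z2 sub C2 Cl0 by auto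
   then show False using cc by auto
  qed
  have psi: "(\<lambda>k. \<psi> k i) \<longlonglongrightarrow> 0" if i: "i < n" for i
  proof -
   obtain y where y: "y < n" "V i y > 0" using FI_n[of "{i}" "{..<n}"] i n by auto
   have "i \<in> Cl" "y \<in> Cl" using i y Cl_all by auto
   then have "(\<lambda>k. (\<xi> k y - (\<xi> k i - \<psi> k i)) - (\<xi> k y - \<xi> k 0) + (\<xi> k i - \<xi> k 0)) \<longlonglongrightarrow> 0 - 0 + 0"
    by (intro tendsto_add tendsto_diff edge i y) (auto simp: Cl_def)
   then show ?thesis by simp
  qed
  have small: "(\<lambda>k. 1 / \<theta> k i * \<psi> k i) \<longlonglongrightarrow> 0" if i: "i < n" for i
  proof (rule tendsto_0_le[OF psi[OF i], of _ "1 / Tlo T"])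
   have "norm (1 / \<theta> k i * \<psi> k i) \<le> norm (\<psi> k i) * (1 / Tlo T)" for k
   proof -
    have "1 / \<theta> k i \<le> 1 / Tlo T" using LB(3)[OF i i, of k] tl by (intro divide_left_mono) auto
    then have "\<bar>\<psi> k i\<bar> * (1 / \<theta> k i) \<le> \<bar>\<psi> k i\<bar> * (1 / Tlo T)" by (intro mult_left_mono) auto
    then show ?thesis using F(3)[OF i, of k] by (simp add: abs_mult mult.commute)
   qed
   then show "eventually (\<lambda>k. norm (1 / \<theta> k i * \<psi> k i) \<le> norm (\<psi> k i) * (1 / Tlo T)) sequentially" by (rule always_eventually[OF allI])
  qed
  have "(\<lambda>k. (g (x k) + (\<Sum>i<n. 1 / \<theta> k i * \<psi> k i)) / real n) \<longlonglongrightarrow> (g0 + (\<Sum>i<n. 0)) / real n"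
   using glim[OF x] small nn by (intro tendsto_divide tendsto_add tendsto_sum tendsto_const) auto
  moreover have "deriv cdf (x k) = (g (x k) + (\<Sum>i<n. 1 / \<theta> k i * \<psi> k i)) / real n" for k
  proof -
   have "deriv cdf (x k) = (\<Sum>i<n. x k / \<theta> k i * D k i) / (real n * x k)"
    using DERIV_imp_deriv[OF der[of k]] by (simp add: \<theta>_def)
   also have "(\<Sum>i<n. x k / \<theta> k i * D k i) = x k * (g (x k) + (\<Sum>i<n. 1 / \<theta> k i * \<psi> k i))"
    unfolding g_def \<theta>_def[symmetric] sum.distrib[symmetric] sum_distrib_left
    by (intro sum.cong) (auto simp: \<psi>_def algebra_simps diff_divide_distrib)
   finally show ?thesis using xp[of k] by simp
  qed
  ultimately show ?thesis by simp
 qed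
 then show ?thesis by (rule that)
qed

end

section \<open>Rotation invariant measures on the plane\<close>

text \<open>The uniform distribution of an angle, measured in full turns.\<close>
definition turn :: "real measure" where "turn = density lborel (indicator {0..<1})"

lemma sets_turn [measurable_cong, simp]: "sets turn = sets borel" by (simp add: turn_def)
lemma space_turn [simp]: "space turn = UNIV" by (simp add: turn_def)

lemma prob_space_turn: "prob_space turn"
 by standard (simp add: turn_def emeasure_density)

lemma nn_integral_turn:
 assumes [measurable]: "g \<in> borel_measurable borel"
 shows "(\<integral>\<^sup>+u. g u \<partial>turn) = (\<integral>\<^sup>+u. g u * indicator {0..<1} u \<partial>lborel)"
 unfolding turn_def by (subst nn_integral_density) (auto simp: mult.commute)

text \<open>Only the fractional part of the shift matters, and the interval is cut at the point where it passes the period.\<close>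
lemma nn_integral_turn_shift:
 fixes g :: "real \<Rightarrow> ennreal"
 assumes [measurable]: "g \<in> borel_measurable borel" and per: "\<And>u. g (u + 1) = g u"
 shows "(\<integral>\<^sup>+u. g (u + a) \<partial>turn) = (\<integral>\<^sup>+u. g u \<partial>turn)"
proof -
 have per_nat: "g (u + real k) = g u" for u k
  by (induction k) (auto simp: per add.assoc[symmetric] add.commute[of 1])
 have per_int: "g (u + of_int k) = g u" for u k
 proof (cases "k \<ge> 0")
  case True then show ?thesis using per_nat[of u "nat k"] by simp
 next
  case False then show ?thesis using per_nat[of "u + of_int k" "nat (- k)"] by simp
 qed
 define b where "b = frac a"
 have b: "0 \<le> b" "b < 1" by (auto simp: b_def frac_lt_1)
 have gb: "g (u + a) = g (u + b)" for u
 proof -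
  have "u + a = (u + b) + of_int \<lfloor>a\<rfloor>" by (simp add: b_def frac_def)
  then show ?thesis by (simp only: per_int)
 qed
 have "(\<integral>\<^sup>+u. g (u + a) \<partial>turn) = (\<integral>\<^sup>+u. g (u + b) * indicator {0..<1} u \<partial>lborel)"
  unfolding gb by (intro nn_integral_turn) simp
 also have "\<dots> = (\<integral>\<^sup>+u. g (b + 1 * u) * indicator {b..<b+1} (b + 1 * u) \<partial>lborel)"
  by (intro nn_integral_cong) (auto simp: indicator_def add.commute)
 also have "\<dots> = (\<integral>\<^sup>+u. g u * indicator {b..<b+1} u \<partial>lborel)"
  using nn_integral_real_affine[of "\<lambda>u. g u * indicator {b..<b+1} u" 1 b] by simp
 also have "\<dots> = (\<integral>\<^sup>+u. g u * indicator {b..<1} u + g u * indicator {1..<b+1} u \<partial>lborel)"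
  using b by (intro nn_integral_cong) (auto simp: indicator_def)
 also have "\<dots> = (\<integral>\<^sup>+u. g u * indicator {b..<1} u \<partial>lborel) + (\<integral>\<^sup>+u. g u * indicator {1..<b+1} u \<partial>lborel)"
  by (intro nn_integral_add) auto
 also have "(\<integral>\<^sup>+u. g u * indicator {1..<b+1} u \<partial>lborel) = (\<integral>\<^sup>+u. g (1 + 1 * u) * indicator {1..<b+1} (1 + 1 * u) \<partial>lborel)"
  by (subst nn_integral_real_affine[where c = 1 and t = 1]) auto
 also have "\<dots> = (\<integral>\<^sup>+u. g u * indicator {0..<b} u \<partial>lborel)"
  using per by (intro nn_integral_cong) (auto simp: indicator_def add.commute)
 also have "(\<integral>\<^sup>+u. g u * indicator {b..<1} u \<partial>lborel) + (\<integral>\<^sup>+u. g u * indicator {0..<b} u \<partial>lborel)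
   = (\<integral>\<^sup>+u. g u * indicator {b..<1} u + g u * indicator {0..<b} u \<partial>lborel)"
  by (intro nn_integral_add[symmetric]) auto
 also have "\<dots> = (\<integral>\<^sup>+u. g u * indicator {0..<1} u \<partial>lborel)"
  using b by (intro nn_integral_cong) (auto simp: indicator_def)
 also have "\<dots> = (\<integral>\<^sup>+u. g u \<partial>turn)" by (rule nn_integral_turn[symmetric]) simp
 finally show ?thesis .
qed

lemma cis_measurable [measurable]: "cis \<in> borel_measurable borel"
 by (intro borel_measurable_continuous_onI continuous_on_cis continuous_on_id)

lemma nn_integral_turn_rotate:
 fixes g :: "complex \<Rightarrow> ennreal"
 assumes [measurable]: "g \<in> borel_measurable borel"
 shows "(\<integral>\<^sup>+u. g (cis (2 * pi * u) * cis \<phi> * w) \<partial>turn) = (\<integral>\<^sup>+u. g (cis (2 * pi * u) * w) \<partial>turn)"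
proof -
 define h where "h u = g (cis (2 * pi * u) * w)" for u
 have [measurable]: "h \<in> borel_measurable borel" unfolding h_def by measurable
 have "h (u + 1) = h u" for u
  by (simp add: h_def distrib_left flip: cis_mult)
 then have "(\<integral>\<^sup>+u. h (u + \<phi> / (2 * pi)) \<partial>turn) = (\<integral>\<^sup>+u. h u \<partial>turn)" by (intro nn_integral_turn_shift) auto
 moreover have "h (u + \<phi> / (2 * pi)) = g (cis (2 * pi * u) * cis \<phi> * w)" for u
  by (simp add: h_def distrib_left cis_mult)
 ultimately show ?thesis by (simp add: h_def)
qed

text \<open>Averaging the invariance over all rotations and exchanging the integrals replaces every point by the uniform distribution
 on its circle.\<close>
lemma radial_polar:
 assumes M: "prob_space M" "sets M = sets borel" and rot: "\<And>\<theta>. distr M borel (\<lambda>z. cis \<theta> * z) = M" and A: "A \<in> sets borel"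
 shows "emeasure M A = (\<integral>\<^sup>+r. (\<integral>\<^sup>+u. indicator A (cis (2 * pi * u) * complex_of_real r) \<partial>turn) \<partial>distr M borel cmod)"
proof -
 interpret M: prob_space M by (rule M)
 interpret U: prob_space turn by (rule prob_space_turn)
 interpret P: pair_sigma_finite M turn ..
 note [measurable_cong] = M(2)
 note [measurable] = A
 have "emeasure turn UNIV = 1" using U.emeasure_space_1 by simp
 then have "emeasure M A = (\<integral>\<^sup>+u. emeasure M A \<partial>turn)" by simp
 also have "\<dots> = (\<integral>\<^sup>+u. (\<integral>\<^sup>+z. indicator A (cis (2 * pi * u) * z) \<partial>M) \<partial>turn)"
 proof (rule nn_integral_cong)
  fix u :: real
  have "emeasure M A = emeasure (distr M borel (\<lambda>z. cis (2 * pi * u) * z)) A" by (simp only: rot)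
  also have "\<dots> = (\<integral>\<^sup>+z. indicator A z \<partial>distr M borel (\<lambda>z. cis (2 * pi * u) * z))" by simp
  also have "\<dots> = (\<integral>\<^sup>+z. indicator A (cis (2 * pi * u) * z) \<partial>M)" by (subst nn_integral_distr) auto
  finally show "emeasure M A = (\<integral>\<^sup>+z. indicator A (cis (2 * pi * u) * z) \<partial>M)" .
 qed
 also have "\<dots> = (\<integral>\<^sup>+z. (\<integral>\<^sup>+u. indicator A (cis (2 * pi * u) * z) \<partial>turn) \<partial>M)"
  by (rule P.Fubini') measurable
 also have "\<dots> = (\<integral>\<^sup>+z. (\<integral>\<^sup>+u. indicator A (cis (2 * pi * u) * complex_of_real (cmod z)) \<partial>turn) \<partial>M)"
 proof (rule nn_integral_cong)
  fix z :: complex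
  have z: "z = cis (Arg z) * complex_of_real (cmod z)" by (metis mult.commute rcis_cmod_Arg rcis_def)
  have "(\<integral>\<^sup>+u. indicator A (cis (2 * pi * u) * cis (Arg z) * complex_of_real (cmod z)) \<partial>turn) = (\<integral>\<^sup>+u. indicator A (cis (2 * pi * u) * complex_of_real (cmod z)) \<partial>turn)"
   by (rule nn_integral_turn_rotate) simp
  then show "(\<integral>\<^sup>+u. indicator A (cis (2 * pi * u) * z) \<partial>turn) = (\<integral>\<^sup>+u. indicator A (cis (2 * pi * u) * complex_of_real (cmod z)) \<partial>turn)"
   using z by (simp add: mult.assoc)
 qed
 also have "\<dots> = (\<integral>\<^sup>+r. (\<integral>\<^sup>+u. indicator A (cis (2 * pi * u) * complex_of_real r) \<partial>turn) \<partial>distr M borel cmod)"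
  by (subst nn_integral_distr) (auto intro!: U.borel_measurable_nn_integral)
 finally show ?thesis .
qed

text \<open>By the polar representation the measure is determined by the distribution of the modulus. The value of its distribution function at
 \<open>0\<close> is the limit from the right.\<close>
lemma radial_unique:
 assumes M: "prob_space M" "sets M = sets borel" and rotM: "\<And>\<theta>. distr M borel (\<lambda>z. cis \<theta> * z) = M"
  and N: "prob_space N" "sets N = sets borel" and rotN: "\<And>\<theta>. distr N borel (\<lambda>z. cis \<theta> * z) = N"
  and eq: "\<And>s. s > 0 \<Longrightarrow> measure M {z. cmod z \<le> s} = measure N {z. cmod z \<le> s}"
 shows "M = N"
proof -
 have real_distr: "real_distribution (distr X borel cmod)" if "prob_space X" "sets X = sets borel" for X
 proof -
  interpret X: prob_space X by (rule that)
  have "cmod \<in> borel_measurable X" using that(2) by (simp cong: measurable_cong_sets)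
  then show ?thesis by (rule X.real_distribution_distr)
 qed
 have cdfs: "cdf (distr X borel cmod) s = measure X {z. cmod z \<le> s}" if "sets X = sets borel" for X s
 proof -
  have "cmod \<in> borel_measurable X" using that by (simp cong: measurable_cong_sets)
  moreover have "space X = UNIV" using sets_eq_imp_space_eq[OF that] by simp
  ultimately show ?thesis unfolding cdf_def by (subst measure_distr) (auto simp: vimage_def)
 qed
 interpret DM: real_distribution "distr M borel cmod" by (rule real_distr[OF M])
 interpret DN: real_distribution "distr N borel cmod" by (rule real_distr[OF N])
 have pos: "cdf (distr M borel cmod) s = cdf (distr N borel cmod) s" if "s > 0" for s
  using cdfs[OF M(2)] cdfs[OF N(2)] eq[OF that] by simp
 have "cdf (distr M borel cmod) s = cdf (distr N borel cmod) s" for s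
 proof (cases s "0 :: real" rule: linorder_cases)
  case less
  then have "{z. cmod z \<le> s} = {}" by (auto simp: not_le intro: less_le_trans)
  then show ?thesis using cdfs[OF M(2)] cdfs[OF N(2)] by simp
 next
  case equal
  have "(cdf (distr M borel cmod) \<longlongrightarrow> cdf (distr M borel cmod) 0) (at_right 0)"
   using DM.cdf_is_right_cont[of 0] by (simp add: continuous_within)
  moreover have "(cdf (distr N borel cmod) \<longlongrightarrow> cdf (distr N borel cmod) 0) (at_right 0)"
   using DN.cdf_is_right_cont[of 0] by (simp add: continuous_within)
  moreover have "eventually (\<lambda>s. cdf (distr N borel cmod) s = cdf (distr M borel cmod) s) (at_right 0)"
   using eventually_at_right_less[of "0::real"] by eventually_elim (use pos in auto)
  ultimately have "(cdf (distr M borel cmod) \<longlongrightarrow> cdf (distr N borel cmod) 0) (at_right 0)"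
   using tendsto_cong by blast
  then show ?thesis using equal \<open>(cdf (distr M borel cmod) \<longlongrightarrow> cdf (distr M borel cmod) 0) (at_right 0)\<close>
   by (metis tendsto_unique trivial_limit_at_right_real)
 qed (use pos in auto)
 then have D: "distr M borel cmod = distr N borel cmod"
  by (intro cdf_unique real_distr M N) auto
 show ?thesis
 proof (rule measure_eqI)
  show "sets M = sets N" using M N by simp
  fix A assume "A \<in> sets M"
  then have A: "A \<in> sets borel" using M by simp
  show "emeasure M A = emeasure N A" unfolding radial_polar[OF M rotM A] radial_polar[OF N rotN A] D ..
 qed
qed

text \<open>A possible jump of the distribution function at zero becomes an atom at the origin.\<close>
lemma radial_exists:
 fixes F :: "real \<Rightarrow> real"
 assumes F01: "\<And>s. s > 0 \<Longrightarrow> 0 \<le> F s \<and> F s \<le> 1" and mono: "\<And>s t. 0 < s \<Longrightarrow> s \<le> t \<Longrightarrow> F s \<le> F t"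
  and rc: "\<And>s. s > 0 \<Longrightarrow> continuous (at_right s) F" and one: "\<And>s. b \<le> s \<Longrightarrow> 0 < s \<Longrightarrow> F s = 1"
 shows "\<exists>M. prob_space M \<and> sets M = sets borel \<and> (\<forall>\<theta>. distr M borel (\<lambda>z. cis \<theta> * z) = M) \<and>
  (\<forall>s>0. measure M {z. cmod z \<le> s} = F s)"
proof -
 define F0 where "F0 = Inf (F ` {0<..})"
 have bd: "bdd_below (F ` {0<..})" using F01 by (intro bdd_belowI[of _ 0]) auto
 have F0: "F0 \<le> F s" if "s > 0" for s unfolding F0_def using bd that by (intro cINF_lower) auto
 have F00: "0 \<le> F0" unfolding F0_def using F01 by (intro cINF_greatest) auto
 define G where "G s = (if s < 0 then 0 else if s = 0 then F0 else F s)" for s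
 have Gm: "G x \<le> G y" if "x \<le> y" for x y
  using that F01[of y] F0[of y] F00 mono[of x y] by (auto simp: G_def)
 have Grc: "continuous (at_right a) G" for a
 proof (cases a "0 :: real" rule: linorder_cases)
  case less
  have "eventually (\<lambda>s. G s = 0) (at_right a)"
   using eventually_at_right_real[OF less] by eventually_elim (auto simp: G_def)
  then have "(G \<longlongrightarrow> 0) (at_right a)" by (rule tendsto_eventually)
  then show ?thesis using less by (simp add: continuous_within G_def)
 next
  case equal
  have "(F \<longlongrightarrow> F0) (at_right 0)"
  proof (rule order_tendstoI)
   fix x assume x: "x < F0"
   show "eventually (\<lambda>s. x < F s) (at_right 0)"
    using eventually_at_right_less[of "0::real"] by eventually_elim (use F0 x in force)
  next
   fix x assume "F0 < x"
   then obtain s where s: "s > 0" "F s < x" unfolding F0_def using bd by (subst (asm) cInf_less_iff) auto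
   show "eventually (\<lambda>s. F s < x) (at_right 0)"
    using eventually_at_right_real[OF s(1)]
   proof eventually_elim
    case (elim t)
    then have "F t \<le> F s" using mono[of t s] by auto
    then show ?case using s(2) by linarith
   qed
  qed
  moreover have "eventually (\<lambda>s. F s = G s) (at_right 0)"
   using eventually_at_right_less[of "0::real"] by eventually_elim (auto simp: G_def)
  ultimately have "(G \<longlongrightarrow> F0) (at_right 0)" using tendsto_cong by blast
  then show ?thesis using equal by (simp add: continuous_within G_def)
 next
  case greater
  have "(F \<longlongrightarrow> F a) (at_right a)" using rc[OF greater] by (simp add: continuous_within)
  moreover have "eventually (\<lambda>s. F s = G s) (at_right a)"
   using eventually_at_right_less[of a] by eventually_elim (use greater in \<open>auto simp: G_def\<close>)
  ultimately have "(G \<longlongrightarrow> F a) (at_right a)" using tendsto_cong by blast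
  then show ?thesis using greater by (simp add: continuous_within G_def)
 qed
 have Gbot: "(G \<longlongrightarrow> 0) at_bot"
 proof (rule tendsto_eventually)
  show "eventually (\<lambda>s. G s = 0) at_bot" using eventually_gt_at_bot[of "0::real"]
   by (auto simp: G_def eventually_at_bot_linorder intro!: exI[of _ "-1"])
 qed
 have Gtop: "(G \<longlongrightarrow> 1) at_top"
 proof (rule tendsto_eventually)
  show "eventually (\<lambda>s. G s = 1) at_top" using one by (auto simp: G_def eventually_at_top_linorder intro!: exI[of _ "max 1 b"])
 qed
 define R where "R = interval_measure G"
 interpret R: real_distribution R unfolding R_def by (rule real_distribution_interval_measure[OF Gm Grc Gbot Gtop])
 have cR: "measure R {..x} = G x" for x
  using cdf_interval_measure[OF Gm Grc Gbot] by (simp add: R_def cdf_def fun_eq_iff)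
 interpret U: prob_space turn by (rule prob_space_turn)
 interpret P: pair_prob_space R turn ..
 define M where "M = distr (R \<Otimes>\<^sub>M turn) borel (\<lambda>p. cis (2 * pi * snd p) * complex_of_real (fst p))"
 have m [measurable]: "(\<lambda>p. cis (2 * pi * snd p) * complex_of_real (fst p)) \<in> borel_measurable (R \<Otimes>\<^sub>M turn)" by measurable
 have sM: "sets M = sets borel" by (simp add: M_def)
 have pM: "prob_space M" unfolding M_def by (rule P.prob_space_distr) simp
 have nnM: "(\<integral>\<^sup>+z. g z \<partial>M) = (\<integral>\<^sup>+r. (\<integral>\<^sup>+u. g (cis (2 * pi * u) * complex_of_real r) \<partial>turn) \<partial>R)" if [measurable]: "g \<in> borel_measurable borel" for g
 proof -
  have "(\<integral>\<^sup>+z. g z \<partial>M) = (\<integral>\<^sup>+p. g (cis (2 * pi * snd p) * complex_of_real (fst p)) \<partial>(R \<Otimes>\<^sub>M turn))"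
   unfolding M_def by (rule nn_integral_distr) auto
  also have "\<dots> = (\<integral>\<^sup>+r. (\<integral>\<^sup>+u. g (cis (2 * pi * u) * complex_of_real r) \<partial>turn) \<partial>R)"
   by (subst U.nn_integral_fst[symmetric]) auto
  finally show ?thesis .
 qed
 have "distr M borel (\<lambda>z. cis \<theta> * z) = M" for \<theta>
 proof (rule measure_eqI)
  show "sets (distr M borel (\<lambda>z. cis \<theta> * z)) = sets M" by (simp add: sM)
  fix A assume "A \<in> sets (distr M borel (\<lambda>z. cis \<theta> * z))"
  then have [measurable]: "A \<in> sets borel" by simp
  have mm: "(\<lambda>z. cis \<theta> * z) \<in> measurable M borel" using sM by (simp cong: measurable_cong_sets)
  have "emeasure (distr M borel (\<lambda>z. cis \<theta> * z)) A = (\<integral>\<^sup>+z. indicator A z \<partial>distr M borel (\<lambda>z. cis \<theta> * z))" by simp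
  also have "\<dots> = (\<integral>\<^sup>+z. indicator A (cis \<theta> * z) \<partial>M)" using mm by (subst nn_integral_distr) auto
  also have "\<dots> = (\<integral>\<^sup>+r. (\<integral>\<^sup>+u. indicator A (cis \<theta> * (cis (2 * pi * u) * complex_of_real r)) \<partial>turn) \<partial>R)"
   by (rule nnM) measurable
  also have "\<dots> = (\<integral>\<^sup>+r. (\<integral>\<^sup>+u. indicator A (cis (2 * pi * u) * cis \<theta> * complex_of_real r) \<partial>turn) \<partial>R)"
   by (simp only: mult.assoc mult.left_commute)
  also have "\<dots> = (\<integral>\<^sup>+r. (\<integral>\<^sup>+u. indicator A (cis (2 * pi * u) * complex_of_real r) \<partial>turn) \<partial>R)"
   by (subst nn_integral_turn_rotate) auto
  also have "\<dots> = (\<integral>\<^sup>+z. indicator A z \<partial>M)" by (rule nnM[symmetric]) simp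
  also have "\<dots> = emeasure M A" by (simp add: sM)
  finally show "emeasure (distr M borel (\<lambda>z. cis \<theta> * z)) A = emeasure M A" .
 qed
 moreover have "measure M {z. cmod z \<le> s} = F s" if s: "s > 0" for s
 proof -
  have "emeasure M {z. cmod z \<le> s} = (\<integral>\<^sup>+z. indicator {z. cmod z \<le> s} z \<partial>M)" by (subst nn_integral_indicator) (auto simp: sM)
  also have "\<dots> = (\<integral>\<^sup>+r. (\<integral>\<^sup>+u. indicator {z. cmod z \<le> s} (cis (2 * pi * u) * complex_of_real r) \<partial>turn) \<partial>R)" by (rule nnM) simp
  also have "\<dots> = (\<integral>\<^sup>+r. indicator {- s..s} r \<partial>R)"
  proof (rule nn_integral_cong)
   fix r :: real
   have "indicator {z. cmod z \<le> s} (cis (2 * pi * u) * complex_of_real r) = (indicator {- s..s} r :: ennreal)" for u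
    by (auto simp: indicator_def norm_mult abs_le_iff)
   then show "(\<integral>\<^sup>+u. indicator {z. cmod z \<le> s} (cis (2 * pi * u) * complex_of_real r) \<partial>turn) = (indicator {- s..s} r :: ennreal)"
    using U.emeasure_space_1 by simp
  qed
  also have "\<dots> = emeasure R {- s..s}" by simp
  finally have "measure M {z. cmod z \<le> s} = measure R {- s..s}" by (simp add: measure_def)
  moreover have "measure R {..s} = measure R {..< - s} + measure R {- s..s}"
  proof -
   have "{..s} = {..< - s} \<union> {- s..s}" using s by auto
   then show ?thesis by (simp only:) (rule R.finite_measure_Union, auto)
  qed
  moreover have "measure R {..< - s} \<le> measure R {.. - s}" by (intro R.finite_measure_mono) auto
  moreover have "measure R {.. - s} = 0" "measure R {..s} = F s" using s by (auto simp: cR G_def)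
  moreover have "0 \<le> measure R {..< - s}" by simp
  ultimately show ?thesis by linarith
 qed
 ultimately show ?thesis using sM pM by blast
qed

section \<open>The density of a variance profile\<close>

lemma mat_vec_sum:
 assumes "V \<in> carrier_mat n n" "q \<in> carrier_vec n" "i < n"
 shows "(V *\<^sub>v q) $ i = (\<Sum>j<n. V $$ (i, j) * q $ j)" "(V\<^sup>T *\<^sub>v q) $ i = (\<Sum>j<n. V $$ (j, i) * q $ j)"
 using assms by (auto simp: scalar_prod_def atLeast0LessThan)

locale matrix_profile =
 fixes V :: "real mat" and n :: nat and S :: real
 assumes V: "V \<in> carrier_mat n n" and prof: "profile n (\<lambda>i j. V $$ (i, j)) S"

sublocale matrix_profile \<subseteq> P: profile n "\<lambda>i j. V $$ (i, j)" S by (rule prof)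

context matrix_profile
begin

interpretation dual: profile n "\<lambda>i j. V $$ (j, i)" S by (rule P.dual_profile)

lemma dimV: "dim_row V = n" "dim_col V = n" using V by auto

lemma spec_rad_eigen:
 obtains k x where "cmod k = spec_rad V" "x \<in> carrier_vec n" "x \<noteq> 0\<^sub>v n" "map_mat complex_of_real V *\<^sub>v x = k \<cdot>\<^sub>v x"
proof -
 have c: "map_mat complex_of_real V \<in> carrier_mat n n" using V by simp
 have "spec_rad V \<in> norm ` spectrum (map_mat complex_of_real V)"
  unfolding spec_rad_def by (rule spectral_radius_mem_max(1)[OF c]) (rule P.n)
 then obtain k where k: "cmod k = spec_rad V" "eigenvalue (map_mat complex_of_real V) k" by (auto simp: spectrum_def)
 then obtain x where "eigenvector (map_mat complex_of_real V) x k" by (auto simp: eigenvalue_def)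
 then show ?thesis using that k(1) dimV by (auto simp: eigenvector_def)
qed

lemma spec_rad_nonneg: "0 \<le> spec_rad V" using spec_rad_eigen by (metis norm_ge_zero)

text \<open>The moduli \<open>y\<close> of a dominant eigenvector satisfy \<open>\<rho> y \<le> V y\<close>. Comparing them with a supposed subsolution \<open>u\<close> at a maximum of \<open>y / u\<close>
 would give \<open>\<rho> \<le> \<tau>\<close>.\<close>
lemma supercritical_below: assumes tau: "0 < \<tau>" "\<tau> < spec_rad V" shows "P.supercritical \<tau>"
 unfolding P.supercritical_def
proof (intro conjI allI impI tau(1))
 fix u :: "nat \<Rightarrow> real" assume u: "\<forall>i<n. 0 < u i"
 show "\<exists>i<n. \<tau> * u i < (\<Sum>j<n. V $$ (i, j) * u j)"
 proof (rule ccontr)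
  assume "\<not> ?thesis"
  then have le: "(\<Sum>j<n. V $$ (i, j) * u j) \<le> \<tau> * u i" if "i < n" for i using that by (meson not_le)
  obtain k x where x: "cmod k = spec_rad V" "x \<in> carrier_vec n" "x \<noteq> 0\<^sub>v n" "map_mat complex_of_real V *\<^sub>v x = k \<cdot>\<^sub>v x"
   by (rule spec_rad_eigen)
  define y where "y i = cmod (x $ i)" for i
  have row: "cmod k * y i \<le> (\<Sum>j<n. V $$ (i, j) * y j)" if i: "i < n" for i
  proof -
   have "k * x $ i = (k \<cdot>\<^sub>v x) $ i" using x(2) i by simp
   also have "\<dots> = (map_mat complex_of_real V *\<^sub>v x) $ i" by (simp only: x(4))
   also have "\<dots> = (\<Sum>j<n. complex_of_real (V $$ (i, j)) * x $ j)"
    using x(2) i V by (simp add: scalar_prod_def atLeast0LessThan)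
   finally have "cmod k * y i = cmod (\<Sum>j<n. complex_of_real (V $$ (i, j)) * x $ j)" by (simp add: y_def flip: norm_mult)
   also have "\<dots> \<le> (\<Sum>j<n. cmod (complex_of_real (V $$ (i, j)) * x $ j))" by (rule norm_sum)
   also have "\<dots> = (\<Sum>j<n. V $$ (i, j) * y j)" using P.V0[OF i] by (intro sum.cong) (auto simp: y_def norm_mult)
   finally show ?thesis .
  qed
  define m where "m = arg_min_on (\<lambda>i. - (y i / u i)) {..<n}"
  have ne: "finite {..<n}" "{..<n} \<noteq> {}" using P.n by auto
  have m: "m < n" "\<And>i. i < n \<Longrightarrow> y i / u i \<le> y m / u m"
   using arg_min_if_finite[OF ne, of "\<lambda>i. - (y i / u i)"] by (auto simp: m_def not_less)
  define c where "c = y m / u m"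
  have yc: "y i \<le> c * u i" if "i < n" for i using m(2)[OF that] u that by (simp add: c_def pos_divide_le_eq)
  have um: "u m > 0" "y m = c * u m" using u m(1) by (auto simp: c_def)
  obtain i0 where i0: "i0 < n" "x $ i0 \<noteq> 0" using x(2,3) by (metis carrier_vecD eq_vecI index_zero_vec(1,2))
  have "0 < y i0 / u i0" using i0 u by (simp add: y_def)
  then have cp: "c > 0" using m(2)[OF i0(1)] by (simp add: c_def)
  have "cmod k * (c * u m) \<le> (\<Sum>j<n. V $$ (m, j) * (c * u j))"
   using row[OF m(1)] yc P.V0[OF m(1)] sum_mono[of "{..<n}" "\<lambda>j. V $$ (m, j) * y j" "\<lambda>j. V $$ (m, j) * (c * u j)"]
   by (simp add: um(2) mult_left_mono)
  also have "\<dots> = c * (\<Sum>j<n. V $$ (m, j) * u j)" by (simp add: sum_distrib_left mult_ac)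
  also have "\<dots> \<le> c * (\<tau> * u m)" using le[OF m(1)] cp by (intro mult_left_mono) auto
  finally have "cmod k * (c * u m) \<le> \<tau> * (c * u m)" by (simp add: mult_ac)
  then have "cmod k \<le> \<tau>" using cp um by simp
  then show False using x(1) tau by simp
 qed
qed

lemma sol_of_fixpoint:
 assumes q: "\<And>i. i < n \<Longrightarrow> 0 < q i" "\<And>i. i < n \<Longrightarrow> 0 < z i" and tau: "\<tau> > 0" and t: "0 \<le> t"
  and e: "\<And>i. i < n \<Longrightarrow> q i = ((\<Sum>j<n. V $$ (j, i) * q j) + t) / (\<tau> + ((\<Sum>j<n. V $$ (i, j) * z j) + t) * ((\<Sum>j<n. V $$ (j, i) * q j) + t))"
   "\<And>i. i < n \<Longrightarrow> z i = ((\<Sum>j<n. V $$ (i, j) * z j) + t) / (\<tau> + ((\<Sum>j<n. V $$ (i, j) * z j) + t) * ((\<Sum>j<n. V $$ (j, i) * q j) + t))"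
 shows "P.sol \<tau> t q z (\<lambda>i. \<tau> + ((\<Sum>j<n. V $$ (i, j) * z j) + t) * ((\<Sum>j<n. V $$ (j, i) * q j) + t))"
 unfolding P.sol_def
proof (intro allI impI)
 fix i assume i: "i < n"
 define a b where "a = (\<Sum>j<n. V $$ (j, i) * q j) + t" and "b = (\<Sum>j<n. V $$ (i, j) * z j) + t"
 have ab: "0 \<le> a" "0 \<le> b" unfolding a_def b_def using t P.V0 q i
  by (auto intro!: add_nonneg_nonneg sum_nonneg mult_nonneg_nonneg simp: order_less_imp_le)
 have th: "\<tau> + b * a > 0" using tau ab by (intro add_pos_nonneg) auto
 have qe: "q i = a / (\<tau> + b * a)" "z i = b / (\<tau> + b * a)" using e[OF i] by (simp_all add: a_def b_def)
 have "q i * z i * (\<tau> + b * a) = a * b / (\<tau> + b * a)" unfolding qe using th by simp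
 also have "\<dots> = 1 - \<tau> / (\<tau> + b * a)" using th by (simp add: field_simps)
 finally have "q i * z i * (\<tau> + b * a) = 1 - \<tau> / (\<tau> + b * a)" .
 moreover have "(\<tau> + b * a) * q i = a" "(\<tau> + b * a) * z i = b" unfolding qe using th by simp_all
 ultimately show "0 < q i \<and> 0 < z i \<and> 0 < \<tau> + ((\<Sum>j<n. V $$ (i, j) * z j) + t) * ((\<Sum>j<n. V $$ (j, i) * q j) + t) \<and>
   (\<tau> + ((\<Sum>j<n. V $$ (i, j) * z j) + t) * ((\<Sum>j<n. V $$ (j, i) * q j) + t)) * q i = (\<Sum>j<n. V $$ (j, i) * q j) + t \<and>
   (\<tau> + ((\<Sum>j<n. V $$ (i, j) * z j) + t) * ((\<Sum>j<n. V $$ (j, i) * q j) + t)) * z i = (\<Sum>j<n. V $$ (i, j) * z j) + t \<and>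
   q i * z i * (\<tau> + ((\<Sum>j<n. V $$ (i, j) * z j) + t) * ((\<Sum>j<n. V $$ (j, i) * q j) + t)) =
    1 - \<tau> / (\<tau> + ((\<Sum>j<n. V $$ (i, j) * z j) + t) * ((\<Sum>j<n. V $$ (j, i) * q j) + t))"
  unfolding a_def[symmetric] b_def[symmetric] using q i th by blast
qed

lemma fixpoint_of_sol:
 assumes s: "P.sol \<tau> t q z \<theta>" and i: "i < n"
 shows "q i = ((\<Sum>j<n. V $$ (j, i) * q j) + t) / (\<tau> + ((\<Sum>j<n. V $$ (i, j) * z j) + t) * ((\<Sum>j<n. V $$ (j, i) * q j) + t))"
  "z i = ((\<Sum>j<n. V $$ (i, j) * z j) + t) / (\<tau> + ((\<Sum>j<n. V $$ (i, j) * z j) + t) * ((\<Sum>j<n. V $$ (j, i) * q j) + t))"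
proof -
 note D = P.solD[OF s i]
 have th: "\<theta> i = \<tau> + ((\<Sum>j<n. V $$ (i, j) * z j) + t) * ((\<Sum>j<n. V $$ (j, i) * q j) + t)"
  using P.sol_theta[OF s i] by (simp only: mult.commute)
 show "q i = ((\<Sum>j<n. V $$ (j, i) * q j) + t) / (\<tau> + ((\<Sum>j<n. V $$ (i, j) * z j) + t) * ((\<Sum>j<n. V $$ (j, i) * q j) + t))"
  unfolding th[symmetric] unfolding D(4)[symmetric] using D(3) by simp
 show "z i = ((\<Sum>j<n. V $$ (i, j) * z j) + t) / (\<tau> + ((\<Sum>j<n. V $$ (i, j) * z j) + t) * ((\<Sum>j<n. V $$ (j, i) * q j) + t))"
  unfolding th[symmetric] unfolding D(5)[symmetric] using D(3) by simp
qed

lemma vec_sums: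
 assumes i: "i < n"
 shows "(V *\<^sub>v vec n z) $ i = (\<Sum>j<n. V $$ (i, j) * z j)" "(V\<^sup>T *\<^sub>v vec n q) $ i = (\<Sum>j<n. V $$ (j, i) * q j)"
 unfolding mat_vec_sum(1)[OF V vec_carrier i] mat_vec_sum(2)[OF V vec_carrier i] by (rule sum.cong[OF refl], simp)+

lemma reg_master_sol_eq:
 assumes st: "s > 0" "t > 0" and sol: "P.sol (s\<^sup>2) t q z \<theta>"
 shows "reg_master_sol V s t = (vec n q, vec n z)"
 unfolding reg_master_sol_def
proof (rule the_equality)
 show "case (vec n q, vec n z) of (r, r') \<Rightarrow> reg_master_eqs V s t r r' \<and> (\<forall>i<dim_row V. r $ i > 0 \<and> r' $ i > 0)"
  unfolding reg_master_eqs_def dimV prod.case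
 proof (intro conjI allI impI)
  fix i assume i: "i < n"
  show "vec n q $ i = ((V\<^sup>T *\<^sub>v vec n q) $ i + t) / (s\<^sup>2 + ((V *\<^sub>v vec n z) $ i + t) * ((V\<^sup>T *\<^sub>v vec n q) $ i + t))"
   unfolding vec_sums[OF i] index_vec[OF i] by (rule fixpoint_of_sol(1)[OF sol i])
  show "vec n z $ i = ((V *\<^sub>v vec n z) $ i + t) / (s\<^sup>2 + ((V *\<^sub>v vec n z) $ i + t) * ((V\<^sup>T *\<^sub>v vec n q) $ i + t))"
   unfolding vec_sums[OF i] index_vec[OF i] by (rule fixpoint_of_sol(2)[OF sol i])
  show "0 < vec n q $ i" "0 < vec n z $ i" using P.solD(1,2)[OF sol i] by (simp_all add: i)
 qed simp_all
next
 fix p assume p: "case p of (r, r') \<Rightarrow> reg_master_eqs V s t r r' \<and> (\<forall>i<dim_row V. r $ i > 0 \<and> r' $ i > 0)"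
 obtain r r' where pr: "p = (r, r')" by (cases p)
 have c: "r \<in> carrier_vec n" "r' \<in> carrier_vec n" and pos: "\<And>i. i < n \<Longrightarrow> 0 < r $ i" "\<And>i. i < n \<Longrightarrow> 0 < r' $ i"
  using p by (auto simp: pr reg_master_eqs_def dimV)
 have eqs: "r $ i = ((V\<^sup>T *\<^sub>v r) $ i + t) / (s\<^sup>2 + ((V *\<^sub>v r') $ i + t) * ((V\<^sup>T *\<^sub>v r) $ i + t))"
  "r' $ i = ((V *\<^sub>v r') $ i + t) / (s\<^sup>2 + ((V *\<^sub>v r') $ i + t) * ((V\<^sup>T *\<^sub>v r) $ i + t))" if "i < n" for i
  using p that unfolding pr reg_master_eqs_def dimV prod.case by blast+
 have "P.sol (s\<^sup>2) t (\<lambda>i. r $ i) (\<lambda>i. r' $ i) (\<lambda>i. s\<^sup>2 + ((\<Sum>j<n. V $$ (i, j) * r' $ j) + t) * ((\<Sum>j<n. V $$ (j, i) * r $ j) + t))"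
 proof (rule sol_of_fixpoint)
  fix i assume i: "i < n"
  note e = eqs[OF i, unfolded mat_vec_sum(1)[OF V c(2) i] mat_vec_sum(2)[OF V c(1) i]]
  show "r $ i = ((\<Sum>j<n. V $$ (j, i) * r $ j) + t) / (s\<^sup>2 + ((\<Sum>j<n. V $$ (i, j) * r' $ j) + t) * ((\<Sum>j<n. V $$ (j, i) * r $ j) + t))"
   by (rule e(1))
  show "r' $ i = ((\<Sum>j<n. V $$ (i, j) * r' $ j) + t) / (s\<^sup>2 + ((\<Sum>j<n. V $$ (i, j) * r' $ j) + t) * ((\<Sum>j<n. V $$ (j, i) * r $ j) + t))"
   by (rule e(2))
 qed (use st pos in simp_all)
 from P.sol_unique[OF this sol st(2)] st have "r $ i = q i \<and> r' $ i = z i" if "i < n" for i using that by auto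
 then show "p = (vec n q, vec n z)" unfolding pr using c by (auto intro!: eq_vecI)
qed

text \<open>A solution of the master equations which is not zero is positive everywhere, by irreducibility and since the sums of its two halves
 agree. So it is the normalized \<open>sol\<close> at \<open>t = 0\<close>.\<close>
lemma master_sol_eq:
 assumes s: "s > 0" "s < sqrt (spec_rad V)"
 shows "master_sol V s = (vec n (P.gq (s\<^sup>2)), vec n (P.gz (s\<^sup>2)))"
proof -
 have tau: "0 < s\<^sup>2" "s\<^sup>2 < spec_rad V"
 proof -
  show "0 < s\<^sup>2" using s by simp
  have "s\<^sup>2 < (sqrt (spec_rad V))\<^sup>2" using s by (intro power_strict_mono) auto
  then show "s\<^sup>2 < spec_rad V" using spec_rad_nonneg by simp
 qed
 note sol = P.canon[OF supercritical_below[OF tau]]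
 define q z where "q = P.gq (s\<^sup>2)" and "z = P.gz (s\<^sup>2)"
 note sol = sol[folded q_def z_def]
 have "(THE (q, q'). master_eqs V s q q' \<and> (q, q') \<noteq> (0\<^sub>v (dim_row V), 0\<^sub>v (dim_row V))) = (vec n q, vec n z)"
 proof (rule the_equality)
  have "vec n q \<noteq> 0\<^sub>v n"
  proof
   assume "vec n q = 0\<^sub>v n"
   then have "vec n q $ 0 = 0\<^sub>v n $ 0" by simp
   then show False using P.n P.solD(1)[OF sol(1) P.n] by simp
  qed
  then show "case (vec n q, vec n z) of (q, q') \<Rightarrow> master_eqs V s q q' \<and> (q, q') \<noteq> (0\<^sub>v (dim_row V), 0\<^sub>v (dim_row V))"
   unfolding master_eqs_def dimV prod.case
  proof (intro conjI allI impI)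
   fix i assume i: "i < n"
   show "vec n q $ i = (V\<^sup>T *\<^sub>v vec n q) $ i / (s\<^sup>2 + (V *\<^sub>v vec n z) $ i * (V\<^sup>T *\<^sub>v vec n q) $ i)"
    unfolding vec_sums[OF i] index_vec[OF i] by (rule fixpoint_of_sol(1)[OF sol(1) i, unfolded add_0_right])
   show "vec n z $ i = (V *\<^sub>v vec n z) $ i / (s\<^sup>2 + (V *\<^sub>v vec n z) $ i * (V\<^sup>T *\<^sub>v vec n q) $ i)"
    unfolding vec_sums[OF i] index_vec[OF i] by (rule fixpoint_of_sol(2)[OF sol(1) i, unfolded add_0_right])
   show "0 \<le> vec n q $ i" "0 \<le> vec n z $ i" using P.solD(1,2)[OF sol(1) i] by (simp_all add: i)
  qed (use sol(2) in simp_all)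
 next
  fix p assume p: "case p of (q, q') \<Rightarrow> master_eqs V s q q' \<and> (q, q') \<noteq> (0\<^sub>v (dim_row V), 0\<^sub>v (dim_row V))"
  obtain r r' where pr: "p = (r, r')" by (cases p)
  have c: "r \<in> carrier_vec n" "r' \<in> carrier_vec n" and nn: "\<And>i. i < n \<Longrightarrow> 0 \<le> r $ i" "\<And>i. i < n \<Longrightarrow> 0 \<le> r' $ i"
   and su: "(\<Sum>i<n. r $ i) = (\<Sum>i<n. r' $ i)" and nz: "r \<noteq> 0\<^sub>v n \<or> r' \<noteq> 0\<^sub>v n"
   using p unfolding pr master_eqs_def dimV prod.case by blast+
  define a b where "a i = (\<Sum>j<n. V $$ (j, i) * r $ j)" and "b i = (\<Sum>j<n. V $$ (i, j) * r' $ j)" for i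
  have ab: "0 \<le> a i" "0 \<le> b i" if "i < n" for i
   unfolding a_def b_def using P.V0 nn that by (auto intro!: sum_nonneg mult_nonneg_nonneg)
  have eqs: "r $ i = a i / (s\<^sup>2 + b i * a i)" "r' $ i = b i / (s\<^sup>2 + b i * a i)" if "i < n" for i
  proof -
   have "r $ i = (V\<^sup>T *\<^sub>v r) $ i / (s\<^sup>2 + (V *\<^sub>v r') $ i * (V\<^sup>T *\<^sub>v r) $ i)"
    "r' $ i = (V *\<^sub>v r') $ i / (s\<^sup>2 + (V *\<^sub>v r') $ i * (V\<^sup>T *\<^sub>v r) $ i)"
    using p that unfolding pr master_eqs_def dimV prod.case by blast+
   then show "r $ i = a i / (s\<^sup>2 + b i * a i)" "r' $ i = b i / (s\<^sup>2 + b i * a i)"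
    unfolding mat_vec_sum(1)[OF V c(2) that] mat_vec_sum(2)[OF V c(1) that] a_def b_def .
  qed
  have den: "s\<^sup>2 + b i * a i > 0" if "i < n" for i using tau ab[OF that] by (intro add_pos_nonneg) auto
  have zero1: "\<forall>i<n. r $ i = 0" if "k < n" "r $ k = 0" for k
  proof (intro allI impI)
   fix i assume "i < n"
   show "r $ i = 0"
   proof (rule dual.irr_zero[where y = "\<lambda>i. r $ i", OF nn(1) _ that(1) that(2) \<open>i < n\<close>])
    fix i assume i: "i < n" "r $ i = 0"
    then have "a i = 0" using eqs(1)[OF i(1)] den[OF i(1)] by simp
    then show "(\<Sum>j<n. V $$ (j, i) * r $ j) \<le> 0" by (simp add: a_def)
   qed
  qed
  have zero2: "\<forall>i<n. r' $ i = 0" if "k < n" "r' $ k = 0" for k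
  proof (intro allI impI)
   fix i assume "i < n"
   show "r' $ i = 0"
   proof (rule P.irr_zero[where y = "\<lambda>i. r' $ i", OF nn(2) _ that(1) that(2) \<open>i < n\<close>])
    fix i assume i: "i < n" "r' $ i = 0"
    then have "b i = 0" using eqs(2)[OF i(1)] den[OF i(1)] by simp
    then show "(\<Sum>j<n. V $$ (i, j) * r' $ j) \<le> 0" by (simp add: b_def)
   qed
  qed
  have zz: "(\<forall>i<n. r $ i = 0) \<longleftrightarrow> (\<forall>i<n. r' $ i = 0)"
  proof -
   have "(\<forall>i<n. r $ i = 0) \<longleftrightarrow> (\<Sum>i<n. r $ i) = 0" using nn by (subst sum_nonneg_eq_0_iff) auto
   moreover have "(\<forall>i<n. r' $ i = 0) \<longleftrightarrow> (\<Sum>i<n. r' $ i) = 0" using nn by (subst sum_nonneg_eq_0_iff) auto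
   ultimately show ?thesis using su by simp
  qed
  have "\<not> ((\<forall>i<n. r $ i = 0) \<and> (\<forall>i<n. r' $ i = 0))"
   using nz c by (metis carrier_vecD eq_vecI index_zero_vec(1,2))
  then have pos: "0 < r $ i" "0 < r' $ i" if "i < n" for i
   using zero1[OF that] zero2[OF that] zz nn[OF that] by (auto simp: order_less_le)
  have "P.sol (s\<^sup>2) 0 (\<lambda>i. r $ i) (\<lambda>i. r' $ i) (\<lambda>i. s\<^sup>2 + ((\<Sum>j<n. V $$ (i, j) * r' $ j) + 0) * ((\<Sum>j<n. V $$ (j, i) * r $ j) + 0))"
  proof (rule sol_of_fixpoint)
   fix i assume i: "i < n"
   note e = eqs[OF i, unfolded a_def b_def]
   show "r $ i = ((\<Sum>j<n. V $$ (j, i) * r $ j) + 0) / (s\<^sup>2 + ((\<Sum>j<n. V $$ (i, j) * r' $ j) + 0) * ((\<Sum>j<n. V $$ (j, i) * r $ j) + 0))"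
    unfolding add_0_right by (rule e(1))
   show "r' $ i = ((\<Sum>j<n. V $$ (i, j) * r' $ j) + 0) / (s\<^sup>2 + ((\<Sum>j<n. V $$ (i, j) * r' $ j) + 0) * ((\<Sum>j<n. V $$ (j, i) * r $ j) + 0))"
    unfolding add_0_right by (rule e(2))
  qed (use tau pos in simp_all)
  from P.sol_unique0[OF this sol(1) tau(1) su sol(2)] have "r $ i = q i \<and> r' $ i = z i" if "i < n" for i using that by auto
  then show "p = (vec n q, vec n z)" unfolding pr using c by (auto intro!: eq_vecI)
 qed
 then show ?thesis using s by (simp add: master_sol_def Let_def q_def z_def)
qed

lemma radial_cdf_below:
 assumes s: "s > 0" "s < sqrt (spec_rad V)"
 shows "radial_cdf V s = P.cdf (s\<^sup>2)"
proof -
 have tau: "0 < s\<^sup>2" "s\<^sup>2 < spec_rad V"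
 proof -
  show "0 < s\<^sup>2" using s by simp
  have "s\<^sup>2 < (sqrt (spec_rad V))\<^sup>2" using s by (intro power_strict_mono) auto
  then show "s\<^sup>2 < spec_rad V" using spec_rad_nonneg by simp
 qed
 note sol = P.canon(1)[OF supercritical_below[OF tau]]
 define q z \<theta> where "q = P.gq (s\<^sup>2)" and "z = P.gz (s\<^sup>2)" and "\<theta> = P.gth (s\<^sup>2)"
 note D = P.solD[OF sol[folded q_def z_def \<theta>_def]]
 have "vec n q \<bullet> (V *\<^sub>v vec n z) = (\<Sum>i<n. q i * (V *\<^sub>v vec n z) $ i)"
  using dimV by (simp add: scalar_prod_def atLeast0LessThan)
 also have "\<dots> = (\<Sum>i<n. 1 - s\<^sup>2 / \<theta> i)"
 proof (rule sum.cong[OF refl])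
  fix i assume "i \<in> {..<n}" then have i: "i < n" by simp
  have "q i * (V *\<^sub>v vec n z) $ i = q i * (\<theta> i * z i)" using D(5)[OF i] vec_sums(1)[OF i] by simp
  also have "\<dots> = 1 - s\<^sup>2 / \<theta> i" using D(6)[OF i] by (simp add: mult_ac)
  finally show "q i * (V *\<^sub>v vec n z) $ i = 1 - s\<^sup>2 / \<theta> i" .
 qed
 finally show ?thesis using P.n unfolding radial_cdf_def master_sol_eq[OF s] P.cdf_def
  by (simp add: dimV q_def[symmetric] z_def[symmetric] \<theta>_def[symmetric] sum_subtractf diff_divide_distrib)
qed

lemma radial_cdf_above: "sqrt (spec_rad V) \<le> s \<Longrightarrow> radial_cdf V s = 1"
 using scalar_prod_left_zero[OF mult_mat_vec_carrier[OF V zero_carrier_vec]]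
 by (simp add: radial_cdf_def master_sol_def Let_def dimV)

lemma square_below: "0 < s \<Longrightarrow> s < sqrt (spec_rad V) \<Longrightarrow> 0 < s\<^sup>2 \<and> s\<^sup>2 < spec_rad V"
 using power_strict_mono[of s "sqrt (spec_rad V)" 2] spec_rad_nonneg by simp

lemma cdf_has_derivative:
 assumes "0 < \<tau>" "\<tau> < spec_rad V"
 shows "(P.cdf has_real_derivative deriv P.cdf \<tau>) (at \<tau>)" "0 \<le> deriv P.cdf \<tau>"
proof -
 obtain D \<xi> \<eta> where d: "P.lin (P.gq \<tau>) (P.gz \<tau>) (P.gth \<tau>) \<tau> 1 D \<xi> \<eta>"
  "(P.cdf has_real_derivative (\<Sum>i<n. \<tau> / P.gth \<tau> i * D i) / (real n * \<tau>)) (at \<tau>)"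
  using P.cdf_derivative[OF supercritical_below assms] by blast
 then show "(P.cdf has_real_derivative deriv P.cdf \<tau>) (at \<tau>)" using DERIV_imp_deriv by metis
 have "0 \<le> (\<Sum>i<n. \<tau> / P.gth \<tau> i * D i) / (real n * \<tau>)"
  using P.cdf_slope(3)[OF P.canon(1)[OF supercritical_below[OF assms]] assms(1) d(1)] assms by simp
 then show "0 \<le> deriv P.cdf \<tau>" using DERIV_imp_deriv[OF d(2)] by simp
qed

lemma radial_cdf_derivative:
 assumes s: "s > 0" "s < sqrt (spec_rad V)"
 shows "(radial_cdf V has_real_derivative deriv P.cdf (s\<^sup>2) * (2 * s)) (at s)"
proof -
 have "((\<lambda>s. P.cdf (s\<^sup>2)) has_real_derivative deriv P.cdf (s\<^sup>2) * (2 * s)) (at s)"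
  using square_below[OF s] by (intro DERIV_chain2[OF cdf_has_derivative(1)]) (auto intro!: derivative_eq_intros)
 moreover have "eventually (\<lambda>x. P.cdf (x\<^sup>2) = radial_cdf V x) (nhds s)"
  using eventually_nhds_in_open[of "{0<..<sqrt (spec_rad V)}" s] s by (auto elim!: eventually_mono simp: radial_cdf_below)
 ultimately show ?thesis using DERIV_cong_ev[OF refl, of "\<lambda>s. P.cdf (s\<^sup>2)" "radial_cdf V" s] by blast
qed

text \<open>The distribution function is monotone by the sign of its derivative and equals \<open>1\<close> from \<open>sqrt (spec_rad V)\<close> on, so the
 measure exists and is unique.\<close>
lemma measure_mu: assumes "s > 0" shows "measure (mu V) {z. cmod z \<le> s} = radial_cdf V s"
proof -
 define b where "b = sqrt (spec_rad V)"
 have b0: "0 \<le> b" using spec_rad_nonneg by (simp add: b_def)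
 have cdf01: "0 \<le> P.cdf \<tau> \<and> P.cdf \<tau> \<le> 1" if "0 < \<tau>" "\<tau> < spec_rad V" for \<tau>
 proof -
  note D = P.solD[OF P.canon(1)[OF supercritical_below[OF that]]]
  have "0 \<le> (\<Sum>i<n. \<tau> / P.gth \<tau> i)" using D(3) that by (intro sum_nonneg) (auto simp: order_less_imp_le)
  moreover have "(\<Sum>i<n. \<tau> / P.gth \<tau> i) \<le> real n"
   using sum_bounded_above[of "{..<n}" "\<lambda>i. \<tau> / P.gth \<tau> i" 1] D(7) by (auto simp: order_less_imp_le)
  ultimately show ?thesis using P.n by (simp add: P.cdf_def)
 qed
 have F01: "0 \<le> radial_cdf V s \<and> radial_cdf V s \<le> 1" if "s > 0" for s
  using that radial_cdf_above[of s] radial_cdf_below[of s] cdf01[of "s\<^sup>2"] square_below[of s] by (cases "s < b") (auto simp: b_def)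
 have mono: "radial_cdf V s \<le> radial_cdf V t" if st: "0 < s" "s \<le> t" for s t
 proof (cases "t < b")
  case True
  show ?thesis
  proof (rule DERIV_nonneg_imp_nondecreasing[OF st(2)])
   fix x assume "s \<le> x" "x \<le> t"
   then have x: "0 < x" "x < sqrt (spec_rad V)" using st True by (auto simp: b_def)
   then show "\<exists>y. (radial_cdf V has_real_derivative y) (at x) \<and> 0 \<le> y"
    using radial_cdf_derivative[OF x] cdf_has_derivative(2) square_below[OF x] by (intro exI conjI) auto
  qed
 next
  case False
  then show ?thesis using radial_cdf_above[of t] F01[OF st(1)] by (simp add: b_def)
 qed
 have rc: "continuous (at_right s) (radial_cdf V)" if "s > 0" for s
 proof (cases "s < b")
  case True
  then have "isCont (radial_cdf V) s" using radial_cdf_derivative[of s] that by (auto simp: b_def intro: DERIV_isCont)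
  then show ?thesis by (rule continuous_at_imp_continuous_at_within)
 next
  case False
  have "eventually (\<lambda>x. radial_cdf V x = 1) (at_right s)"
   using eventually_at_right_less[of s] by eventually_elim (use False radial_cdf_above in \<open>auto simp: b_def\<close>)
  then have "(radial_cdf V \<longlongrightarrow> 1) (at_right s)" by (rule tendsto_eventually)
  then show ?thesis using False radial_cdf_above[of s] by (simp add: continuous_within b_def)
 qed
 have one: "radial_cdf V s = 1" if "b \<le> s" "0 < s" for s using radial_cdf_above that by (simp add: b_def)
 obtain M where M: "prob_space M" "sets M = sets borel" "\<forall>\<theta>. distr M borel (\<lambda>z. cis \<theta> * z) = M"
  "\<forall>s>0. measure M {z. cmod z \<le> s} = radial_cdf V s"
  using radial_exists[OF F01 mono rc one] by blast
 have "mu V = M" unfolding mu_def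
 proof (rule the_equality)
  show "prob_space M \<and> sets M = sets borel \<and> radially_symmetric M \<and> (\<forall>s>0. measure M {z. cmod z \<le> s} = radial_cdf V s)"
   using M by (simp add: radially_symmetric_def)
  fix N assume N: "prob_space N \<and> sets N = sets borel \<and> radially_symmetric N \<and> (\<forall>s>0. measure N {z. cmod z \<le> s} = radial_cdf V s)"
  show "N = M" by (rule radial_unique) (use N M in \<open>auto simp: radially_symmetric_def\<close>)
 qed
 then show ?thesis using M(4) assms by simp
qed

text \<open>The factor \<open>2 * s\<close> from the chain rule for \<open>\<tau> = s^2\<close> cancels the circumference up to \<open>\<pi>\<close>.\<close>
lemma density_below:
 assumes z: "0 < cmod z" "cmod z < sqrt (spec_rad V)"
 shows "mu_density0 V z = deriv P.cdf ((cmod z)\<^sup>2) / pi"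
proof -
 have "eventually (\<lambda>s. radial_cdf V s = measure (mu V) {w. cmod w \<le> s}) (nhds (cmod z))"
  using eventually_nhds_in_open[of "{0<..}" "cmod z"] z(1) by (auto elim!: eventually_mono simp: measure_mu)
 then have "((\<lambda>s. measure (mu V) {w. cmod w \<le> s}) has_real_derivative deriv P.cdf ((cmod z)\<^sup>2) * (2 * cmod z)) (at (cmod z))"
  using radial_cdf_derivative[OF z] DERIV_cong_ev[OF refl, of "radial_cdf V" "\<lambda>s. measure (mu V) {w. cmod w \<le> s}" "cmod z"] by blast
 then have "deriv (\<lambda>s. measure (mu V) {w. cmod w \<le> s}) (cmod z) = deriv P.cdf ((cmod z)\<^sup>2) * (2 * cmod z)" by (rule DERIV_imp_deriv)
 then show ?thesis using z by (simp add: mu_density0_def)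
qed

lemma density_above:
 assumes z: "0 < cmod z" "sqrt (spec_rad V) \<le> cmod z"
 shows "mu_density0 V z = 0"
proof (cases "cmod z = sqrt (spec_rad V)")
 case False
 have "sqrt (spec_rad V) < cmod z" using z False by simp
 then have "eventually (\<lambda>s. 1 = measure (mu V) {w. cmod w \<le> s}) (nhds (cmod z))"
  using eventually_nhds_in_open[of "{max 0 (sqrt (spec_rad V))<..}" "cmod z"] z(1)
  by (auto elim!: eventually_mono simp: measure_mu radial_cdf_above)
 then have "((\<lambda>s. measure (mu V) {w. cmod w \<le> s}) has_real_derivative 0) (at (cmod z))"
  using DERIV_cong_ev[OF refl, of "\<lambda>_. 1" "\<lambda>s. measure (mu V) {w. cmod w \<le> s}" "cmod z" 0 0] by auto
 then show ?thesis using DERIV_imp_deriv by (fastforce simp: mu_density0_def)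
qed (simp add: mu_density0_def)

text \<open>The maximum with \<open>1\<close> guarantees a positive denominator.\<close>
lemma admissible_density:
 assumes s: "0 < s" "s < sqrt (spec_rad V)" and C: "C > 0"
  and adm: "\<And>t. 0 < t \<Longrightarrow> t \<le> 1 \<Longrightarrow> 1 / real n * (\<Sum>i<n. fst (reg_master_sol V s t) $ i) \<le> C"
  and z: "cmod z = s"
 shows "1 / (pi * Theta_adm S (s\<^sup>2) C * max 1 (K_adm S (s\<^sup>2) C)) \<le> mu_density V z"
proof -
 define \<tau> where "\<tau> = s\<^sup>2"
 define K where "K = max 1 (K_adm S \<tau> C)"
 define \<Theta> where "\<Theta> = Theta_adm S \<tau> C"
 have tau: "0 < \<tau>" "\<tau> < spec_rad V" using square_below[OF s] by (auto simp: \<tau>_def)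
 have nn: "real n > 0" using P.n by simp
 note sc = supercritical_below[OF tau]
 have le: "(\<Sum>i<n. q i) \<le> C * real n" if "0 < t" "t \<le> 1" "P.sol \<tau> t q y \<theta>" for t q y \<theta>
 proof -
  have "reg_master_sol V s t = (vec n q, vec n y)" by (rule reg_master_sol_eq[OF s(1) that(1) that(3)[unfolded \<tau>_def]])
  then have "1 / real n * (\<Sum>i<n. q i) \<le> C" using adm[OF that(1,2)] by simp
  then show ?thesis using nn by (simp add: divide_le_eq)
 qed
 have B: "(\<Sum>i<n. (1 - \<tau> / P.gth \<tau> i)\<^sup>2) \<le> K_adm S \<tau> C / real n * (\<Sum>i<n. 1 - \<tau> / P.gth \<tau> i)\<^sup>2"
  "\<And>i. i < n \<Longrightarrow> P.gth \<tau> i \<le> Theta_adm S \<tau> C"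
  by (rule P.admissible_balance[OF sc C _ P.canon[OF sc]], rule le, assumption+)+
 obtain D \<xi> \<eta> where d: "P.lin (P.gq \<tau>) (P.gz \<tau>) (P.gth \<tau>) \<tau> 1 D \<xi> \<eta>"
  "(P.cdf has_real_derivative (\<Sum>i<n. \<tau> / P.gth \<tau> i * D i) / (real n * \<tau>)) (at \<tau>)"
  using P.cdf_derivative[OF supercritical_below tau] by blast
 define k where "k = (\<Sum>i<n. 1 - \<tau> / P.gth \<tau> i)"
 define X where "X = (\<Sum>i<n. \<tau> / P.gth \<tau> i * D i)"
 note F = P.solD[OF P.canon(1)[OF sc]]
 have k: "k > 0" unfolding k_def using F(7) P.n by (intro sum_pos) auto
 have Tp: "\<Theta> > 0" using tau by (simp add: \<Theta>_def Theta_adm_def add_pos_nonneg)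
 have Kp: "K \<ge> 1" by (simp add: K_def)
 have X0: "0 \<le> X" unfolding X_def by (rule P.cdf_slope(3)[OF P.canon(1)[OF sc] tau(1) d(1)])
 define Y where "Y = (\<Sum>i<n. (1 - \<tau> / P.gth \<tau> i)\<^sup>2 * P.gth \<tau> i)"
 have "Y \<le> (\<Sum>i<n. (1 - \<tau> / P.gth \<tau> i)\<^sup>2 * \<Theta>)"
  unfolding Y_def \<Theta>_def by (intro sum_mono mult_left_mono B(2)) simp_all
 also have "\<dots> = (\<Sum>i<n. (1 - \<tau> / P.gth \<tau> i)\<^sup>2) * \<Theta>" by (simp only: sum_distrib_right)
 finally have Y1: "Y \<le> (\<Sum>i<n. (1 - \<tau> / P.gth \<tau> i)\<^sup>2) * \<Theta>" .
 have "K_adm S \<tau> C / real n * k\<^sup>2 \<le> K / real n * k\<^sup>2" using nn by (intro mult_right_mono divide_right_mono) (auto simp: K_def)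
 then have "(\<Sum>i<n. (1 - \<tau> / P.gth \<tau> i)\<^sup>2) \<le> K / real n * k\<^sup>2" using B(1) unfolding k_def[symmetric] by linarith
 then have "(\<Sum>i<n. (1 - \<tau> / P.gth \<tau> i)\<^sup>2) * \<Theta> \<le> (K / real n * k\<^sup>2) * \<Theta>" by (rule mult_right_mono) (use Tp in simp)
 then have "Y \<le> (K / real n * k\<^sup>2) * \<Theta>" using Y1 by linarith
 then have "Y / \<tau> * X \<le> (K / real n * k\<^sup>2) * \<Theta> / \<tau> * X"
  by (rule mult_right_mono[OF divide_right_mono]) (use tau X0 in simp_all)
 then have "k\<^sup>2 \<le> (K / real n * k\<^sup>2) * \<Theta> / \<tau> * X"
  using P.cdf_slope(1)[OF P.canon(1)[OF sc] tau(1) d(1)] unfolding k_def[symmetric] X_def[symmetric] Y_def[symmetric] by linarith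
 then have "1 * k\<^sup>2 \<le> (K * \<Theta> * (X / (real n * \<tau>))) * k\<^sup>2" by (simp add: mult_ac)
 then have "1 \<le> K * \<Theta> * (X / (real n * \<tau>))" using k by (metis mult_le_cancel_right_pos zero_less_power)
 then have "1 / (\<Theta> * K) \<le> X / (real n * \<tau>)" using Tp Kp by (simp add: divide_le_eq mult_ac)
 also have "\<dots> = deriv P.cdf \<tau>" using DERIV_imp_deriv[OF d(2)] by (simp add: X_def)
 finally have "1 / (\<Theta> * K) / pi \<le> deriv P.cdf \<tau> / pi" by (intro divide_right_mono) auto
 moreover have "mu_density V z = deriv P.cdf \<tau> / pi" using density_below[of z] s z by (auto simp: mu_density_def \<tau>_def)
 ultimately show ?thesis by (simp add: \<Theta>_def K_def \<tau>_def mult_ac)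
qed

end

locale matrix_block_profile = matrix_profile V n S for V n S +
 fixes \<phi> :: real and K :: nat and B :: "nat \<Rightarrow> nat set" and N :: "nat \<Rightarrow> nat \<Rightarrow> bool"
 assumes block: "block_profile n (\<lambda>i j. V $$ (i, j)) S \<phi> K B N"

sublocale matrix_block_profile \<subseteq> Q: block_profile n "\<lambda>i j. V $$ (i, j)" S \<phi> K B N by (rule block)

context matrix_block_profile
begin

lemma block_density:
 assumes s: "0 < cmod z" "cmod z < sqrt (spec_rad V)" and T: "(cmod z)\<^sup>2 \<le> T"
 shows "1 / (pi * (Q.Tup T * (Q.rat T)\<^sup>2)) \<le> mu_density0 V z"
proof -
 define \<tau> where "\<tau> = (cmod z)\<^sup>2"
 have tau: "0 < \<tau>" "\<tau> < spec_rad V" "\<tau> \<le> T" using square_below[OF s] T by (auto simp: \<tau>_def)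
 obtain D \<xi> \<eta> where d: "P.lin (P.gq \<tau>) (P.gz \<tau>) (P.gth \<tau>) \<tau> 1 D \<xi> \<eta>"
  "(P.cdf has_real_derivative (\<Sum>i<n. \<tau> / P.gth \<tau> i * D i) / (real n * \<tau>)) (at \<tau>)"
  using P.cdf_derivative[OF supercritical_below tau(1,2)] by blast
 have "1 / (Q.Tup T * (Q.rat T)\<^sup>2) \<le> (\<Sum>i<n. \<tau> / P.gth \<tau> i * D i) / (real n * \<tau>)"
  by (rule Q.block_slope[OF P.canon[OF supercritical_below[OF tau(1,2)]] tau(1,3) d(1)])
 also have "\<dots> = deriv P.cdf \<tau>" using DERIV_imp_deriv[OF d(2)] by simp
 finally have "1 / (Q.Tup T * (Q.rat T)\<^sup>2) / pi \<le> deriv P.cdf \<tau> / pi" by (intro divide_right_mono) auto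
 then show ?thesis using density_below[OF s] by (simp add: \<tau>_def mult_ac)
qed

lemma density_limit: "\<exists>l. (mu_density0 V \<longlongrightarrow> l) (at 0)"
proof (cases "spec_rad V = 0")
 case True
 have "mu_density0 V z = 0" if "z \<noteq> 0" for z using density_above[of z] that True by simp
 then have "eventually (\<lambda>z. mu_density0 V z = 0) (at 0)" by (auto simp: eventually_at_filter)
 then have "(mu_density0 V \<longlongrightarrow> 0) (at 0)" by (rule tendsto_eventually)
 then show ?thesis ..
next
 case False
 then have rho: "0 < spec_rad V" using spec_rad_nonneg by simp
 obtain l where l: "\<And>x :: nat \<Rightarrow> real. (\<And>k. 0 < x k \<and> x k < spec_rad V) \<Longrightarrow> x \<longlonglongrightarrow> 0 \<Longrightarrow> (\<lambda>k. deriv P.cdf (x k)) \<longlonglongrightarrow> l"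
  using Q.slope_limit_at_zero[OF supercritical_below rho] by blast
 have "(mu_density0 V \<longlongrightarrow> l / pi) (at 0 within ball 0 (sqrt (spec_rad V)))"
  unfolding tendsto_at_iff_sequentially
 proof (intro allI impI)
  fix X :: "nat \<Rightarrow> complex" assume X: "\<forall>i. X i \<in> ball 0 (sqrt (spec_rad V)) - {0}" "X \<longlonglongrightarrow> 0"
  have in0: "0 < cmod (X k)" "cmod (X k) < sqrt (spec_rad V)" for k using X(1) by auto
  have "(\<lambda>k. (cmod (X k))\<^sup>2) \<longlonglongrightarrow> (cmod 0)\<^sup>2" by (intro tendsto_power tendsto_norm X(2))
  then have "(\<lambda>k. deriv P.cdf ((cmod (X k))\<^sup>2)) \<longlonglongrightarrow> l" using square_below[OF in0] by (intro l) auto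
  then have "(\<lambda>k. deriv P.cdf ((cmod (X k))\<^sup>2) / pi) \<longlonglongrightarrow> l / pi" by (intro tendsto_divide tendsto_const) auto
  then show "(mu_density0 V \<circ> X) \<longlonglongrightarrow> l / pi" using density_below[OF in0] by (simp add: o_def)
 qed
 moreover have "at 0 within ball 0 (sqrt (spec_rad V)) = at (0 :: complex)" using rho by (intro at_within_open) auto
 ultimately show ?thesis by auto
qed

lemma density_at_zero: "(mu_density0 V \<longlongrightarrow> mu_density V 0) (at 0)"
 using density_limit tendsto_Lim[OF trivial_limit_at] by (auto simp: mu_density_def)

lemma density_limit': "\<exists>l. (mu_density V \<longlongrightarrow> l) (at 0)"
proof -
 have "eventually (\<lambda>z. mu_density0 V z = mu_density V z) (at 0)" by (auto simp: eventually_at_filter mu_density_def)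
 then show ?thesis using density_at_zero tendsto_cong by blast
qed

text \<open>The bound for \<open>\<tau> \<le> 1\<close> passes to the limit at the origin.\<close>
lemma density_at_zero_ge:
 assumes rho: "0 < spec_rad V"
 shows "1 / (pi * (Q.Tup 1 * (Q.rat 1)\<^sup>2)) \<le> mu_density V 0"
proof (rule tendsto_lowerbound[OF density_at_zero])
 have "eventually (\<lambda>z. z \<in> ball 0 (min 1 (sqrt (spec_rad V))) - {0}) (at (0::complex))"
  using eventually_at_in_open[of "ball (0::complex) (min 1 (sqrt (spec_rad V)))" 0] rho by simp
 then show "eventually (\<lambda>z. 1 / (pi * (Q.Tup 1 * (Q.rat 1)\<^sup>2)) \<le> mu_density0 V z) (at 0)"
 proof eventually_elim
  case (elim z)
  then have "0 < cmod z" "cmod z < sqrt (spec_rad V)" "cmod z < 1" by auto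
  moreover from this have "(cmod z)\<^sup>2 \<le> 1" by (simp add: power_le_one)
  ultimately show ?case by (intro block_density) auto
 qed
qed simp

end

lemma profile_of_deviations:
 assumes std: "std_profiles N A" and bd: "\<And>n i j. n \<in> N \<Longrightarrow> i < n \<Longrightarrow> j < n \<Longrightarrow> A n $$ (i, j) \<le> \<sigma>" and sp: "\<sigma> > 0"
  and irr: "irreducible_matrix (A n)" and n: "n \<in> N"
 shows "matrix_profile (variance_profile (A n)) n (\<sigma>\<^sup>2)"
proof -
 have A: "A n \<in> carrier_mat n n" and A0: "\<And>i j. i < n \<Longrightarrow> j < n \<Longrightarrow> 0 \<le> A n $$ (i, j)" and np: "n > 0"
  using std n by (auto simp: std_profiles_def) (metis gr0I)
 define V where "V = variance_profile (A n)"
 have V: "V \<in> carrier_mat n n" using A by (simp add: V_def variance_profile_def)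
 have e: "V $$ (i, j) = (A n $$ (i, j))\<^sup>2 / real n" if "i < n" "j < n" for i j
  using A that by (simp add: V_def variance_profile_def)
 have "profile n (\<lambda>i j. V $$ (i, j)) (\<sigma>\<^sup>2)"
 proof
  show "0 \<le> V $$ (i, j) \<and> V $$ (i, j) \<le> \<sigma>\<^sup>2 / real n" if "i < n" "j < n" for i j
   using A0[OF that] bd[OF n that] by (auto simp: e[OF that] intro!: divide_right_mono power_mono)
  fix I :: "nat set" assume I: "I \<noteq> {}" "I \<subset> {..<n}"
  have "dim_row (A n) = n" using A by simp
  then have "\<exists>i\<in>I. \<exists>j\<in>{..<n} - I. A n $$ (i, j) \<noteq> 0"
   using irr I unfolding irreducible_matrix_def by metis
  then obtain i j where ij: "i \<in> I" "j \<in> {..<n} - I" "A n $$ (i, j) \<noteq> 0" by blast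
  then have "i < n" "j < n" using I by auto
  then have "V $$ (i, j) > 0" using ij e np by simp
  then show "\<exists>i\<in>I. \<exists>j\<in>{..<n} - I. 0 < V $$ (i, j)" using ij by blast
 qed (use np sp in auto)
 then show ?thesis using V by (simp add: matrix_profile_def V_def)
qed

theorem theorem2p8:
  fixes N :: "nat set" and A :: "nat \<Rightarrow> real mat"
  assumes "std_profiles N A"
    and "bounded_profiles N A"
    and "\<And>n. n \<in> N \<Longrightarrow> irreducible_matrix (A n)"
  shows "(admissible N A \<longrightarrow>
           (\<forall>s>0. \<exists>c>0. \<forall>n\<in>N. \<forall>z. cmod z = s \<and> s < sqrt (spec_rad (variance_profile (A n))) \<longrightarrow>
              mu_density (variance_profile (A n)) z \<ge> c)) \<and>
         (block_fully_indecomposable N A \<longrightarrow>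
           (\<forall>n\<in>N. \<exists>l. (mu_density (variance_profile (A n)) \<longlongrightarrow> l) (at 0)) \<and>
           (\<forall>s\<ge>0. \<exists>c>0. \<forall>n\<in>N. \<forall>z. cmod z = s \<and> s < sqrt (spec_rad (variance_profile (A n))) \<longrightarrow>
              mu_density (variance_profile (A n)) z \<ge> c))"
proof -
 obtain \<sigma> where sp: "\<sigma> > 0" and bd: "\<And>n i j. n \<in> N \<Longrightarrow> i < n \<Longrightarrow> j < n \<Longrightarrow> A n $$ (i, j) \<le> \<sigma>"
  using assms(2) by (auto simp: bounded_profiles_def)
 define S where "S = \<sigma>\<^sup>2"
 have S: "S > 0" using sp by (simp add: S_def)
 have mp: "matrix_profile (variance_profile (A n)) n S" if "n \<in> N" for n
  unfolding S_def by (rule profile_of_deviations[OF assms(1) bd sp assms(3)[OF that] that])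
 have part1: "\<exists>c>0. \<forall>n\<in>N. \<forall>z. cmod z = s \<and> s < sqrt (spec_rad (variance_profile (A n))) \<longrightarrow> mu_density (variance_profile (A n)) z \<ge> c"
  if adm: "admissible N A" and s: "s > 0" for s
 proof -
  obtain C where C: "C > 0" "\<And>n t. n \<in> N \<Longrightarrow> 0 < t \<Longrightarrow> t \<le> 1 \<Longrightarrow> 1 / real n * (\<Sum>i<n. fst (reg_master_sol (variance_profile (A n)) s t) $ i) \<le> C"
   using adm s unfolding admissible_def by (metis greaterThanAtMost_iff)
  define c where "c = 1 / (pi * Theta_adm S (s\<^sup>2) C * max 1 (K_adm S (s\<^sup>2) C))"
  have "Theta_adm S (s\<^sup>2) C > 0" using s by (simp add: Theta_adm_def add_pos_nonneg)
  then have c: "c > 0" unfolding c_def by (intro divide_pos_pos mult_pos_pos) auto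
  have "c \<le> mu_density (variance_profile (A n)) z" if "n \<in> N" "cmod z = s" "s < sqrt (spec_rad (variance_profile (A n)))" for n z
   unfolding c_def by (rule matrix_profile.admissible_density[OF mp[OF that(1)] s that(3) C(1) C(2)[OF that(1)] that(2)])
  with c show ?thesis by blast
 qed
 have part2: "(\<forall>n\<in>N. \<exists>l. (mu_density (variance_profile (A n)) \<longlongrightarrow> l) (at 0)) \<and>
      (\<forall>s\<ge>0. \<exists>c>0. \<forall>n\<in>N. \<forall>z. cmod z = s \<and> s < sqrt (spec_rad (variance_profile (A n))) \<longrightarrow>
       mu_density (variance_profile (A n)) z \<ge> c)"
  if bf: "block_fully_indecomposable N A"
 proof -
  obtain \<phi> K where phi: "\<phi> > 0" "K \<ge> 1" and bl: "\<forall>n\<in>N. K dvd n \<and>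
    (\<exists>Z\<in>carrier_mat K K. \<exists>I :: nat \<Rightarrow> nat set.
      fully_indecomposable Z \<and>
      (\<forall>i<K. \<forall>j<K. Z $$ (i, j) \<in> {0, 1}) \<and>
      (\<Union>i<K. I i) = {..<n} \<and> disjoint_family_on I {..<K} \<and>
      (\<forall>i<K. card (I i) = n div K) \<and>
      (\<forall>i<K. \<forall>j<K. \<forall>x\<in>I i. \<forall>y\<in>I j.
       variance_profile (A n) $$ (x, y) \<ge> \<phi> / real n * Z $$ (i, j)))"
   using bf unfolding block_fully_indecomposable_def by (elim exE conjE) (rule that; assumption)
  have mb: "\<exists>B R. matrix_block_profile (variance_profile (A n)) n S \<phi> K B R" if n: "n \<in> N" for n
  proof -
   obtain Z I where Z: "Z \<in> carrier_mat K K" "fully_indecomposable Z" "\<forall>i<K. \<forall>j<K. Z $$ (i, j) \<in> {0, 1}"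
    and I: "(\<Union>i<K. I i) = {..<n}" "disjoint_family_on I {..<K}" "\<forall>i<K. card (I i) = n div K"
     "\<forall>i<K. \<forall>j<K. \<forall>x\<in>I i. \<forall>y\<in>I j. variance_profile (A n) $$ (x, y) \<ge> \<phi> / real n * Z $$ (i, j)" and Kn: "K dvd n"
   proof -
    from bl n show ?thesis by (elim ballE conjE bexE exE) (rule that, assumption+, blast)
   qed
   interpret matrix_profile "variance_profile (A n)" n S by (rule mp[OF n])
   have "block_profile n (\<lambda>i j. variance_profile (A n) $$ (i, j)) S \<phi> K I (\<lambda>i j. Z $$ (i, j) \<noteq> 0)"
   proof
    fix I' J' :: "nat set" assume "I' \<noteq> {}" "J' \<noteq> {}" "I' \<subseteq> {..<K}" "J' \<subseteq> {..<K}" "K \<le> card I' + card J'"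
    then show "\<exists>i\<in>I'. \<exists>j\<in>J'. Z $$ (i, j) \<noteq> 0" using Z(1,2) unfolding fully_indecomposable_def by auto
   next
    fix i j x y assume "i < K" "j < K" "Z $$ (i, j) \<noteq> 0" "x \<in> I i" "y \<in> I j"
    moreover from this have "Z $$ (i, j) = 1" using Z(3) by auto
    ultimately show "\<phi> / real n \<le> variance_profile (A n) $$ (x, y)" using I(4) by force
   qed (use phi Kn I in auto)
   then show ?thesis using matrix_profile_axioms by (auto simp: matrix_block_profile_def matrix_block_profile_axioms_def)
  qed
  define cc where "cc T = 1 / (pi * (block_profile.Tup S \<phi> K T * (block_profile.rat S \<phi> K T)\<^sup>2))" for T
  have "\<exists>l. (mu_density (variance_profile (A n)) \<longlongrightarrow> l) (at 0)" if n: "n \<in> N" for n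
   using mb[OF n] matrix_block_profile.density_limit' by blast
  moreover have "\<exists>c>0. \<forall>n\<in>N. \<forall>z. cmod z = s \<and> s < sqrt (spec_rad (variance_profile (A n))) \<longrightarrow>
       mu_density (variance_profile (A n)) z \<ge> c" if s: "s \<ge> 0" for s
  proof -
   define T where "T = (if s = 0 then 1 else s\<^sup>2)"
   have pos: "0 < cc T" if n: "n \<in> N" for n
   proof -
    obtain B R where "matrix_block_profile (variance_profile (A n)) n S \<phi> K B R" using mb[OF n] by blast
    then interpret G: matrix_block_profile "variance_profile (A n)" n S \<phi> K B R .
    have "G.Q.Tup T > 0" using G.Q.rat_pos[of T] by (simp add: G.Q.Tup_def)
    then show ?thesis unfolding cc_def using G.Q.rat_pos[of T] by simp
   qed
   have "cc T \<le> mu_density (variance_profile (A n)) z"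
    if n: "n \<in> N" and z: "cmod z = s" "s < sqrt (spec_rad (variance_profile (A n)))" for n z
   proof -
    obtain B R where "matrix_block_profile (variance_profile (A n)) n S \<phi> K B R" using mb[OF n] by blast
    then interpret G: matrix_block_profile "variance_profile (A n)" n S \<phi> K B R .
    show ?thesis
    proof (cases "s = 0")
     case True
     then show ?thesis using G.density_at_zero_ge z by (simp add: cc_def T_def)
    next
     case False
     then show ?thesis using G.block_density[of z T] z s by (auto simp: cc_def T_def mu_density_def)
    qed
   qed
   moreover obtain n0 where "n0 \<in> N" using assms(1) by (metis ex_in_conv finite.emptyI std_profiles_def)
   ultimately show ?thesis using pos[OF \<open>n0 \<in> N\<close>] by blast
  qed
  ultimately show ?thesis by blast
 qed
 show ?thesis using part1 part2 by blast
qed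

end
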